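(* Let $n\ge 1$ and $\Lambda>0$. There is $\alpha\in(0,1)$, depending only on $\Lambda$ and $n$, such that the following holds. Let $\mathcal U\subset\mathbb R^n$ be open, let $A:\mathcal U\to\mathbb R^{n\times n}$ be a symmetric-matrix-valued function with measurable entries such that $\Lambda^{-1}\le A(x)\le\Lambda$ for almost every $x\in\mathcal U$, and let $f\in H^1(\mathcal U)$ be a weak solution on $\mathcal U$ of $$\nabla_x\cdot(A\nabla_x f)=0.$$ Then $f\in C^\alpha_{\mathrm{loc}}(\mathcal U)$. Moreover, given $\delta>0$, there is $C>0$, depending only on $\Lambda$, $\delta$ and $n$, such that for any such $\mathcal U$, $A$, $f$ and any $\tilde{\mathcal U}\subset\subset\mathcal U$ with $\mathrm{dist}(\tilde{\mathcal U},\partial\mathcal U)\ge\delta$, $$\|f\|_{C^\alpha(\tilde{\mathcal U})}\le C\,\|f\|_{L^2(\mathcal U)}.$$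
   Context: Matrix inequalities are in the sense of quadratic forms: $\Lambda^{-1}|\xi|^2\le A(x)\xi\cdot\xi\le\Lambda|\xi|^2$ for all $\xi\in\mathbb R^n$. A weak solution $f\in H^1(\mathcal U)$ of $\nabla_x\cdot(A\nabla_x f)=0$ satisfies $\int_{\mathcal U}A\nabla_x f\cdot\nabla_x\varphi\,dx=0$ for all $\varphi\in C^\infty_c(\mathcal U)$. The notation $\tilde{\mathcal U}\subset\subset\mathcal U$ means that $\tilde{\mathcal U}$ is an open subset of $\mathcal U$ with compact closure included in $\mathcal U$. For $\alpha\in(0,1)$, $\|f\|_{C^\alpha(\mathcal V)}:=\|f\|_{L^\infty(\mathcal V)}+\sup_{x,y\in\mathcal V,\,x\ne y}\frac{|f(x)-f(y)|}{|x-y|^\alpha}$, and $f\in C^\alpha_{\mathrm{loc}}(\mathcal U)$ means that $f$ (after modification on a null set) has finite $C^\alpha(\mathcal V)$ norm for every $\mathcal V\subset\subset\mathcal U$. *)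

theory Defs
  imports "HOL-Analysis.Analysis" "HOL-Probability.Essential_Supremum"
begin

text \<open>
  Functions on an open set \<open>U\<close> are total functions on \<^typ>\<open>real^'n\<close> of which only the values on \<open>U\<close>
  matter; \<^typ>\<open>real^'n\<close> with \<open>'n\<close> an arbitrary finite type renders Euclidean space of dimension
  \<open>n \<ge> 1\<close>. Measurability is Lebesgue measurability.
\<close>

subsection \<open>Test functions\<close>

definition partial_deriv :: "'n \<Rightarrow> (real^'n \<Rightarrow> real) \<Rightarrow> real^'n \<Rightarrow> real" where
  "partial_deriv i \<phi> x = frechet_derivative \<phi> (at x) (axis i 1)"

definition grad :: "(real^'n \<Rightarrow> real) \<Rightarrow> real^'n \<Rightarrow> real^'n" where
  "grad \<phi> x = (\<chi> i. partial_deriv i \<phi> x)"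

primrec C_k :: "nat \<Rightarrow> (real^'n \<Rightarrow> real) \<Rightarrow> bool" where
  "C_k 0 \<phi> \<longleftrightarrow> continuous_on UNIV \<phi>"
| "C_k (Suc k) \<phi> \<longleftrightarrow> \<phi> differentiable_on UNIV \<and> (\<forall>i. C_k k (partial_deriv i \<phi>))"

text \<open>Elements of \<open>C\<^sub>c\<^sup>\<infinity>(U)\<close> are identified with their extension by zero to the whole space.\<close>

definition test_functions :: "(real^'n) set \<Rightarrow> (real^'n \<Rightarrow> real) set" where
  "test_functions U =
    {\<phi>. (\<forall>k. C_k k \<phi>) \<and> compact (closure {x. \<phi> x \<noteq> 0}) \<and> closure {x. \<phi> x \<noteq> 0} \<subseteq> U}"

subsection \<open>The spaces \<open>L\<^sup>2\<close> and \<open>H\<^sup>1\<close>\<close>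

definition L2_space :: "(real^'n) set \<Rightarrow> (real^'n \<Rightarrow> 'b::euclidean_space) set" where
  "L2_space U = {f. f \<in> borel_measurable (lebesgue_on U) \<and>
    integrable (lebesgue_on U) (\<lambda>x. (norm (f x))\<^sup>2)}"

definition L2_norm :: "(real^'n) set \<Rightarrow> (real^'n \<Rightarrow> 'b::euclidean_space) \<Rightarrow> real" where
  "L2_norm U f = sqrt (integral\<^sup>L (lebesgue_on U) (\<lambda>x. (norm (f x))\<^sup>2))"

definition L1_loc :: "(real^'n) set \<Rightarrow> (real^'n \<Rightarrow> 'b::euclidean_space) set" where
  "L1_loc U = {f. \<forall>K. compact K \<and> K \<subseteq> U \<longrightarrow> integrable (lebesgue_on K) f}"

text \<open>The local integrability requirements make all integrals below genuine (the Bochner integral of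
  a non-integrable function is 0 by convention), so that a weak gradient is unique up to null sets.\<close>

definition has_weak_gradient ::
    "(real^'n) set \<Rightarrow> (real^'n \<Rightarrow> real) \<Rightarrow> (real^'n \<Rightarrow> real^'n) \<Rightarrow> bool" where
  "has_weak_gradient U f g \<longleftrightarrow> f \<in> L1_loc U \<and> g \<in> L1_loc U \<and>
    (\<forall>\<phi>\<in>test_functions U. \<forall>i.
      integral\<^sup>L (lebesgue_on U) (\<lambda>x. f x * partial_deriv i \<phi> x) =
      - integral\<^sup>L (lebesgue_on U) (\<lambda>x. g x $ i * \<phi> x))"

definition H1_space :: "(real^'n) set \<Rightarrow> (real^'n \<Rightarrow> real) set" where
  "H1_space U = {f. f \<in> L2_space U \<and> (\<exists>g. has_weak_gradient U f g \<and> g \<in> L2_space U)}"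

subsection \<open>The equation\<close>

definition elliptic_coefficients :: "real \<Rightarrow> (real^'n) set \<Rightarrow> (real^'n \<Rightarrow> real^'n^'n) \<Rightarrow> bool" where
  "elliptic_coefficients \<Lambda> U A \<longleftrightarrow>
    (\<forall>x\<in>U. transpose (A x) = A x) \<and>
    (\<forall>i j. (\<lambda>x. A x $ i $ j) \<in> borel_measurable (lebesgue_on U)) \<and>
    (AE x in lebesgue_on U. \<forall>\<xi>. inverse \<Lambda> * (norm \<xi>)\<^sup>2 \<le> (A x *v \<xi>) \<bullet> \<xi> \<and>
      (A x *v \<xi>) \<bullet> \<xi> \<le> \<Lambda> * (norm \<xi>)\<^sup>2)"

definition weak_solution :: "(real^'n) set \<Rightarrow> (real^'n \<Rightarrow> real^'n^'n) \<Rightarrow> (real^'n \<Rightarrow> real) \<Rightarrow> bool" where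
  "weak_solution U A f \<longleftrightarrow> f \<in> H1_space U \<and>
    (\<exists>g. has_weak_gradient U f g \<and>
      (\<forall>\<phi>\<in>test_functions U. integral\<^sup>L (lebesgue_on U) (\<lambda>x. (A x *v g x) \<bullet> grad \<phi> x) = 0))"

subsection \<open>Hoelder spaces\<close>

definition compactly_inside :: "(real^'n) set \<Rightarrow> (real^'n) set \<Rightarrow> bool" where
  "compactly_inside V U \<longleftrightarrow> open V \<and> compact (closure V) \<and> closure V \<subseteq> U"

definition holder_norm :: "real \<Rightarrow> (real^'n) set \<Rightarrow> (real^'n \<Rightarrow> real) \<Rightarrow> ennreal" where
  "holder_norm \<alpha> V f = esssup (lebesgue_on V) (\<lambda>x. ennreal \<bar>f x\<bar>) +
    (SUP (x, y)\<in>{(x, y). x \<in> V \<and> y \<in> V \<and> x \<noteq> y}.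
      ennreal (\<bar>f x - f y\<bar> / (norm (x - y)) powr \<alpha>))"

text \<open>\<open>h\<close> is a modification of \<open>f\<close> on a null set that is locally Hoelder; on an open set \<open>U\<close> its
  values are uniquely determined by \<open>f\<close>, since it is continuous there.\<close>

definition holder_version ::
    "real \<Rightarrow> (real^'n) set \<Rightarrow> (real^'n \<Rightarrow> real) \<Rightarrow> (real^'n \<Rightarrow> real) \<Rightarrow> bool" where
  "holder_version \<alpha> U f h \<longleftrightarrow> (AE x in lebesgue_on U. h x = f x) \<and>
    (\<forall>V. compactly_inside V U \<longrightarrow> holder_norm \<alpha> V h < \<infinity>)"

definition C_holder_loc :: "real \<Rightarrow> (real^'n) set \<Rightarrow> (real^'n \<Rightarrow> real) set" where
  "C_holder_loc \<alpha> U = {f. \<exists>h. holder_version \<alpha> U f h}"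

text \<open>Extended-valued, so that the distance to the empty set (e.g. to the boundary of the whole
  space) is \<open>\<infinity>\<close>, whereas the real-valued \<^const>\<open>setdist\<close> would give 0.\<close>

definition set_edist :: "(real^'n) set \<Rightarrow> (real^'n) set \<Rightarrow> ennreal" where
  "set_edist S T = (INF x\<in>S. INF y\<in>T. ennreal (dist x y))"

end

theory Submission
  imports Defs "HOL-Computational_Algebra.Polynomial"
begin

text \<open>
  The solution is only ever used through its flux \<open>q = A \<nabla>f\<close>, which is divergence free and satisfies
  \<open>\<bar>q\<bar> \<le> \<Lambda> \<bar>\<nabla>f\<bar>\<close> and \<open>\<bar>\<nabla>f\<bar>\<^sup>2 \<le> \<Lambda> q \<cdot> \<nabla>f\<close>. For convex \<open>\<Psi>\<close>, the truncations of \<open>\<Psi> \<circ> f\<close> satisfy Caccioppoli's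
  inequality. Together with a Faber--Krahn inequality this makes the energy of \<open>\<Psi> \<circ> f\<close> above
  increasing levels decay geometrically, so \<open>\<Psi> \<circ> f\<close> is bounded above by its \<open>L\<^sup>2\<close> norm (De Giorgi). With
  \<open>\<Psi>(s) = \<plusminus>s\<close> this bounds \<open>f\<close>. On a ball where \<open>m \<le> f \<le> M\<close>, one of the two functions \<open>f - m\<close>, \<open>M - f\<close> is
  at least \<open>(M - m) / 2\<close> on half of the ball; the negative logarithm of that function has a gradient
  bounded in \<open>L\<^sup>2\<close>, hence by Poincare's inequality it is bounded in \<open>L\<^sup>2\<close>, and by the first step it is
  bounded above on a smaller ball (Moser, Kruzhkov). Thus the oscillation decays by a fixed factor,
  and iteration yields Hoelder continuity.

  Both the Faber--Krahn and the Poincare inequality follow from the bound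
  \<open>\<parallel>u(\<cdot> + h) - u\<parallel> \<le> \<bar>h\<bar> \<parallel>\<nabla>u\<parallel>\<close> of \<open>L\<^sup>2\<close> norms by integrating a pointwise inequality over \<open>h\<close>.
\<close>

subsection \<open>Translation estimates\<close>

text \<open>Two obstacles shape the development. The functions inserted into the equation, above all
  the logarithm, have bounded derivatives only on the range of \<open>f\<close>. Hence an interval
  \<open>I\<close> containing that range is carried along: mollification averages values, so the
  smooth approximants stay in \<open>I\<close>, and the chain rule, the testing and the limits need
  estimates on \<open>I\<close> alone. Moreover, the weak formulation admits smooth test functions
  only, and the gradient in the equation is not assumed to be the square integrable one.
  Mollification and the fundamental lemma of the calculus of variations close both gaps at the end,
  so the estimates proper deal with neither.

  No Sobolev exponent enters. The Faber-Krahn inequality is applied at a radius that shrinks with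
  the level, tuned so that the measure it tolerates shrinks exactly as fast as the energy decays.
  Applying the same boundedness result to the convex function -log takes the place of a Harnack
  inequality. Uniformity of the constants is expressed by fixing them from \<open>\<Lambda>\<close>
  and the dimension (and \<open>\<delta>\<close>) before a solution is introduced.\<close>

lemma nn_integral_lborel_translate:
  fixes f :: "'a::euclidean_space \<Rightarrow> ennreal"
  assumes [measurable]: "f \<in> borel_measurable borel"
  shows "(\<integral>\<^sup>+x. f (x + h) \<partial>lborel) = (\<integral>\<^sup>+x. f x \<partial>lborel)"
proof -
  have "(\<integral>\<^sup>+x. f x \<partial>lborel) = (\<integral>\<^sup>+x. f x \<partial>distr lborel borel ((+) h))"
    by (simp add: lborel_distr_plus)
  also have "\<dots> = (\<integral>\<^sup>+x. f (h + x) \<partial>lborel)"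
    by (subst nn_integral_distr) auto
  finally show ?thesis by (simp add: add.commute)
qed

lemma lborel_distr_reflect:
  fixes a :: "'a::euclidean_space"
  shows "distr lborel borel (\<lambda>x. a - x) = lborel"
  using lborel_affine[of "-1" a] by (simp add: density_1)

lemma integral_lborel_reflect:
  fixes f :: "'a::euclidean_space \<Rightarrow> 'b::euclidean_space"
  assumes [measurable]: "f \<in> borel_measurable borel"
  shows "(\<integral>x. f (a - x) \<partial>lborel) = (\<integral>x. f x \<partial>lborel)"
proof -
  have "(\<integral>x. f x \<partial>lborel) = (\<integral>x. f x \<partial>distr lborel borel (\<lambda>x. a - x))"
    by (simp add: lborel_distr_reflect)
  also have "\<dots> = (\<integral>x. f (a - x) \<partial>lborel)"
    by (subst integral_distr) auto
  finally show ?thesis ..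
qed

lemma measure_ball_scale:
  fixes x :: "'a::euclidean_space"
  assumes "0 \<le> r"
  shows "measure lborel (ball x r) = r ^ DIM('a) * measure lborel (ball (0::'a) 1)"
  using content_ball_conv_unit_ball[OF assms, of x] by simp

lemma measure_ball_positive:
  fixes x :: "'a::euclidean_space"
  assumes "0 < r"
  shows "0 < measure lborel (ball x r)"
  using content_ball_pos[OF assms, of x] by simp

lemma emeasure_ball_eq:
  fixes x :: "'a::euclidean_space"
  shows "emeasure lborel (ball x r) = ennreal (measure lborel (ball x r))"
  using emeasure_bounded_finite[OF bounded_ball, of x r]
  by (intro emeasure_eq_ennreal_measure) auto

lemma ball_sets_borel [measurable]: "ball (x::'a::euclidean_space) r \<in> sets borel"
  by simp

lemma sq_le_double:
  fixes a b :: real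
  shows "a\<^sup>2 \<le> 2 * (b - a)\<^sup>2 + 2 * b\<^sup>2"
  using zero_le_power2[of "2 * b - a"] by (simp add: power2_eq_square algebra_simps)

text \<open>This is all that the two inequalities below retain of a gradient; \<open>Y\<close>
  stands for its squared L2 norm on \<open>B\<close>. Both \<open>x\<close> and \<open>x + h\<close>
  must lie in \<open>B\<close>, so nothing is claimed about \<open>u\<close> elsewhere.\<close>

definition translation_bound :: "'a::euclidean_space set \<Rightarrow> ('a \<Rightarrow> real) \<Rightarrow> real \<Rightarrow> bool" where
  "translation_bound B u Y \<longleftrightarrow> (\<forall>h. (\<integral>\<^sup>+x. ennreal (indicator B x * indicator B (x + h) * (u (x + h) - u x)\<^sup>2) \<partial>lborel)
     \<le> ennreal ((norm h)\<^sup>2 * Y))"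

text \<open>For \<open>x\<close> in \<open>S\<close> and \<open>|z| < r\<close>,
  \<open>u(x)^2 \<le> 2 (u(x+z) - u(x))^2 + 2 u(x+z)^2\<close>. After averaging over
  \<open>z\<close>, the translation bound controls the first term, and the second contributes at
  most \<open>2 |S|\<close> over the volume of the ball times the integral of \<open>u^2\<close>,
  which \<open>small\<close> makes at most one half of that integral. Finiteness of the integral
  allows this half to be absorbed on the left.\<close>

lemma faber_krahn:
  fixes u :: "'a::euclidean_space \<Rightarrow> real"
  assumes u[measurable]: "u \<in> borel_measurable borel"
    and T: "translation_bound (ball x0 (2 * R)) u Y" and Y: "0 \<le> Y"
    and S[measurable]: "S \<in> sets borel" and SB: "S \<subseteq> ball x0 R" and u0: "\<And>x. x \<notin> S \<Longrightarrow> u x = 0"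
    and r: "0 < r" "r \<le> R"
    and small: "4 * measure lborel S \<le> measure lborel (ball (0::'a) r)"
    and fin: "(\<integral>\<^sup>+x. ennreal ((u x)\<^sup>2) \<partial>lborel) < \<infinity>"
  shows "(\<integral>\<^sup>+x. ennreal ((u x)\<^sup>2) \<partial>lborel) \<le> ennreal (4 * r\<^sup>2 * Y)"
proof -
  let ?B = "ball x0 (2 * R)" and ?b = "ball (0::'a) r"
  define X where "X = (\<integral>\<^sup>+x. ennreal ((u x)\<^sup>2) \<partial>lborel)"
  obtain \<xi> where \<xi>: "X = ennreal \<xi>" "0 \<le> \<xi>"
    using fin unfolding X_def by (cases "\<integral>\<^sup>+x. ennreal ((u x)\<^sup>2) \<partial>lborel") auto
  define v where "v = measure lborel ?b"
  define s where "s = measure lborel S"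
  have eS: "emeasure lborel S = ennreal s"
    unfolding s_def
  proof (rule emeasure_eq_ennreal_measure)
    have "emeasure lborel S \<le> emeasure lborel (ball x0 R)"
      by (rule emeasure_mono[OF SB]) auto
    then show "emeasure lborel S \<noteq> top"
      using emeasure_bounded_finite[OF bounded_ball, of x0 R] by (auto simp: top_unique)
  qed
  have eb: "emeasure lborel ?b = ennreal v"
    unfolding v_def by (rule emeasure_ball_eq)
  have v: "0 < v" unfolding v_def by (rule measure_ball_positive[OF r(1)])
  have s0: "0 \<le> s" unfolding s_def by simp
  have pw: "X \<le> ennreal (2 * r\<^sup>2 * Y) + 2 * (\<integral>\<^sup>+x. indicator S x * ennreal ((u (x + z))\<^sup>2) \<partial>lborel)"
    if z: "z \<in> ?b" for z
  proof -
    have "ennreal ((u x)\<^sup>2) \<le> 2 * ennreal (indicator ?B x * indicator ?B (x + z) * (u (x + z) - u x)\<^sup>2)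
        + 2 * (indicator S x * ennreal ((u (x + z))\<^sup>2))" for x
    proof (cases "x \<in> S")
      case True
      then have "dist x0 x < R" using SB by auto
      moreover have "dist x0 (x + z) \<le> dist x0 x + norm z"
        by (metis add_diff_cancel_left' dist_commute dist_norm dist_triangle)
      moreover have "norm z < r" using z by simp
      ultimately have "x \<in> ?B" "x + z \<in> ?B" using r by auto
      with True show ?thesis
        using sq_le_double[of "u x" "u (x + z)"]
        by (auto simp: ennreal_plus[symmetric] ennreal_mult'[symmetric] mult.assoc
            simp flip: ennreal_numeral intro!: ennreal_leI simp del: ennreal_plus)
    qed (simp add: u0)
    then have "X \<le> (\<integral>\<^sup>+x. 2 * ennreal (indicator ?B x * indicator ?B (x + z) * (u (x + z) - u x)\<^sup>2)
        + 2 * (indicator S x * ennreal ((u (x + z))\<^sup>2)) \<partial>lborel)"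
      unfolding X_def by (intro nn_integral_mono) auto
    also have "\<dots> = 2 * (\<integral>\<^sup>+x. ennreal (indicator ?B x * indicator ?B (x + z) * (u (x + z) - u x)\<^sup>2) \<partial>lborel)
        + 2 * (\<integral>\<^sup>+x. indicator S x * ennreal ((u (x + z))\<^sup>2) \<partial>lborel)"
      by (subst nn_integral_add, measurable, simp add: nn_integral_cmult)
    also have "\<dots> \<le> 2 * ennreal ((norm z)\<^sup>2 * Y)
        + 2 * (\<integral>\<^sup>+x. indicator S x * ennreal ((u (x + z))\<^sup>2) \<partial>lborel)"
      using T unfolding translation_bound_def by (intro add_right_mono mult_left_mono) auto
    also have "2 * ennreal ((norm z)\<^sup>2 * Y) \<le> ennreal (2 * r\<^sup>2 * Y)"
    proof -
      have "(norm z)\<^sup>2 * Y \<le> r\<^sup>2 * Y"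
        using z Y by (intro mult_right_mono power_mono) auto
      then show ?thesis
        by (simp add: ennreal_mult'[symmetric] flip: ennreal_numeral) (intro ennreal_leI, simp)
    qed
    finally show ?thesis by (simp add: add_right_mono)
  qed
  have "ennreal v * X = (\<integral>\<^sup>+z. indicator ?b z * X \<partial>lborel)"
    by (simp add: nn_integral_multc eb)
  also have "\<dots> \<le> (\<integral>\<^sup>+z. ennreal (2 * r\<^sup>2 * Y) * indicator ?b z + 2 * (\<integral>\<^sup>+x. indicator ?b z * (indicator S x * ennreal ((u (x + z))\<^sup>2)) \<partial>lborel) \<partial>lborel)"
  proof (rule nn_integral_mono)
    fix z show "indicator ?b z * X \<le> ennreal (2 * r\<^sup>2 * Y) * indicator ?b z + 2 * (\<integral>\<^sup>+x. indicator ?b z * (indicator S x * ennreal ((u (x + z))\<^sup>2)) \<partial>lborel)"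
      using pw[of z] by (cases "z \<in> ?b") auto
  qed
  also have "\<dots> = ennreal (2 * r\<^sup>2 * Y) * ennreal v + 2 * (\<integral>\<^sup>+z. (\<integral>\<^sup>+x. indicator ?b z * (indicator S x * ennreal ((u (x + z))\<^sup>2)) \<partial>lborel) \<partial>lborel)"
    by (subst nn_integral_add) (auto simp: nn_integral_cmult eb)
  also have "(\<integral>\<^sup>+z. (\<integral>\<^sup>+x. indicator ?b z * (indicator S x * ennreal ((u (x + z))\<^sup>2)) \<partial>lborel) \<partial>lborel)
     = (\<integral>\<^sup>+x. (\<integral>\<^sup>+z. indicator ?b z * (indicator S x * ennreal ((u (x + z))\<^sup>2)) \<partial>lborel) \<partial>lborel)"
    by (rule lborel_pair.Fubini') measurable
  also have "\<dots> \<le> (\<integral>\<^sup>+x. indicator S x * X \<partial>lborel)"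
  proof (rule nn_integral_mono)
    fix x :: 'a
    have "(\<integral>\<^sup>+z. indicator ?b z * (indicator S x * ennreal ((u (x + z))\<^sup>2)) \<partial>lborel)
      \<le> (\<integral>\<^sup>+z. indicator S x * ennreal ((u (z + x))\<^sup>2) \<partial>lborel)"
      by (intro nn_integral_mono) (auto simp: indicator_def add.commute)
    also have "\<dots> = indicator S x * X"
      unfolding X_def by (subst nn_integral_cmult) (auto simp: nn_integral_lborel_translate[where f="\<lambda>y. ennreal ((u y)\<^sup>2)"])
    finally show "(\<integral>\<^sup>+z. indicator ?b z * (indicator S x * ennreal ((u (x + z))\<^sup>2)) \<partial>lborel) \<le> indicator S x * X" .
  qed
  also have "(\<integral>\<^sup>+x. indicator S x * X \<partial>lborel) = ennreal s * X"
    by (simp add: nn_integral_multc eS)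
  finally have "ennreal v * X \<le> ennreal (2 * r\<^sup>2 * Y) * ennreal v + 2 * (ennreal s * X)"
    by (simp add: mult_left_mono)
  then have "ennreal (v * \<xi>) \<le> ennreal (2 * r\<^sup>2 * Y * v + 2 * (s * \<xi>))"
    using v s0 \<xi> Y
    by (simp add: ennreal_mult[symmetric] ennreal_plus[symmetric] flip: ennreal_numeral del: ennreal_plus)
  then have "v * \<xi> \<le> 2 * r\<^sup>2 * Y * v + 2 * (s * \<xi>)"
    using v s0 \<xi> Y by (subst (asm) ennreal_le_iff) auto
  moreover have "4 * s * \<xi> \<le> v * \<xi>"
    using small \<xi> unfolding s_def v_def by (intro mult_right_mono) auto
  ultimately have "v * \<xi> \<le> v * (4 * r\<^sup>2 * Y)" by (simp add: algebra_simps)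
  then have "\<xi> \<le> 4 * r\<^sup>2 * Y" using v by simp
  then show ?thesis unfolding X_def[symmetric] \<xi>(1) by (rule ennreal_leI)
qed

text \<open>Every \<open>x\<close> in the ball is compared with every \<open>y\<close> in
  \<open>E\<close>, where \<open>u\<close> is already bounded. In the double integral over
  \<open>x\<close> and \<open>h = y - x\<close> only \<open>|h| < 2 R\<close> occurs, so the
  translation bound gives \<open>4 R^2 Y\<close> times the volume \<open>2^n |B_R|\<close> of the
  shifts. Dividing by \<open>|E|\<close>, at least half of \<open>|B_R|\<close>, produces the
  constant \<open>16 * 2^n\<close>.\<close>

lemma poincare_large_set:
  fixes u :: "'a::euclidean_space \<Rightarrow> real"
  assumes u[measurable]: "u \<in> borel_measurable borel"
    and T: "translation_bound (ball x0 R) u Y" and Y: "0 \<le> Y" and R: "0 < R"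
    and E[measurable]: "E \<in> sets borel" and EB: "E \<subseteq> ball x0 R"
    and large: "measure lborel (ball x0 R) \<le> 2 * measure lborel E"
    and uE: "\<And>x. x \<in> E \<Longrightarrow> \<bar>u x\<bar> \<le> c"
  shows "(\<integral>\<^sup>+x. indicator (ball x0 R) x * ennreal ((u x)\<^sup>2) \<partial>lborel)
    \<le> ennreal (16 * 2 ^ DIM('a) * R\<^sup>2 * Y + 2 * c\<^sup>2 * measure lborel (ball x0 R))"
proof -
  let ?B = "ball x0 R" and ?b = "ball (0::'a) (2 * R)"
  define X where "X = (\<integral>\<^sup>+x. indicator ?B x * ennreal ((u x)\<^sup>2) \<partial>lborel)"
  define v where "v = measure lborel ?B"
  define w where "w = measure lborel ?b"
  define e where "e = measure lborel E"
  have v: "0 < v" unfolding v_def by (rule measure_ball_positive[OF R])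
  have eE: "emeasure lborel E = ennreal e"
    unfolding e_def
  proof (rule emeasure_eq_ennreal_measure)
    have "emeasure lborel E \<le> emeasure lborel (ball x0 R)"
      by (rule emeasure_mono[OF EB]) auto
    then show "emeasure lborel E \<noteq> top"
      using emeasure_bounded_finite[OF bounded_ball, of x0 R] by (auto simp: top_unique)
  qed
  have e2: "v \<le> 2 * e" using large unfolding e_def v_def .
  then have e: "0 < e" "v \<le> 2 * e" using v by linarith+
  have w_eq: "w = 2 ^ DIM('a) * v"
    using R unfolding w_def v_def by (subst (1 2) measure_ball_scale) (auto simp: power_mult_distrib)
  let ?F = "\<lambda>x y. ennreal (indicator ?B x * indicator ?B y * (u y - u x)\<^sup>2)"
  have "ennreal e * X = (\<integral>\<^sup>+x. (\<integral>\<^sup>+y. indicator E y * (indicator ?B x * ennreal ((u x)\<^sup>2)) \<partial>lborel) \<partial>lborel)"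
    unfolding X_def by (subst nn_integral_cmult[symmetric]) (auto simp: nn_integral_multc eE)
  also have "\<dots> \<le> (\<integral>\<^sup>+x. (\<integral>\<^sup>+y. 2 * ?F x y + ennreal (2 * c\<^sup>2) * (indicator ?B x * indicator E y) \<partial>lborel) \<partial>lborel)"
  proof (intro nn_integral_mono)
    fix x y :: 'a
    show "indicator E y * (indicator ?B x * ennreal ((u x)\<^sup>2)) \<le> 2 * ?F x y + ennreal (2 * c\<^sup>2) * (indicator ?B x * indicator E y)"
    proof (cases "x \<in> ?B \<and> y \<in> E")
      case True
      then have y: "y \<in> ?B" using EB by auto
      have "(u y)\<^sup>2 \<le> c\<^sup>2" using uE[of y] True by (metis abs_ge_zero power2_abs power_mono)
      then show ?thesis using True y
        using sq_le_double[of "u x" "u y"]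
        by (auto simp: ennreal_plus[symmetric] ennreal_mult'[symmetric] mult.assoc
            simp flip: ennreal_numeral intro!: ennreal_leI simp del: ennreal_plus)
    qed auto
  qed
  also have "\<dots> = (\<integral>\<^sup>+x. 2 * (\<integral>\<^sup>+y. ?F x y \<partial>lborel) + ennreal (2 * c\<^sup>2) * (indicator ?B x * ennreal e) \<partial>lborel)"
    by (intro nn_integral_cong, subst nn_integral_add) (auto simp: nn_integral_cmult eE)
  also have "\<dots> = 2 * (\<integral>\<^sup>+x. (\<integral>\<^sup>+y. ?F x y \<partial>lborel) \<partial>lborel) + ennreal (2 * c\<^sup>2) * (ennreal v * ennreal e)"
    by (subst nn_integral_add) (auto simp: nn_integral_cmult nn_integral_multc v_def emeasure_ball_eq)
  also have "(\<integral>\<^sup>+x. (\<integral>\<^sup>+y. ?F x y \<partial>lborel) \<partial>lborel) = (\<integral>\<^sup>+x. (\<integral>\<^sup>+h. ?F x (h + x) \<partial>lborel) \<partial>lborel)"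
    by (rule nn_integral_cong, rule nn_integral_lborel_translate[symmetric], measurable)
  also have "\<dots> = (\<integral>\<^sup>+h. (\<integral>\<^sup>+x. ?F x (h + x) \<partial>lborel) \<partial>lborel)"
    by (rule lborel_pair.Fubini') measurable
  also have "\<dots> \<le> (\<integral>\<^sup>+h. ennreal ((2 * R)\<^sup>2 * Y) * indicator ?b h \<partial>lborel)"
  proof (rule nn_integral_mono)
    fix h :: 'a
    show "(\<integral>\<^sup>+x. ?F x (h + x) \<partial>lborel) \<le> ennreal ((2 * R)\<^sup>2 * Y) * indicator ?b h"
    proof (cases "h \<in> ?b")
      case True
      have "(\<integral>\<^sup>+x. ?F x (h + x) \<partial>lborel) \<le> ennreal ((norm h)\<^sup>2 * Y)"
        using T[unfolded translation_bound_def, rule_format, of h] unfolding add.commute[of h] .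
      also have "\<dots> \<le> ennreal ((2 * R)\<^sup>2 * Y)"
        using True Y by (intro ennreal_leI mult_right_mono power_mono) auto
      finally show ?thesis using True by simp
    next
      case False
      have zero: "?F x (h + x) = 0" for x
      proof -
        have "\<not> (x \<in> ?B \<and> h + x \<in> ?B)"
        proof
          assume "x \<in> ?B \<and> h + x \<in> ?B"
          then have "dist x (h + x) < 2 * R"
            using dist_triangle2[of x "h + x" x0] by (auto simp: dist_commute)
          then show False using False by (simp add: dist_norm)
        qed
        then show ?thesis by auto
      qed
      show ?thesis unfolding zero by simp
    qed
  qed
  also have "\<dots> = ennreal ((2 * R)\<^sup>2 * Y) * ennreal w"
    by (simp add: nn_integral_cmult emeasure_ball_eq w_def)
  finally have "ennreal e * X \<le> 2 * (ennreal ((2 * R)\<^sup>2 * Y) * ennreal w) + ennreal (2 * c\<^sup>2) * (ennreal v * ennreal e)"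
    by (simp add: mult_left_mono)
  also have "\<dots> = ennreal (2 * ((2 * R)\<^sup>2 * Y * w) + 2 * c\<^sup>2 * (v * e))"
    using v e Y by (simp add: ennreal_mult'[symmetric] ennreal_mult''[symmetric] ennreal_plus[symmetric] w_eq
        flip: ennreal_numeral del: ennreal_plus)
  also have "\<dots> \<le> ennreal (e * (16 * 2 ^ DIM('a) * R\<^sup>2 * Y + 2 * c\<^sup>2 * v))"
  proof (rule ennreal_leI)
    have "2 * ((2 * R)\<^sup>2 * Y * w) = v * (8 * 2 ^ DIM('a) * R\<^sup>2 * Y)"
      by (simp add: w_eq power2_eq_square algebra_simps)
    also have "\<dots> \<le> 2 * e * (8 * 2 ^ DIM('a) * R\<^sup>2 * Y)"
      using e Y by (intro mult_right_mono) auto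
    finally show "2 * ((2 * R)\<^sup>2 * Y * w) + 2 * c\<^sup>2 * (v * e) \<le> e * (16 * 2 ^ DIM('a) * R\<^sup>2 * Y + 2 * c\<^sup>2 * v)"
      by (simp add: algebra_simps)
  qed
  finally have "ennreal e * X \<le> ennreal e * ennreal (16 * 2 ^ DIM('a) * R\<^sup>2 * Y + 2 * c\<^sup>2 * v)"
    using e Y v by (simp add: ennreal_mult)
  then show ?thesis
    using e unfolding X_def v_def by (simp add: ennreal_mult_le_mult_iff)
qed

subsection \<open>Strong gradients\<close>

lemma AE_lborel_translate:
  fixes h :: "'a::euclidean_space"
  assumes "AE x in lborel. P x"
  shows "AE x in lborel. P (x + h)"
proof -
  from assms obtain N where N: "{x. \<not> P x} \<subseteq> N" "N \<in> sets lborel" "emeasure lborel N = 0"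
    by (auto elim!: AE_E)
  then have N': "N \<in> sets borel" by simp
  have "AE x in lborel. x \<notin> N" using N by (intro AE_not_in) auto
  then have "AE x in distr lborel borel ((+) h). x \<notin> N" by (simp only: lborel_distr_plus)
  then have "AE x in lborel. h + x \<notin> N"
    by (subst (asm) AE_distr_iff) (use N' in auto)
  then show ?thesis
    by eventually_elim (use N in \<open>auto simp: add.commute\<close>)
qed

text \<open>Along a segment in the convex set \<open>B\<close> the increment is the integral of
  \<open>h \<bullet> D (x + t h)\<close> over \<open>t\<close> in [0,1]. Its square is bounded by
  Jensen's inequality, the integrals are exchanged, and for each \<open>t\<close> the integral over
  \<open>x\<close> is shifted back by \<open>t h\<close>.\<close>

lemma translation_estimate_C1:
  fixes F :: "'a::euclidean_space \<Rightarrow> real"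
  assumes B: "open B" "convex B"
    and der: "\<And>x. x \<in> B \<Longrightarrow> GDERIV F x :> D x" and cont: "continuous_on B D"
  shows "(\<integral>\<^sup>+x. ennreal (indicator B x * indicator B (x + h) * (F (x + h) - F x)\<^sup>2) \<partial>lborel)
    \<le> ennreal ((norm h)\<^sup>2) * (\<integral>\<^sup>+x. ennreal (indicator B x * (norm (D x))\<^sup>2) \<partial>lborel)"
proof -
  \<comment> \<open>Extension by zero turns the gradient into a Borel function on the whole space,
    where the integral is translation invariant.\<close>
  define E where "E x = (indicator B x :: real) *\<^sub>R D x" for x
  have E[measurable]: "E \<in> borel_measurable borel"
    unfolding E_def by (rule borel_measurable_continuous_on_indicator) (use B cont in auto)
  have pw: "ennreal (indicator B x * indicator B (x + h) * (F (x + h) - F x)\<^sup>2)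
    \<le> (\<integral>\<^sup>+t. indicator {0..1} t * ennreal ((norm h)\<^sup>2 * (norm (E (x + t *\<^sub>R h)))\<^sup>2) \<partial>lborel)" for x
  proof (cases "x \<in> B \<and> x + h \<in> B")
    case True
    have seg: "x + t *\<^sub>R h \<in> B" if "t \<in> {0..1}" for t
      using convexD_alt[OF B(2), of x "x + h" t] True that by (simp add: algebra_simps)
    have d: "((\<lambda>t. F (x + t *\<^sub>R h)) has_vector_derivative h \<bullet> D (x + t *\<^sub>R h)) (at t within {0..1})" if "0 \<le> t" "t \<le> 1" for t
    proof -
      have "((\<lambda>t. x + t *\<^sub>R h) has_derivative (\<lambda>s. s *\<^sub>R h)) (at t within {0..1})"
        by (auto intro!: derivative_eq_intros)
      moreover have "(F has_derivative (\<lambda>k. k \<bullet> D (x + t *\<^sub>R h))) (at (x + t *\<^sub>R h))"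
        using der[OF seg, of t] that unfolding gderiv_def by auto
      ultimately have "((\<lambda>t. F (x + t *\<^sub>R h)) has_derivative (\<lambda>s. (s *\<^sub>R h) \<bullet> D (x + t *\<^sub>R h))) (at t within {0..1})"
        by (rule has_derivative_compose)
      then show ?thesis unfolding has_vector_derivative_def by simp
    qed
    have c: "continuous_on {0..1} (\<lambda>t. D (x + t *\<^sub>R h))"
      by (rule continuous_on_compose2[OF cont]) (use seg in \<open>auto intro!: continuous_intros\<close>)
    let ?\<phi> = "\<lambda>t. h \<bullet> D (x + t *\<^sub>R h)"
    define a where "a = F (x + h) - F x"
    have I1: "has_bochner_integral lborel (\<lambda>t. indicator {0..1} t *\<^sub>R ?\<phi> t) a"
      using has_bochner_integral_FTC_Icc[of 0 1 "\<lambda>t. F (x + t *\<^sub>R h)" ?\<phi>, OF _ d continuous_on_inner[OF continuous_on_const c]]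
      unfolding a_def by auto
    have I2: "integrable lborel (\<lambda>t. indicator {0..1} t *\<^sub>R ((norm h)\<^sup>2 * (norm (D (x + t *\<^sub>R h)))\<^sup>2))"
      by (rule borel_integrable_compact) (use c in \<open>auto intro!: continuous_intros\<close>)
    have ind: "integrable lborel (indicat_real {0..1::real})"
      by (rule integrable_real_indicator) auto
    have I0: "integrable lborel (\<lambda>t. indicator {0..1::real} t *\<^sub>R (a\<^sup>2) :: real)" "(\<integral>t. indicator {0..1::real} t *\<^sub>R (a\<^sup>2) \<partial>lborel) = a\<^sup>2"
      using ind by auto
    \<comment> \<open>Jensen's inequality on [0,1] in linear form: the function under the integral
      satisfies \<open>2 a \<phi> \<le> \<phi>^2 + a^2\<close>, and \<open>\<phi>\<close> has
      integral \<open>a\<close>.\<close>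
    have "2 * a * a \<le> (\<integral>t. indicator {0..1} t *\<^sub>R ((norm h)\<^sup>2 * (norm (D (x + t *\<^sub>R h)))\<^sup>2) + indicator {0..1} t *\<^sub>R a\<^sup>2 \<partial>lborel)"
    proof -
      have "2 * a * a = (\<integral>t. 2 * a * (indicator {0..1} t *\<^sub>R ?\<phi> t) \<partial>lborel)"
        using I1 by (simp add: has_bochner_integral_iff)
      also have "\<dots> \<le> (\<integral>t. indicator {0..1} t *\<^sub>R ((norm h)\<^sup>2 * (norm (D (x + t *\<^sub>R h)))\<^sup>2) + indicator {0..1} t *\<^sub>R a\<^sup>2 \<partial>lborel)"
      proof (rule integral_mono)
        show "integrable lborel (\<lambda>t. 2 * a * (indicator {0..1} t *\<^sub>R ?\<phi> t))"
          using I1 by (simp add: has_bochner_integral_iff)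
        show "integrable lborel (\<lambda>t. indicator {0..1} t *\<^sub>R ((norm h)\<^sup>2 * (norm (D (x + t *\<^sub>R h)))\<^sup>2) + indicator {0..1} t *\<^sub>R a\<^sup>2)"
          using I2 I0(1) by (rule Bochner_Integration.integrable_add)
        fix t :: real
        have "2 * a * ?\<phi> t \<le> (?\<phi> t)\<^sup>2 + a\<^sup>2"
          using sum_squares_bound[of a "?\<phi> t"] by simp
        moreover have "(?\<phi> t)\<^sup>2 \<le> (norm h)\<^sup>2 * (norm (D (x + t *\<^sub>R h)))\<^sup>2"
          using Cauchy_Schwarz_ineq[of h "D (x + t *\<^sub>R h)"] by (simp add: power2_norm_eq_inner)
        ultimately show "2 * a * (indicator {0..1} t *\<^sub>R ?\<phi> t) \<le> indicator {0..1} t *\<^sub>R ((norm h)\<^sup>2 * (norm (D (x + t *\<^sub>R h)))\<^sup>2) + indicator {0..1} t *\<^sub>R a\<^sup>2"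
          by (simp split: split_indicator)
      qed
      finally show ?thesis .
    qed
    then have "a\<^sup>2 \<le> (\<integral>t. indicator {0..1} t *\<^sub>R ((norm h)\<^sup>2 * (norm (D (x + t *\<^sub>R h)))\<^sup>2) \<partial>lborel)"
      using I2 I0 by (simp add: power2_eq_square)
    then have "ennreal (a\<^sup>2) \<le> (\<integral>\<^sup>+t. ennreal (indicator {0..1} t *\<^sub>R ((norm h)\<^sup>2 * (norm (D (x + t *\<^sub>R h)))\<^sup>2)) \<partial>lborel)"
      using I2 by (subst nn_integral_eq_integral) (auto intro: ennreal_leI)
    also have "\<dots> = (\<integral>\<^sup>+t. indicator {0..1} t * ennreal ((norm h)\<^sup>2 * (norm (E (x + t *\<^sub>R h)))\<^sup>2) \<partial>lborel)"
      using seg by (intro nn_integral_cong) (auto simp: E_def split: split_indicator)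
    finally show ?thesis using True by (simp add: a_def)
  qed auto
  have "(\<integral>\<^sup>+x. ennreal (indicator B x * indicator B (x + h) * (F (x + h) - F x)\<^sup>2) \<partial>lborel)
    \<le> (\<integral>\<^sup>+x. (\<integral>\<^sup>+t. indicator {0..1::real} t * ennreal ((norm h)\<^sup>2 * (norm (E (x + t *\<^sub>R h)))\<^sup>2) \<partial>lborel) \<partial>lborel)"
    by (rule nn_integral_mono) (rule pw)
  also have "\<dots> = (\<integral>\<^sup>+t. (\<integral>\<^sup>+x. indicator {0..1::real} t * ennreal ((norm h)\<^sup>2 * (norm (E (x + t *\<^sub>R h)))\<^sup>2) \<partial>lborel) \<partial>lborel)"
    by (rule lborel_pair.Fubini') measurable
  also have "\<dots> = (\<integral>\<^sup>+t. indicator {0..1::real} t * (\<integral>\<^sup>+x. ennreal ((norm h)\<^sup>2 * (norm (E x))\<^sup>2) \<partial>lborel) \<partial>lborel)"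
  proof (rule nn_integral_cong)
    fix t :: real
    show "(\<integral>\<^sup>+x. indicator {0..1::real} t * ennreal ((norm h)\<^sup>2 * (norm (E (x + t *\<^sub>R h)))\<^sup>2) \<partial>lborel)
      = indicator {0..1::real} t * (\<integral>\<^sup>+x. ennreal ((norm h)\<^sup>2 * (norm (E x))\<^sup>2) \<partial>lborel)"
      by (subst nn_integral_cmult, measurable, subst nn_integral_lborel_translate[where f="\<lambda>x. ennreal ((norm h)\<^sup>2 * (norm (E x))\<^sup>2)"]) auto
  qed
  also have "\<dots> = (\<integral>\<^sup>+x. ennreal ((norm h)\<^sup>2 * (norm (E x))\<^sup>2) \<partial>lborel)"
    by (simp add: nn_integral_multc)
  also have "\<dots> = ennreal ((norm h)\<^sup>2) * (\<integral>\<^sup>+x. ennreal ((norm (E x))\<^sup>2) \<partial>lborel)"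
    by (subst nn_integral_cmult[symmetric]) (auto simp: ennreal_mult)
  also have "(\<integral>\<^sup>+x. ennreal ((norm (E x))\<^sup>2) \<partial>lborel) = (\<integral>\<^sup>+x. ennreal (indicator B x * (norm (D x))\<^sup>2) \<partial>lborel)"
    by (intro nn_integral_cong) (auto simp: E_def split: split_indicator)
  finally show ?thesis .
qed

text \<open>\<open>g\<close> is the gradient of \<open>f\<close> in the strong sense. A convergent sequence in \<open>L\<^sup>2\<close> has a subsequence
  that converges almost everywhere and is dominated in \<open>L\<^sup>2\<close>; recording the latter makes every passage
  to the limit an instance of dominated convergence.\<close>

definition H1_approx :: "'a::euclidean_space set \<Rightarrow> real set \<Rightarrow> ('a \<Rightarrow> real) \<Rightarrow> ('a \<Rightarrow> 'a) \<Rightarrow> bool" where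
  "H1_approx B I f g \<longleftrightarrow> f \<in> borel_measurable borel \<and> g \<in> borel_measurable borel \<and>
    (\<exists>F D W. (\<forall>k. \<forall>x\<in>B. GDERIV (F k) x :> D k x \<and> F k x \<in> I) \<and> (\<forall>k::nat. continuous_on B (D k)) \<and>
      set_integrable lborel B W \<and>
      (AE x in lborel. x \<in> B \<longrightarrow> (\<lambda>k. F k x) \<longlonglongrightarrow> f x \<and> (\<lambda>k. D k x) \<longlonglongrightarrow> g x \<and>
        (\<forall>k. (F k x)\<^sup>2 \<le> W x \<and> (norm (D k x))\<^sup>2 \<le> W x)))"

lemma borel_measurable_GDERIV_on:
  fixes F :: "'a::euclidean_space \<Rightarrow> real"
  assumes "open B" "\<And>x. x \<in> B \<Longrightarrow> GDERIV F x :> D x"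
  shows "(\<lambda>x. indicator B x * F x) \<in> borel_measurable borel" "continuous_on B F"
proof -
  show c: "continuous_on B F"
    unfolding continuous_on_eq_continuous_at[OF assms(1)]
    using assms(2) unfolding gderiv_def by (auto intro: has_derivative_continuous)
  have "(\<lambda>x. indicator B x *\<^sub>R F x) \<in> borel_measurable borel"
    by (rule borel_measurable_continuous_on_indicator) (use assms c in auto)
  then show "(\<lambda>x. indicator B x * F x) \<in> borel_measurable borel" by simp
qed

lemma borel_measurable_on_open:
  fixes D :: "'a::euclidean_space \<Rightarrow> 'b::{real_normed_vector,second_countable_topology}"
  assumes "open B" "continuous_on B D"
  shows "(\<lambda>x. (indicator B x :: real) *\<^sub>R D x) \<in> borel_measurable borel"
  by (rule borel_measurable_continuous_on_indicator) (use assms in auto)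

lemma H1_approx_integrable:
  fixes f :: "'a::euclidean_space \<Rightarrow> real"
  assumes "H1_approx B I f g" "open B"
  shows "integrable lborel (\<lambda>x. indicator B x * (f x)\<^sup>2)"
    "integrable lborel (\<lambda>x. indicator B x * (norm (g x))\<^sup>2)"
    "closed I \<Longrightarrow> AE x in lborel. x \<in> B \<longrightarrow> f x \<in> I"
proof -
  from assms(1)[unfolded H1_approx_def] obtain F D W where
      m[measurable]: "f \<in> borel_measurable borel" "g \<in> borel_measurable borel"
    and der: "\<And>k x. x \<in> B \<Longrightarrow> GDERIV (F k) x :> D k x" "\<And>k x. x \<in> B \<Longrightarrow> F k x \<in> I"
    and cont: "\<And>k::nat. continuous_on B (D k)"
    and W: "set_integrable lborel B W"
    and ae: "AE x in lborel. x \<in> B \<longrightarrow> (\<lambda>k. F k x) \<longlonglongrightarrow> f x \<and> (\<lambda>k. D k x) \<longlonglongrightarrow> g x \<and>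
        (\<forall>k. (F k x)\<^sup>2 \<le> W x \<and> (norm (D k x))\<^sup>2 \<le> W x)"
    by blast
  have [measurable]: "B \<in> sets borel" using assms(2) by simp
  have ae2: "AE x in lborel. x \<in> B \<longrightarrow> (f x)\<^sup>2 \<le> W x \<and> (norm (g x))\<^sup>2 \<le> W x"
    using ae
  proof eventually_elim
    case (elim x)
    show ?case
    proof
      assume x: "x \<in> B"
      have "(\<lambda>k. (F k x)\<^sup>2) \<longlonglongrightarrow> (f x)\<^sup>2" "(\<lambda>k. (norm (D k x))\<^sup>2) \<longlonglongrightarrow> (norm (g x))\<^sup>2"
        using elim x by (auto intro!: tendsto_intros)
      then show "(f x)\<^sup>2 \<le> W x \<and> (norm (g x))\<^sup>2 \<le> W x"
        using elim x by (auto intro: LIMSEQ_le_const2)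
    qed
  qed
  show "integrable lborel (\<lambda>x. indicator B x * (f x)\<^sup>2)"
    by (rule Bochner_Integration.integrable_bound[OF W[unfolded set_integrable_def]])
       (use ae2 in \<open>auto split: split_indicator\<close>)
  show "integrable lborel (\<lambda>x. indicator B x * (norm (g x))\<^sup>2)"
    by (rule Bochner_Integration.integrable_bound[OF W[unfolded set_integrable_def]])
       (use ae2 in \<open>auto split: split_indicator\<close>)
  show "AE x in lborel. x \<in> B \<longrightarrow> f x \<in> I" if "closed I"
    using ae
  proof eventually_elim
    case (elim x)
    then show ?case using closed_sequentially[OF that, of "\<lambda>k. F k x" "f x"] der(2)[of x] by auto
  qed
qed

text \<open>The C1 estimate passes to the limit by Fatou's lemma on the side of the differences and
  by dominated convergence on the side of the gradients.\<close>

lemma translation_bound_H1: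
  fixes u :: "'a::euclidean_space \<Rightarrow> real"
  assumes "H1_approx B I u w" and B: "open B" "convex B"
  shows "translation_bound B u (\<integral>x. indicator B x * (norm (w x))\<^sup>2 \<partial>lborel)"
  unfolding translation_bound_def
proof
  fix h :: 'a
  from assms(1)[unfolded H1_approx_def] obtain F D W where
      m[measurable]: "u \<in> borel_measurable borel" "w \<in> borel_measurable borel"
    and der: "\<And>k x. x \<in> B \<Longrightarrow> GDERIV (F k) x :> D k x" "\<And>k x. x \<in> B \<Longrightarrow> F k x \<in> I"
    and cont: "\<And>k::nat. continuous_on B (D k)"
    and W: "set_integrable lborel B W"
    and ae: "AE x in lborel. x \<in> B \<longrightarrow> (\<lambda>k. F k x) \<longlonglongrightarrow> u x \<and> (\<lambda>k. D k x) \<longlonglongrightarrow> w x \<and>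
        (\<forall>k. (F k x)\<^sup>2 \<le> W x \<and> (norm (D k x))\<^sup>2 \<le> W x)"
    by blast
  have [measurable]: "B \<in> sets borel" using B by simp
  let ?i = "\<lambda>x. indicator B x * indicator B (x + h) :: real"
  have Fm[measurable]: "(\<lambda>x. indicator B x * F k x) \<in> borel_measurable borel" for k
    by (rule borel_measurable_GDERIV_on[OF B(1) der(1)])
  have Dm: "(\<lambda>x. (indicator B x :: real) *\<^sub>R D k x) \<in> borel_measurable borel" for k
    by (rule borel_measurable_on_open[OF B(1) cont])
  have Dm2: "(\<lambda>x. indicator B x * (norm (D k x))\<^sup>2) \<in> borel_measurable borel" for k
  proof -
    have "(\<lambda>x. indicator B x * (norm (D k x))\<^sup>2) = (\<lambda>x. (norm ((indicator B x :: real) *\<^sub>R D k x))\<^sup>2)"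
      by (auto split: split_indicator)
    moreover have "(\<lambda>x. (norm ((indicator B x :: real) *\<^sub>R D k x))\<^sup>2) \<in> borel_measurable borel"
      using Dm[of k] by measurable
    ultimately show ?thesis by (simp only:)
  qed
  have lim: "(\<lambda>k. \<integral>x. indicator B x * (norm (D k x))\<^sup>2 \<partial>lborel) \<longlonglongrightarrow> (\<integral>x. indicator B x * (norm (w x))\<^sup>2 \<partial>lborel)"
    and int: "integrable lborel (\<lambda>x. indicator B x * (norm (D k x))\<^sup>2)" for k
  proof -
    have a1: "AE x in lborel. (\<lambda>k. indicator B x * (norm (D k x))\<^sup>2) \<longlonglongrightarrow> indicator B x * (norm (w x))\<^sup>2"
      using ae by eventually_elim (auto split: split_indicator intro!: tendsto_intros)
    have a2: "AE x in lborel. norm (indicator B x * (norm (D k x))\<^sup>2) \<le> indicator B x *\<^sub>R W x" for k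
      using ae by eventually_elim (auto split: split_indicator)
    have m1: "(\<lambda>x. indicator B x * (norm (w x))\<^sup>2) \<in> borel_measurable lborel" by measurable
    have m2: "\<And>k. (\<lambda>x. indicator B x * (norm (D k x))\<^sup>2) \<in> borel_measurable lborel" using Dm2 by simp
    note dc = m1 m2 W[unfolded set_integrable_def] a1 a2
    show "(\<lambda>k. \<integral>x. indicator B x * (norm (D k x))\<^sup>2 \<partial>lborel) \<longlonglongrightarrow> (\<integral>x. indicator B x * (norm (w x))\<^sup>2 \<partial>lborel)"
      by (rule integral_dominated_convergence[OF dc])
    show "integrable lborel (\<lambda>x. indicator B x * (norm (D k x))\<^sup>2)"
      by (rule integrable_dominated_convergence2[OF dc])
  qed
  have "(\<integral>\<^sup>+x. ennreal (?i x * (u (x + h) - u x)\<^sup>2) \<partial>lborel)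
    = (\<integral>\<^sup>+x. liminf (\<lambda>k. ennreal (?i x * (F k (x + h) - F k x)\<^sup>2)) \<partial>lborel)"
  proof (rule nn_integral_cong_AE)
    show "AE x in lborel. ennreal (?i x * (u (x + h) - u x)\<^sup>2) = liminf (\<lambda>k. ennreal (?i x * (F k (x + h) - F k x)\<^sup>2))"
      using ae AE_lborel_translate[OF ae, of h]
    proof eventually_elim
      case (elim x)
      have "(\<lambda>k. ennreal (?i x * (F k (x + h) - F k x)\<^sup>2)) \<longlonglongrightarrow> ennreal (?i x * (u (x + h) - u x)\<^sup>2)"
        using elim by (auto split: split_indicator intro!: tendsto_intros)
      then show ?case by (rule lim_imp_Liminf[OF sequentially_bot, symmetric])
    qed
  qed
  also have "\<dots> \<le> liminf (\<lambda>k. \<integral>\<^sup>+x. ennreal (?i x * (F k (x + h) - F k x)\<^sup>2) \<partial>lborel)"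
  proof (rule nn_integral_liminf)
    fix k
    have "(\<lambda>x. ennreal (?i x * (F k (x + h) - F k x)\<^sup>2)) =
      (\<lambda>x. ennreal (?i x * ((\<lambda>x. indicator B x * F k x) (x + h) - indicator B x * F k x)\<^sup>2))"
      by (auto split: split_indicator)
    also have "\<dots> \<in> borel_measurable lborel"
      using measurable_compose[OF _ Fm[of k], of "\<lambda>x. x + h" borel] by measurable
    finally show "(\<lambda>x. ennreal (?i x * (F k (x + h) - F k x)\<^sup>2)) \<in> borel_measurable lborel" .
  qed
  also have "\<dots> \<le> liminf (\<lambda>k. ennreal ((norm h)\<^sup>2 * (\<integral>x. indicator B x * (norm (D k x))\<^sup>2 \<partial>lborel)))"
  proof (rule Liminf_mono, rule always_eventually, rule allI)
    fix k
    have "(\<integral>\<^sup>+x. ennreal (?i x * (F k (x + h) - F k x)\<^sup>2) \<partial>lborel)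
      \<le> ennreal ((norm h)\<^sup>2) * (\<integral>\<^sup>+x. ennreal (indicator B x * (norm (D k x))\<^sup>2) \<partial>lborel)"
      by (rule translation_estimate_C1[OF B der(1) cont])
    also have "\<dots> = ennreal ((norm h)\<^sup>2 * (\<integral>x. indicator B x * (norm (D k x))\<^sup>2 \<partial>lborel))"
      by (subst nn_integral_eq_integral[OF int]) (auto simp: ennreal_mult)
    finally show "(\<integral>\<^sup>+x. ennreal (?i x * (F k (x + h) - F k x)\<^sup>2) \<partial>lborel)
      \<le> ennreal ((norm h)\<^sup>2 * (\<integral>x. indicator B x * (norm (D k x))\<^sup>2 \<partial>lborel))" .
  qed
  also have "\<dots> = ennreal ((norm h)\<^sup>2 * (\<integral>x. indicator B x * (norm (w x))\<^sup>2 \<partial>lborel))"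
    by (intro lim_imp_Liminf tendsto_intros lim) simp
  finally show "(\<integral>\<^sup>+x. ennreal (?i x * (u (x + h) - u x)\<^sup>2) \<partial>lborel)
    \<le> ennreal ((norm h)\<^sup>2 * (\<integral>x. indicator B x * (norm (w x))\<^sup>2 \<partial>lborel))" .
qed

text \<open>Turns the common majorant \<open>W\<close> of the squared approximants into a majorant
  of the squared compositions; the constant \<open>a\<close> is integrable there because the sets
  concerned have finite measure.\<close>

lemma linear_growth:
  fixes G :: "real \<Rightarrow> real"
  assumes I: "is_interval I" "I \<noteq> {}"
    and G: "\<And>s. s \<in> I \<Longrightarrow> (G has_real_derivative G' s) (at s)" and L: "\<And>s. s \<in> I \<Longrightarrow> \<bar>G' s\<bar> \<le> L"
  obtains a where "0 \<le> a" "\<And>s. s \<in> I \<Longrightarrow> (G s)\<^sup>2 \<le> a + 2 * L\<^sup>2 * s\<^sup>2"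
proof -
  obtain s0 where s0: "s0 \<in> I" using I by auto
  have L0: "0 \<le> L" using L[OF s0] by linarith
  define b where "b = \<bar>G s0\<bar> + L * \<bar>s0\<bar>"
  have b: "0 \<le> b" using L0 by (simp add: b_def)
  show ?thesis
  proof (rule that[of "2 * b\<^sup>2"])
    fix s assume s: "s \<in> I"
    have "\<bar>G s - G s0\<bar> \<le> L * \<bar>s - s0\<bar>"
      using field_differentiable_bound[of I G G' L s s0] s s0 I L
        has_field_derivative_at_within[OF G] by (auto simp: is_interval_convex)
    also have "\<dots> \<le> L * \<bar>s\<bar> + L * \<bar>s0\<bar>"
      using L0 abs_triangle_ineq4[of s s0] by (metis distrib_left mult_left_mono)
    finally have "\<bar>G s\<bar> \<le> b + L * \<bar>s\<bar>" unfolding b_def by linarith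
    then have "(G s)\<^sup>2 \<le> (b + L * \<bar>s\<bar>)\<^sup>2" by (metis abs_ge_zero power2_abs power_mono)
    also have "\<dots> \<le> 2 * b\<^sup>2 + 2 * L\<^sup>2 * s\<^sup>2"
      using sum_squares_bound[of b "L * \<bar>s\<bar>"] by (simp add: power2_sum power_mult_distrib)
    finally show "(G s)\<^sup>2 \<le> 2 * b\<^sup>2 + 2 * L\<^sup>2 * s\<^sup>2" .
  qed simp
qed

lemma tendsto_compose_on:
  assumes "continuous_on I G" "\<And>k::nat. F k \<in> I" "F \<longlonglongrightarrow> y" "closed I"
  shows "(\<lambda>k. G (F k)) \<longlonglongrightarrow> G y"
proof -
  have "y \<in> I" using closed_sequentially[OF assms(4)] assms(2,3) by blast
  then show ?thesis
    using assms by (auto intro!: continuous_on_tendsto_compose[OF assms(1)])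
qed

lemma set_integrable_const_finite:
  fixes c :: real
  assumes "B \<in> sets borel" "emeasure lborel B < \<infinity>"
  shows "set_integrable lborel B (\<lambda>x. c)"
  using assms unfolding set_integrable_def by simp

text \<open>Product and chain rule hold for each approximant. Continuity of \<open>G\<close> and
  \<open>G'\<close> on the closed set \<open>I\<close> carries them to the limit, and the old
  dominating function yields a new one.\<close>

lemma H1_approx_comp_mult:
  fixes f :: "'a::euclidean_space \<Rightarrow> real"
  assumes H: "H1_approx B I f g" and B: "open B" "emeasure lborel B < \<infinity>"
    and I: "is_interval I" "I \<noteq> {}" "closed I"
    and G: "\<And>s. s \<in> I \<Longrightarrow> (G has_real_derivative G' s) (at s)" and L: "\<And>s. s \<in> I \<Longrightarrow> \<bar>G' s\<bar> \<le> L"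
    and G'c: "continuous_on I G'"
    and meas: "G \<in> borel_measurable borel" "G' \<in> borel_measurable borel" "\<zeta> \<in> borel_measurable borel" "Z \<in> borel_measurable borel"
    and \<zeta>: "\<And>x. x \<in> B \<Longrightarrow> GDERIV \<zeta> x :> Z x" "continuous_on B Z"
    and c: "\<And>x. x \<in> B \<Longrightarrow> \<bar>\<zeta> x\<bar> \<le> c" "\<And>x. x \<in> B \<Longrightarrow> norm (Z x) \<le> c"
  shows "H1_approx B UNIV (\<lambda>x. \<zeta> x * G (f x)) (\<lambda>x. (\<zeta> x * G' (f x)) *\<^sub>R g x + G (f x) *\<^sub>R Z x)"
proof -
  note [measurable] = meas
  from H[unfolded H1_approx_def] obtain F D W where
      m[measurable]: "f \<in> borel_measurable borel" "g \<in> borel_measurable borel"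
    and der: "\<And>k x. x \<in> B \<Longrightarrow> GDERIV (F k) x :> D k x" "\<And>k x. x \<in> B \<Longrightarrow> F k x \<in> I"
    and cont: "\<And>k::nat. continuous_on B (D k)"
    and W: "set_integrable lborel B W"
    and ae: "AE x in lborel. x \<in> B \<longrightarrow> (\<lambda>k. F k x) \<longlonglongrightarrow> f x \<and> (\<lambda>k. D k x) \<longlonglongrightarrow> g x \<and>
        (\<forall>k. (F k x)\<^sup>2 \<le> W x \<and> (norm (D k x))\<^sup>2 \<le> W x)"
    by blast
  obtain a where a: "0 \<le> a" "\<And>s. s \<in> I \<Longrightarrow> (G s)\<^sup>2 \<le> a + 2 * L\<^sup>2 * s\<^sup>2"
    using linear_growth[OF I(1,2) G L] by metis
  have Gc: "continuous_on I G"
    using G by (meson DERIV_continuous_on has_field_derivative_at_within)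
  have Fc: "continuous_on B (F k)" for k
    by (rule borel_measurable_GDERIV_on[OF B(1) der(1)])
  have \<zeta>c: "continuous_on B \<zeta>"
    by (rule borel_measurable_GDERIV_on[OF B(1) \<zeta>(1)])
  have GF: "continuous_on B (\<lambda>x. G (F k x))" "continuous_on B (\<lambda>x. G' (F k x))" for k
    using continuous_on_compose2[OF Gc Fc] continuous_on_compose2[OF G'c Fc] der(2) by auto
  \<comment> \<open>The gradient contributes \<open>2 c^2 L^2 W\<close> from the term with
    \<open>G'\<close> and \<open>2 c^2 (a + 2 L^2 W)\<close> from the term with \<open>G\<close>;
    their sum also dominates the square of the function itself.\<close>
  define W' where "W' x = c\<^sup>2 * (2 * a) + (c\<^sup>2 * 6 * L\<^sup>2) * W x" for x
  have "set_integrable lborel B W'"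
    unfolding W'_def using B
    by (intro set_integral_add set_integrable_mult_right[OF W] set_integrable_const_finite) auto
  moreover have "\<forall>k. \<forall>x\<in>B. GDERIV (\<lambda>x. \<zeta> x * G (F k x)) x :> (\<zeta> x * G' (F k x)) *\<^sub>R D k x + G (F k x) *\<^sub>R Z x \<and> \<zeta> x * G (F k x) \<in> UNIV"
  proof (intro allI ballI)
    fix k x assume x: "x \<in> B"
    have "GDERIV (\<lambda>x. \<zeta> x * G (F k x)) x :> \<zeta> x *\<^sub>R (G' (F k x) *\<^sub>R D k x) + G (F k x) *\<^sub>R Z x"
      by (intro GDERIV_mult GDERIV_DERIV_compose \<zeta> der G x)
    then show "GDERIV (\<lambda>x. \<zeta> x * G (F k x)) x :> (\<zeta> x * G' (F k x)) *\<^sub>R D k x + G (F k x) *\<^sub>R Z x \<and> \<zeta> x * G (F k x) \<in> UNIV"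
      by simp
  qed
  moreover have "\<forall>k. continuous_on B (\<lambda>x. (\<zeta> x * G' (F k x)) *\<^sub>R D k x + G (F k x) *\<^sub>R Z x)"
    by (intro allI continuous_intros \<zeta>c GF cont \<zeta>)
  moreover have "AE x in lborel. x \<in> B \<longrightarrow> (\<lambda>k. \<zeta> x * G (F k x)) \<longlonglongrightarrow> \<zeta> x * G (f x) \<and>
      (\<lambda>k. (\<zeta> x * G' (F k x)) *\<^sub>R D k x + G (F k x) *\<^sub>R Z x) \<longlonglongrightarrow> (\<zeta> x * G' (f x)) *\<^sub>R g x + G (f x) *\<^sub>R Z x \<and>
        (\<forall>k. (\<zeta> x * G (F k x))\<^sup>2 \<le> W' x \<and> (norm ((\<zeta> x * G' (F k x)) *\<^sub>R D k x + G (F k x) *\<^sub>R Z x))\<^sup>2 \<le> W' x)"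
    using ae
  proof eventually_elim
    case (elim x)
    show ?case
    proof
      assume x: "x \<in> B"
      have F: "(\<lambda>k. F k x) \<longlonglongrightarrow> f x" and D: "(\<lambda>k. D k x) \<longlonglongrightarrow> g x"
        and bd: "\<And>k. (F k x)\<^sup>2 \<le> W x" "\<And>k. (norm (D k x))\<^sup>2 \<le> W x" using elim x by auto
      have l: "(\<lambda>k. G (F k x)) \<longlonglongrightarrow> G (f x)" "(\<lambda>k. G' (F k x)) \<longlonglongrightarrow> G' (f x)"
        using tendsto_compose_on[OF Gc _ F I(3)] tendsto_compose_on[OF G'c _ F I(3)] der(2)[OF x] by auto
      have "0 \<le> W x" using bd(1)[of 0] zero_le_power2 order_trans by blast
      have "(\<zeta> x * G (F k x))\<^sup>2 \<le> W' x \<and> (norm ((\<zeta> x * G' (F k x)) *\<^sub>R D k x + G (F k x) *\<^sub>R Z x))\<^sup>2 \<le> W' x" for k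
      proof -
        have c2: "(\<zeta> x)\<^sup>2 \<le> c\<^sup>2" "(norm (Z x))\<^sup>2 \<le> c\<^sup>2"
          using c[OF x] by (metis abs_ge_zero power2_abs power_mono, metis norm_ge_zero power_mono c(2) x)
        have G2: "(G (F k x))\<^sup>2 \<le> a + 2 * L\<^sup>2 * W x"
          using a(2)[OF der(2)[OF x], of k] mult_left_mono[OF bd(1)[of k], of "2 * L\<^sup>2"] by simp
        have L2: "(G' (F k x))\<^sup>2 \<le> L\<^sup>2"
          using L[OF der(2)[OF x]] by (metis abs_ge_zero power2_abs power_mono)
        have A: "(\<zeta> x)\<^sup>2 * (G (F k x))\<^sup>2 \<le> c\<^sup>2 * (a + 2 * L\<^sup>2 * W x)"
          using c2 G2 by (intro mult_mono) auto
        have A2: "(norm (Z x))\<^sup>2 * (G (F k x))\<^sup>2 \<le> c\<^sup>2 * (a + 2 * L\<^sup>2 * W x)"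
          using c2 G2 by (intro mult_mono) auto
        have A3: "((\<zeta> x)\<^sup>2 * (G' (F k x))\<^sup>2) * (norm (D k x))\<^sup>2 \<le> (c\<^sup>2 * L\<^sup>2) * W x"
          using c2 L2 bd by (intro mult_mono) auto
        have "(norm ((\<zeta> x * G' (F k x)) *\<^sub>R D k x + G (F k x) *\<^sub>R Z x))\<^sup>2
          \<le> (norm ((\<zeta> x * G' (F k x)) *\<^sub>R D k x) + norm (G (F k x) *\<^sub>R Z x))\<^sup>2"
          by (intro power_mono norm_triangle_ineq) simp
        also have "\<dots> \<le> 2 * (norm ((\<zeta> x * G' (F k x)) *\<^sub>R D k x))\<^sup>2 + 2 * (norm (G (F k x) *\<^sub>R Z x))\<^sup>2"
          using sum_squares_bound[of "norm ((\<zeta> x * G' (F k x)) *\<^sub>R D k x)" "norm (G (F k x) *\<^sub>R Z x)"]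
          unfolding power2_sum by linarith
        also have "\<dots> = 2 * (((\<zeta> x)\<^sup>2 * (G' (F k x))\<^sup>2) * (norm (D k x))\<^sup>2) + 2 * ((norm (Z x))\<^sup>2 * (G (F k x))\<^sup>2)"
          by (simp add: power_mult_distrib)
        also have "\<dots> \<le> 2 * ((c\<^sup>2 * L\<^sup>2) * W x) + 2 * (c\<^sup>2 * (a + 2 * L\<^sup>2 * W x))"
          using A2 A3 by linarith
        also have "\<dots> = W' x" by (simp add: W'_def algebra_simps)
        finally have B1: "(norm ((\<zeta> x * G' (F k x)) *\<^sub>R D k x + G (F k x) *\<^sub>R Z x))\<^sup>2 \<le> W' x" .
        have "(\<zeta> x * G (F k x))\<^sup>2 \<le> c\<^sup>2 * (a + 2 * L\<^sup>2 * W x)"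
          using A by (simp add: power_mult_distrib)
        also have "\<dots> \<le> c\<^sup>2 * (2 * a + 6 * L\<^sup>2 * W x)"
          using a(1) \<open>0 \<le> W x\<close> by (intro mult_left_mono add_mono mult_right_mono) auto
        finally have "(\<zeta> x * G (F k x))\<^sup>2 \<le> W' x" by (simp add: W'_def algebra_simps)
        with B1 show ?thesis by simp
      qed
      then show "(\<lambda>k. \<zeta> x * G (F k x)) \<longlonglongrightarrow> \<zeta> x * G (f x) \<and>
      (\<lambda>k. (\<zeta> x * G' (F k x)) *\<^sub>R D k x + G (F k x) *\<^sub>R Z x) \<longlonglongrightarrow> (\<zeta> x * G' (f x)) *\<^sub>R g x + G (f x) *\<^sub>R Z x \<and>
        (\<forall>k. (\<zeta> x * G (F k x))\<^sup>2 \<le> W' x \<and> (norm ((\<zeta> x * G' (F k x)) *\<^sub>R D k x + G (F k x) *\<^sub>R Z x))\<^sup>2 \<le> W' x)"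
        by (intro conjI tendsto_intros l D) auto
    qed
  qed
  moreover have "(\<lambda>x. \<zeta> x * G (f x)) \<in> borel_measurable borel" by measurable
  moreover have "(\<lambda>x. (\<zeta> x * G' (f x)) *\<^sub>R g x + G (f x) *\<^sub>R Z x) \<in> borel_measurable borel" by measurable
  ultimately show ?thesis unfolding H1_approx_def
    by (intro conjI exI[of _ "\<lambda>k x. \<zeta> x * G (F k x)"]
        exI[of _ "\<lambda>k x. (\<zeta> x * G' (F k x)) *\<^sub>R D k x + G (F k x) *\<^sub>R Z x"] exI[of _ W'])
qed

subsection \<open>Energy estimates\<close>

lemma GDERIV_zero_outside:
  fixes \<zeta> :: "'a::euclidean_space \<Rightarrow> real"
  assumes "closed K" "\<And>x. x \<notin> K \<Longrightarrow> \<zeta> x = 0" "x \<notin> K"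
  shows "GDERIV \<zeta> x :> Z \<longleftrightarrow> Z = 0"
proof -
  have z: "(\<zeta> has_derivative (\<lambda>h. 0)) (at x)"
    by (rule has_derivative_transform_within_open[where f="\<lambda>_. 0" and t=UNIV and s="- K"])
       (use assms in auto)
  show ?thesis
  proof
    assume "GDERIV \<zeta> x :> Z"
    then have "(\<lambda>h. h \<bullet> Z) = (\<lambda>h. 0)"
      unfolding gderiv_def using z has_derivative_unique by blast
    then have "Z \<bullet> Z = 0" by metis
    then show "Z = 0" by simp
  qed (use z in \<open>simp add: gderiv_def\<close>)
qed

lemma continuous_compact_support_bounded:
  fixes \<zeta> :: "'a::euclidean_space \<Rightarrow> 'b::real_normed_vector"
  assumes "compact K" "\<And>x. x \<notin> K \<Longrightarrow> \<zeta> x = 0" "continuous_on UNIV \<zeta>"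
  obtains c where "0 < c" "\<And>x. norm (\<zeta> x) \<le> c"
proof -
  have "bounded (\<zeta> ` K)"
    by (intro compact_imp_bounded compact_continuous_image continuous_on_subset[OF assms(3)]) (use assms in auto)
  then obtain b where b: "\<And>x. x \<in> K \<Longrightarrow> norm (\<zeta> x) \<le> b"
    unfolding bounded_iff by auto
  show ?thesis
  proof (rule that[of "max 1 b"])
    fix x show "norm (\<zeta> x) \<le> max 1 b"
      using b[of x] assms(2)[of x] by (cases "x \<in> K") auto
  qed auto
qed

text \<open>The matrix has disappeared: what remains is the flux \<open>q\<close>, its comparison
  with \<open>g\<close>, and its orthogonality to gradients of C1 functions with compact support in
  \<open>B\<close>. The integral in \<open>div_free\<close> is in effect one over \<open>K\<close>,
  since \<open>D\<close> vanishes off \<open>K\<close>. The interval \<open>I\<close> contains the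
  values of \<open>f\<close> on \<open>B\<close> up to a null set.\<close>

locale elliptic_flux =
  fixes \<Lambda> :: real and B :: "'a::euclidean_space set" and I :: "real set"
    and f :: "'a \<Rightarrow> real" and g q :: "'a \<Rightarrow> 'a"
  assumes Lam: "0 < \<Lambda>" and open_B: "open B" and bounded_B: "bounded B"
    and approx: "H1_approx B I f g"
    and I: "is_interval I" "I \<noteq> {}" "closed I"
    and q_measurable [measurable]: "q \<in> borel_measurable borel"
    and flux: "AE x in lborel. x \<in> B \<longrightarrow> norm (q x) \<le> \<Lambda> * norm (g x) \<and> (norm (g x))\<^sup>2 \<le> \<Lambda> * (q x \<bullet> g x)"
    and div_free: "\<And>\<phi> D K. (\<And>x. GDERIV \<phi> x :> D x) \<Longrightarrow> continuous_on UNIV D \<Longrightarrow> compact K \<Longrightarrow> K \<subseteq> B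
      \<Longrightarrow> (\<And>x. x \<notin> K \<Longrightarrow> \<phi> x = 0) \<Longrightarrow> (\<integral>x. q x \<bullet> D x \<partial>lborel) = 0"
begin

lemma f_measurable [measurable]: "f \<in> borel_measurable borel"
  and g_measurable [measurable]: "g \<in> borel_measurable borel"
  using approx unfolding H1_approx_def by auto

lemma B_sets [measurable]: "B \<in> sets borel"
  using open_B by simp

lemma B_finite: "emeasure lborel B < \<infinity>"
  by (rule emeasure_bounded_finite[OF bounded_B])

text \<open>The equation is tested with \<open>\<zeta>^2 \<psi>(f)\<close>. With \<open>f\<close>
  replaced by an approximant this is a C1 function supported in \<open>K\<close>, so
  \<open>div_free\<close> applies; dominated convergence does the rest.\<close>

lemma tested_equation:
  assumes \<psi>: "\<And>s. s \<in> I \<Longrightarrow> (\<psi> has_real_derivative \<psi>' s) (at s)" and L: "\<And>s. s \<in> I \<Longrightarrow> \<bar>\<psi>' s\<bar> \<le> L"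
    and \<psi>'c: "continuous_on I \<psi>'"
    and meas[measurable]: "\<psi> \<in> borel_measurable borel" "\<psi>' \<in> borel_measurable borel"
    and \<zeta>: "\<And>x. GDERIV \<zeta> x :> Z x" "continuous_on UNIV Z"
    and K: "compact K" "K \<subseteq> B" "\<And>x. x \<notin> K \<Longrightarrow> \<zeta> x = 0"
  shows "integrable lborel (\<lambda>x. (\<zeta> x)\<^sup>2 * \<psi>' (f x) * (q x \<bullet> g x) + 2 * \<zeta> x * \<psi> (f x) * (q x \<bullet> Z x))" (is "integrable _ ?h")
    and "(\<integral>x. (\<zeta> x)\<^sup>2 * \<psi>' (f x) * (q x \<bullet> g x) + 2 * \<zeta> x * \<psi> (f x) * (q x \<bullet> Z x) \<partial>lborel) = 0"
proof -
  from approx[unfolded H1_approx_def] obtain F D W where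
      der: "\<And>k x. x \<in> B \<Longrightarrow> GDERIV (F k) x :> D k x" "\<And>k x. x \<in> B \<Longrightarrow> F k x \<in> I"
    and cont: "\<And>k::nat. continuous_on B (D k)"
    and W: "set_integrable lborel B W"
    and ae: "AE x in lborel. x \<in> B \<longrightarrow> (\<lambda>k. F k x) \<longlonglongrightarrow> f x \<and> (\<lambda>k. D k x) \<longlonglongrightarrow> g x \<and>
        (\<forall>k. (F k x)\<^sup>2 \<le> W x \<and> (norm (D k x))\<^sup>2 \<le> W x)"
    by blast
  have Z0: "Z x = 0" if "x \<notin> K" for x
    using GDERIV_zero_outside[OF compact_imp_closed[OF K(1)], of \<zeta> x "Z x"] K(3) that \<zeta>(1) by blast
  have \<zeta>c: "continuous_on UNIV \<zeta>"
    using borel_measurable_GDERIV_on(2)[of UNIV \<zeta> Z] \<zeta> by auto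
  have [measurable]: "\<zeta> \<in> borel_measurable borel" "Z \<in> borel_measurable borel"
    using \<zeta>c \<zeta>(2) by (auto intro: borel_measurable_continuous_onI)
  obtain c1 where c1: "0 < c1" "\<And>x. norm (\<zeta> x) \<le> c1"
    using continuous_compact_support_bounded[OF K(1,3) \<zeta>c] by blast
  obtain c2 where c2: "0 < c2" "\<And>x. norm (Z x) \<le> c2"
    using continuous_compact_support_bounded[OF K(1) Z0 \<zeta>(2)] by blast
  define c where "c = max c1 c2"
  have c: "0 < c" "\<And>x. \<bar>\<zeta> x\<bar> \<le> c" "\<And>x. norm (Z x) \<le> c"
    using c1 c2 unfolding c_def by (auto simp: le_max_iff_disj)
  obtain a where a: "0 \<le> a" "\<And>s. s \<in> I \<Longrightarrow> (\<psi> s)\<^sup>2 \<le> a + 2 * L\<^sup>2 * s\<^sup>2"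
    using linear_growth[OF I(1,2) \<psi> L] by metis
  have L0: "0 \<le> L" using L I(2) by (metis abs_ge_zero all_not_in_conv order_trans)
  have \<psi>c: "continuous_on I \<psi>"
    using \<psi> by (meson DERIV_continuous_on has_field_derivative_at_within)
  have Fc: "continuous_on B (F k)" for k
    by (rule borel_measurable_GDERIV_on[OF open_B der(1)])
  have \<psi>F: "continuous_on B (\<lambda>x. \<psi> (F k x))" "continuous_on B (\<lambda>x. \<psi>' (F k x))" for k
    using continuous_on_compose2[OF \<psi>c Fc] continuous_on_compose2[OF \<psi>'c Fc] der(2) by auto
  define T where "T k x = ((\<zeta> x)\<^sup>2 * \<psi>' (F k x)) *\<^sub>R D k x + (2 * \<zeta> x * \<psi> (F k x)) *\<^sub>R Z x" for k x
  have T0: "T k x = 0" if "x \<notin> K" for k x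
    using Z0[OF that] K(3)[OF that] by (simp add: T_def)
  \<comment> \<open>\<open>T k\<close> is continuous on \<open>B\<close> and zero on the complement
    of \<open>K\<close>; these two open sets cover the space.\<close>
  have Tc: "continuous_on UNIV (T k)" for k
  proof -
    have "continuous_on B (T k)"
      unfolding T_def by (intro continuous_intros \<psi>F cont continuous_on_subset[OF \<zeta>c] continuous_on_subset[OF \<zeta>(2)]) auto
    moreover have "continuous_on (- K) (T k)"
      by (subst continuous_on_cong[OF refl, of _ _ "\<lambda>_. 0"]) (auto simp: T0)
    ultimately have "continuous_on (B \<union> - K) (T k)"
      using open_B K(1) by (intro continuous_on_open_Un) (auto simp: compact_imp_closed)
    moreover have "B \<union> - K = UNIV" using K(2) by auto
    ultimately show ?thesis by simp
  qed
  have Td: "GDERIV (\<lambda>x. \<zeta> x * (\<zeta> x * \<psi> (F k x))) x :> T k x" for k x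
  proof (cases "x \<in> B")
    case True
    have "GDERIV (\<lambda>x. \<zeta> x * (\<zeta> x * \<psi> (F k x))) x :>
      \<zeta> x *\<^sub>R (\<zeta> x *\<^sub>R (\<psi>' (F k x) *\<^sub>R D k x) + \<psi> (F k x) *\<^sub>R Z x) + (\<zeta> x * \<psi> (F k x)) *\<^sub>R Z x"
      by (intro GDERIV_mult GDERIV_DERIV_compose \<zeta> der \<psi> True)
    moreover have "\<zeta> x *\<^sub>R (\<zeta> x *\<^sub>R (\<psi>' (F k x) *\<^sub>R D k x) + \<psi> (F k x) *\<^sub>R Z x) + (\<zeta> x * \<psi> (F k x)) *\<^sub>R Z x = T k x"
      by (simp add: T_def power2_eq_square algebra_simps flip: scaleR_add_left)
    ultimately show ?thesis by simp
  next
    case False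
    then have "x \<notin> K" using K by auto
    then show ?thesis
      using GDERIV_zero_outside[OF compact_imp_closed[OF K(1)], of "\<lambda>x. \<zeta> x * (\<zeta> x * \<psi> (F k x))" x "T k x"] K(3) T0 by auto
  qed
  have zero: "(\<integral>x. q x \<bullet> T k x \<partial>lborel) = 0" for k
    by (rule div_free[OF Td Tc K(1,2)]) (simp add: K(3))
  \<comment> \<open>Half of \<open>|q|^2 + |T k|^2\<close>, where
    \<open>|q|^2 \<le> \<Lambda>^2 W\<close> and
    \<open>|T k|^2 \<le> 18 c^4 L^2 W + 8 c^4 a\<close>.\<close>
  define V where "V x = (\<Lambda>\<^sup>2 / 2 + 9 * c^4 * L\<^sup>2) * W x + 4 * c^4 * a" for x
  have V: "integrable lborel (\<lambda>x. indicator B x *\<^sub>R V x)"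
    using B_finite unfolding V_def set_integrable_def[symmetric]
    by (intro set_integral_add set_integrable_mult_right[OF W] set_integrable_const_finite) auto
  have lim: "AE x in lborel. (\<lambda>k. q x \<bullet> T k x) \<longlonglongrightarrow> ?h x"
    using ae
  proof eventually_elim
    case (elim x)
    show ?case
    proof (cases "x \<in> B")
      case True
      then have F: "(\<lambda>k. F k x) \<longlonglongrightarrow> f x" and D: "(\<lambda>k. D k x) \<longlonglongrightarrow> g x"
        using elim by auto
      have l: "(\<lambda>k. \<psi> (F k x)) \<longlonglongrightarrow> \<psi> (f x)" "(\<lambda>k. \<psi>' (F k x)) \<longlonglongrightarrow> \<psi>' (f x)"
        using tendsto_compose_on[OF \<psi>c _ F I(3)] tendsto_compose_on[OF \<psi>'c _ F I(3)] der(2)[OF True] by auto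
      have "(\<lambda>k. q x \<bullet> T k x) \<longlonglongrightarrow> q x \<bullet> (((\<zeta> x)\<^sup>2 * \<psi>' (f x)) *\<^sub>R g x + (2 * \<zeta> x * \<psi> (f x)) *\<^sub>R Z x)"
        unfolding T_def by (intro tendsto_intros l D)
      then show ?thesis by (simp add: inner_add_right)
    next
      case False
      then have "x \<notin> K" using K by auto
      then show ?thesis using T0 Z0 K(3) by simp
    qed
  qed
  have bd: "AE x in lborel. norm (q x \<bullet> T k x) \<le> indicator B x *\<^sub>R V x" for k
    using ae flux
  proof eventually_elim
    case (elim x)
    show ?case
    proof (cases "x \<in> B")
      case True
      have D: "(\<lambda>k. (norm (D k x))\<^sup>2) \<longlonglongrightarrow> (norm (g x))\<^sup>2"
        and b: "(F k x)\<^sup>2 \<le> W x" "\<And>k. (norm (D k x))\<^sup>2 \<le> W x" and q: "norm (q x) \<le> \<Lambda> * norm (g x)"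
        using elim True by (auto intro!: tendsto_intros)
      have gW: "(norm (g x))\<^sup>2 \<le> W x" by (rule LIMSEQ_le_const2[OF D]) (use b in auto)
      have W0: "0 \<le> W x" using gW zero_le_power2 order_trans by blast
      have "(norm (q x))\<^sup>2 \<le> (\<Lambda> * norm (g x))\<^sup>2" using q by (intro power_mono) auto
      also have "\<dots> \<le> \<Lambda>\<^sup>2 * W x" using gW by (simp add: power_mult_distrib mult_left_mono)
      finally have q2: "(norm (q x))\<^sup>2 \<le> \<Lambda>\<^sup>2 * W x" .
      have FI: "F k x \<in> I" using der(2)[OF True] .
      have \<psi>2: "(\<psi> (F k x))\<^sup>2 \<le> a + 2 * L\<^sup>2 * W x"
        using a(2)[OF FI] mult_left_mono[OF b(1), of "2 * L\<^sup>2"] by simp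
      have L2: "(\<psi>' (F k x))\<^sup>2 \<le> L\<^sup>2"
        using L[OF FI] by (metis abs_ge_zero power2_abs power_mono)
      have \<zeta>2: "(\<zeta> x)\<^sup>2 \<le> c\<^sup>2" using c(2)[of x] by (metis abs_ge_zero power2_abs power_mono)
      have \<zeta>4: "((\<zeta> x)\<^sup>2)\<^sup>2 \<le> (c\<^sup>2)\<^sup>2" using power_mono[OF \<zeta>2, of 2] by simp
      have Z2: "(norm (Z x))\<^sup>2 \<le> c\<^sup>2" using c(3)[of x] by (intro power_mono) auto
      have t1: "(norm (((\<zeta> x)\<^sup>2 * \<psi>' (F k x)) *\<^sub>R D k x))\<^sup>2 \<le> c^4 * L\<^sup>2 * W x"
      proof -
        have "(norm (((\<zeta> x)\<^sup>2 * \<psi>' (F k x)) *\<^sub>R D k x))\<^sup>2 = ((\<zeta> x)\<^sup>2)\<^sup>2 * (\<psi>' (F k x))\<^sup>2 * (norm (D k x))\<^sup>2"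
          by (simp add: power_mult_distrib)
        also have "\<dots> \<le> (c\<^sup>2)\<^sup>2 * L\<^sup>2 * W x"
          using \<zeta>4 L2 b by (intro mult_mono) auto
        finally show ?thesis by (simp flip: power_mult)
      qed
      have t2: "(norm ((2 * \<zeta> x * \<psi> (F k x)) *\<^sub>R Z x))\<^sup>2 \<le> 4 * c^4 * (a + 2 * L\<^sup>2 * W x)"
      proof -
        have "(norm ((2 * \<zeta> x * \<psi> (F k x)) *\<^sub>R Z x))\<^sup>2 = 4 * ((\<zeta> x)\<^sup>2 * (norm (Z x))\<^sup>2) * (\<psi> (F k x))\<^sup>2"
          by (simp add: power_mult_distrib)
        also have "\<dots> \<le> 4 * (c\<^sup>2 * c\<^sup>2) * (a + 2 * L\<^sup>2 * W x)"
          using \<zeta>2 Z2 \<psi>2 by (intro mult_mono) auto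
        finally show ?thesis by (simp flip: power_add)
      qed
      have "(norm (T k x))\<^sup>2 \<le> (norm (((\<zeta> x)\<^sup>2 * \<psi>' (F k x)) *\<^sub>R D k x) + norm ((2 * \<zeta> x * \<psi> (F k x)) *\<^sub>R Z x))\<^sup>2"
        unfolding T_def by (intro power_mono norm_triangle_ineq) simp
      also have "\<dots> \<le> 2 * (norm (((\<zeta> x)\<^sup>2 * \<psi>' (F k x)) *\<^sub>R D k x))\<^sup>2 + 2 * (norm ((2 * \<zeta> x * \<psi> (F k x)) *\<^sub>R Z x))\<^sup>2"
        using sum_squares_bound[of "norm (((\<zeta> x)\<^sup>2 * \<psi>' (F k x)) *\<^sub>R D k x)" "norm ((2 * \<zeta> x * \<psi> (F k x)) *\<^sub>R Z x)"]
        unfolding power2_sum by linarith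
      finally have T2: "(norm (T k x))\<^sup>2 \<le> 2 * (c^4 * L\<^sup>2 * W x) + 2 * (4 * c^4 * (a + 2 * L\<^sup>2 * W x))"
        using t1 t2 by linarith
      have "norm (q x \<bullet> T k x) \<le> norm (q x) * norm (T k x)" by (simp add: Cauchy_Schwarz_ineq2)
      also have "\<dots> \<le> ((norm (q x))\<^sup>2 + (norm (T k x))\<^sup>2) / 2"
        using sum_squares_bound[of "norm (q x)" "norm (T k x)"] by simp
      also have "\<dots> \<le> (\<Lambda>\<^sup>2 * W x + (2 * (c^4 * L\<^sup>2 * W x) + 2 * (4 * c^4 * (a + 2 * L\<^sup>2 * W x)))) / 2"
        using q2 T2 by simp
      also have "\<dots> = V x" by (simp add: V_def algebra_simps)
      finally show ?thesis using True by simp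
    next
      case False
      then have "x \<notin> K" using K by auto
      then show ?thesis using T0 False by simp
    qed
  qed
  have hm: "?h \<in> borel_measurable lborel" by measurable
  have Tm: "(\<lambda>x. q x \<bullet> T k x) \<in> borel_measurable lborel" for k
    using borel_measurable_continuous_onI[OF Tc[of k]] by measurable
  show "integrable lborel ?h"
    by (rule integrable_dominated_convergence[OF hm Tm V lim bd])
  have "(\<lambda>k. \<integral>x. q x \<bullet> T k x \<partial>lborel) \<longlonglongrightarrow> (\<integral>x. ?h x \<partial>lborel)"
    by (rule integral_dominated_convergence[OF hm Tm V lim bd])
  then show "(\<integral>x. ?h x \<partial>lborel) = 0" unfolding zero by (simp add: LIMSEQ_const_iff)
qed

text \<open>Caccioppoli's inequality. With \<open>p = G'\<close> and \<open>m = G\<close> it bounds the energy of \<open>G \<circ> f\<close> by its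
  \<open>L\<^sup>2\<close> norm; with \<open>m = 1\<close> it is the logarithmic estimate.\<close>

lemma energy_estimate:
  assumes \<psi>: "\<And>s. s \<in> I \<Longrightarrow> (\<psi> has_real_derivative \<psi>' s) (at s)" and L: "\<And>s. s \<in> I \<Longrightarrow> \<bar>\<psi>' s\<bar> \<le> L"
    and \<psi>'c: "continuous_on I \<psi>'"
    and meas[measurable]: "\<psi> \<in> borel_measurable borel" "\<psi>' \<in> borel_measurable borel"
      "p \<in> borel_measurable borel" "m \<in> borel_measurable borel"
    and pm: "\<And>s. s \<in> I \<Longrightarrow> (p s)\<^sup>2 \<le> \<psi>' s" "\<And>s. s \<in> I \<Longrightarrow> \<bar>\<psi> s\<bar> \<le> \<bar>p s\<bar> * \<bar>m s\<bar>"
    and m: "integrable lborel (\<lambda>x. indicator B x * (m (f x))\<^sup>2)"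
    and \<zeta>: "\<And>x. GDERIV \<zeta> x :> Z x" "continuous_on UNIV Z"
    and K: "compact K" "K \<subseteq> B" "\<And>x. x \<notin> K \<Longrightarrow> \<zeta> x = 0"
  shows "integrable lborel (\<lambda>x. (\<zeta> x)\<^sup>2 * (p (f x))\<^sup>2 * (norm (g x))\<^sup>2)" (is "integrable _ ?X")
    and "integrable lborel (\<lambda>x. (m (f x))\<^sup>2 * (norm (Z x))\<^sup>2)" (is "integrable _ ?Y")
    and "(\<integral>x. (\<zeta> x)\<^sup>2 * (p (f x))\<^sup>2 * (norm (g x))\<^sup>2 \<partial>lborel)
      \<le> 4 * \<Lambda>^4 * (\<integral>x. (m (f x))\<^sup>2 * (norm (Z x))\<^sup>2 \<partial>lborel)"
proof -
  let ?h = "\<lambda>x. (\<zeta> x)\<^sup>2 * \<psi>' (f x) * (q x \<bullet> g x) + 2 * \<zeta> x * \<psi> (f x) * (q x \<bullet> Z x)"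
  have te: "integrable lborel ?h" "(\<integral>x. ?h x \<partial>lborel) = 0"
    by (rule tested_equation[where L=L and K=K]; fact)+
  have Z0: "Z x = 0" if "x \<notin> K" for x
    using GDERIV_zero_outside[OF compact_imp_closed[OF K(1)], of \<zeta> x "Z x"] K(3) that \<zeta>(1) by blast
  have \<zeta>c: "continuous_on UNIV \<zeta>"
    using borel_measurable_GDERIV_on(2)[of UNIV \<zeta> Z] \<zeta> by auto
  have [measurable]: "\<zeta> \<in> borel_measurable borel" "Z \<in> borel_measurable borel"
    using \<zeta>c \<zeta>(2) by (auto intro: borel_measurable_continuous_onI)
  obtain c2 where c2: "0 < c2" "\<And>x. norm (Z x) \<le> c2"
    using continuous_compact_support_bounded[OF K(1) Z0 \<zeta>(2)] by blast
  show Y: "integrable lborel ?Y"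
  proof (rule Bochner_Integration.integrable_bound[OF integrable_mult_right[OF m, of "c2\<^sup>2"]])
    show "AE x in lborel. norm ((m (f x))\<^sup>2 * (norm (Z x))\<^sup>2) \<le> norm (c2\<^sup>2 * (indicator B x * (m (f x))\<^sup>2))"
    proof (rule AE_I2)
      fix x
      have "(norm (Z x))\<^sup>2 \<le> c2\<^sup>2" using c2 by (intro power_mono) auto
      then show "norm ((m (f x))\<^sup>2 * (norm (Z x))\<^sup>2) \<le> norm (c2\<^sup>2 * (indicator B x * (m (f x))\<^sup>2))"
        using Z0[of x] K(2) by (cases "x \<in> K") (auto simp: mult.commute mult_right_mono)
    qed
  qed measurable
  have fI: "AE x in lborel. x \<in> B \<longrightarrow> f x \<in> I"
    by (rule H1_approx_integrable(3)[OF approx open_B I(3)])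
  \<comment> \<open>Since \<open>?h\<close> integrates to zero, it is enough to bound
    \<open>?X\<close> by multiples of \<open>?h\<close> and \<open>?Y\<close>. With \<open>A\<close>
    and \<open>C\<close> the square roots of \<open>?X\<close> and \<open>?Y\<close>, ellipticity
    gives \<open>2 A^2 - 4 \<Lambda>^2 A C \<le> 2 \<Lambda> ?h\<close>, and Young's inequality
    absorbs the mixed term.\<close>
  have pw: "AE x in lborel. ?X x \<le> (2 * \<Lambda>) * ?h x + (4 * \<Lambda>^4) * ?Y x"
    using flux fI
  proof eventually_elim
    case (elim x)
    show ?case
    proof (cases "x \<in> B")
      case False
      then have "x \<notin> K" using K by auto
      then show ?thesis using K(3) Z0 by simp
    next
      case True
      then have q: "norm (q x) \<le> \<Lambda> * norm (g x)" "(norm (g x))\<^sup>2 \<le> \<Lambda> * (q x \<bullet> g x)" and s: "f x \<in> I"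
        using elim by auto
      have qg: "0 \<le> \<Lambda> * (q x \<bullet> g x)" using q(2) zero_le_power2 order_trans by blast
      define A where "A = \<bar>\<zeta> x\<bar> * \<bar>p (f x)\<bar> * norm (g x)"
      define C where "C = \<bar>m (f x)\<bar> * norm (Z x)"
      have AC: "0 \<le> A" "0 \<le> C" by (auto simp: A_def C_def)
      have X: "?X x = A\<^sup>2" and Yx: "?Y x = C\<^sup>2" by (auto simp: A_def C_def power_mult_distrib)
      have \<psi>0: "0 \<le> \<psi>' (f x)" using pm(1)[OF s] zero_le_power2 order_trans by blast
      have 1: "A\<^sup>2 \<le> (\<zeta> x)\<^sup>2 * \<psi>' (f x) * (\<Lambda> * (q x \<bullet> g x))"
        unfolding X[symmetric] using pm(1)[OF s] q(2) qg \<psi>0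
        by (intro mult_mono mult_left_mono) auto
      have "\<bar>2 * \<zeta> x * \<psi> (f x) * (q x \<bullet> Z x)\<bar> \<le> 2 * \<bar>\<zeta> x\<bar> * (\<bar>p (f x)\<bar> * \<bar>m (f x)\<bar>) * (\<Lambda> * norm (g x) * norm (Z x))"
      proof -
        have "\<bar>q x \<bullet> Z x\<bar> \<le> norm (q x) * norm (Z x)" by (rule Cauchy_Schwarz_ineq2)
        also have "\<dots> \<le> \<Lambda> * norm (g x) * norm (Z x)" using q by (intro mult_right_mono) auto
        finally have qZ: "\<bar>q x \<bullet> Z x\<bar> \<le> \<Lambda> * norm (g x) * norm (Z x)" .
        have "\<bar>2 * \<zeta> x * \<psi> (f x) * (q x \<bullet> Z x)\<bar> = 2 * \<bar>\<zeta> x\<bar> * \<bar>\<psi> (f x)\<bar> * \<bar>q x \<bullet> Z x\<bar>"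
          by (simp add: abs_mult)
        also have "\<dots> \<le> 2 * \<bar>\<zeta> x\<bar> * (\<bar>p (f x)\<bar> * \<bar>m (f x)\<bar>) * (\<Lambda> * norm (g x) * norm (Z x))"
          using qZ pm(2)[OF s] by (intro mult_mono) auto
        finally show ?thesis .
      qed
      also have "\<dots> = 2 * \<Lambda> * (A * C)" by (simp add: A_def C_def)
      finally have 2: "- (2 * \<Lambda> * (A * C)) \<le> 2 * \<zeta> x * \<psi> (f x) * (q x \<bullet> Z x)" by linarith
      have "2 * A\<^sup>2 - 4 * \<Lambda>\<^sup>2 * (A * C) \<le> (2 * \<Lambda>) * ?h x"
      proof -
        have "2 * A\<^sup>2 - 4 * \<Lambda>\<^sup>2 * (A * C) = 2 * A\<^sup>2 + (2 * \<Lambda>) * (- (2 * \<Lambda> * (A * C)))"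
          by (simp add: power2_eq_square)
        also have "\<dots> \<le> 2 * ((\<zeta> x)\<^sup>2 * \<psi>' (f x) * (\<Lambda> * (q x \<bullet> g x))) + (2 * \<Lambda>) * (2 * \<zeta> x * \<psi> (f x) * (q x \<bullet> Z x))"
          using 1 2 Lam by (intro add_mono mult_left_mono) auto
        also have "\<dots> = (2 * \<Lambda>) * ?h x" by (simp add: algebra_simps)
        finally show ?thesis .
      qed
      moreover have "0 \<le> (A - 2 * \<Lambda>\<^sup>2 * C)\<^sup>2" by simp
      then have "4 * \<Lambda>\<^sup>2 * (A * C) \<le> A\<^sup>2 + 4 * \<Lambda>^4 * C\<^sup>2"
        by (simp add: power2_eq_square power4_eq_xxxx algebra_simps)
      ultimately show ?thesis unfolding X Yx by linarith
    qed
  qed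
  have RI: "integrable lborel (\<lambda>x. (2 * \<Lambda>) * ?h x + (4 * \<Lambda>^4) * ?Y x)"
    by (rule Bochner_Integration.integrable_add[OF integrable_mult_right[OF te(1)] integrable_mult_right[OF Y]])
  show X: "integrable lborel ?X"
  proof (rule Bochner_Integration.integrable_bound[OF RI])
    show "AE x in lborel. norm (?X x) \<le> norm ((2 * \<Lambda>) * ?h x + (4 * \<Lambda>^4) * ?Y x)"
      using pw by eventually_elim auto
  qed measurable
  have "(\<integral>x. ?X x \<partial>lborel) \<le> (\<integral>x. (2 * \<Lambda>) * ?h x + (4 * \<Lambda>^4) * ?Y x \<partial>lborel)"
    by (rule integral_mono_AE[OF X RI pw])
  also have "\<dots> = (2 * \<Lambda>) * (\<integral>x. ?h x \<partial>lborel) + (4 * \<Lambda>^4) * (\<integral>x. ?Y x \<partial>lborel)"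
    by (simp only: Bochner_Integration.integral_add[OF integrable_mult_right[OF te(1)] integrable_mult_right[OF Y]]
        integral_mult_right_zero)
  finally show "(\<integral>x. ?X x \<partial>lborel) \<le> 4 * \<Lambda>^4 * (\<integral>x. ?Y x \<partial>lborel)"
    using te(2) by simp
qed

end

subsection \<open>The De Giorgi iteration\<close>

lemma DERIV_pos_part_power:
  "((\<lambda>s::real. (max 0 s) ^ (n + 2)) has_real_derivative real (n + 2) * (max 0 s) ^ (n + 1)) (at s)"
proof -
  consider "s > 0" | "s < 0" | "s = 0" by linarith
  then show ?thesis
  proof cases
    case 1
    have "((\<lambda>s::real. s ^ (n + 2)) has_real_derivative real (n + 2) * s ^ (n + 1)) (at s)"
      using DERIV_pow[of "n + 2" s UNIV] by simp
    then have "((\<lambda>s::real. (max 0 s) ^ (n + 2)) has_real_derivative real (n + 2) * s ^ (n + 1)) (at s)"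
      by (rule has_field_derivative_transform_within_open[where S="{0<..}"]) (use 1 in auto)
    then show ?thesis using 1 by simp
  next
    case 2
    have "((\<lambda>s::real. 0) has_real_derivative 0) (at s)" by simp
    then have "((\<lambda>s::real. (max 0 s) ^ (n + 2)) has_real_derivative 0) (at s)"
      by (rule has_field_derivative_transform_within_open[where S="{..<0}"]) (use 2 in auto)
    then show ?thesis using 2 by simp
  next
    case 3
    have c: "(\<lambda>h::real. (max 0 h) ^ (n + 1)) \<midarrow>0\<rightarrow> (max 0 0) ^ (n + 1)"
      by (intro tendsto_intros)
    have "(\<lambda>h::real. ((max 0 (0 + h)) ^ (n + 2) - (max 0 0) ^ (n + 2)) / h) \<midarrow>0\<rightarrow> 0"
    proof (rule Lim_transform_eventually)
      show "(\<lambda>h::real. (max 0 h) ^ (n + 1)) \<midarrow>0\<rightarrow> 0" using c by simp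
      show "\<forall>\<^sub>F h::real in at 0. (max 0 h) ^ (n + 1) = ((max 0 (0 + h)) ^ (n + 2) - (max 0 0) ^ (n + 2)) / h"
        unfolding eventually_at_filter by (rule always_eventually) (auto simp: max_def)
    qed
    then show ?thesis unfolding DERIV_def 3 by simp
  qed
qed

lemma DERIV_pos_part_2 [derivative_intros]:
  assumes "(\<phi> has_real_derivative d) (at s)"
  shows "((\<lambda>s. (max 0 (\<phi> s))\<^sup>2) has_real_derivative 2 * max 0 (\<phi> s) * d) (at s)"
  using DERIV_chain2[OF DERIV_pos_part_power[of 0 "\<phi> s"] assms] by (simp add: numeral_2_eq_2)

lemma DERIV_pos_part_3 [derivative_intros]:
  assumes "(\<phi> has_real_derivative d) (at s)"
  shows "((\<lambda>s. (max 0 (\<phi> s))^3) has_real_derivative 3 * (max 0 (\<phi> s))\<^sup>2 * d) (at s)"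
  using DERIV_chain2[OF DERIV_pos_part_power[of 1 "\<phi> s"] assms] by (simp add: numeral_3_eq_3 numeral_2_eq_2)

text \<open>A quadratic spline rising from 0 to 1 on [0,1] with slope at most 2 is composed with a
  function of the squared distance, which is smooth also at the centre. The chain rule gives a
  gradient of at most \<open>4 R / (R^2 - r^2)\<close>, hence at most
  \<open>4 / (R - r)\<close>.\<close>

lemma cutoff_exists:
  fixes x0 :: "'a::euclidean_space"
  assumes r: "0 < r" "r < R"
  obtains \<zeta> Z where "\<And>x. GDERIV \<zeta> x :> Z x" "continuous_on UNIV Z"
    "\<And>x. 0 \<le> \<zeta> x" "\<And>x. \<zeta> x \<le> 1" "\<And>x. x \<in> ball x0 r \<Longrightarrow> \<zeta> x = 1"
    "\<And>x. x \<notin> ball x0 R \<Longrightarrow> \<zeta> x = 0" "\<And>x. x \<notin> ball x0 R \<Longrightarrow> Z x = 0"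
    "\<And>x. norm (Z x) \<le> 4 / (R - r)"
proof -
  define p where "p t = 2 * (max 0 t)\<^sup>2 - 4 * (max 0 (t - 1/2))\<^sup>2 + 2 * (max 0 (t - 1))\<^sup>2" for t :: real
  define p' where "p' t = 4 * max 0 t - 8 * max 0 (t - 1/2) + 4 * max 0 (t - 1)" for t :: real
  have dp: "(p has_real_derivative p' t) (at t)" for t
    unfolding p_def p'_def by (auto intro!: derivative_eq_intros)
  have p'c: "continuous_on UNIV p'"
    unfolding p'_def by (intro continuous_intros)
  define d where "d = R\<^sup>2 - r\<^sup>2"
  have d: "0 < d" "d = (R - r) * (R + r)" using r unfolding d_def
    by (auto simp: power2_eq_square algebra_simps intro: mult_strict_mono)
  define \<tau> where "\<tau> x = (R\<^sup>2 - (x - x0) \<bullet> (x - x0)) / d" for x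
  have d\<tau>: "GDERIV \<tau> x :> (- 2 / d) *\<^sub>R (x - x0)" for x
    unfolding \<tau>_def gderiv_def using d(1)
    by (auto intro!: derivative_eq_intros ext simp: inner_commute algebra_simps diff_divide_distrib)
  have p_range: "0 \<le> p t" "p t \<le> 1" and p_zero: "t \<le> 0 \<Longrightarrow> p t = 0" "t \<le> 0 \<Longrightarrow> p' t = 0" and p_one: "1 \<le> t \<Longrightarrow> p t = 1"
    and p'_bound: "\<bar>p' t\<bar> \<le> 2" for t
  proof -
    show "t \<le> 0 \<Longrightarrow> p t = 0" "t \<le> 0 \<Longrightarrow> p' t = 0" by (auto simp: p_def p'_def)
    show "1 \<le> t \<Longrightarrow> p t = 1" by (simp add: p_def power2_eq_square algebra_simps)
    consider "t \<le> 0" | "0 < t" "t \<le> 1/2" | "1/2 < t" "t \<le> 1" | "1 < t" by linarith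
    then have "0 \<le> p t \<and> p t \<le> 1 \<and> \<bar>p' t\<bar> \<le> 2"
    proof cases
      case 2
      then have "t\<^sup>2 \<le> (1/2)\<^sup>2" by (intro power_mono) auto
      with 2 show ?thesis by (simp add: p_def p'_def power2_eq_square)
    next
      case 3
      then have "p t = 1 - 2 * (1 - t)\<^sup>2" by (simp add: p_def power2_eq_square algebra_simps)
      moreover have "(1 - t)\<^sup>2 \<le> (1/2)\<^sup>2" using 3 by (intro power_mono) auto
      ultimately show ?thesis using 3 by (simp add: p'_def power2_eq_square)
    next
      case 4
      then have "p t = 1" by (simp add: p_def power2_eq_square algebra_simps)
      with 4 show ?thesis by (simp add: p'_def)
    qed (auto simp: p_def p'_def)
    then show "0 \<le> p t" "p t \<le> 1" "\<bar>p' t\<bar> \<le> 2" by auto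
  qed
  have \<tau>0: "\<tau> x \<le> 0" if "x \<notin> ball x0 R" for x
  proof -
    have "R \<le> norm (x - x0)" using that by (simp add: dist_norm norm_minus_commute)
    then have "R\<^sup>2 \<le> (norm (x - x0))\<^sup>2" using r by (intro power_mono) auto
    then show ?thesis using d(1) by (simp add: \<tau>_def divide_le_0_iff power2_norm_eq_inner)
  qed
  have \<tau>1: "1 \<le> \<tau> x" if "x \<in> ball x0 r" for x
  proof -
    have "norm (x - x0) \<le> r" using that by (simp add: dist_norm norm_minus_commute)
    then have "(norm (x - x0))\<^sup>2 \<le> r\<^sup>2" by (intro power_mono) auto
    then show ?thesis using d(1) by (simp add: \<tau>_def power2_norm_eq_inner) (simp add: d_def)
  qed
  show ?thesis
  proof (rule that[of "\<lambda>x. p (\<tau> x)" "\<lambda>x. p' (\<tau> x) *\<^sub>R ((- 2 / d) *\<^sub>R (x - x0))"])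
    show "GDERIV (\<lambda>x. p (\<tau> x)) x :> p' (\<tau> x) *\<^sub>R ((- 2 / d) *\<^sub>R (x - x0))" for x
      by (rule GDERIV_DERIV_compose[OF d\<tau> dp])
    have "continuous_on UNIV \<tau>" unfolding \<tau>_def using d(1) by (intro continuous_intros) auto
    then show "continuous_on UNIV (\<lambda>x. p' (\<tau> x) *\<^sub>R ((- 2 / d) *\<^sub>R (x - x0)))"
      by (intro continuous_intros continuous_on_compose2[OF p'c]) auto
    show "norm (p' (\<tau> x) *\<^sub>R ((- 2 / d) *\<^sub>R (x - x0))) \<le> 4 / (R - r)" for x
    proof (cases "x \<in> ball x0 R")
      case True
      then have n: "norm (x - x0) \<le> R" by (simp add: dist_norm norm_minus_commute)
      have "norm (p' (\<tau> x) *\<^sub>R ((- 2 / d) *\<^sub>R (x - x0))) = \<bar>p' (\<tau> x)\<bar> * (2 / d * norm (x - x0))"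
        using d(1) by (simp add: abs_mult)
      also have "\<dots> \<le> 2 * (2 / d * R)"
        using p'_bound n d(1) by (intro mult_mono) (auto intro!: divide_right_mono)
      also have "\<dots> = 4 / (R - r) * (R / (R + r))" by (simp add: d(2))
      also have "\<dots> \<le> 4 / (R - r) * 1"
        using r by (intro mult_left_mono) (auto simp: divide_le_eq)
      finally show ?thesis by simp
    next
      case False
      then show ?thesis using p_zero(2)[OF \<tau>0] r by simp
    qed
  qed (use p_range p_zero p_one \<tau>0 \<tau>1 in auto)
qed

text \<open>A \<open>C\<^sup>1\<close> substitute for the positive part, because the chain rule is only available for \<open>C\<^sup>1\<close>
  functions.\<close>

definition trunc :: "real \<Rightarrow> real" where "trunc s = ((max 0 s)\<^sup>2 - (max 0 (s - 1))\<^sup>2) / 2"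
definition trunc' :: "real \<Rightarrow> real" where "trunc' s = max 0 s - max 0 (s - 1)"
text \<open>The primitive of the square of \<open>trunc'\<close> that vanishes on the negative half
  line; it equals \<open>s - 2/3\<close> for \<open>s > 1\<close>. Used as a test function it
  reproduces the energy density of \<open>trunc\<close>.\<close>

definition trunc_flux :: "real \<Rightarrow> real" where
  "trunc_flux s = (max 0 s) ^ 3 / 3 - (max 0 (s - 1)) ^ 3 / 3 - (max 0 (s - 1))\<^sup>2"

lemma DERIV_trunc: "(trunc has_real_derivative trunc' s) (at s)"
  unfolding trunc_def trunc'_def by (auto intro!: derivative_eq_intros)

lemma DERIV_trunc_flux: "(trunc_flux has_real_derivative (trunc' s)\<^sup>2) (at s)"
proof -
  have "(max 0 s)\<^sup>2 - (max 0 (s - 1))\<^sup>2 - 2 * max 0 (s - 1) = (trunc' s)\<^sup>2"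
    by (auto simp: trunc'_def max_def power2_eq_square algebra_simps)
  moreover have "(trunc_flux has_real_derivative (max 0 s)\<^sup>2 - (max 0 (s - 1))\<^sup>2 - 2 * max 0 (s - 1)) (at s)"
    unfolding trunc_flux_def by (auto intro!: derivative_eq_intros)
  ultimately show ?thesis by simp
qed

text \<open>The bounds by \<open>max 0 (s - 1)\<close> and \<open>max 0 s\<close> let
  \<open>trunc\<close> replace the positive part at the price of one unit of level. The bound of
  \<open>trunc_flux\<close> by \<open>trunc' * trunc\<close> reflects that \<open>trunc'\<close> is
  nondecreasing; it supplies the hypothesis \<open>|\<psi>| \<le> |p| |m|\<close> of the energy
  estimate.\<close>

lemma trunc_bounds:
  shows "0 \<le> trunc' s" "trunc' s \<le> 1" "0 \<le> trunc s" "trunc s \<le> max 0 s" "max 0 (s - 1) \<le> trunc s"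
    "0 \<le> trunc_flux s" "trunc_flux s \<le> trunc' s * trunc s" "trunc_flux s \<le> max 0 s" "s \<le> 0 \<Longrightarrow> trunc s = 0"
proof -
  show a: "0 \<le> trunc' s" "trunc' s \<le> 1" by (auto simp: trunc'_def)
  have "0 \<le> trunc s \<and> trunc s \<le> max 0 s \<and> max 0 (s - 1) \<le> trunc s \<and> 0 \<le> trunc_flux s \<and> trunc_flux s \<le> trunc' s * trunc s"
  proof -
    consider "s \<le> 0" | "0 < s" "s \<le> 1" | "1 < s" by linarith
    then show ?thesis
    proof cases
      case 2
      then have "s * s \<le> s * 1" by (intro mult_left_mono) auto
      moreover have "0 < s ^ 3" using 2 by simp
      ultimately show ?thesis using 2
        by (simp add: trunc_def trunc'_def trunc_flux_def power2_eq_square power3_eq_cube)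
    next
      case 3
      have "trunc s = s - 1/2" using 3 by (simp add: trunc_def power2_eq_square field_simps)
      moreover have "trunc_flux s = s - 2/3" using 3
        by (simp add: trunc_flux_def power2_eq_square power3_eq_cube field_simps)
      ultimately show ?thesis using 3 by (simp add: trunc'_def)
    qed (simp add: trunc_def trunc'_def trunc_flux_def)
  qed
  then show b: "0 \<le> trunc s" "trunc s \<le> max 0 s" "max 0 (s - 1) \<le> trunc s" "0 \<le> trunc_flux s" "trunc_flux s \<le> trunc' s * trunc s"
    by auto
  show "trunc_flux s \<le> max 0 s"
    using b a mult_right_mono[OF a(2) b(1)] by linarith
  show "s \<le> 0 \<Longrightarrow> trunc s = 0" by (simp add: trunc_def)
qed

lemma trunc_measurable [measurable]:
  "trunc \<in> borel_measurable borel" "trunc' \<in> borel_measurable borel" "trunc_flux \<in> borel_measurable borel"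
  unfolding trunc_def[abs_def] trunc'_def[abs_def] trunc_flux_def[abs_def] by measurable

lemma continuous_trunc: "continuous_on UNIV trunc" "continuous_on UNIV trunc'" "continuous_on UNIV trunc_flux"
  unfolding trunc_def[abs_def] trunc'_def[abs_def] trunc_flux_def[abs_def] by (intro continuous_intros; simp)+

section \<open>Energy decay between levels and local boundedness\<close>

context elliptic_flux
begin

lemma truncation_integrable:
  fixes \<Psi> :: "real \<Rightarrow> real"
  assumes \<Psi>: "\<And>s. s \<in> I \<Longrightarrow> (\<Psi> has_real_derivative \<Psi>' s) (at s)" "\<And>s. s \<in> I \<Longrightarrow> \<bar>\<Psi>' s\<bar> \<le> L"
    and [measurable]: "\<Psi> \<in> borel_measurable borel" and c: "0 \<le> c"
  shows "integrable lborel (\<lambda>x. indicator B x * (max 0 (\<Psi> (f x) - c))\<^sup>2)"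
proof -
  obtain a where a: "0 \<le> a" "\<And>s. s \<in> I \<Longrightarrow> (\<Psi> s)\<^sup>2 \<le> a + 2 * L\<^sup>2 * s\<^sup>2"
    using linear_growth[OF I(1,2) \<Psi>] by metis
  show ?thesis
  proof (rule Bochner_Integration.integrable_bound)
    show "integrable lborel (\<lambda>x. a * indicator B x + (2 * L\<^sup>2) * (indicator B x * (f x)\<^sup>2))"
      using B_finite by (intro Bochner_Integration.integrable_add integrable_mult_right
          H1_approx_integrable(1)[OF approx open_B] integrable_real_indicator) auto
    show "AE x in lborel. norm (indicator B x * (max 0 (\<Psi> (f x) - c))\<^sup>2) \<le> norm (a * indicator B x + (2 * L\<^sup>2) * (indicator B x * (f x)\<^sup>2))"
      using H1_approx_integrable(3)[OF approx open_B I(3)]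
    proof eventually_elim
      case (elim x)
      show ?case
      proof (cases "x \<in> B")
        case True
        have "(max 0 (\<Psi> (f x) - c))\<^sup>2 \<le> \<bar>\<Psi> (f x)\<bar>\<^sup>2" using c by (intro power_mono) auto
        also have "\<dots> \<le> a + 2 * L\<^sup>2 * (f x)\<^sup>2" using a(2) elim True by simp
        finally show ?thesis using True a(1) by simp
      qed simp
    qed
  qed measurable
qed

text \<open>The level rises by \<open>2 \<delta>\<close> in two halves. Chebyshev's inequality at
  level \<open>c + \<delta>\<close> makes the support of the truncation small enough for the
  Faber-Krahn inequality; the other \<open>\<delta>\<close> pays for using a C1 truncation. The
  factor is the product of \<open>4 r^2\<close> (Faber-Krahn), \<open>8 \<Lambda>^4 + 2\<close>
  (energy estimate and product rule) and \<open>16 / (\<rho> - \<rho>')^2\<close> (gradient of the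
  cutoff).\<close>

lemma level_step:
  fixes \<Psi> \<Psi>' \<Psi>'' :: "real \<Rightarrow> real"
  assumes B: "B = ball x0 (2 * R)" and R: "0 < R"
    and \<Psi>: "\<And>s. s \<in> I \<Longrightarrow> (\<Psi> has_real_derivative \<Psi>' s) (at s)"
      "\<And>s. s \<in> I \<Longrightarrow> (\<Psi>' has_real_derivative \<Psi>'' s) (at s)" "continuous_on I \<Psi>''"
      "\<And>s. s \<in> I \<Longrightarrow> 0 \<le> \<Psi>'' s" "\<And>s. s \<in> I \<Longrightarrow> \<bar>\<Psi>' s\<bar> \<le> L" "\<And>s. s \<in> I \<Longrightarrow> max 0 (\<Psi> s) * \<Psi>'' s \<le> L"
    and meas[measurable]: "\<Psi> \<in> borel_measurable borel" "\<Psi>' \<in> borel_measurable borel" "\<Psi>'' \<in> borel_measurable borel"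
    and c: "0 \<le> c" "0 < \<delta>" and \<rho>: "0 < \<rho>'" "\<rho>' < \<rho>" "\<rho> \<le> R" and r: "0 < r" "r \<le> R"
    and small: "4 * (\<integral>x. indicator (ball x0 \<rho>) x * (max 0 (\<Psi> (f x) - c))\<^sup>2 \<partial>lborel) \<le> \<delta>\<^sup>2 * measure lborel (ball (0::'a) r)"
  shows "(\<integral>x. indicator (ball x0 \<rho>') x * (max 0 (\<Psi> (f x) - (c + 2 * \<delta>)))\<^sup>2 \<partial>lborel)
    \<le> 64 * r\<^sup>2 * (8 * \<Lambda>^4 + 2) / (\<rho> - \<rho>')\<^sup>2 * (\<integral>x. indicator (ball x0 \<rho>) x * (max 0 (\<Psi> (f x) - c))\<^sup>2 \<partial>lborel)"
proof -
  define U where "U = (\<integral>x. indicator (ball x0 \<rho>) x * (max 0 (\<Psi> (f x) - c))\<^sup>2 \<partial>lborel)"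
  define \<sigma> where "\<sigma> s = (\<Psi> s - (c + \<delta>)) / \<delta>" for s
  have [measurable]: "\<sigma> \<in> borel_measurable borel" unfolding \<sigma>_def[abs_def] by measurable
  define G where "G s = \<delta> * trunc (\<sigma> s)" for s
  define G' where "G' s = trunc' (\<sigma> s) * \<Psi>' s" for s
  \<comment> \<open>The derivative of \<open>\<psi>\<close> is \<open>G'^2\<close> plus a term with
    \<open>\<Psi>''\<close>, nonnegative by convexity; this gives the condition
    \<open>(p s)^2 \<le> \<psi>' s\<close> with \<open>p = G'\<close>. The assumed bound on
    \<open>max 0 \<Psi> * \<Psi>''\<close> keeps the extra term bounded, so that
    \<open>\<psi>\<close> is admissible.\<close>
  define \<psi> where "\<psi> s = \<delta> * trunc_flux (\<sigma> s) * \<Psi>' s" for s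
  define \<psi>' where "\<psi>' s = (trunc' (\<sigma> s) * \<Psi>' s)\<^sup>2 + \<delta> * trunc_flux (\<sigma> s) * \<Psi>'' s" for s
  have Gm[measurable]: "G \<in> borel_measurable borel" "G' \<in> borel_measurable borel" "\<psi> \<in> borel_measurable borel" "\<psi>' \<in> borel_measurable borel"
    unfolding G_def[abs_def] G'_def[abs_def] \<psi>_def[abs_def] \<psi>'_def[abs_def] by measurable
  have d\<sigma>: "(\<sigma> has_real_derivative \<Psi>' s / \<delta>) (at s)" if "s \<in> I" for s
    unfolding \<sigma>_def[abs_def] using \<Psi>(1)[OF that] c by (auto intro!: derivative_eq_intros)
  have dG: "(G has_real_derivative G' s) (at s)" if "s \<in> I" for s
    using DERIV_cmult[OF DERIV_chain2[OF DERIV_trunc d\<sigma>[OF that]], of \<delta>] c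
    unfolding G_def[abs_def] G'_def by simp
  have d\<psi>: "(\<psi> has_real_derivative \<psi>' s) (at s)" if "s \<in> I" for s
    using DERIV_mult[OF DERIV_cmult[OF DERIV_chain2[OF DERIV_trunc_flux d\<sigma>[OF that]], of \<delta>] \<Psi>(2)[OF that]] c
    unfolding \<psi>_def[abs_def] \<psi>'_def by (simp add: power2_eq_square algebra_simps)
  have \<Psi>c: "continuous_on I \<Psi>" "continuous_on I \<Psi>'"
    using \<Psi>(1,2) by (meson DERIV_continuous_on has_field_derivative_at_within)+
  have \<sigma>c: "continuous_on I \<sigma>" unfolding \<sigma>_def[abs_def] using c by (intro continuous_intros \<Psi>c) auto
  have tc: "continuous_on I (\<lambda>s. trunc' (\<sigma> s))" "continuous_on I (\<lambda>s. trunc_flux (\<sigma> s))"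
    using continuous_on_compose2[OF continuous_trunc(2) \<sigma>c] continuous_on_compose2[OF continuous_trunc(3) \<sigma>c] by auto
  have G'c: "continuous_on I G'" unfolding G'_def[abs_def] by (intro continuous_intros tc \<Psi>c)
  have \<psi>'c: "continuous_on I \<psi>'" unfolding \<psi>'_def[abs_def] by (intro continuous_intros tc \<Psi>c \<Psi>(3))
  have L0: "0 \<le> L" using \<Psi>(5) I(2) by (metis abs_ge_zero all_not_in_conv order_trans)
  have G'L: "\<bar>G' s\<bar> \<le> L" if "s \<in> I" for s
  proof -
    have "\<bar>G' s\<bar> \<le> 1 * L" unfolding G'_def abs_mult
      using trunc_bounds(1,2)[of "\<sigma> s"] \<Psi>(5)[OF that] by (intro mult_mono) auto
    then show ?thesis by simp
  qed
  have \<sigma>\<delta>: "\<delta> * max 0 (\<sigma> s) = max 0 (\<Psi> s - (c + \<delta>))" for s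
    using c by (auto simp: \<sigma>_def max_def field_simps)
  have \<sigma>\<delta>1: "\<delta> * max 0 (\<sigma> s - 1) = max 0 (\<Psi> s - (c + 2 * \<delta>))" for s
    using c by (auto simp: \<sigma>_def max_def field_simps)
  have \<psi>'L: "\<bar>\<psi>' s\<bar> \<le> L\<^sup>2 + L" if "s \<in> I" for s
  proof -
    have "(G' s)\<^sup>2 \<le> L\<^sup>2" using G'L[OF that] by (metis abs_ge_zero power2_abs power_mono)
    moreover have "\<delta> * trunc_flux (\<sigma> s) \<le> \<delta> * max 0 (\<sigma> s)"
      using trunc_bounds(8) c by (intro mult_left_mono) auto
    then have "\<delta> * trunc_flux (\<sigma> s) \<le> max 0 (\<Psi> s)" unfolding \<sigma>\<delta> using c by linarith
    then have "\<delta> * trunc_flux (\<sigma> s) * \<Psi>'' s \<le> max 0 (\<Psi> s) * \<Psi>'' s"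
      using \<Psi>(4)[OF that] by (intro mult_right_mono) auto
    moreover have "0 \<le> \<delta> * trunc_flux (\<sigma> s) * \<Psi>'' s"
      using \<Psi>(4)[OF that] trunc_bounds(6) c by auto
    ultimately show ?thesis using \<Psi>(6)[OF that] by (simp add: \<psi>'_def G'_def)
  qed
  have pm: "(G' s)\<^sup>2 \<le> \<psi>' s" "\<bar>\<psi> s\<bar> \<le> \<bar>G' s\<bar> * \<bar>G s\<bar>" if "s \<in> I" for s
  proof -
    show "(G' s)\<^sup>2 \<le> \<psi>' s"
      using \<Psi>(4)[OF that] trunc_bounds(6)[of "\<sigma> s"] c by (simp add: \<psi>'_def G'_def)
    have "\<bar>\<psi> s\<bar> = \<delta> * \<bar>\<Psi>' s\<bar> * trunc_flux (\<sigma> s)"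
      using trunc_bounds(6)[of "\<sigma> s"] c by (simp add: \<psi>_def abs_mult)
    also have "\<dots> \<le> \<delta> * \<bar>\<Psi>' s\<bar> * (trunc' (\<sigma> s) * trunc (\<sigma> s))"
      using trunc_bounds(7)[of "\<sigma> s"] c by (intro mult_left_mono) auto
    also have "\<dots> = \<bar>G' s\<bar> * \<bar>G s\<bar>"
      using trunc_bounds(1,3)[of "\<sigma> s"] c by (simp add: G_def G'_def abs_mult)
    finally show "\<bar>\<psi> s\<bar> \<le> \<bar>G' s\<bar> * \<bar>G s\<bar>" .
  qed
  have G_upper: "0 \<le> G s" "G s \<le> max 0 (\<Psi> s - c)" for s
  proof -
    show "0 \<le> G s" using trunc_bounds(3) c by (simp add: G_def)
    have "G s \<le> \<delta> * max 0 (\<sigma> s)" unfolding G_def using trunc_bounds(4) c by (intro mult_left_mono) auto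
    then show "G s \<le> max 0 (\<Psi> s - c)" unfolding \<sigma>\<delta> using c by linarith
  qed
  have G_lower: "max 0 (\<Psi> s - (c + 2 * \<delta>)) \<le> G s" for s
    unfolding \<sigma>\<delta>1[symmetric] G_def using trunc_bounds(5) c by (intro mult_left_mono) auto
  have G_zero: "G s = 0" if "\<Psi> s \<le> c + \<delta>" for s
    using that c trunc_bounds(9)[of "\<sigma> s"] by (simp add: G_def \<sigma>_def divide_le_0_iff)
  obtain \<zeta> Z where \<zeta>: "\<And>x. GDERIV \<zeta> x :> Z x" "continuous_on UNIV Z"
    "\<And>x. 0 \<le> \<zeta> x" "\<And>x. \<zeta> x \<le> 1" "\<And>x. x \<in> ball x0 \<rho>' \<Longrightarrow> \<zeta> x = 1"
    "\<And>x. x \<notin> ball x0 \<rho> \<Longrightarrow> \<zeta> x = 0" "\<And>x. x \<notin> ball x0 \<rho> \<Longrightarrow> Z x = 0"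
    "\<And>x. norm (Z x) \<le> 4 / (\<rho> - \<rho>')"
    using cutoff_exists[OF \<rho>(1,2), of x0] by blast
  have [measurable]: "\<zeta> \<in> borel_measurable borel" "Z \<in> borel_measurable borel"
    using borel_measurable_GDERIV_on(2)[of UNIV \<zeta> Z] \<zeta>(1,2) by (auto intro: borel_measurable_continuous_onI)
  define C where "C = max 1 (4 / (\<rho> - \<rho>'))"
  have cC: "\<bar>\<zeta> x\<bar> \<le> C" "norm (Z x) \<le> C" for x
    using \<zeta>(3,4,8)[of x] unfolding C_def by (auto simp: le_max_iff_disj)
  define u where "u x = \<zeta> x * G (f x)" for x
  define w where "w x = (\<zeta> x * G' (f x)) *\<^sub>R g x + G (f x) *\<^sub>R Z x" for x
  have H: "H1_approx B UNIV u w"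
    unfolding u_def w_def
    by (rule H1_approx_comp_mult[OF approx open_B B_finite I dG G'L G'c, where c=C])
       (use \<zeta> cC in \<open>auto intro: continuous_on_subset\<close>)
  have um[measurable]: "u \<in> borel_measurable borel" "w \<in> borel_measurable borel"
    using H unfolding H1_approx_def by auto
  define Y where "Y = (\<integral>x. indicator B x * (norm (w x))\<^sup>2 \<partial>lborel)"
  have T: "translation_bound (ball x0 (2 * R)) u Y"
    using translation_bound_H1[OF H] unfolding Y_def B by simp
  have Y0: "0 \<le> Y" unfolding Y_def by simp
  have \<rho>B: "ball x0 \<rho> \<subseteq> B" unfolding B using \<rho> R by (intro subset_ball) auto
  have u0: "u x = 0" if "x \<notin> ball x0 \<rho>" for x using that \<zeta>(6) by (simp add: u_def)
  have "integrable lborel (\<lambda>x. indicator B x * (u x)\<^sup>2)"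
    by (rule H1_approx_integrable(1)[OF H open_B])
  moreover have "(\<lambda>x. indicator B x * (u x)\<^sup>2) = (\<lambda>x. (u x)\<^sup>2)"
  proof
    fix x show "indicator B x * (u x)\<^sup>2 = (u x)\<^sup>2"
      using u0[of x] \<rho>B by (cases "x \<in> ball x0 \<rho>") auto
  qed
  ultimately have u2: "integrable lborel (\<lambda>x. (u x)\<^sup>2)" by simp
  have posint: "integrable lborel (\<lambda>x. indicator B x * (max 0 (\<Psi> (f x) - c))\<^sup>2)"
    by (rule truncation_integrable[OF \<Psi>(1,5) meas(1) c(1)])
  have Gint: "integrable lborel (\<lambda>x. indicator B x * (G (f x))\<^sup>2)"
  proof (rule Bochner_Integration.integrable_bound[OF posint])
    show "AE x in lborel. norm (indicator B x * (G (f x))\<^sup>2) \<le> norm (indicator B x * (max 0 (\<Psi> (f x) - c))\<^sup>2)"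
      using G_upper by (intro AE_I2) (auto split: split_indicator intro!: power_mono)
  qed measurable
  have posint\<rho>: "integrable lborel (\<lambda>x. indicator (ball x0 t) x * (max 0 (\<Psi> (f x) - c))\<^sup>2)" if "t \<le> \<rho>" for t
  proof (rule Bochner_Integration.integrable_bound[OF posint])
    have "ball x0 t \<subseteq> B" using \<rho>B that by auto
    then show "AE x in lborel. norm (indicator (ball x0 t) x * (max 0 (\<Psi> (f x) - c))\<^sup>2) \<le> norm (indicator B x * (max 0 (\<Psi> (f x) - c))\<^sup>2)"
      by (intro AE_I2) (auto split: split_indicator)
  qed measurable
  have K: "cball x0 \<rho> \<subseteq> B" unfolding B using \<rho> R by (intro cball_subset_ball_iff[THEN iffD2]) auto
  have K0: "\<zeta> x = 0" if "x \<notin> cball x0 \<rho>" for x using \<zeta>(6)[of x] that by auto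
  have en: "integrable lborel (\<lambda>x. (\<zeta> x)\<^sup>2 * (G' (f x))\<^sup>2 * (norm (g x))\<^sup>2)"
    "integrable lborel (\<lambda>x. (G (f x))\<^sup>2 * (norm (Z x))\<^sup>2)"
    "(\<integral>x. (\<zeta> x)\<^sup>2 * (G' (f x))\<^sup>2 * (norm (g x))\<^sup>2 \<partial>lborel) \<le> 4 * \<Lambda>^4 * (\<integral>x. (G (f x))\<^sup>2 * (norm (Z x))\<^sup>2 \<partial>lborel)"
    using energy_estimate[where \<psi>=\<psi> and \<psi>'=\<psi>' and L="L\<^sup>2 + L" and p=G' and m=G and \<zeta>=\<zeta> and Z=Z and K="cball x0 \<rho>"]
      d\<psi> \<psi>'L \<psi>'c Gm pm Gint \<zeta>(1,2) compact_cball K K0 by blast+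
  \<comment> \<open>By the product rule \<open>|w|^2\<close> is at most twice the energy density,
    whose integral is at most \<open>4 \<Lambda>^4\<close> times the cutoff term, plus twice the
    cutoff term.\<close>
  have "Y \<le> (8 * \<Lambda>^4 + 2) * (\<integral>x. (G (f x))\<^sup>2 * (norm (Z x))\<^sup>2 \<partial>lborel)"
  proof -
    have "Y \<le> (\<integral>x. 2 * ((\<zeta> x)\<^sup>2 * (G' (f x))\<^sup>2 * (norm (g x))\<^sup>2) + 2 * ((G (f x))\<^sup>2 * (norm (Z x))\<^sup>2) \<partial>lborel)"
      unfolding Y_def
    proof (rule integral_mono)
      show "integrable lborel (\<lambda>x. indicator B x * (norm (w x))\<^sup>2)"
        by (rule H1_approx_integrable(2)[OF H open_B])
      show "integrable lborel (\<lambda>x. 2 * ((\<zeta> x)\<^sup>2 * (G' (f x))\<^sup>2 * (norm (g x))\<^sup>2) + 2 * ((G (f x))\<^sup>2 * (norm (Z x))\<^sup>2))"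
        using en(1,2) by auto
      fix x
      have "(norm (w x))\<^sup>2 \<le> (norm ((\<zeta> x * G' (f x)) *\<^sub>R g x) + norm (G (f x) *\<^sub>R Z x))\<^sup>2"
        unfolding w_def by (intro power_mono norm_triangle_ineq) simp
      also have "\<dots> \<le> 2 * (norm ((\<zeta> x * G' (f x)) *\<^sub>R g x))\<^sup>2 + 2 * (norm (G (f x) *\<^sub>R Z x))\<^sup>2"
        using sum_squares_bound[of "norm ((\<zeta> x * G' (f x)) *\<^sub>R g x)" "norm (G (f x) *\<^sub>R Z x)"]
        unfolding power2_sum by linarith
      also have "\<dots> = 2 * ((\<zeta> x)\<^sup>2 * (G' (f x))\<^sup>2 * (norm (g x))\<^sup>2) + 2 * ((G (f x))\<^sup>2 * (norm (Z x))\<^sup>2)"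
        by (simp add: power_mult_distrib)
      finally show "indicator B x * (norm (w x))\<^sup>2 \<le> 2 * ((\<zeta> x)\<^sup>2 * (G' (f x))\<^sup>2 * (norm (g x))\<^sup>2) + 2 * ((G (f x))\<^sup>2 * (norm (Z x))\<^sup>2)"
        by (auto split: split_indicator)
    qed
    also have "\<dots> = 2 * (\<integral>x. (\<zeta> x)\<^sup>2 * (G' (f x))\<^sup>2 * (norm (g x))\<^sup>2 \<partial>lborel) + 2 * (\<integral>x. (G (f x))\<^sup>2 * (norm (Z x))\<^sup>2 \<partial>lborel)"
      using en(1,2) by simp
    also have "\<dots> \<le> (8 * \<Lambda>^4 + 2) * (\<integral>x. (G (f x))\<^sup>2 * (norm (Z x))\<^sup>2 \<partial>lborel)"
      using en(3) by (simp add: algebra_simps)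
    finally show ?thesis .
  qed
  also have "(\<integral>x. (G (f x))\<^sup>2 * (norm (Z x))\<^sup>2 \<partial>lborel) \<le> (\<integral>x. (4 / (\<rho> - \<rho>'))\<^sup>2 * (indicator (ball x0 \<rho>) x * (max 0 (\<Psi> (f x) - c))\<^sup>2) \<partial>lborel)"
  proof (rule integral_mono)
    show "integrable lborel (\<lambda>x. (4 / (\<rho> - \<rho>'))\<^sup>2 * (indicator (ball x0 \<rho>) x * (max 0 (\<Psi> (f x) - c))\<^sup>2))"
      using posint\<rho>[of \<rho>] by (intro integrable_mult_right) auto
    fix x
    have "(G (f x))\<^sup>2 * (norm (Z x))\<^sup>2 \<le> (max 0 (\<Psi> (f x) - c))\<^sup>2 * (4 / (\<rho> - \<rho>'))\<^sup>2"
      using G_upper \<zeta>(8) by (intro mult_mono power_mono) auto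
    then show "(G (f x))\<^sup>2 * (norm (Z x))\<^sup>2 \<le> (4 / (\<rho> - \<rho>'))\<^sup>2 * (indicator (ball x0 \<rho>) x * (max 0 (\<Psi> (f x) - c))\<^sup>2)"
      using \<zeta>(7)[of x] by (cases "x \<in> ball x0 \<rho>") (auto simp: mult.commute)
  qed (rule en(2))
  also have "\<dots> = (4 / (\<rho> - \<rho>'))\<^sup>2 * U" by (simp add: U_def)
  finally have Y: "Y \<le> (8 * \<Lambda>^4 + 2) * ((4 / (\<rho> - \<rho>'))\<^sup>2 * U)"
    using Lam by (simp add: mult_left_mono)
  define S where "S = {x \<in> ball x0 \<rho>. c + \<delta> < \<Psi> (f x)}"
  have Sm[measurable]: "S \<in> sets borel" unfolding S_def by measurable
  \<comment> \<open>Chebyshev: on \<open>S\<close> the excess over the level \<open>c\<close> is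
    more than \<open>\<delta>\<close>.\<close>
  have "\<delta>\<^sup>2 * measure lborel S \<le> U"
  proof -
    have Sf: "emeasure lborel S < \<infinity>"
    proof -
      have "S \<subseteq> B" using \<rho>B by (auto simp: S_def)
      then have "emeasure lborel S \<le> emeasure lborel B" by (intro emeasure_mono) auto
      then show ?thesis using B_finite by (rule le_less_trans)
    qed
    have "\<delta>\<^sup>2 * measure lborel S = (\<integral>x. \<delta>\<^sup>2 * indicator S x \<partial>lborel)"
      using Sf by simp
    also have "\<dots> \<le> U" unfolding U_def
    proof (rule integral_mono)
      show "integrable lborel (\<lambda>x. \<delta>\<^sup>2 * indicator S x)" using Sf by auto
      fix x
      have "\<delta>\<^sup>2 \<le> (max 0 (\<Psi> (f x) - c))\<^sup>2" if "c + \<delta> < \<Psi> (f x)"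
        using that c by (intro power_mono) auto
      then show "\<delta>\<^sup>2 * indicator S x \<le> indicator (ball x0 \<rho>) x * (max 0 (\<Psi> (f x) - c))\<^sup>2"
        by (auto simp: S_def split: split_indicator)
    qed (use posint\<rho> in auto)
    finally show ?thesis .
  qed
  with small have "\<delta>\<^sup>2 * (4 * measure lborel S) \<le> \<delta>\<^sup>2 * measure lborel (ball (0::'a) r)"
    unfolding U_def[symmetric] by linarith
  then have S4: "4 * measure lborel S \<le> measure lborel (ball (0::'a) r)"
    using c by (subst (asm) mult_le_cancel_left_pos) auto
  have Su: "u x = 0" if "x \<notin> S" for x
    using that u0[of x] G_zero[of "f x"] by (cases "x \<in> ball x0 \<rho>") (auto simp: S_def u_def)
  have SB: "S \<subseteq> ball x0 R" using \<rho> by (auto simp: S_def)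
  have fin: "(\<integral>\<^sup>+x. ennreal ((u x)\<^sup>2) \<partial>lborel) = ennreal (\<integral>x. (u x)\<^sup>2 \<partial>lborel)"
    by (rule nn_integral_eq_integral[OF u2]) simp
  have "ennreal (\<integral>x. (u x)\<^sup>2 \<partial>lborel) \<le> ennreal (4 * r\<^sup>2 * Y)"
    using faber_krahn[OF um(1) T Y0 Sm SB Su r S4] unfolding fin by simp
  then have uY: "(\<integral>x. (u x)\<^sup>2 \<partial>lborel) \<le> 4 * r\<^sup>2 * Y"
    using Y0 by (subst (asm) ennreal_le_iff) auto
  have "(\<integral>x. indicator (ball x0 \<rho>') x * (max 0 (\<Psi> (f x) - (c + 2 * \<delta>)))\<^sup>2 \<partial>lborel) \<le> (\<integral>x. (u x)\<^sup>2 \<partial>lborel)"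
  proof (rule integral_mono')
    fix x
    have "(max 0 (\<Psi> (f x) - (c + 2 * \<delta>)))\<^sup>2 \<le> (G (f x))\<^sup>2"
      using G_lower by (intro power_mono) auto
    then show "indicator (ball x0 \<rho>') x * (max 0 (\<Psi> (f x) - (c + 2 * \<delta>)))\<^sup>2 \<le> (u x)\<^sup>2"
      using \<zeta>(5)[of x] by (auto simp: u_def split: split_indicator)
  qed (use u2 in auto)
  also note uY
  also have "4 * r\<^sup>2 * Y \<le> 4 * r\<^sup>2 * ((8 * \<Lambda>^4 + 2) * ((4 / (\<rho> - \<rho>'))\<^sup>2 * U))"
    using Y by (intro mult_left_mono) auto
  also have "\<dots> = 64 * r\<^sup>2 * (8 * \<Lambda>^4 + 2) / (\<rho> - \<rho>')\<^sup>2 * U"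
    by (simp add: power_divide)
  finally show ?thesis unfolding U_def .
qed

end

lemma H1_approx_subset:
  assumes H: "H1_approx B I f g" and "B' \<subseteq> B" "B' \<in> sets borel"
  shows "H1_approx B' I f g"
proof -
  from H[unfolded H1_approx_def] obtain F D W where
      m: "f \<in> borel_measurable borel" "g \<in> borel_measurable borel"
    and der: "\<And>k x. x \<in> B \<Longrightarrow> GDERIV (F k) x :> D k x" "\<And>k x. x \<in> B \<Longrightarrow> F k x \<in> I"
    and cont: "\<And>k::nat. continuous_on B (D k)"
    and W: "set_integrable lborel B W"
    and ae: "AE x in lborel. x \<in> B \<longrightarrow> (\<lambda>k. F k x) \<longlonglongrightarrow> f x \<and> (\<lambda>k. D k x) \<longlonglongrightarrow> g x \<and>
        (\<forall>k. (F k x)\<^sup>2 \<le> W x \<and> (norm (D k x))\<^sup>2 \<le> W x)"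
    by blast
  have "set_integrable lborel B' W" by (rule set_integrable_subset[OF W]) (use assms in auto)
  moreover have "AE x in lborel. x \<in> B' \<longrightarrow> (\<lambda>k. F k x) \<longlonglongrightarrow> f x \<and> (\<lambda>k. D k x) \<longlonglongrightarrow> g x \<and>
        (\<forall>k. (F k x)\<^sup>2 \<le> W x \<and> (norm (D k x))\<^sup>2 \<le> W x)"
    using ae by eventually_elim (use assms(2) in blast)
  moreover have "\<forall>k. continuous_on B' (D k)"
    using cont continuous_on_subset assms(2) by blast
  moreover have "\<forall>k. \<forall>x\<in>B'. GDERIV (F k) x :> D k x \<and> F k x \<in> I"
    using der assms(2) by blast
  ultimately show ?thesis unfolding H1_approx_def
    by (intro conjI m exI[of _ F] exI[of _ D] exI[of _ W])
qed

context elliptic_flux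
begin

text \<open>Levels increase to \<open>M\<close>, radii decrease to \<open>R / 2\<close>, and the
  Faber-Krahn radius \<open>R b 2^-k\<close> shrinks with the gaps between the radii. The ratio of
  the two is constant, so each step multiplies \<open>U\<close> by
  \<open>1024 (8 \<Lambda>^4 + 2) b^2\<close>, which the choice of \<open>b\<close> makes at most
  \<open>\<theta>\<close>. The right side of the smallness hypothesis of \<open>level_step\<close>
  is proportional to \<open>4^-k 2^-(n k) = \<theta>^k\<close>. It thus decreases exactly as the
  bound on \<open>U k\<close> does, and the hypothesis persists.\<close>

lemma local_bound:
  fixes \<Psi> \<Psi>' \<Psi>'' :: "real \<Rightarrow> real"
  assumes B: "B = ball x0 (2 * R)" and R: "0 < R"
    and \<Psi>: "\<And>s. s \<in> I \<Longrightarrow> (\<Psi> has_real_derivative \<Psi>' s) (at s)"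
      "\<And>s. s \<in> I \<Longrightarrow> (\<Psi>' has_real_derivative \<Psi>'' s) (at s)" "continuous_on I \<Psi>''"
      "\<And>s. s \<in> I \<Longrightarrow> 0 \<le> \<Psi>'' s" "\<And>s. s \<in> I \<Longrightarrow> \<bar>\<Psi>' s\<bar> \<le> L" "\<And>s. s \<in> I \<Longrightarrow> max 0 (\<Psi> s) * \<Psi>'' s \<le> L"
    and meas[measurable]: "\<Psi> \<in> borel_measurable borel" "\<Psi>' \<in> borel_measurable borel" "\<Psi>'' \<in> borel_measurable borel"
    and b: "0 < b" "b \<le> 1" "1024 * (8 * \<Lambda>^4 + 2) * b\<^sup>2 \<le> 1 / (4 * 2 ^ DIM('a))"
    and \<kappa>: "64 * \<kappa> \<le> measure lborel (ball (0::'a) 1) * b ^ DIM('a)"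
    and M: "0 < M"
    and small: "(\<integral>x. indicator (ball x0 R) x * (max 0 (\<Psi> (f x)))\<^sup>2 \<partial>lborel) \<le> \<kappa> * M\<^sup>2 * R ^ DIM('a)"
  shows "AE x in lborel. x \<in> ball x0 (R / 2) \<longrightarrow> \<Psi> (f x) \<le> M"
proof -
  define n where "n = DIM('a)"
  define \<omega> where "\<omega> = measure lborel (ball (0::'a) 1)"
  define \<theta> :: real where "\<theta> = 1 / (4 * 2 ^ n)"
  define c where "c k = M * (1 - (1/2) ^ k)" for k :: nat
  define \<rho> where "\<rho> k = R / 2 * (1 + (1/2) ^ k)" for k :: nat
  \<comment> \<open>Consecutive levels differ by \<open>M/2 * (1/2)^k\<close>, and
    \<open>level_step\<close> raises the level by \<open>2 \<delta>\<close>.\<close>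
  define \<delta> where "\<delta> k = M / 4 * (1/2) ^ k" for k :: nat
  define U where "U k = (\<integral>x. indicator (ball x0 (\<rho> k)) x * (max 0 (\<Psi> (f x) - c k))\<^sup>2 \<partial>lborel)" for k
  have pw: "0 < (1/2::real) ^ k" "(1/2::real) ^ k \<le> 1" for k
    by (auto simp: power_le_one)
  have "1 \<le> (2::real) ^ n" by simp
  then have "1 < 4 * (2::real) ^ n" by linarith
  then have \<theta>: "0 < \<theta>" "\<theta> < 1" unfolding \<theta>_def by (auto simp: divide_less_eq)
  have posint: "integrable lborel (\<lambda>x. indicator B x * (max 0 (\<Psi> (f x) - t))\<^sup>2)" if "0 \<le> t" for t
    by (rule truncation_integrable[OF \<Psi>(1,5) meas(1) that])
  have posint_ball: "integrable lborel (\<lambda>x. indicator (ball x0 s) x * (max 0 (\<Psi> (f x) - t))\<^sup>2)" if "0 \<le> t" "s \<le> R" for s t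
  proof (rule Bochner_Integration.integrable_bound[OF posint[OF that(1)]])
    have "ball x0 s \<subseteq> B" unfolding B using R that by (intro subset_ball) auto
    then show "AE x in lborel. norm (indicator (ball x0 s) x * (max 0 (\<Psi> (f x) - t))\<^sup>2) \<le> norm (indicator B x * (max 0 (\<Psi> (f x) - t))\<^sup>2)"
      by (intro AE_I2) (auto split: split_indicator)
  qed measurable
  have c0: "0 \<le> c k" for k using pw[of k] M by (simp add: c_def)
  have \<rho>R: "\<rho> k \<le> R" "R / 2 \<le> \<rho> k" for k
    using pw[of k] R by (auto simp: \<rho>_def field_simps)
  have U0: "U 0 \<le> \<kappa> * M\<^sup>2 * R ^ n"
    using small by (simp add: U_def c_def \<rho>_def n_def)
  have Upos: "0 \<le> U k" for k unfolding U_def by (rule Bochner_Integration.integral_nonneg) auto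
  have U_small: "U k \<le> \<theta> ^ k * U 0" for k
  proof (induction k)
    case (Suc k)
    define p :: real where "p = (1/2) ^ k"
    have p: "0 < p" "p \<le> 1" using pw by (auto simp: p_def)
    have pn: "((1/2) ^ m) ^ k = p ^ m" for m
      unfolding p_def by (metis power_mult mult.commute)
    let ?r = "R * b * p"
    have "b * p \<le> 1 * 1" using b p by (intro mult_mono) auto
    then have r: "0 < ?r" "?r \<le> R" using R b p by (auto simp: mult.assoc)
    have vol: "measure lborel (ball (0::'a) ?r) = (R ^ n * b ^ n * p ^ n) * \<omega>"
      using measure_ball_scale[of ?r "0::'a"] r unfolding n_def \<omega>_def power_mult_distrib by simp
    have "\<theta> = (1/2)\<^sup>2 * (1/2) ^ n" by (simp add: \<theta>_def power_divide)
    then have th: "\<theta> ^ k = p\<^sup>2 * p ^ n" by (simp only: power_mult_distrib pn)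
    have "4 * U k \<le> 4 * (\<theta> ^ k * (\<kappa> * M\<^sup>2 * R ^ n))"
      using order_trans[OF Suc mult_left_mono[OF U0, of "\<theta> ^ k"]] \<theta> by simp
    \<comment> \<open>The 64 in the hypothesis on \<open>\<kappa>\<close> is the 4 of
      \<open>level_step\<close> times the 16 from the square of \<open>\<delta> k\<close>.\<close>
    also have "\<dots> = (64 * \<kappa>) * (M\<^sup>2 * R ^ n * \<theta> ^ k / 16)" by simp
    also have "\<dots> \<le> (\<omega> * b ^ n) * (M\<^sup>2 * R ^ n * \<theta> ^ k / 16)"
      using \<kappa> R \<theta> unfolding \<omega>_def n_def by (intro mult_right_mono) auto
    also have "\<dots> = (\<delta> k)\<^sup>2 * measure lborel (ball (0::'a) ?r)"
      unfolding vol \<delta>_def th p_def[symmetric] by (simp add: power_mult_distrib power_divide)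
    finally have sm: "4 * U k \<le> (\<delta> k)\<^sup>2 * measure lborel (ball (0::'a) ?r)" .
    have \<rho>: "0 < \<rho> (Suc k)" "\<rho> (Suc k) < \<rho> k" "\<rho> k \<le> R"
    proof -
      have "\<rho> (Suc k) = R / 2 * (1 + p / 2)" "\<rho> k = R / 2 * (1 + p)" by (simp_all add: \<rho>_def p_def)
      moreover have "R / 2 * (1 + p / 2) < R / 2 * (1 + p)" using R p by (intro mult_strict_left_mono) auto
      ultimately show "\<rho> (Suc k) < \<rho> k" by simp
      show "0 < \<rho> (Suc k)" using R \<rho>R(2)[of "Suc k"] by linarith
    qed (rule \<rho>R)
    have \<delta>: "0 < \<delta> k" using M by (simp add: \<delta>_def)
    have cS: "c k + 2 * \<delta> k = c (Suc k)" by (simp add: c_def \<delta>_def algebra_simps)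
    have \<rho>d: "\<rho> k - \<rho> (Suc k) = R / 4 * p" by (simp add: \<rho>_def p_def algebra_simps)
    have "U (Suc k) \<le> 64 * ?r\<^sup>2 * (8 * \<Lambda>^4 + 2) / (\<rho> k - \<rho> (Suc k))\<^sup>2 * U k"
      unfolding U_def cS[symmetric]
      by (rule level_step[OF B R \<Psi> meas c0 \<delta> \<rho> r sm[unfolded U_def]])
    also have "64 * ?r\<^sup>2 * (8 * \<Lambda>^4 + 2) / (\<rho> k - \<rho> (Suc k))\<^sup>2 = 1024 * (8 * \<Lambda>^4 + 2) * b\<^sup>2"
      using R p unfolding \<rho>d by (simp add: power_mult_distrib power_divide)
    also have "1024 * (8 * \<Lambda>^4 + 2) * b\<^sup>2 * U k \<le> \<theta> * U k"
      using b(3) Upos[of k] unfolding \<theta>_def n_def by (intro mult_right_mono) auto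
    also have "\<dots> \<le> \<theta> ^ Suc k * U 0"
      using Suc \<theta> by simp
    finally show ?case .
  qed simp
  define V where "V = (\<integral>x. indicator (ball x0 (R / 2)) x * (max 0 (\<Psi> (f x) - M))\<^sup>2 \<partial>lborel)"
  have Vint: "integrable lborel (\<lambda>x. indicator (ball x0 (R / 2)) x * (max 0 (\<Psi> (f x) - M))\<^sup>2)"
    using posint_ball[of M "R / 2"] M R by auto
  have "V \<le> \<theta> ^ k * U 0" for k
  proof -
    have "V \<le> U k" unfolding V_def U_def
    proof (rule integral_mono[OF Vint posint_ball[OF c0 \<rho>R(1)]])
      fix x
      have "ball x0 (R / 2) \<subseteq> ball x0 (\<rho> k)" using \<rho>R by (intro subset_ball) auto
      moreover have "c k \<le> M" using M pw[of k] by (simp add: c_def)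
      then have "(max 0 (\<Psi> (f x) - M))\<^sup>2 \<le> (max 0 (\<Psi> (f x) - c k))\<^sup>2" by (intro power_mono) auto
      ultimately show "indicator (ball x0 (R / 2)) x * (max 0 (\<Psi> (f x) - M))\<^sup>2
          \<le> indicator (ball x0 (\<rho> k)) x * (max 0 (\<Psi> (f x) - c k))\<^sup>2"
        by (auto split: split_indicator)
    qed
    also note U_small
    finally show ?thesis .
  qed
  moreover have "(\<lambda>k. \<theta> ^ k * U 0) \<longlonglongrightarrow> 0 * U 0"
    using \<theta> by (intro tendsto_intros LIMSEQ_realpow_zero) auto
  ultimately have "V \<le> 0" by (intro LIMSEQ_le_const[where a=V]) auto
  moreover have "0 \<le> V" unfolding V_def by (rule Bochner_Integration.integral_nonneg) auto
  ultimately have "V = 0" by simp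
  then have "AE x in lborel. indicator (ball x0 (R / 2)) x * (max 0 (\<Psi> (f x) - M))\<^sup>2 = 0"
    unfolding V_def using integral_nonneg_eq_0_iff_AE[OF Vint] by auto
  then show ?thesis by eventually_elim (auto simp: max_def split: if_splits)
qed

text \<open>Here \<open>\<beta> + a f\<close> is a normalised copy of the solution with values in
  [0,2]. For \<open>\<Psi> = - ln (\<beta> + a s + \<epsilon>)\<close> one has
  \<open>\<Psi>'' = \<Psi>'^2\<close>, so the energy estimate with
  \<open>\<psi> = p = \<Psi>'\<close> and \<open>m = 1\<close> bounds the gradient of
  \<open>\<Psi>(f)\<close> by that of the cutoff alone. As \<open>|\<Psi>(f)| \<le> 2\<close> on at
  least half of the ball, Poincare's inequality gives an L2 bound, and \<open>local_bound\<close>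
  turns it into \<open>\<Psi>(f) \<le> M\<close>, a lower bound for the argument of the logarithm.
  The shift \<open>\<epsilon>\<close> keeps that argument away from 0 and leaves \<open>M\<close>
  unaffected.\<close>

lemma log_estimate:
  assumes B: "B = ball x0 (2 * R)" and R: "0 < R"
    and v: "\<And>s. s \<in> I \<Longrightarrow> 0 \<le> \<beta> + a * s" and \<epsilon>: "0 < \<epsilon>" "\<epsilon> \<le> 1"
    and large: "measure lborel (ball x0 R) \<le> 2 * measure lborel {x \<in> ball x0 R. 1 \<le> \<beta> + a * f x \<and> \<beta> + a * f x \<le> 2}"
    and b: "0 < b" "b \<le> 1" "1024 * (8 * \<Lambda>^4 + 2) * b\<^sup>2 \<le> 1 / (4 * 2 ^ DIM('a))"
    and \<kappa>: "64 * \<kappa> \<le> measure lborel (ball (0::'a) 1) * b ^ DIM('a)"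
    and M: "0 < M" "(4096 * 3 ^ DIM('a) * \<Lambda>^4 + 8) * measure lborel (ball (0::'a) 1) \<le> \<kappa> * M\<^sup>2"
    and bounded_above: "\<And>s. s \<in> I \<Longrightarrow> \<beta> + a * s \<le> 2"
  shows "AE x in lborel. x \<in> ball x0 (R / 2) \<longrightarrow> exp (- M) \<le> \<beta> + a * f x + \<epsilon>"
proof -
  define v where "v s = \<beta> + a * s + \<epsilon>" for s
  define \<Psi> where "\<Psi> s = - ln (v s)" for s
  define \<Psi>' where "\<Psi>' s = - (a / v s)" for s
  define \<Psi>'' where "\<Psi>'' s = (a / v s)\<^sup>2" for s
  have [measurable]: "v \<in> borel_measurable borel" unfolding v_def[abs_def] by measurable
  have meas[measurable]: "\<Psi> \<in> borel_measurable borel" "\<Psi>' \<in> borel_measurable borel" "\<Psi>'' \<in> borel_measurable borel"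
    unfolding \<Psi>_def[abs_def] \<Psi>'_def[abs_def] \<Psi>''_def[abs_def] by measurable
  have v\<epsilon>: "\<epsilon> \<le> v s" if "s \<in> I" for s using v[OF that] by (simp add: v_def)
  have dv: "(v has_real_derivative a) (at s)" for s
    unfolding v_def[abs_def] by (auto intro!: derivative_eq_intros)
  have d\<Psi>: "(\<Psi> has_real_derivative \<Psi>' s) (at s)" if "s \<in> I" for s
    unfolding \<Psi>_def[abs_def] \<Psi>'_def using v\<epsilon>[OF that] \<epsilon>
    by (auto intro!: derivative_eq_intros dv simp: divide_inverse)
  have d\<Psi>': "(\<Psi>' has_real_derivative \<Psi>'' s) (at s)" if "s \<in> I" for s
    unfolding \<Psi>'_def[abs_def] \<Psi>''_def using v\<epsilon>[OF that] \<epsilon>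
    by (auto intro!: derivative_eq_intros dv simp: power2_eq_square)
  have vc: "continuous_on I v" unfolding v_def[abs_def] by (intro continuous_intros)
  have v0: "v s \<noteq> 0" if "s \<in> I" for s using v\<epsilon>[OF that] \<epsilon> by auto
  have \<Psi>c: "continuous_on I \<Psi>'" "continuous_on I \<Psi>''"
    unfolding \<Psi>'_def[abs_def] \<Psi>''_def[abs_def] using v0 by (auto intro!: continuous_intros vc)
  \<comment> \<open>This depends on \<open>\<epsilon>\<close>, but it occurs only in hypotheses of
    \<open>local_bound\<close>, not in its conclusion.\<close>
  define L where "L = max (\<bar>a\<bar> / \<epsilon>) (\<bar>ln \<epsilon>\<bar> * (\<bar>a\<bar> / \<epsilon>)\<^sup>2)"
  have \<Psi>'b: "\<bar>\<Psi>' s\<bar> \<le> \<bar>a\<bar> / \<epsilon>" if "s \<in> I" for s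
    using v\<epsilon>[OF that] \<epsilon> by (simp add: \<Psi>'_def frac_le)
  have \<Psi>''b: "\<Psi>'' s \<le> (\<bar>a\<bar> / \<epsilon>)\<^sup>2" if "s \<in> I" for s
  proof -
    have "\<Psi>'' s = \<bar>\<Psi>' s\<bar>\<^sup>2" by (simp only: \<Psi>''_def \<Psi>'_def power2_abs power2_minus)
    also have "\<dots> \<le> (\<bar>a\<bar> / \<epsilon>)\<^sup>2" using \<Psi>'b[OF that] by (intro power_mono) auto
    finally show ?thesis .
  qed
  have \<Psi>up: "max 0 (\<Psi> s) \<le> \<bar>ln \<epsilon>\<bar>" if "s \<in> I" for s
    using v\<epsilon>[OF that] \<epsilon> ln_le_cancel_iff[of \<epsilon> "v s"] by (auto simp: \<Psi>_def)
  have L: "\<bar>\<Psi>' s\<bar> \<le> L" "max 0 (\<Psi> s) * \<Psi>'' s \<le> L" if "s \<in> I" for s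
  proof -
    show "\<bar>\<Psi>' s\<bar> \<le> L" using \<Psi>'b[OF that] by (simp add: L_def)
    have "max 0 (\<Psi> s) * \<Psi>'' s \<le> \<bar>ln \<epsilon>\<bar> * (\<bar>a\<bar> / \<epsilon>)\<^sup>2"
      using \<Psi>up[OF that] \<Psi>''b[OF that] by (intro mult_mono) (auto simp: \<Psi>''_def)
    then show "max 0 (\<Psi> s) * \<Psi>'' s \<le> L" by (simp add: L_def)
  qed
  have \<Psi>''0: "0 \<le> \<Psi>'' s" for s by (simp add: \<Psi>''_def)
  let ?b = "ball x0 R"
  define \<omega> where "\<omega> = measure lborel (ball (0::'a) 1)"
  have bB: "?b \<subseteq> B" unfolding B using R by (intro subset_ball) auto
  define u where "u x = 1 * \<Psi> (f x)" for x
  define w where "w x = (1 * \<Psi>' (f x)) *\<^sub>R g x + \<Psi> (f x) *\<^sub>R 0" for x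
  have H: "H1_approx ?b UNIV u w"
    unfolding u_def w_def
    by (rule H1_approx_comp_mult[OF H1_approx_subset[OF approx bB] _ _ I d\<Psi> L(1) \<Psi>c(1), where c=1])
       (auto simp: GDERIV_const emeasure_ball_eq)
  have um[measurable]: "u \<in> borel_measurable borel" "w \<in> borel_measurable borel"
    using H unfolding H1_approx_def by auto
  define Y where "Y = (\<integral>x. indicator ?b x * (norm (w x))\<^sup>2 \<partial>lborel)"
  have T: "translation_bound ?b u Y"
    using translation_bound_H1[OF H] unfolding Y_def by simp
  have Y0: "0 \<le> Y" unfolding Y_def by simp
  obtain \<zeta> Z where \<zeta>: "\<And>x. GDERIV \<zeta> x :> Z x" "continuous_on UNIV Z"
    "\<And>x. 0 \<le> \<zeta> x" "\<And>x. \<zeta> x \<le> 1" "\<And>x. x \<in> ball x0 R \<Longrightarrow> \<zeta> x = 1"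
    "\<And>x. x \<notin> ball x0 (3/2 * R) \<Longrightarrow> \<zeta> x = 0" "\<And>x. x \<notin> ball x0 (3/2 * R) \<Longrightarrow> Z x = 0"
    "\<And>x. norm (Z x) \<le> 4 / (3/2 * R - R)"
    using cutoff_exists[of R "3/2 * R" x0] R by auto
  have K: "cball x0 (3/2 * R) \<subseteq> B" unfolding B using R by (intro cball_subset_ball_iff[THEN iffD2]) auto
  have K0: "\<zeta> x = 0" if "x \<notin> cball x0 (3/2 * R)" for x using \<zeta>(6)[of x] that by auto
  have one: "integrable lborel (\<lambda>x. indicator B x * (1::real)\<^sup>2)" using B_finite by auto
  have pm: "(\<Psi>' s)\<^sup>2 \<le> \<Psi>'' s" "\<bar>\<Psi>' s\<bar> \<le> \<bar>\<Psi>' s\<bar> * \<bar>1\<bar>" for s by (auto simp: \<Psi>'_def \<Psi>''_def)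
  have \<Psi>''L: "\<bar>\<Psi>'' s\<bar> \<le> (\<bar>a\<bar> / \<epsilon>)\<^sup>2" if "s \<in> I" for s using \<Psi>''b[OF that] \<Psi>''0[of s] by simp
  have en: "integrable lborel (\<lambda>x. (\<zeta> x)\<^sup>2 * (\<Psi>' (f x))\<^sup>2 * (norm (g x))\<^sup>2)"
    "integrable lborel (\<lambda>x. 1\<^sup>2 * (norm (Z x))\<^sup>2)"
    "(\<integral>x. (\<zeta> x)\<^sup>2 * (\<Psi>' (f x))\<^sup>2 * (norm (g x))\<^sup>2 \<partial>lborel) \<le> 4 * \<Lambda>^4 * (\<integral>x. 1\<^sup>2 * (norm (Z x))\<^sup>2 \<partial>lborel)"
    using energy_estimate[where \<psi>=\<Psi>' and \<psi>'=\<Psi>'' and L="(\<bar>a\<bar> / \<epsilon>)\<^sup>2" and p=\<Psi>' and m="\<lambda>_. 1" and \<zeta>=\<zeta> and Z=Z and K="cball x0 (3/2 * R)"]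
      d\<Psi>' \<Psi>''L \<Psi>c(2) meas pm one \<zeta>(1,2) compact_cball K K0 borel_measurable_const by blast+
  have "Y \<le> (\<integral>x. (\<zeta> x)\<^sup>2 * (\<Psi>' (f x))\<^sup>2 * (norm (g x))\<^sup>2 \<partial>lborel)"
    unfolding Y_def
  proof (rule integral_mono[OF H1_approx_integrable(2)[OF H open_ball] en(1)])
    fix x show "indicator ?b x * (norm (w x))\<^sup>2 \<le> (\<zeta> x)\<^sup>2 * (\<Psi>' (f x))\<^sup>2 * (norm (g x))\<^sup>2"
      using \<zeta>(5)[of x] by (auto simp: w_def power_mult_distrib split: split_indicator)
  qed
  also note en(3)
  also have "(\<integral>x. 1\<^sup>2 * (norm (Z x))\<^sup>2 \<partial>lborel) \<le> (\<integral>x. (8 / R)\<^sup>2 * indicator (ball x0 (3/2 * R)) x \<partial>lborel)"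
  proof (rule integral_mono[OF en(2)])
    show "integrable lborel (\<lambda>x. (8 / R)\<^sup>2 * indicator (ball x0 (3/2 * R)) x)"
      by (intro integrable_mult_right integrable_real_indicator) (auto simp: emeasure_ball_eq)
    fix x
    have "(norm (Z x))\<^sup>2 \<le> (8 / R)\<^sup>2" using \<zeta>(8)[of x] by (intro power_mono) auto
    then show "1\<^sup>2 * (norm (Z x))\<^sup>2 \<le> (8 / R)\<^sup>2 * indicator (ball x0 (3/2 * R)) x"
      using \<zeta>(7)[of x] by (cases "x \<in> ball x0 (3/2 * R)") auto
  qed
  also have "\<dots> = (8 / R)\<^sup>2 * measure lborel (ball x0 (3/2 * R))" by simp
  also have "\<dots> = (8 / R)\<^sup>2 * ((3/2) ^ DIM('a) * R ^ DIM('a) * \<omega>)"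
  proof -
    have "(3/2 * R) ^ DIM('a) = (3/2) ^ DIM('a) * R ^ DIM('a)" by (rule power_mult_distrib)
    then show ?thesis using R measure_ball_scale[of "3/2 * R" x0] unfolding \<omega>_def by simp
  qed
  finally have Y: "Y \<le> 4 * \<Lambda>^4 * ((8 / R)\<^sup>2 * ((3/2) ^ DIM('a) * R ^ DIM('a) * \<omega>))"
    by (simp add: mult_left_mono)
  define E where "E = {x \<in> ?b. 1 \<le> \<beta> + a * f x \<and> \<beta> + a * f x \<le> 2}"
  have Em[measurable]: "E \<in> sets borel" unfolding E_def by measurable
  have uE: "\<bar>u x\<bar> \<le> 2" if "x \<in> E" for x
  proof -
    have "1 \<le> v (f x)" "v (f x) \<le> 3" using that \<epsilon> by (auto simp: E_def v_def)
    moreover from this have "ln (v (f x)) \<le> v (f x) - 1" by (intro ln_le_minus_one) auto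
    moreover have "0 \<le> ln (v (f x))" using \<open>1 \<le> v (f x)\<close> by simp
    ultimately show ?thesis by (simp add: u_def \<Psi>_def)
  qed
  have "(\<integral>\<^sup>+x. indicator ?b x * ennreal ((u x)\<^sup>2) \<partial>lborel)
    \<le> ennreal (16 * 2 ^ DIM('a) * R\<^sup>2 * Y + 2 * 2\<^sup>2 * measure lborel ?b)"
    by (rule poincare_large_set[OF um(1) T Y0 R Em _ large[folded E_def] uE]) (auto simp: E_def)
  also have "(\<integral>\<^sup>+x. indicator ?b x * ennreal ((u x)\<^sup>2) \<partial>lborel) = (\<integral>\<^sup>+x. ennreal (indicator ?b x * (u x)\<^sup>2) \<partial>lborel)"
    by (intro nn_integral_cong) (auto split: split_indicator)
  also have "\<dots> = ennreal (\<integral>x. indicator ?b x * (u x)\<^sup>2 \<partial>lborel)"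
    by (rule nn_integral_eq_integral[OF H1_approx_integrable(1)[OF H open_ball]]) auto
  finally have "(\<integral>x. indicator ?b x * (u x)\<^sup>2 \<partial>lborel) \<le> 16 * 2 ^ DIM('a) * R\<^sup>2 * Y + 2 * 2\<^sup>2 * measure lborel ?b"
    using Y0 by (subst (asm) ennreal_le_iff) auto
  also have "\<dots> \<le> 16 * 2 ^ DIM('a) * R\<^sup>2 * (4 * \<Lambda>^4 * ((8 / R)\<^sup>2 * ((3/2) ^ DIM('a) * R ^ DIM('a) * \<omega>))) + 2 * 2\<^sup>2 * (R ^ DIM('a) * \<omega>)"
  proof -
    have vb: "measure lborel ?b = R ^ DIM('a) * \<omega>"
      using measure_ball_scale[of R x0] R by (simp add: \<omega>_def)
    show ?thesis unfolding vb using Y by (intro add_right_mono mult_left_mono) auto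
  qed
  \<comment> \<open>Origin of the factor: \<open>16 * 2^n\<close> from Poincare, 4 from the energy
    estimate, 64 from the gradient bound \<open>8 / R\<close> and \<open>(3/2)^n\<close> from the
    volume of the larger ball.\<close>
  also have "\<dots> = (4096 * 3 ^ DIM('a) * \<Lambda>^4 + 8) * \<omega> * R ^ DIM('a)"
    using R by (simp add: power_divide field_simps)
  also have "\<dots> \<le> \<kappa> * M\<^sup>2 * R ^ DIM('a)"
    using M(2) R unfolding \<omega>_def by (intro mult_right_mono) auto
  finally have u2: "(\<integral>x. indicator ?b x * (u x)\<^sup>2 \<partial>lborel) \<le> \<kappa> * M\<^sup>2 * R ^ DIM('a)" .
  have "(\<integral>x. indicator ?b x * (max 0 (\<Psi> (f x)))\<^sup>2 \<partial>lborel) \<le> (\<integral>x. indicator ?b x * (u x)\<^sup>2 \<partial>lborel)"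
  proof (rule integral_mono')
    fix x
    have "(max 0 (\<Psi> (f x)))\<^sup>2 \<le> \<bar>u x\<bar>\<^sup>2" by (intro power_mono) (auto simp: u_def)
    then show "indicator ?b x * (max 0 (\<Psi> (f x)))\<^sup>2 \<le> indicator ?b x * (u x)\<^sup>2"
      by (auto split: split_indicator)
  qed (use H1_approx_integrable(1)[OF H open_ball] in auto)
  also note u2
  finally have sm: "(\<integral>x. indicator ?b x * (max 0 (\<Psi> (f x)))\<^sup>2 \<partial>lborel) \<le> \<kappa> * M\<^sup>2 * R ^ DIM('a)" .
  have "AE x in lborel. x \<in> ball x0 (R / 2) \<longrightarrow> \<Psi> (f x) \<le> M"
    by (rule local_bound[OF B R d\<Psi> d\<Psi>' \<Psi>c(2) \<Psi>''0 L meas b \<kappa> M(1) sm])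
  then show ?thesis
    using H1_approx_integrable(3)[OF approx open_B I(3)]
  proof eventually_elim
    case (elim x)
    show ?case
    proof
      assume x: "x \<in> ball x0 (R / 2)"
      moreover have "ball x0 (R / 2) \<subseteq> B" unfolding B using R by (intro subset_ball) auto
      ultimately have "f x \<in> I" "- M \<le> ln (v (f x))" using elim by (auto simp: \<Psi>_def)
      then have "exp (- M) \<le> v (f x)"
        using v\<epsilon>[of "f x"] \<epsilon> by (subst ln_ge_iff[symmetric]) auto
      then show "exp (- M) \<le> \<beta> + a * f x + \<epsilon>" by (simp add: v_def)
    qed
  qed
qed

end

text \<open>Because \<open>b \<le> 1\<close>, a condition linear in \<open>b\<close> implies the
  quadratic one, so the reciprocal of the product of the constants will do.\<close>

lemma de_giorgi_constants:
  fixes \<Lambda> :: real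
  assumes "0 < \<Lambda>"
  obtains b \<kappa> :: real where "0 < b" "b \<le> 1" "1024 * (8 * \<Lambda>^4 + 2) * b\<^sup>2 \<le> 1 / (4 * 2 ^ DIM('a::euclidean_space))"
    "0 < \<kappa>" "64 * \<kappa> \<le> measure lborel (ball (0::'a) 1) * b ^ DIM('a)"
proof -
  define Q where "Q = 1024 * (8 * \<Lambda>^4 + 2) * (4 * 2 ^ DIM('a))"
  have "1 \<le> (2::real) ^ DIM('a)" by simp
  then have "1 \<le> 4 * (2::real) ^ DIM('a)" by linarith
  then have "1 * 1 \<le> (1024 * (8 * \<Lambda>^4 + 2)) * (4 * (2::real) ^ DIM('a))"
    using assms by (intro mult_mono) auto
  then have Q: "1 \<le> Q" unfolding Q_def by simp
  define b where "b = 1 / Q"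
  have b: "0 < b" "b \<le> 1" using Q by (auto simp: b_def)
  have "b\<^sup>2 \<le> b * 1" unfolding power2_eq_square using b by (intro mult_left_mono) auto
  then have "1024 * (8 * \<Lambda>^4 + 2) * b\<^sup>2 \<le> 1024 * (8 * \<Lambda>^4 + 2) * b"
    using assms by (intro mult_left_mono) auto
  also have "\<dots> = 1 / (4 * 2 ^ DIM('a))"
  proof -
    have "1024 * (8 * \<Lambda>^4 + 2) \<noteq> 0" using assms by (smt (verit) zero_less_power)
    then show ?thesis by (simp add: b_def Q_def)
  qed
  finally have b3: "1024 * (8 * \<Lambda>^4 + 2) * b\<^sup>2 \<le> 1 / (4 * 2 ^ DIM('a))" .
  show ?thesis
    by (rule that[of b "measure lborel (ball (0::'a) 1) * b ^ DIM('a) / 64"])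
       (use b b3 measure_ball_positive[of 1 "0::'a"] in auto)
qed

section \<open>Sup bound and oscillation decay with uniform constants\<close>

lemma sup_bound:
  fixes \<Lambda> :: real
  assumes "0 < \<Lambda>"
  obtains \<kappa> where "0 < \<kappa>"
    "\<And>(x0::'a::euclidean_space) R f g q M. \<lbrakk>elliptic_flux \<Lambda> (ball x0 (2 * R)) UNIV f g q; 0 < R; 0 < M;
      (\<integral>x. indicator (ball x0 R) x * (f x)\<^sup>2 \<partial>lborel) \<le> \<kappa> * M\<^sup>2 * R ^ DIM('a)\<rbrakk>
      \<Longrightarrow> AE x in lborel. x \<in> ball x0 (R / 2) \<longrightarrow> \<bar>f x\<bar> \<le> M"
proof -
  obtain b \<kappa> :: real where b: "0 < b" "b \<le> 1" "1024 * (8 * \<Lambda>^4 + 2) * b\<^sup>2 \<le> 1 / (4 * 2 ^ DIM('a))"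
    and \<kappa>: "0 < \<kappa>" "64 * \<kappa> \<le> measure lborel (ball (0::'a) 1) * b ^ DIM('a)"
    using de_giorgi_constants[OF assms, where ?'a='a] by blast
  show ?thesis
  proof (rule that[OF \<kappa>(1)])
    fix x0 :: 'a and R f g q and M :: real
    assume ef: "elliptic_flux \<Lambda> (ball x0 (2 * R)) UNIV f g q" and R: "0 < R" and M: "0 < M"
      and small: "(\<integral>x. indicator (ball x0 R) x * (f x)\<^sup>2 \<partial>lborel) \<le> \<kappa> * M\<^sup>2 * R ^ DIM('a)"
    interpret elliptic_flux \<Lambda> "ball x0 (2 * R)" UNIV f g q by (rule ef)
    have int: "integrable lborel (\<lambda>x. indicator (ball x0 R) x * (f x)\<^sup>2)"
    proof (rule Bochner_Integration.integrable_bound[OF H1_approx_integrable(1)[OF approx open_B]])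
      have "ball x0 R \<subseteq> ball x0 (2 * R)" using R by (intro subset_ball) auto
      then show "AE x in lborel. norm (indicator (ball x0 R) x * (f x)\<^sup>2) \<le> norm (indicator (ball x0 (2 * R)) x * (f x)\<^sup>2)"
        by (intro AE_I2) (auto split: split_indicator)
    qed measurable
    have one_side: "AE x in lborel. x \<in> ball x0 (R / 2) \<longrightarrow> t * f x \<le> M" if t: "\<bar>t\<bar> = 1" for t
    proof (rule local_bound[OF refl R, where \<Psi>'="\<lambda>_. t" and \<Psi>''="\<lambda>_. 0" and L=1])
      show "((*) t has_real_derivative t) (at s)" for s by (auto intro!: derivative_eq_intros)
      have "(\<integral>x. indicator (ball x0 R) x * (max 0 (t * f x))\<^sup>2 \<partial>lborel) \<le> (\<integral>x. indicator (ball x0 R) x * (f x)\<^sup>2 \<partial>lborel)"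
      proof (rule integral_mono')
        fix x
        have "(max 0 (t * f x))\<^sup>2 \<le> \<bar>t * f x\<bar>\<^sup>2" by (intro power_mono) auto
        then show "indicator (ball x0 R) x * (max 0 (t * f x))\<^sup>2 \<le> indicator (ball x0 R) x * (f x)\<^sup>2"
          using t by (auto simp: abs_mult split: split_indicator)
      qed (use int in auto)
      then show "(\<integral>x. indicator (ball x0 R) x * (max 0 (t * f x))\<^sup>2 \<partial>lborel) \<le> \<kappa> * M\<^sup>2 * R ^ DIM('a)"
        using small by linarith
    qed (use t b \<kappa> M in auto)
    have "AE x in lborel. x \<in> ball x0 (R / 2) \<longrightarrow> 1 * f x \<le> M"
      "AE x in lborel. x \<in> ball x0 (R / 2) \<longrightarrow> - 1 * f x \<le> M"
      by (rule one_side; simp)+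
    then show "AE x in lborel. x \<in> ball x0 (R / 2) \<longrightarrow> \<bar>f x\<bar> \<le> M"
      by eventually_elim auto
  qed
qed

lemma oscillation_decay:
  fixes \<Lambda> :: real
  assumes "0 < \<Lambda>"
  obtains c where "0 < c" "c < 1"
    "\<And>(x0::'a::euclidean_space) R f g q m M. \<lbrakk>elliptic_flux \<Lambda> (ball x0 (2 * R)) {m..M} f g q; 0 < R; m < M\<rbrakk>
      \<Longrightarrow> \<exists>m' M'. m' \<le> M' \<and> M' - m' \<le> (1 - c) * (M - m) \<and>
        (AE x in lborel. x \<in> ball x0 (R / 2) \<longrightarrow> f x \<in> {m'..M'})"
proof -
  obtain b \<kappa> :: real where b: "0 < b" "b \<le> 1" "1024 * (8 * \<Lambda>^4 + 2) * b\<^sup>2 \<le> 1 / (4 * 2 ^ DIM('a))"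
    and \<kappa>: "0 < \<kappa>" "64 * \<kappa> \<le> measure lborel (ball (0::'a) 1) * b ^ DIM('a)"
    using de_giorgi_constants[OF assms, where ?'a='a] by blast
  define Q where "Q = (4096 * 3 ^ DIM('a) * \<Lambda>^4 + 8) * measure lborel (ball (0::'a) 1)"
  have Q: "0 < Q"
    unfolding Q_def using assms measure_ball_positive[of 1 "0::'a"] by (intro mult_pos_pos add_nonneg_pos) auto
  \<comment> \<open>Solves \<open>Q = \<kappa> N^2\<close>, the condition that
    \<open>log_estimate\<close> puts on its bound.\<close>
  define N where "N = sqrt (Q / \<kappa>)"
  have N: "0 < N" "Q \<le> \<kappa> * N\<^sup>2" using Q \<kappa> by (auto simp: N_def)
  \<comment> \<open>The logarithmic estimate is used with \<open>\<epsilon> = exp (- N) / 2\<close>,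
    leaving a gain of \<open>exp (- N) / 2\<close> for the scaled function. Undoing the scaling by
    \<open>2 / (M - m)\<close> halves it once more.\<close>
  define c where "c = exp (- N) / 4"
  have "exp (- N) < 1" using N by simp
  then have c: "0 < c" "c < 1/2" unfolding c_def using exp_gt_zero[of "- N"] by linarith+
  show ?thesis
  proof (rule that[of c])
    fix x0 :: 'a and R f g q and m M :: real
    assume ef: "elliptic_flux \<Lambda> (ball x0 (2 * R)) {m..M} f g q" and R: "0 < R" and mM: "m < M"
    interpret elliptic_flux \<Lambda> "ball x0 (2 * R)" "{m..M}" f g q by (rule ef)
    define s where "s = 2 / (M - m)"
    have s: "0 < s" "s * (M - m) = 2" using mM by (auto simp: s_def field_simps)
    let ?b = "ball x0 R"
    define E1 where "E1 = {x \<in> ?b. 1 \<le> - s * m + s * f x \<and> - s * m + s * f x \<le> 2}"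
    define E2 where "E2 = {x \<in> ?b. 1 \<le> s * M + - s * f x \<and> s * M + - s * f x \<le> 2}"
    have [measurable]: "E1 \<in> sets borel" "E2 \<in> sets borel" unfolding E1_def E2_def by measurable
    have "exp (- N) \<le> 1" using N by simp
    then have e0: "exp (- N) \<le> 2" by linarith
    have sb: "0 \<le> s * (t - m)" "s * (t - m) \<le> 2" "0 \<le> s * (M - t)" "s * (M - t) \<le> 2" if "t \<in> {m..M}" for t
    proof -
      have "s * (t - m) \<le> s * (M - m)" "s * (M - t) \<le> s * (M - m)" using that s(1) by (intro mult_left_mono; simp)+
      then show "s * (t - m) \<le> 2" "s * (M - t) \<le> 2" using s by auto
    qed (use that s in auto)
    have fI: "AE x in lborel. x \<in> ball x0 (2 * R) \<longrightarrow> f x \<in> {m..M}"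
      by (rule H1_approx_integrable(3)[OF approx open_B I(3)])
    have sub: "ball x0 R \<subseteq> ball x0 (2 * R)" "ball x0 (R / 2) \<subseteq> ball x0 (2 * R)" using R by (auto intro!: subset_ball)
    have fin: "E1 \<in> fmeasurable lborel" "E2 \<in> fmeasurable lborel"
      by (rule fmeasurableI2[of ?b]; auto simp: E1_def E2_def fmeasurable_def emeasure_ball_eq)+
    \<comment> \<open>Scaled by \<open>s\<close>, the functions \<open>f - m\<close> and
      \<open>M - f\<close> add up to 2, so almost everywhere one of them is at least 1. Hence one of
      \<open>E1\<close>, \<open>E2\<close> fills half of the ball.\<close>
    have "measure lborel ?b \<le> measure lborel (E1 \<union> E2)"
    proof -
      have "emeasure lborel ?b \<le> emeasure lborel (E1 \<union> E2)"
      proof (rule emeasure_mono_AE)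
        show "AE x in lborel. x \<in> ?b \<longrightarrow> x \<in> E1 \<union> E2"
          using fI
        proof eventually_elim
          case (elim x)
          show ?case
          proof
            assume x: "x \<in> ?b"
            then have t: "f x \<in> {m..M}" using elim sub by auto
            have "s * (f x - m) + s * (M - f x) = 2" using s by (simp add: algebra_simps)
            then have "1 \<le> s * (f x - m) \<or> 1 \<le> s * (M - f x)" by linarith
            then show "x \<in> E1 \<union> E2" using x sb[OF t] by (auto simp: E1_def E2_def algebra_simps)
          qed
        qed
      qed auto
      moreover have "E1 \<union> E2 \<in> fmeasurable lborel" using fin by (rule fmeasurable.Un)
      ultimately show ?thesis
        by (auto simp: emeasure_eq_measure2 emeasure_ball_eq)
    qed
    also have "\<dots> \<le> measure lborel E1 + measure lborel E2"
      by (rule measure_Un_le) auto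
    finally have "measure lborel ?b \<le> 2 * measure lborel E1 \<or> measure lborel ?b \<le> 2 * measure lborel E2"
      by linarith
    have "s * (c * (M - m)) = c * (s * (M - m))" by (rule mult.left_commute)
    then have sc: "s * (c * (M - m)) = exp (- N) / 2" unfolding s(2) by (simp add: c_def)
    from \<open>measure lborel ?b \<le> 2 * measure lborel E1 \<or> measure lborel ?b \<le> 2 * measure lborel E2\<close>
    show "\<exists>m' M'. m' \<le> M' \<and> M' - m' \<le> (1 - c) * (M - m) \<and>
        (AE x in lborel. x \<in> ball x0 (R / 2) \<longrightarrow> f x \<in> {m'..M'})"
    proof
      assume 1: "measure lborel ?b \<le> 2 * measure lborel E1"
      have "AE x in lborel. x \<in> ball x0 (R / 2) \<longrightarrow> exp (- N) \<le> - s * m + s * f x + exp (- N) / 2"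
      proof (rule log_estimate[OF refl R _ _ _ _ b \<kappa>(2) N(1)])
        show "0 \<le> - s * m + s * t" "- s * m + s * t \<le> 2" if "t \<in> {m..M}" for t
          using sb[OF that] by (auto simp: algebra_simps)
      qed (use 1 N e0 in \<open>auto simp: E1_def Q_def\<close>)
      then have "AE x in lborel. x \<in> ball x0 (R / 2) \<longrightarrow> f x \<in> {m + c * (M - m)..M}"
        using fI
      proof eventually_elim
        case (elim x)
        show ?case
        proof
          assume x: "x \<in> ball x0 (R / 2)"
          then have "s * (c * (M - m)) \<le> s * (f x - m)"
            using elim(1) unfolding sc by (simp add: algebra_simps)
          then have "c * (M - m) \<le> f x - m" using s(1) by simp
          then show "f x \<in> {m + c * (M - m)..M}" using elim(2) x sub by auto
        qed
      qed
      moreover have "c * (M - m) \<le> 1 * (M - m)" using c mM by (intro mult_right_mono) auto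
      ultimately show ?thesis
        by (intro exI[of _ "m + c * (M - m)"] exI[of _ M]) (auto simp: algebra_simps)
    next
      assume 2: "measure lborel ?b \<le> 2 * measure lborel E2"
      have "AE x in lborel. x \<in> ball x0 (R / 2) \<longrightarrow> exp (- N) \<le> s * M + - s * f x + exp (- N) / 2"
      proof (rule log_estimate[OF refl R _ _ _ _ b \<kappa>(2) N(1)])
        show "0 \<le> s * M + - s * t" "s * M + - s * t \<le> 2" if "t \<in> {m..M}" for t
          using sb[OF that] by (auto simp: algebra_simps)
      qed (use 2 N e0 in \<open>auto simp: E2_def Q_def\<close>)
      then have "AE x in lborel. x \<in> ball x0 (R / 2) \<longrightarrow> f x \<in> {m..M - c * (M - m)}"
        using fI
      proof eventually_elim
        case (elim x)
        show ?case
        proof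
          assume x: "x \<in> ball x0 (R / 2)"
          then have "s * (c * (M - m)) \<le> s * (M - f x)"
            using elim(1) unfolding sc by (simp add: algebra_simps)
          then have "c * (M - m) \<le> M - f x" using s(1) by simp
          then show "f x \<in> {m..M - c * (M - m)}" using elim(2) x sub by auto
        qed
      qed
      moreover have "c * (M - m) \<le> 1 * (M - m)" using c mM by (intro mult_right_mono) auto
      ultimately show ?thesis
        by (intro exI[of _ m] exI[of _ "M - c * (M - m)"]) (auto simp: algebra_simps)
    qed
  qed (use c in auto)
qed

subsection \<open>Hoelder regularity of flux solutions\<close>

text \<open>Collects the local hypotheses for all balls and all ranges at once. The range is assumed
  on a ball of radius \<open>R\<close> and the structure obtained on a smaller one, because
  mollification needs room; this loss reappears in the radii below.\<close>

definition flux_solution :: "real \<Rightarrow> 'a::euclidean_space set \<Rightarrow> ('a \<Rightarrow> real) \<Rightarrow> ('a \<Rightarrow> 'a) \<Rightarrow> ('a \<Rightarrow> 'a) \<Rightarrow> bool" where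
  "flux_solution \<Lambda> U f g q \<longleftrightarrow> f \<in> borel_measurable borel \<and> set_integrable lborel U (\<lambda>x. (f x)\<^sup>2) \<and>
    (\<forall>x r R I. ball x R \<subseteq> U \<and> 0 < r \<and> r < R \<and> is_interval I \<and> I \<noteq> {} \<and> closed I \<and>
      (AE y in lborel. y \<in> ball x R \<longrightarrow> f y \<in> I) \<longrightarrow> elliptic_flux \<Lambda> (ball x r) I f g q)"

text \<open>The value \<open>h x\<close> lies between all essential bounds of \<open>f\<close> near \<open>x\<close>; this identifies the
  continuous version of \<open>f\<close> without mentioning continuity.\<close>

definition precise_version :: "'a::euclidean_space set \<Rightarrow> ('a \<Rightarrow> real) \<Rightarrow> ('a \<Rightarrow> real) \<Rightarrow> bool" where
  "precise_version U f h \<longleftrightarrow> (\<forall>x r m M. 0 < r \<and> ball x r \<subseteq> U \<and> (AE y in lborel. y \<in> ball x r \<longrightarrow> f y \<in> {m..M})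
    \<longrightarrow> (\<forall>y\<in>ball x r. h y \<in> {m..M}))"

section \<open>Precise representatives and iteration over scales\<close>

lemma precise_versionD:
  assumes "precise_version U f h" "0 < r" "ball x r \<subseteq> U" "AE y in lborel. y \<in> ball x r \<longrightarrow> f y \<in> {m..M}" "y \<in> ball x r"
  shows "h y \<in> {m..M}"
  using assms unfolding precise_version_def by blast

lemma AE_ball_witness:
  fixes x :: "'a::euclidean_space"
  assumes "AE y in lborel. y \<in> ball x r \<longrightarrow> P y" "0 < r"
  obtains y where "y \<in> ball x r" "P y"
proof (rule ccontr)
  assume "\<not> thesis"
  with that have no: "\<not> P y" if "y \<in> ball x r" for y using that by blast
  have "AE y in lborel. y \<notin> ball x r" using assms(1) by eventually_elim (use no in auto)
  then have "emeasure lborel (ball x r) = 0"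
    by (subst (asm) AE_iff_measurable[of "ball x r"]) auto
  then show False using measure_ball_positive[OF assms(2), of x] by (simp add: measure_def)
qed

text \<open>The witness is an essential limit superior: the infimum of the essential upper bounds of
  \<open>f\<close> on balls around \<open>x\<close>. It cannot fall below an essential lower bound,
  because two balls with the same centre share one of positive measure.\<close>

lemma precise_version_exists:
  fixes f :: "'a::euclidean_space \<Rightarrow> real"
  shows "\<exists>h. precise_version U f h"
proof -
  define S where "S x = {M. \<exists>r>0. ball x r \<subseteq> U \<and> (AE y in lborel. y \<in> ball x r \<longrightarrow> f y \<le> M)}" for x
  define h where "h x = Inf (S x)" for x
  have "h z \<in> {m..M}" if z: "z \<in> ball x r" and r: "ball x r \<subseteq> U"
    and ae: "AE y in lborel. y \<in> ball x r \<longrightarrow> f y \<in> {m..M}" for x z r m M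
  proof -
    obtain e where e: "0 < e" "ball z e \<subseteq> ball x r"
      using openE[OF open_ball z] by blast
    have MS: "M \<in> S z"
      unfolding S_def mem_Collect_eq
    proof (intro exI[of _ e] conjI e)
      show "ball z e \<subseteq> U" using e r by auto
      show "AE y in lborel. y \<in> ball z e \<longrightarrow> f y \<le> M"
        using ae by eventually_elim (use e in auto)
    qed
    have lower: "m \<le> N" if N: "N \<in> S z" for N
    proof -
      obtain d where d: "0 < d" "AE y in lborel. y \<in> ball z d \<longrightarrow> f y \<le> N"
        using N unfolding S_def by auto
      have "AE y in lborel. y \<in> ball z (min d e) \<longrightarrow> m \<le> N"
        using ae d(2) by eventually_elim (use e in auto)
      then show ?thesis using AE_ball_witness[of z "min d e" "\<lambda>_. m \<le> N"] d e by auto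
    qed
    have "h z \<le> M" unfolding h_def by (rule cInf_lower[OF MS]) (use lower in \<open>auto simp: bdd_below_def\<close>)
    moreover have "m \<le> h z" unfolding h_def by (rule cInf_greatest) (use MS lower in auto)
    ultimately show ?thesis by simp
  qed
  then show ?thesis unfolding precise_version_def by blast
qed

text \<open>Brings an arbitrary Hoelder version into the scope of the estimates. If
  \<open>h y\<close> were outside \<open>{m..M}\<close>, then by continuity \<open>h\<close> would
  be outside on a whole ball, where it agrees with \<open>f\<close> almost everywhere.\<close>

lemma precise_version_continuous:
  fixes f h :: "'a::euclidean_space \<Rightarrow> real"
  assumes ae: "AE x in lborel. x \<in> U \<longrightarrow> h x = f x" and c: "continuous_on U h" and U: "open U"
  shows "precise_version U f h"
  unfolding precise_version_def
proof (intro allI impI ballI)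
  fix x r m M y
  assume a: "0 < r \<and> ball x r \<subseteq> U \<and> (AE y in lborel. y \<in> ball x r \<longrightarrow> f y \<in> {m..M})" and y: "y \<in> ball x r"
  show "h y \<in> {m..M}"
  proof (rule ccontr)
    assume no: "h y \<notin> {m..M}"
    have "continuous_on (ball x r) h" using c a continuous_on_subset by blast
    moreover have "open (- {m..M})" by auto
    ultimately have "open (h -` (- {m..M}) \<inter> ball x r)"
      by (subst (asm) continuous_on_open_vimage) auto
    then obtain e where e: "0 < e" "ball y e \<subseteq> h -` (- {m..M}) \<inter> ball x r"
      using no y open_contains_ball by blast
    from a have "AE z in lborel. z \<in> ball x r \<longrightarrow> f z \<in> {m..M}" by blast
    with ae have "AE z in lborel. z \<in> ball y e \<longrightarrow> False"
      by eventually_elim (use e a in auto)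
    then show False using AE_ball_witness[of y e "\<lambda>_. False"] e by auto
  qed
qed

text \<open>One round costs a factor 8 in the radius: from \<open>\<rho>\<close> to
  \<open>\<rho> / 2\<close> for the room demanded by \<open>flux_solution\<close>, then to
  \<open>\<rho> / 8\<close> because \<open>oscillation_decay\<close> goes from \<open>2 R\<close> to
  \<open>R / 2\<close>. It assumes \<open>m < M\<close>; if \<open>m = M\<close>, the oscillation is
  already zero.\<close>

lemma oscillation_iterate:
  fixes \<Lambda> :: real
  assumes "0 < \<Lambda>"
  obtains \<sigma> where "0 < \<sigma>" "\<sigma> < 1"
    "\<And>(U::'a::euclidean_space set) f g q x R K k. \<lbrakk>flux_solution \<Lambda> U f g q; 0 < R; ball x R \<subseteq> U; 0 \<le> K;
      AE y in lborel. y \<in> ball x R \<longrightarrow> \<bar>f y\<bar> \<le> K\<rbrakk> \<Longrightarrow>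
      \<exists>m M. M - m \<le> 2 * K * \<sigma> ^ k \<and> (AE y in lborel. y \<in> ball x (R * (1/8) ^ k) \<longrightarrow> f y \<in> {m..M})"
proof -
  obtain c where c: "0 < c" "c < 1" and osc:
    "\<And>(x0::'a) R f g q m M. \<lbrakk>elliptic_flux \<Lambda> (ball x0 (2 * R)) {m..M} f g q; 0 < R; m < M\<rbrakk>
      \<Longrightarrow> \<exists>m' M'. m' \<le> M' \<and> M' - m' \<le> (1 - c) * (M - m) \<and>
        (AE x in lborel. x \<in> ball x0 (R / 2) \<longrightarrow> f x \<in> {m'..M'})"
    using oscillation_decay[OF assms, where ?'a='a] by blast
  show ?thesis
  proof (rule that[of "1 - c"])
    fix U :: "'a set" and f g q x and R K :: real and k :: nat
    assume fs: "flux_solution \<Lambda> U f g q" and R: "0 < R" "ball x R \<subseteq> U" and K: "0 \<le> K"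
      and ae: "AE y in lborel. y \<in> ball x R \<longrightarrow> \<bar>f y\<bar> \<le> K"
    have "\<exists>m M. m \<le> M \<and> M - m \<le> 2 * K * (1 - c) ^ k \<and> (AE y in lborel. y \<in> ball x (R * (1/8) ^ k) \<longrightarrow> f y \<in> {m..M})"
    proof (induction k)
      case 0
      have "AE y in lborel. y \<in> ball x R \<longrightarrow> f y \<in> {- K..K}"
        using ae by eventually_elim auto
      then show ?case using K by (intro exI[of _ "- K"] exI[of _ K]) auto
    next
      case (Suc k)
      then obtain m M where mM: "m \<le> M" "M - m \<le> 2 * K * (1 - c) ^ k"
        and ae': "AE y in lborel. y \<in> ball x (R * (1/8) ^ k) \<longrightarrow> f y \<in> {m..M}" by blast
      define \<rho> where "\<rho> = R * (1/8) ^ k"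
      have \<rho>: "0 < \<rho>" "\<rho> \<le> R" using R by (auto simp: \<rho>_def power_le_one)
      have \<rho>U: "ball x \<rho> \<subseteq> U" using R \<rho> by (meson order_trans subset_ball)
      have \<rho>S: "R * (1/8) ^ Suc k = \<rho> / 4 / 2" by (simp add: \<rho>_def)
      show ?case
      proof (cases "m < M")
        case True
        have "elliptic_flux \<Lambda> (ball x (2 * (\<rho> / 4))) {m..M} f g q"
          using fs[unfolded flux_solution_def, THEN conjunct2, THEN conjunct2, rule_format, of x \<rho> "2 * (\<rho> / 4)" "{m..M}"]
            \<rho> \<rho>U ae' True by (auto simp: \<rho>_def[symmetric] is_interval_cc)
        from osc[OF this] obtain m' M' where m': "m' \<le> M'" "M' - m' \<le> (1 - c) * (M - m)"
          "AE y in lborel. y \<in> ball x (\<rho> / 4 / 2) \<longrightarrow> f y \<in> {m'..M'}"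
          using \<rho> True by auto
        have "(1 - c) * (M - m) \<le> (1 - c) * (2 * K * (1 - c) ^ k)"
          using mM c by (intro mult_left_mono) auto
        then have "M' - m' \<le> 2 * K * (1 - c) ^ Suc k" using m'(2) by (simp add: mult_ac)
        with m' show ?thesis unfolding \<rho>S by blast
      next
        case False
        then have "M = m" using mM by simp
        have sub: "ball x (\<rho> / 4 / 2) \<subseteq> ball x \<rho>" using \<rho> by (intro subset_ball) auto
        from ae' have "AE y in lborel. y \<in> ball x (\<rho> / 4 / 2) \<longrightarrow> f y \<in> {m..M}"
          unfolding \<rho>_def[symmetric] by eventually_elim (use sub in blast)
        then show ?thesis unfolding \<rho>S
          using \<open>M = m\<close> K c by (intro exI[of _ m] exI[of _ M]) auto
      qed
    qed
    then show "\<exists>m M. M - m \<le> 2 * K * (1 - c) ^ k \<and> (AE y in lborel. y \<in> ball x (R * (1/8) ^ k) \<longrightarrow> f y \<in> {m..M})"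
      by blast
  qed (use c in auto)
qed

text \<open>Used where only strictly larger bounds are at hand, for instance because
  \<open>sup_bound\<close> asks for \<open>0 < M\<close> while the norm of \<open>f\<close> may
  vanish. Countably many \<open>M'\<close> keep the exceptional set null.\<close>

lemma AE_le_of_AE_less:
  fixes u :: "'a \<Rightarrow> real"
  assumes "\<And>M'. M < M' \<Longrightarrow> AE x in N. P x \<longrightarrow> u x \<le> M'"
  shows "AE x in N. P x \<longrightarrow> u x \<le> M"
proof -
  have "AE x in N. \<forall>j::nat. P x \<longrightarrow> u x \<le> M + 1 / real (Suc j)"
    unfolding AE_all_countable by (intro allI assms) simp
  then show ?thesis
  proof eventually_elim
    case (elim x)
    show ?case
    proof
      assume "P x"
      have "(\<lambda>j. M + 1 / real (Suc j)) \<longlonglongrightarrow> M + 0"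
        by (intro tendsto_intros LIMSEQ_Suc[OF lim_1_over_n])
      then show "u x \<le> M" using elim \<open>P x\<close> by (intro LIMSEQ_le_const) auto
    qed
  qed
qed

text \<open>This is \<open>sup_bound\<close> with radius \<open>\<delta> / 4\<close>, for
  \<open>M\<close> just above the value that turns its smallness hypothesis into an equality, namely
  \<open>a M^2 = X\<close> with \<open>a = \<kappa> (\<delta> / 4)^n\<close>. The ball of radius
  \<open>\<delta> / 2\<close> on which the flux structure is required has room inside the ball of
  radius \<open>\<delta>\<close>.\<close>

lemma sup_estimate:
  fixes \<Lambda> \<delta> :: real
  assumes "0 < \<Lambda>" "0 < \<delta>"
  obtains C where "0 < C"
    "\<And>(U::'a::euclidean_space set) f g q x. \<lbrakk>flux_solution \<Lambda> U f g q; open U; ball x \<delta> \<subseteq> U\<rbrakk> \<Longrightarrow>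
      AE y in lborel. y \<in> ball x (\<delta> / 8) \<longrightarrow> \<bar>f y\<bar> \<le> C * sqrt (\<integral>y. indicator U y * (f y)\<^sup>2 \<partial>lborel)"
proof -
  obtain \<kappa> where \<kappa>: "0 < \<kappa>" and sb:
    "\<And>(x0::'a) R f g q M. \<lbrakk>elliptic_flux \<Lambda> (ball x0 (2 * R)) UNIV f g q; 0 < R; 0 < M;
      (\<integral>x. indicator (ball x0 R) x * (f x)\<^sup>2 \<partial>lborel) \<le> \<kappa> * M\<^sup>2 * R ^ DIM('a)\<rbrakk>
      \<Longrightarrow> AE x in lborel. x \<in> ball x0 (R / 2) \<longrightarrow> \<bar>f x\<bar> \<le> M"
    using sup_bound[OF assms(1), where ?'a='a] by blast
  define a where "a = \<kappa> * (\<delta> / 4) ^ DIM('a)"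
  have a: "0 < a" using \<kappa> assms by (simp add: a_def)
  show ?thesis
  proof (rule that[of "1 / sqrt a"])
    show "0 < 1 / sqrt a" using a by simp
    fix U :: "'a set" and f g q x
    assume fs: "flux_solution \<Lambda> U f g q" and U: "open U" "ball x \<delta> \<subseteq> U"
    have f[measurable]: "f \<in> borel_measurable borel" and int: "integrable lborel (\<lambda>y. indicator U y * (f y)\<^sup>2)"
      using fs unfolding flux_solution_def set_integrable_def by auto
    define X where "X = (\<integral>y. indicator U y * (f y)\<^sup>2 \<partial>lborel)"
    have X: "0 \<le> X" unfolding X_def by (rule Bochner_Integration.integral_nonneg) auto
    have ef: "elliptic_flux \<Lambda> (ball x (2 * (\<delta> / 4))) UNIV f g q"
      using fs[unfolded flux_solution_def, THEN conjunct2, THEN conjunct2, rule_format, of x \<delta> "2 * (\<delta> / 4)" UNIV]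
        U assms by auto
    have "AE y in lborel. y \<in> ball x (\<delta> / 8) \<longrightarrow> \<bar>f y\<bar> \<le> sqrt (X / a)"
    proof (rule AE_le_of_AE_less)
      fix M assume M: "sqrt (X / a) < M"
      have M0: "0 < M" using M X a by (meson divide_nonneg_pos le_less_trans real_sqrt_ge_zero)
      have "X / a \<le> M\<^sup>2"
      proof -
        have "(sqrt (X / a))\<^sup>2 \<le> M\<^sup>2" using M X a by (intro power_mono) auto
        then show ?thesis using X a by simp
      qed
      then have "X \<le> a * M\<^sup>2" using a by (simp add: field_simps)
      moreover have "(\<integral>y. indicator (ball x (\<delta> / 4)) y * (f y)\<^sup>2 \<partial>lborel) \<le> X"
        unfolding X_def
      proof (rule integral_mono'[OF int])
        have "ball x (\<delta> / 4) \<subseteq> U" using subset_ball[of "\<delta> / 4" \<delta> x] U assms by auto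
        then show "indicator (ball x (\<delta> / 4)) y * (f y)\<^sup>2 \<le> indicator U y * (f y)\<^sup>2" for y
          by (auto split: split_indicator)
      qed auto
      ultimately have "(\<integral>y. indicator (ball x (\<delta> / 4)) y * (f y)\<^sup>2 \<partial>lborel) \<le> \<kappa> * M\<^sup>2 * (\<delta> / 4) ^ DIM('a)"
        by (simp add: a_def mult_ac)
      from sb[OF ef _ M0 this] assms show "AE y in lborel. y \<in> ball x (\<delta> / 8) \<longrightarrow> \<bar>f y\<bar> \<le> M" by simp
    qed
    also have "sqrt (X / a) = 1 / sqrt a * sqrt X" by (simp add: real_sqrt_divide)
    finally show "AE y in lborel. y \<in> ball x (\<delta> / 8) \<longrightarrow> \<bar>f y\<bar> \<le> 1 / sqrt a * sqrt (\<integral>y. indicator U y * (f y)\<^sup>2 \<partial>lborel)"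
      unfolding X_def .
  qed
qed

lemma dyadic_scale:
  fixes d R :: real
  assumes "0 < d" "d < R"
  obtains k :: nat where "d < R * (1/8) ^ k" "R * (1/8) ^ k \<le> 8 * d"
proof -
  have "(\<lambda>k. R * (1/8) ^ Suc k) \<longlonglongrightarrow> R * 0"
    by (intro tendsto_intros LIMSEQ_Suc[OF LIMSEQ_realpow_zero]) auto
  then have "\<forall>\<^sub>F k in sequentially. R * (1/8) ^ Suc k < d"
    using assms by (intro order_tendstoD(2)) auto
  then have ex: "\<exists>k. R * (1/8) ^ Suc k \<le> d"
    by (meson eventually_sequentially less_imp_le order_refl)
  define k where "k = (LEAST k. R * (1/8) ^ Suc k \<le> d)"
  have k: "R * (1/8) ^ Suc k \<le> d" unfolding k_def by (rule LeastI_ex[OF ex])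
  have "d < R * (1/8) ^ k"
  proof (cases k)
    case (Suc j)
    then have "\<not> R * (1/8) ^ Suc j \<le> d" unfolding k_def by (intro not_less_Least) simp
    then show ?thesis using Suc by simp
  qed (use assms in simp)
  with k show ?thesis by (intro that[of k]) auto
qed

text \<open>Two points at small distance \<open>d\<close> lie in a ball of radius comparable to
  \<open>d\<close>, reached after a number of rounds logarithmic in \<open>1/d\<close>. A gain of
  \<open>\<sigma>\<close> for each factor 8 in the radius is a power of \<open>d\<close>.\<close>

lemma holder_estimate:
  fixes \<Lambda> :: real
  assumes "0 < \<Lambda>"
  obtains \<alpha> where "0 < \<alpha>" "\<alpha> < 1"
    "\<And>\<delta>. 0 < \<delta> \<Longrightarrow> \<exists>C>0. \<forall>(U::'a::euclidean_space set) f g q h. flux_solution \<Lambda> U f g q \<and> open U \<and> precise_version U f h \<longrightarrow>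
      (\<forall>x y. ball x \<delta> \<subseteq> U \<and> ball y \<delta> \<subseteq> U \<longrightarrow>
        \<bar>h x\<bar> \<le> C * sqrt (\<integral>z. indicator U z * (f z)\<^sup>2 \<partial>lborel) \<and>
        \<bar>h x - h y\<bar> \<le> C * sqrt (\<integral>z. indicator U z * (f z)\<^sup>2 \<partial>lborel) * norm (x - y) powr \<alpha>)"
    "\<And>U f g q h. flux_solution \<Lambda> U f g q \<Longrightarrow> open U \<Longrightarrow> precise_version (U::'a set) f h \<Longrightarrow>
      (AE x in lborel. x \<in> U \<longrightarrow> h x = f x)"
proof -
  obtain \<sigma> where \<sigma>: "0 < \<sigma>" "\<sigma> < 1" and it:
    "\<And>(U::'a set) f g q x R K k. \<lbrakk>flux_solution \<Lambda> U f g q; 0 < R; ball x R \<subseteq> U; 0 \<le> K;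
      AE y in lborel. y \<in> ball x R \<longrightarrow> \<bar>f y\<bar> \<le> K\<rbrakk> \<Longrightarrow>
      \<exists>m M. M - m \<le> 2 * K * \<sigma> ^ k \<and> (AE y in lborel. y \<in> ball x (R * (1/8) ^ k) \<longrightarrow> f y \<in> {m..M})"
    using oscillation_iterate[OF assms, where ?'a='a] by blast
  \<comment> \<open>The number \<open>- ln \<sigma> / ln 8\<close> is the largest exponent with
    \<open>\<sigma> \<le> (1/8) powr \<alpha>\<close>; the minimum with 1/2 keeps
    \<open>\<alpha>\<close> below 1.\<close>
  define \<alpha> where "\<alpha> = min (1/2) (- ln \<sigma> / ln 8)"
  have "ln \<sigma> < 0" using \<sigma> by simp
  then have "0 < - ln \<sigma> / ln 8" by (intro divide_pos_pos) auto
  then have \<alpha>: "0 < \<alpha>" "\<alpha> < 1" unfolding \<alpha>_def by auto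
  have \<sigma>\<alpha>: "\<sigma> \<le> (1/8) powr \<alpha>"
  proof -
    have "ln \<sigma> \<le> \<alpha> * ln (1/8)"
    proof -
      have "\<alpha> * ln 8 \<le> - ln \<sigma> / ln 8 * ln 8" by (intro mult_right_mono) (auto simp: \<alpha>_def)
      then show ?thesis by (simp add: ln_div)
    qed
    then have "exp (ln \<sigma>) \<le> exp (\<alpha> * ln (1/8))" by (simp only: exp_le_cancel_iff)
    moreover have "exp (ln \<sigma>) = \<sigma>" using \<sigma> by simp
    moreover have "exp (\<alpha> * ln (1/8)) = (1/8) powr \<alpha>" by (simp only: powr_def) simp
    ultimately show ?thesis by (simp only:)
  qed
  show ?thesis
  proof (rule that[OF \<alpha>])
    fix \<delta> :: real assume \<delta>: "0 < \<delta>"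
    obtain C where C: "0 < C" and sup:
      "\<And>(U::'a set) f g q x. \<lbrakk>flux_solution \<Lambda> U f g q; open U; ball x \<delta> \<subseteq> U\<rbrakk> \<Longrightarrow>
      AE y in lborel. y \<in> ball x (\<delta> / 8) \<longrightarrow> \<bar>f y\<bar> \<le> C * sqrt (\<integral>y. indicator U y * (f y)\<^sup>2 \<partial>lborel)"
      using sup_estimate[OF assms \<delta>, where ?'a='a] by blast
    \<comment> \<open>For close points \<open>8^-k \<le> 64 d / \<delta>\<close>: one factor 8 from
      the starting radius \<open>\<delta> / 8\<close>, the other from \<open>dyadic_scale\<close>.
      For distant points \<open>64 d / \<delta> \<ge> 1\<close>, and twice the sup bound is
      enough.\<close>
    define D where "D = 2 * C * (64 / \<delta>) powr \<alpha>"
    have D: "0 < D" using C \<delta> by (simp add: D_def)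
    show "\<exists>C>0. \<forall>(U::'a set) f g q h. flux_solution \<Lambda> U f g q \<and> open U \<and> precise_version U f h \<longrightarrow>
      (\<forall>x y. ball x \<delta> \<subseteq> U \<and> ball y \<delta> \<subseteq> U \<longrightarrow>
        \<bar>h x\<bar> \<le> C * sqrt (\<integral>z. indicator U z * (f z)\<^sup>2 \<partial>lborel) \<and>
        \<bar>h x - h y\<bar> \<le> C * sqrt (\<integral>z. indicator U z * (f z)\<^sup>2 \<partial>lborel) * norm (x - y) powr \<alpha>)"
    proof (intro exI[of _ "max C D"] conjI allI impI)
      show "0 < max C D" using C by simp
      fix U :: "'a set" and f g q h x y
      assume A: "flux_solution \<Lambda> U f g q \<and> open U \<and> precise_version U f h"
        and xy: "ball x \<delta> \<subseteq> U \<and> ball y \<delta> \<subseteq> U"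
      define N where "N = sqrt (\<integral>z. indicator U z * (f z)\<^sup>2 \<partial>lborel)"
      have N: "0 \<le> N" unfolding N_def by (auto intro!: Bochner_Integration.integral_nonneg)
      have sub: "ball z (\<delta> / 8) \<subseteq> U" if "ball z \<delta> \<subseteq> U" for z
        using subset_ball[of "\<delta> / 8" \<delta> z] that \<delta> by auto
      have bd: "\<bar>h z\<bar> \<le> C * N" if z: "ball z \<delta> \<subseteq> U" for z
      proof -
        have "AE y in lborel. y \<in> ball z (\<delta> / 8) \<longrightarrow> \<bar>f y\<bar> \<le> C * N"
          unfolding N_def using sup[of U f g q z] A z by auto
        then have "AE y in lborel. y \<in> ball z (\<delta> / 8) \<longrightarrow> f y \<in> {- (C * N)..C * N}"
          by eventually_elim auto
        then have "h z \<in> {- (C * N)..C * N}"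
          using A \<delta> by (intro precise_versionD[of U f h "\<delta> / 8" z] sub[OF z]) auto
        then show ?thesis by auto
      qed
      show "\<bar>h x\<bar> \<le> max C D * sqrt (\<integral>z. indicator U z * (f z)\<^sup>2 \<partial>lborel)"
        using bd[of x] xy N mult_right_mono[of C "max C D" N] unfolding N_def[symmetric] by auto
      have "\<bar>h x - h y\<bar> \<le> D * N * norm (x - y) powr \<alpha>"
      proof -
        define d where "d = norm (x - y)"
        consider "d = 0" | "\<delta> / 8 \<le> d" | "0 < d" "d < \<delta> / 8" unfolding d_def by fastforce
        then show ?thesis
        proof cases
          case 1
          then show ?thesis by (simp add: d_def)
        next
          case 2
          have "1 \<le> (64 / \<delta>) powr \<alpha> * d powr \<alpha>"
          proof -
            have "1 \<le> 64 / \<delta> * d" using 2 \<delta> by (simp add: field_simps)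
            then have "1 \<le> (64 / \<delta> * d) powr \<alpha>" using \<alpha> by (intro ge_one_powr_ge_zero) auto
            also have "(64 / \<delta> * d) powr \<alpha> = (64 / \<delta>) powr \<alpha> * d powr \<alpha>"
              by (rule powr_mult)
            finally show ?thesis .
          qed
          then have "2 * C * N * 1 \<le> 2 * C * N * ((64 / \<delta>) powr \<alpha> * d powr \<alpha>)"
            using C N by (intro mult_left_mono) auto
          then show ?thesis using bd[of x] bd[of y] xy by (simp add: D_def d_def mult_ac)
        next
          case 3
          obtain k where k: "d < \<delta> / 8 * (1/8) ^ k" "\<delta> / 8 * (1/8) ^ k \<le> 8 * d"
            using dyadic_scale[OF 3] by blast
          obtain m M where mM: "M - m \<le> 2 * (C * N) * \<sigma> ^ k"
            "AE y in lborel. y \<in> ball x (\<delta> / 8 * (1/8) ^ k) \<longrightarrow> f y \<in> {m..M}"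
          proof -
            have "AE y in lborel. y \<in> ball x (\<delta> / 8) \<longrightarrow> \<bar>f y\<bar> \<le> C * N"
              unfolding N_def by (rule sup) (use A xy in auto)
            moreover have "0 < \<delta> / 8" "0 \<le> C * N" "ball x (\<delta> / 8) \<subseteq> U" using \<delta> C N sub[of x] xy by auto
            ultimately show ?thesis using that it[of U f g q "\<delta> / 8" x "C * N" k] A by blast
          qed
          have sub2: "ball x (\<delta> / 8 * (1/8) ^ k) \<subseteq> U"
          proof -
            have "\<delta> / 8 * (1/8) ^ k \<le> \<delta> / 8 * 1" using \<delta> by (intro mult_left_mono power_le_one) auto
            then show ?thesis using subset_ball[of "\<delta> / 8 * (1/8) ^ k" "\<delta> / 8" x] sub[of x] xy by auto
          qed
          have pos: "0 < \<delta> / 8 * (1/8) ^ k" using \<delta> by simp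
          have "x \<in> ball x (\<delta> / 8 * (1/8) ^ k)" "y \<in> ball x (\<delta> / 8 * (1/8) ^ k)"
            using pos k(1) by (auto simp: d_def dist_norm)
          then have "h x \<in> {m..M}" "h y \<in> {m..M}"
            using A precise_versionD[OF _ pos sub2 mM(2)] by blast+
          then have "\<bar>h x - h y\<bar> \<le> M - m" by auto
          also note mM(1)
          also have "2 * (C * N) * \<sigma> ^ k \<le> 2 * (C * N) * ((64 / \<delta>) powr \<alpha> * d powr \<alpha>)"
          proof (intro mult_left_mono)
            have "\<sigma> ^ k \<le> ((1/8) powr \<alpha>) ^ k" using \<sigma>\<alpha> \<sigma> by (intro power_mono) auto
            also have "\<dots> = ((1/8) ^ k) powr \<alpha>"
            proof -
              have pos: "0 < (1/8::real) powr \<alpha>" "0 < (1/8::real)" by auto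
              have "((1/8) powr \<alpha>) ^ k = (1/8::real) powr (\<alpha> * real k)"
                unfolding powr_realpow[OF pos(1), symmetric] by (rule powr_powr)
              also have "\<dots> = (1/8::real) powr (real k * \<alpha>)" by (simp only: mult.commute)
              also have "\<dots> = ((1/8) ^ k) powr \<alpha>"
                unfolding powr_realpow[OF pos(2), symmetric] by (rule powr_powr[symmetric])
              finally show ?thesis .
            qed
            also have "\<dots> \<le> (64 / \<delta> * d) powr \<alpha>"
              using k(2) \<delta> \<alpha> by (intro powr_mono2) (auto simp: field_simps)
            also have "\<dots> = (64 / \<delta>) powr \<alpha> * d powr \<alpha>" by (rule powr_mult)
            finally show "\<sigma> ^ k \<le> (64 / \<delta>) powr \<alpha> * d powr \<alpha>" .
          qed (use C N in auto)
          finally show ?thesis by (simp add: D_def d_def mult_ac)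
        qed
      qed
      also have "\<dots> \<le> max C D * N * norm (x - y) powr \<alpha>"
        using N by (intro mult_right_mono) auto
      finally show "\<bar>h x - h y\<bar> \<le> max C D * sqrt (\<integral>z. indicator U z * (f z)\<^sup>2 \<partial>lborel) * norm (x - y) powr \<alpha>"
        unfolding N_def .
    qed
  next
    fix U :: "'a set" and f g q h
    assume fs: "flux_solution \<Lambda> U f g q" and U: "open U" and ph: "precise_version U f h"
    have "AE x in lborel. x \<in> U \<longrightarrow> \<bar>h x - f x\<bar> \<le> e" if e: "0 < e" for e
    proof -
      \<comment> \<open>No differentiation theorem is involved: on a small ball about each point
        both \<open>h\<close> and \<open>f\<close> take values, up to a null set, in one interval
        shorter than \<open>e\<close>, and Lindelof reduces the cover to countably many
        balls.\<close>
      define \<B> where "\<B> = {b. \<exists>x r. 0 < r \<and> b = ball x r \<and> b \<subseteq> U \<and> (AE y in lborel. y \<in> b \<longrightarrow> \<bar>h y - f y\<bar> \<le> e)}"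
      have "U \<subseteq> \<Union>\<B>"
      proof
        fix x assume "x \<in> U"
        then obtain \<delta> where \<delta>: "0 < \<delta>" "ball x \<delta> \<subseteq> U" using U open_contains_ball by blast
        obtain C where "0 < C" and sup:
          "\<And>(U::'a set) f g q x. \<lbrakk>flux_solution \<Lambda> U f g q; open U; ball x \<delta> \<subseteq> U\<rbrakk> \<Longrightarrow>
            AE y in lborel. y \<in> ball x (\<delta> / 8) \<longrightarrow> \<bar>f y\<bar> \<le> C * sqrt (\<integral>y. indicator U y * (f y)\<^sup>2 \<partial>lborel)"
          using sup_estimate[OF assms \<delta>(1), where ?'a='a] by blast
        from sup[OF fs U \<delta>(2)] have K: "AE y in lborel. y \<in> ball x (\<delta> / 8) \<longrightarrow> \<bar>f y\<bar> \<le> max 0 (C * sqrt (\<integral>y. indicator U y * (f y)\<^sup>2 \<partial>lborel))" (is "AE y in _. _ \<longrightarrow> _ \<le> ?K")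
          by eventually_elim auto
        have "(\<lambda>k. 2 * ?K * \<sigma> ^ k) \<longlonglongrightarrow> 2 * ?K * 0"
          using \<sigma> by (intro tendsto_intros LIMSEQ_realpow_zero) auto
        then have "\<forall>\<^sub>F k in sequentially. 2 * ?K * \<sigma> ^ k < e"
          using e by (intro order_tendstoD(2)) auto
        then obtain k where k: "2 * ?K * \<sigma> ^ k < e" by (meson eventually_sequentially order_refl)
        have sub: "ball x (\<delta> / 8) \<subseteq> U" using subset_ball[of "\<delta> / 8" \<delta> x] \<delta> by auto
        obtain m M where mM: "M - m \<le> 2 * ?K * \<sigma> ^ k"
          "AE y in lborel. y \<in> ball x (\<delta> / 8 * (1/8) ^ k) \<longrightarrow> f y \<in> {m..M}"
          using it[OF fs _ sub _ K, of k] \<delta> by auto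
        have sub2: "ball x (\<delta> / 8 * (1/8) ^ k) \<subseteq> U"
        proof -
          have "\<delta> / 8 * (1/8) ^ k \<le> \<delta> / 8 * 1" using \<delta> by (intro mult_left_mono power_le_one) auto
          then show ?thesis using subset_ball[of "\<delta> / 8 * (1/8) ^ k" "\<delta> / 8" x] sub by auto
        qed
        have pos: "0 < \<delta> / 8 * (1/8) ^ k" using \<delta> by simp
        have hin: "\<forall>y\<in>ball x (\<delta> / 8 * (1/8) ^ k). h y \<in> {m..M}"
          using precise_versionD[OF ph pos sub2 mM(2)] by blast
        have "AE y in lborel. y \<in> ball x (\<delta> / 8 * (1/8) ^ k) \<longrightarrow> \<bar>h y - f y\<bar> \<le> e"
          using mM(2)
        proof eventually_elim
          case (elim y)
          show ?case
          proof
            assume y: "y \<in> ball x (\<delta> / 8 * (1/8) ^ k)"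
            then have "f y \<in> {m..M}" "h y \<in> {m..M}" using elim hin by auto
            then show "\<bar>h y - f y\<bar> \<le> e" using mM(1) k by auto
          qed
        qed
        then have "ball x (\<delta> / 8 * (1/8) ^ k) \<in> \<B>" unfolding \<B>_def using pos sub2 by blast
        then show "x \<in> \<Union>\<B>" using pos by (meson UnionI centre_in_ball)
      qed
      obtain \<C> where \<C>: "\<C> \<subseteq> \<B>" "countable \<C>" "\<Union>\<C> = \<Union>\<B>"
        using Lindelof[of \<B>] unfolding \<B>_def by blast
      have "AE x in lborel. \<forall>b\<in>\<C>. x \<in> b \<longrightarrow> \<bar>h x - f x\<bar> \<le> e"
        unfolding AE_ball_countable[OF \<C>(2)] using \<C>(1) unfolding \<B>_def by blast
      then show ?thesis
        by eventually_elim (use \<open>U \<subseteq> \<Union>\<B>\<close> \<C>(3) in blast)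
    qed
    then have "AE x in lborel. x \<in> U \<longrightarrow> \<bar>h x - f x\<bar> \<le> 0" by (rule AE_le_of_AE_less)
    then show "AE x in lborel. x \<in> U \<longrightarrow> h x = f x" by eventually_elim auto
  qed
qed

subsection \<open>Mollification\<close>

text \<open>The polynomial in \<open>1 / t\<close> makes this family of functions, all flat at 0,
  closed under differentiation, so a single derivative rule gives smoothness.\<close>

definition flat :: "real poly \<Rightarrow> real \<Rightarrow> real" where
  "flat p t = (if 0 < t then poly p (1 / t) * exp (- (1 / t)) else 0)"

lemma poly_times_exp_tendsto_0: "((\<lambda>s::real. s ^ k * poly p s * exp (- s)) \<longlongrightarrow> 0) at_top"
proof (induction p arbitrary: k rule: pCons_induct)
  case (pCons a p)
  have "((\<lambda>s::real. a * (s ^ k / exp s) + s ^ Suc k * poly p s * exp (- s)) \<longlongrightarrow> a * 0 + 0) at_top"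
    by (intro tendsto_intros tendsto_power_div_exp_0 pCons.IH)
  then show ?case by (simp add: exp_minus field_simps)
qed simp

lemma flat_tendsto_0: "(flat p \<longlongrightarrow> 0) (at 0)"
proof (rule filterlim_split_at)
  have "(flat p \<longlongrightarrow> 0) (at_left 0) \<longleftrightarrow> ((\<lambda>_. 0::real) \<longlongrightarrow> 0) (at_left (0::real))"
    by (intro tendsto_cong) (auto simp: eventually_at_filter flat_def)
  then show "(flat p \<longlongrightarrow> 0) (at_left 0)" by simp
  have "((\<lambda>t::real. (inverse t) ^ 0 * poly p (inverse t) * exp (- inverse t)) \<longlongrightarrow> 0) (at_right 0)"
    by (rule filterlim_compose[OF poly_times_exp_tendsto_0 filterlim_inverse_at_top_right])
  moreover have "(flat p \<longlongrightarrow> 0) (at_right 0) \<longleftrightarrow>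
    ((\<lambda>t::real. (inverse t) ^ 0 * poly p (inverse t) * exp (- inverse t)) \<longlongrightarrow> 0) (at_right 0)"
    by (intro tendsto_cong) (auto simp: eventually_at_filter flat_def divide_inverse)
  ultimately show "(flat p \<longlongrightarrow> 0) (at_right 0)" by blast
qed

text \<open>With \<open>s = 1 / t\<close>, the derivative of \<open>p(s) exp(-s)\<close> in
  \<open>t\<close> is \<open>s^2 (p(s) - p'(s)) exp(-s)\<close>, whence the factor
  \<open>[:0, 0, 1:]\<close>. At 0 the difference quotient is again a flat function, with
  \<open>p\<close> multiplied by \<open>s\<close>, and tends to 0.\<close>

lemma DERIV_flat: "(flat p has_real_derivative flat ([:0, 0, 1:] * (p - pderiv p)) t) (at t)"
proof -
  consider "t > 0" | "t < 0" | "t = 0" by linarith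
  then show ?thesis
  proof cases
    case 1
    have "((\<lambda>t. poly p (1 / t) * exp (- (1 / t))) has_real_derivative
      flat ([:0, 0, 1:] * (p - pderiv p)) t) (at t)"
      using 1 by (auto intro!: derivative_eq_intros DERIV_chain2[OF poly_DERIV]
          simp: flat_def power2_eq_square field_simps)
    then show ?thesis
      by (rule has_field_derivative_transform_within_open[where S="{0<..}"]) (use 1 in \<open>auto simp: flat_def\<close>)
  next
    case 2
    have "((\<lambda>_::real. 0::real) has_real_derivative 0) (at t)" by simp
    then have "(flat p has_real_derivative 0) (at t)"
      by (rule has_field_derivative_transform_within_open[where S="{..<0}"]) (use 2 in \<open>auto simp: flat_def\<close>)
    then show ?thesis using 2 by (simp add: flat_def)
  next
    case 3
    have "((\<lambda>h. (flat p (0 + h) - flat p 0) / h) \<longlongrightarrow> 0) (at 0) \<longleftrightarrow> (flat (pCons 0 p) \<longlongrightarrow> 0) (at 0)"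
      by (intro tendsto_cong) (auto simp: eventually_at_filter flat_def)
    then have "((\<lambda>h. (flat p (0 + h) - flat p 0) / h) \<longlongrightarrow> 0) (at 0)"
      using flat_tendsto_0 by blast
    then show ?thesis unfolding DERIV_def 3 by (simp add: flat_def)
  qed
qed

section \<open>Gradients in coordinates and smooth bump functions\<close>

lemma partial_deriv_GDERIV:
  fixes \<phi> :: "real^'n \<Rightarrow> real"
  assumes "GDERIV \<phi> x :> D"
  shows "partial_deriv i \<phi> x = D $ i"
proof -
  have "frechet_derivative \<phi> (at x) = (\<lambda>h. h \<bullet> D)"
    using assms unfolding gderiv_def by (metis frechet_derivative_at)
  then show ?thesis unfolding partial_deriv_def by (simp add: inner_axis' )
qed

lemma GDERIV_grad:
  fixes \<phi> :: "real^'n \<Rightarrow> real"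
  assumes "\<phi> differentiable (at x)"
  shows "GDERIV \<phi> x :> grad \<phi> x"
proof -
  let ?f' = "frechet_derivative \<phi> (at x)"
  have d: "(\<phi> has_derivative ?f') (at x)" using assms frechet_derivative_works by blast
  then have lin: "linear ?f'" using has_derivative_linear by blast
  have "?f' h = h \<bullet> grad \<phi> x" for h
  proof -
    have "?f' h = ?f' (\<Sum>i\<in>UNIV. (h $ i) *\<^sub>R axis i 1)"
      using basis_expansion[of h] by (simp add: scalar_mult_eq_scaleR)
    also have "\<dots> = (\<Sum>i\<in>UNIV. h $ i * partial_deriv i \<phi> x)"
      unfolding partial_deriv_def by (simp add: linear_sum[OF lin] linear_scale[OF lin])
    finally show ?thesis by (simp add: inner_vec_def grad_def)
  qed
  then have "?f' = (\<lambda>h. h \<bullet> grad \<phi> x)" by auto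
  then show ?thesis using d unfolding gderiv_def by simp
qed

lemma GDERIV_imp_differentiable:
  assumes "GDERIV \<phi> x :> D"
  shows "\<phi> differentiable (at x)"
  using assms unfolding gderiv_def differentiable_def by blast

lemma continuous_on_grad:
  fixes \<phi> :: "real^'n \<Rightarrow> real"
  assumes "\<And>k. C_k k \<phi>"
  shows "\<And>x. GDERIV \<phi> x :> grad \<phi> x" "continuous_on UNIV (grad \<phi>)" "\<And>i k. C_k k (partial_deriv i \<phi>)"
proof -
  show d: "GDERIV \<phi> x :> grad \<phi> x" for x
    using assms[of 1] GDERIV_grad by (auto simp: differentiable_on_def)
  show "C_k k (partial_deriv i \<phi>)" for i k using assms[of "Suc k"] by simp
  have "continuous_on UNIV (partial_deriv i \<phi>)" for i using assms[of 1] by simp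
  then show "continuous_on UNIV (grad \<phi>)"
    unfolding grad_def[abs_def] by (intro continuous_on_vec_lambda)
qed

text \<open>The span of the products of monomials with functions
  \<open>flat p (r^2 - |x|^2)\<close>. Presented by rules, its closure under partial derivatives is
  an induction, and iteration gives every \<open>C_k\<close>.\<close>

inductive bump_class :: "real \<Rightarrow> (real^'n \<Rightarrow> real) \<Rightarrow> bool" for r where
  base: "bump_class r (\<lambda>x. flat p (r\<^sup>2 - x \<bullet> x))"
| coord: "bump_class r \<phi> \<Longrightarrow> bump_class r (\<lambda>x. x $ i * \<phi> x)"
| add: "bump_class r \<phi> \<Longrightarrow> bump_class r \<psi> \<Longrightarrow> bump_class r (\<lambda>x. \<phi> x + \<psi> x)"
| scale: "bump_class r \<phi> \<Longrightarrow> bump_class r (\<lambda>x. c * \<phi> x)"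

lemma bump_class_GDERIV:
  fixes \<phi> :: "real^'n \<Rightarrow> real"
  assumes "bump_class r \<phi>"
  shows "\<exists>D. (\<forall>x. GDERIV \<phi> x :> D x) \<and> (\<forall>i. bump_class r (\<lambda>x. D x $ i))"
  using assms
proof induction
  case (base p)
  let ?q = "[:0, 0, 1:] * (p - pderiv p)"
  have "GDERIV (\<lambda>x::real^'n. flat p (r\<^sup>2 - x \<bullet> x)) x :> flat ?q (r\<^sup>2 - x \<bullet> x) *\<^sub>R ((-2) *\<^sub>R x)" for x
  proof (rule GDERIV_DERIV_compose[OF _ DERIV_flat])
    show "GDERIV (\<lambda>x. r\<^sup>2 - x \<bullet> x) x :> (-2) *\<^sub>R x"
      unfolding gderiv_def by (auto intro!: derivative_eq_intros ext simp: inner_commute)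
  qed
  moreover have "bump_class r (\<lambda>x::real^'n. (flat ?q (r\<^sup>2 - x \<bullet> x) *\<^sub>R ((-2) *\<^sub>R x)) $ i)" for i
    using bump_class.scale[OF bump_class.coord[OF bump_class.base[of r ?q], of i], of "-2"] by (simp add: mult_ac)
  ultimately show ?case
    by (intro exI[of _ "\<lambda>x. flat ?q (r\<^sup>2 - x \<bullet> x) *\<^sub>R ((-2) *\<^sub>R x)"]) blast
next
  case (coord \<phi> i)
  then obtain D where D: "\<And>x. GDERIV \<phi> x :> D x" "\<And>i. bump_class r (\<lambda>x. D x $ i)" by blast
  have c: "GDERIV (\<lambda>x::real^'n. x $ i) x :> axis i 1" for x
    unfolding gderiv_def using bounded_linear_imp_has_derivative[OF bounded_linear_vec_nth[of i]] by (simp add: inner_axis)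
  have "GDERIV (\<lambda>x. x $ i * \<phi> x) x :> (x $ i) *\<^sub>R D x + \<phi> x *\<^sub>R axis i 1" for x
    by (rule GDERIV_mult[OF c D(1)])
  moreover have "bump_class r (\<lambda>x. ((x $ i) *\<^sub>R D x + \<phi> x *\<^sub>R axis i 1) $ j)" for j
    using bump_class.add[OF bump_class.coord[OF D(2)[of j], of i] bump_class.scale[OF coord.hyps, of "axis i 1 $ j"]]
    by (simp add: mult.commute)
  ultimately show ?case by (intro exI[of _ "\<lambda>x. (x $ i) *\<^sub>R D x + \<phi> x *\<^sub>R axis i 1"]) blast
next
  case (add \<phi> \<psi>)
  then obtain D D' where "\<And>x. GDERIV \<phi> x :> D x" "\<And>i. bump_class r (\<lambda>x. D x $ i)"
    "\<And>x. GDERIV \<psi> x :> D' x" "\<And>i. bump_class r (\<lambda>x. D' x $ i)" by blast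
  then show ?case
    by (intro exI[of _ "\<lambda>x. D x + D' x"]) (auto intro!: GDERIV_add bump_class.add)
next
  case (scale \<phi> c)
  then obtain D where D: "\<And>x. GDERIV \<phi> x :> D x" "\<And>i. bump_class r (\<lambda>x. D x $ i)" by blast
  have "GDERIV (\<lambda>x. c * \<phi> x) x :> c *\<^sub>R D x" for x
    using GDERIV_mult[OF GDERIV_const D(1), of c x] by simp
  then show ?case using D(2) by (intro exI[of _ "\<lambda>x. c *\<^sub>R D x"]) (auto intro!: bump_class.scale)
qed

lemma bump_class_C_k: "bump_class r \<phi> \<Longrightarrow> C_k k \<phi>"
proof (induction k arbitrary: \<phi>)
  case 0
  then obtain D where "\<And>x. GDERIV \<phi> x :> D x" using bump_class_GDERIV by blast
  then show ?case using borel_measurable_GDERIV_on(2)[of UNIV \<phi> D] by simp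
next
  case (Suc k)
  then obtain D where D: "\<And>x. GDERIV \<phi> x :> D x" "\<And>i. bump_class r (\<lambda>x. D x $ i)"
    using bump_class_GDERIV by blast
  have "partial_deriv i \<phi> = (\<lambda>x. D x $ i)" for i
    using partial_deriv_GDERIV[OF D(1)] by auto
  moreover have "\<phi> differentiable_on UNIV"
    using GDERIV_imp_differentiable[OF D(1)] by (auto simp: differentiable_on_def)
  ultimately show ?case using Suc.IH[OF D(2)] by simp
qed

lemma mollifier_exists:
  assumes "0 < r"
  obtains \<eta> :: "real^'n \<Rightarrow> real" where "\<And>k. C_k k \<eta>" "\<And>x. 0 \<le> \<eta> x" "\<And>x. x \<in> ball 0 r \<Longrightarrow> 0 < \<eta> x"
    "\<And>x. x \<notin> ball 0 r \<Longrightarrow> \<eta> x = 0" "integrable lborel \<eta>" "(\<integral>x. \<eta> x \<partial>lborel) = 1"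
proof -
  define \<beta> where "\<beta> x = flat 1 (r\<^sup>2 - x \<bullet> x)" for x :: "real^'n"
  have bc: "bump_class r \<beta>" unfolding \<beta>_def[abs_def] by (rule bump_class.base)
  have cont: "continuous_on UNIV \<beta>" using bump_class_C_k[OF bc, of 0] by simp
  have [measurable]: "\<beta> \<in> borel_measurable borel" using cont by (rule borel_measurable_continuous_onI)
  have nonneg: "0 \<le> \<beta> x" for x by (simp add: \<beta>_def flat_def)
  have in_ball: "x \<in> ball 0 r \<longleftrightarrow> 0 < r\<^sup>2 - x \<bullet> x" for x :: "real^'n"
  proof -
    have "x \<in> ball 0 r \<longleftrightarrow> norm x < r" by simp
    also have "\<dots> \<longleftrightarrow> (norm x)\<^sup>2 < r\<^sup>2" using assms by (auto intro: power_strict_mono power2_less_imp_less)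
    finally show ?thesis by (simp add: power2_norm_eq_inner)
  qed
  have pos: "0 < \<beta> x" if "x \<in> ball 0 r" for x using that unfolding in_ball by (simp add: \<beta>_def flat_def)
  have zero: "\<beta> x = 0" if "x \<notin> ball 0 r" for x using that unfolding in_ball by (simp add: \<beta>_def flat_def)
  have zero': "\<beta> x = 0" if "x \<notin> cball 0 r" for x using that zero[of x] by auto
  have int: "integrable lborel \<beta>"
  proof -
    have "integrable lborel (\<lambda>x. indicator (cball 0 r) x *\<^sub>R \<beta> x)"
      by (rule borel_integrable_compact) (auto intro: continuous_on_subset[OF cont])
    moreover have "(\<lambda>x. indicator (cball 0 r) x *\<^sub>R \<beta> x) = \<beta>"
      using zero' by (auto split: split_indicator)
    ultimately show ?thesis by simp
  qed
  define c where "c = (\<integral>x. \<beta> x \<partial>lborel)"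
  have "c \<noteq> 0"
  proof
    assume "c = 0"
    then have "AE x in lborel. \<beta> x = 0"
      unfolding c_def using integral_nonneg_eq_0_iff_AE[OF int] nonneg by auto
    then have "AE x::real^'n in lborel. x \<in> ball 0 r \<longrightarrow> False"
    proof eventually_elim
      case (elim x)
      then show ?case using pos[of x] by auto
    qed
    then show False using AE_ball_witness[of 0 r "\<lambda>_. False"] assms by auto
  qed
  moreover have "0 \<le> c" unfolding c_def by (rule Bochner_Integration.integral_nonneg) (rule nonneg)
  ultimately have c: "0 < c" by simp
  show ?thesis
  proof (rule that[of "\<lambda>x. 1 / c * \<beta> x"])
    show "C_k k (\<lambda>x. 1 / c * \<beta> x)" for k by (rule bump_class_C_k[OF bump_class.scale[OF bc]])
    show "(\<integral>x. 1 / c * \<beta> x \<partial>lborel) = 1" using c by (simp add: c_def[symmetric])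
    show "integrable lborel (\<lambda>x. 1 / c * \<beta> x)" using int by simp
  qed (use nonneg pos zero c in auto)
qed

section \<open>Convolution\<close>

definition convolution :: "('a::euclidean_space \<Rightarrow> real) \<Rightarrow> ('a \<Rightarrow> 'b::euclidean_space) \<Rightarrow> 'a \<Rightarrow> 'b" where
  "convolution F K x = (\<integral>y. F y *\<^sub>R K (x - y) \<partial>lborel)"

lemma convolution_integrable:
  fixes K :: "'a::euclidean_space \<Rightarrow> 'b::euclidean_space"
  assumes F: "integrable lborel F" and K: "continuous_on UNIV K" "compact S" "\<And>x. x \<notin> S \<Longrightarrow> K x = 0"
  shows "integrable lborel (\<lambda>y. F y *\<^sub>R K (x - y))"
proof -
  obtain c where c: "0 < c" "\<And>x. norm (K x) \<le> c"
    using continuous_compact_support_bounded[OF K(2,3,1)] by blast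
  have [measurable]: "K \<in> borel_measurable borel" using K(1) by (rule borel_measurable_continuous_onI)
  have [measurable]: "F \<in> borel_measurable borel" using F by auto
  show ?thesis
  proof (rule Bochner_Integration.integrable_bound[OF integrable_mult_right[OF integrable_norm[OF F], of c]])
    show "AE y in lborel. norm (F y *\<^sub>R K (x - y)) \<le> norm (c * norm (F y))"
    proof (rule AE_I2)
      fix y
      have "\<bar>F y\<bar> * norm (K (x - y)) \<le> \<bar>F y\<bar> * c" using c by (intro mult_left_mono) auto
      then show "norm (F y *\<^sub>R K (x - y)) \<le> norm (c * norm (F y))" using c by (simp add: abs_mult mult.commute)
    qed
  qed measurable
qed

text \<open>A continuous function with compact support is uniformly continuous on the whole space.
  Here \<open>T\<close> is the closed unit neighbourhood of \<open>S\<close>: two points closer than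
  1 either both lie in \<open>T\<close> or are both outside \<open>S\<close>.\<close>

lemma convolution_uniformly_close:
  fixes K :: "'a::euclidean_space \<Rightarrow> 'b::euclidean_space"
  assumes K: "continuous_on UNIV K" "compact S" "\<And>x. x \<notin> S \<Longrightarrow> K x = 0" and e: "0 < e"
  obtains d where "0 < d" "\<And>x y. dist x y < d \<Longrightarrow> norm (K x - K y) \<le> e"
proof -
  define T where "T = (\<Union>x\<in>S. \<Union>y\<in>cball 0 1. {x + y})"
  have T: "compact T" unfolding T_def using compact_sums'[OF K(2) compact_cball] by simp
  have "uniformly_continuous_on T K"
    by (rule compact_uniformly_continuous[OF continuous_on_subset[OF K(1)] T]) auto
  then obtain d where d: "0 < d" "\<And>x y. x \<in> T \<Longrightarrow> y \<in> T \<Longrightarrow> dist y x < d \<Longrightarrow> dist (K y) (K x) < e"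
    using e unfolding uniformly_continuous_on_def by metis
  show ?thesis
  proof (rule that[of "min d 1"])
    fix x y :: 'a assume xy: "dist x y < min d 1"
    have inT: "a \<in> T" "b \<in> T" if "a \<in> S" "dist a b < 1" for a b
    proof -
      have "a = a + 0" "b = a + (b - a)" by auto
      moreover have "(0::'a) \<in> cball 0 1" "b - a \<in> cball 0 1" using that by (auto simp: dist_norm norm_minus_commute)
      ultimately show "a \<in> T" "b \<in> T" unfolding T_def using that(1) by blast+
    qed
    show "norm (K x - K y) \<le> e"
    proof (cases "x \<in> S \<or> y \<in> S")
      case True
      then have "x \<in> T" "y \<in> T" using inT[of x y] inT[of y x] xy by (auto simp: dist_commute)
      then show ?thesis using d(2)[of y x] xy by (simp add: dist_norm)
    qed (use K(3) e in auto)
  qed (use d in auto)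
qed

lemma convolution_continuous:
  fixes K :: "'a::euclidean_space \<Rightarrow> 'b::euclidean_space"
  assumes F: "integrable lborel F" and K: "continuous_on UNIV K" "compact S" "\<And>x. x \<notin> S \<Longrightarrow> K x = 0"
  shows "continuous_on UNIV (convolution F K)"
  unfolding continuous_on_iff
proof (intro ballI allI impI)
  have i: "integrable lborel (\<lambda>y. F y *\<^sub>R K (x - y))" for x
    using convolution_integrable[OF F K] by blast
  fix x :: 'a and e :: real assume e: "0 < e"
  \<comment> \<open>The summand 1 keeps \<open>A\<close> positive when \<open>F\<close> is zero and
    makes the final inequality strict.\<close>
  define A where "A = (\<integral>y. norm (F y) \<partial>lborel) + 1"
  have A: "0 < A" unfolding A_def by (intro add_nonneg_pos Bochner_Integration.integral_nonneg) auto
  obtain d where d: "0 < d" "\<And>x y. dist x y < d \<Longrightarrow> norm (K x - K y) \<le> e / A"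
    using convolution_uniformly_close[OF K, of "e / A"] e A by auto
  show "\<exists>d>0. \<forall>x'\<in>UNIV. dist x' x < d \<longrightarrow> dist (convolution F K x') (convolution F K x) < e"
  proof (intro exI[of _ d] conjI ballI impI d(1))
    fix x' assume x': "dist x' x < d"
    have "convolution F K x' - convolution F K x = (\<integral>y. F y *\<^sub>R K (x' - y) - F y *\<^sub>R K (x - y) \<partial>lborel)"
      unfolding convolution_def
      by (rule Bochner_Integration.integral_diff[OF i i, symmetric])
    also have "norm \<dots> \<le> (\<integral>y. e / A * norm (F y) \<partial>lborel)"
    proof (rule Bochner_Integration.integral_norm_bound_integral)
      show "integrable lborel (\<lambda>y. F y *\<^sub>R K (x' - y) - F y *\<^sub>R K (x - y))"
        by (intro Bochner_Integration.integrable_diff i)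
      show "norm (F y *\<^sub>R K (x' - y) - F y *\<^sub>R K (x - y)) \<le> e / A * norm (F y)" for y
      proof -
        have "norm (K (x' - y) - K (x - y)) \<le> e / A" using x' by (intro d(2)) (simp add: dist_norm)
        then have "\<bar>F y\<bar> * norm (K (x' - y) - K (x - y)) \<le> \<bar>F y\<bar> * (e / A)" by (intro mult_left_mono) auto
        then show ?thesis by (simp add: mult.commute flip: scaleR_diff_right)
      qed
    qed (use F in auto)
    also have "\<dots> = e / A * (A - 1)" by (simp add: A_def)
    also have "\<dots> < e" using e A by (simp add: field_simps)
    finally show "dist (convolution F K x') (convolution F K x) < e" by (simp add: dist_norm)
  qed
qed

text \<open>Differentiation under the integral: uniform continuity of \<open>D\<close> makes the
  linearisation error of \<open>K\<close> uniform in the base point, so it can be integrated against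
  \<open>F\<close>.\<close>

lemma convolution_GDERIV:
  fixes K :: "'a::euclidean_space \<Rightarrow> real"
  assumes F: "integrable lborel F" and K: "\<And>x. GDERIV K x :> D x" "continuous_on UNIV D" "compact S" "\<And>x. x \<notin> S \<Longrightarrow> K x = 0"
  shows "GDERIV (convolution F K) x :> convolution F D x"
proof -
  have D0: "D x = 0" if "x \<notin> S" for x
    using GDERIV_zero_outside[OF compact_imp_closed[OF K(3)], of K x "D x"] K(1,4) that by blast
  have Kc: "continuous_on UNIV K" using borel_measurable_GDERIV_on(2)[of UNIV K D] K(1) by auto
  have i1: "integrable lborel (\<lambda>y. F y *\<^sub>R K (x - y))" for x
    using convolution_integrable[OF F Kc K(3,4)] by blast
  have i2: "integrable lborel (\<lambda>y. F y *\<^sub>R D (x - y))" for x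
    using convolution_integrable[OF F K(2,3) D0] by blast
  define A where "A = (\<integral>y. norm (F y) \<partial>lborel) + 1"
  have A: "0 < A" unfolding A_def by (intro add_nonneg_pos Bochner_Integration.integral_nonneg) auto
  show ?thesis
    unfolding gderiv_def has_derivative_at_alt
  proof (intro conjI allI impI bounded_linear_inner_left)
    fix e :: real assume e: "0 < e"
    obtain d where d: "0 < d" "\<And>x y. dist x y < d \<Longrightarrow> norm (D x - D y) \<le> e / A"
      using convolution_uniformly_close[OF K(2,3) D0, of "e / A"] e A by auto
    show "\<exists>d>0. \<forall>y. norm (y - x) < d \<longrightarrow> norm (convolution F K y - convolution F K x - (y - x) \<bullet> convolution F D x) \<le> e * norm (y - x)"
    proof (intro exI[of _ d] conjI allI impI d(1))
      fix x' assume x': "norm (x' - x) < d"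
      have lin: "norm (K b - K a - (b - a) \<bullet> D a) \<le> norm (b - a) * (e / A)" if "norm (b - a) < d" for a b
      proof (rule differentiable_bound_linearization[where S="ball a d" and f'="\<lambda>x h. h \<bullet> D x"])
        show "a + t *\<^sub>R (b - a) \<in> ball a d" if "t \<in> {0..1}" for t
        proof -
          have "t * norm (b - a) \<le> 1 * norm (b - a)" using that by (intro mult_right_mono) auto
          then show ?thesis using \<open>norm (b - a) < d\<close> that by (simp add: dist_norm)
        qed
        show "(K has_derivative (\<lambda>h. h \<bullet> D z)) (at z within ball a d)" for z
          using K(1)[of z] unfolding gderiv_def by (rule has_derivative_at_withinI)
        show "onorm ((\<lambda>h. h \<bullet> D z) - (\<lambda>h. h \<bullet> D a)) \<le> e / A" if "z \<in> ball a d" for z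
        proof (rule onorm_le)
          fix h
          have "norm (((\<lambda>h. h \<bullet> D z) - (\<lambda>h. h \<bullet> D a)) h) = \<bar>h \<bullet> (D z - D a)\<bar>" by (simp add: inner_diff_right)
          also have "\<dots> \<le> norm h * norm (D z - D a)" by (rule Cauchy_Schwarz_ineq2)
          also have "\<dots> \<le> norm h * (e / A)" using d(2)[of z a] that by (intro mult_left_mono) (auto simp: dist_commute)
          finally show "norm (((\<lambda>h. h \<bullet> D z) - (\<lambda>h. h \<bullet> D a)) h) \<le> e / A * norm h" by (simp add: mult.commute)
        qed
      qed (use d in auto)
      have "convolution F K x' - convolution F K x - (x' - x) \<bullet> convolution F D x
        = (\<integral>y. F y *\<^sub>R K (x' - y) - F y *\<^sub>R K (x - y) - (x' - x) \<bullet> (F y *\<^sub>R D (x - y)) \<partial>lborel)"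
      proof -
        have eq: "(x' - x) \<bullet> convolution F D x = (\<integral>y. (x' - x) \<bullet> (F y *\<^sub>R D (x - y)) \<partial>lborel)"
          unfolding convolution_def by (rule integral_inner_right[symmetric]) (rule i2)
        have i3: "integrable lborel (\<lambda>y. (x' - x) \<bullet> (F y *\<^sub>R D (x - y)))"
          by (rule integrable_inner_right) (rule i2)
        show ?thesis
          unfolding eq unfolding Bochner_Integration.integral_diff[OF Bochner_Integration.integrable_diff[OF i1 i1] i3]
            Bochner_Integration.integral_diff[OF i1 i1] convolution_def ..
      qed
      also have "norm \<dots> \<le> (\<integral>y. norm (x' - x) * (e / A) * norm (F y) \<partial>lborel)"
      proof (rule Bochner_Integration.integral_norm_bound_integral)
        show "integrable lborel (\<lambda>y. F y *\<^sub>R K (x' - y) - F y *\<^sub>R K (x - y) - (x' - x) \<bullet> (F y *\<^sub>R D (x - y)))"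
          by (intro Bochner_Integration.integrable_diff i1 integrable_inner_right i2)
        show "norm (F y *\<^sub>R K (x' - y) - F y *\<^sub>R K (x - y) - (x' - x) \<bullet> (F y *\<^sub>R D (x - y))) \<le> norm (x' - x) * (e / A) * norm (F y)" for y
        proof -
          have "norm (K (x' - y) - K (x - y) - (x' - x) \<bullet> D (x - y)) \<le> norm (x' - x) * (e / A)"
            using lin[of "x' - y" "x - y"] x' by simp
          then have "\<bar>F y\<bar> * norm (K (x' - y) - K (x - y) - (x' - x) \<bullet> D (x - y)) \<le> \<bar>F y\<bar> * (norm (x' - x) * (e / A))"
            by (intro mult_left_mono) auto
          then show ?thesis by (simp add: abs_mult[symmetric] algebra_simps)
        qed
      qed (use F in auto)
      also have "\<dots> = norm (x' - x) * (e / A * (A - 1))" by (simp add: A_def)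
      also have "\<dots> \<le> norm (x' - x) * e" using e A by (intro mult_left_mono) (auto simp: field_simps)
      finally show "norm (convolution F K x' - convolution F K x - (x' - x) \<bullet> convolution F D x) \<le> e * norm (x' - x)"
        by (simp add: mult.commute)
    qed
  qed
qed

lemma convolution_C_k:
  fixes K :: "real^'n \<Rightarrow> real"
  assumes F: "integrable lborel F" and S: "compact S"
  shows "(\<And>k. C_k k K) \<Longrightarrow> (\<And>x. x \<notin> S \<Longrightarrow> K x = 0) \<Longrightarrow> C_k k (convolution F K)"
proof (induction k arbitrary: K)
  case 0
  have "continuous_on UNIV K" using 0(1)[of 0] by simp
  then show ?case using convolution_continuous[OF F _ S 0(2)] by simp
next
  case (Suc k)
  note g = continuous_on_grad[OF Suc.prems(1)]
  have g0: "grad K x = 0" if "x \<notin> S" for x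
    using GDERIV_zero_outside[OF compact_imp_closed[OF S], of K x "grad K x"] g(1) Suc.prems(2) that by blast
  have gd: "GDERIV (convolution F K) x :> convolution F (grad K) x" for x
    by (rule convolution_GDERIV[OF F g(1,2) S Suc.prems(2)])
  have "partial_deriv i (convolution F K) = convolution F (partial_deriv i K)" for i
  proof
    fix x
    have "partial_deriv i (convolution F K) x = convolution F (grad K) x $ i"
      by (rule partial_deriv_GDERIV[OF gd])
    also have "\<dots> = (\<integral>y. (F y *\<^sub>R grad K (x - y)) \<bullet> axis i 1 \<partial>lborel)"
      unfolding convolution_def
      by (subst integral_inner_left) (auto intro!: convolution_integrable[OF F g(2) S g0] simp: inner_axis)
    also have "\<dots> = convolution F (partial_deriv i K) x"
      unfolding convolution_def by (simp add: inner_axis grad_def)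
    finally show "partial_deriv i (convolution F K) x = convolution F (partial_deriv i K) x" .
  qed
  moreover have "C_k k (convolution F (partial_deriv i K))" for i
  proof (rule Suc.IH[OF g(3)])
    show "partial_deriv i K x = 0" if "x \<notin> S" for x
      using g0[OF that] by (metis grad_def vec_lambda_beta zero_index)
  qed
  ultimately show ?case
    using GDERIV_imp_differentiable[OF gd] by (auto simp: differentiable_on_def)
qed

text \<open>The factor \<open>c\<close> serves the induction: each derivative of a reflected
  function changes the sign.\<close>

lemma C_k_reflect:
  fixes K :: "real^'n \<Rightarrow> real"
  shows "(\<And>k. C_k k K) \<Longrightarrow> C_k k (\<lambda>y. c * K (x - y))"
    and "(\<And>k. C_k k K) \<Longrightarrow> partial_deriv i (\<lambda>y. K (x - y)) y = - partial_deriv i K (x - y)"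
proof -
  have gd: "GDERIV (\<lambda>y. c * K (x - y)) y :> (- c) *\<^sub>R grad K (x - y)" if "\<And>k. C_k k K" for c and K :: "real^'n \<Rightarrow> real" and y
  proof -
    have "(K has_derivative (\<lambda>h. h \<bullet> grad K (x - y))) (at (x - y))"
      using continuous_on_grad(1)[OF that] unfolding gderiv_def by blast
    then have "((\<lambda>y. K (x - y)) has_derivative (\<lambda>h. (- h) \<bullet> grad K (x - y))) (at y)"
      by (rule has_derivative_compose[rotated]) (auto intro!: derivative_eq_intros)
    then show ?thesis unfolding gderiv_def by (auto intro!: derivative_eq_intros)
  qed
  show "C_k k (\<lambda>y. c * K (x - y))" if "\<And>k. C_k k K" using that
  proof (induction k arbitrary: K c)
    case 0
    have "continuous_on UNIV K" using 0[of 0] by simp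
    then show ?case by (auto intro!: continuous_intros continuous_on_compose2[of UNIV K])
  next
    case (Suc k)
    have "partial_deriv i (\<lambda>y. c * K (x - y)) = (\<lambda>y. (- c) * partial_deriv i K (x - y))" for i
      using partial_deriv_GDERIV[OF gd[OF Suc.prems]] by (auto simp: grad_def)
    then show ?case
      using Suc.IH[OF continuous_on_grad(3)[OF Suc.prems], of "- c"] GDERIV_imp_differentiable[OF gd[OF Suc.prems]]
      by (simp add: differentiable_on_def)
  qed
  show "partial_deriv i (\<lambda>y. K (x - y)) y = - partial_deriv i K (x - y)" if "\<And>k. C_k k K"
    using partial_deriv_GDERIV[OF gd[OF that, of 1]] by (simp add: grad_def)
qed

section \<open>Continuous approximation and continuity of translations in L2\<close>

lemma continuous_approximation_AE:
  fixes F :: "'a::euclidean_space \<Rightarrow> real"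
  assumes "F \<in> borel_measurable borel"
  obtains G where "\<And>n::nat. continuous_on UNIV (G n)" "AE x in lborel. (\<lambda>n. G n x) \<longlonglongrightarrow> F x"
proof -
  have "F \<in> borel_measurable lebesgue" using assms by (simp add: measurable_completion)
  then have "F measurable_on UNIV" by (rule lebesgue_measurable_imp_measurable_on_real) simp
  then obtain N G where N: "negligible N" and G: "\<And>n::nat. continuous_on UNIV (G n)"
    "\<And>x. x \<notin> N \<Longrightarrow> (\<lambda>n. G n x) \<longlonglongrightarrow> F x"
    unfolding measurable_on_def by auto
  have "AE x in lebesgue. x \<notin> N"
    using N unfolding negligible_iff_null_sets by (rule AE_not_in)
  then have "AE x in lborel. x \<notin> N" by (simp only: AE_completion_iff)
  then have "AE x in lborel. (\<lambda>n. G n x) \<longlonglongrightarrow> F x" by eventually_elim (rule G(2))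
  with G(1) show ?thesis by (rule that)
qed

definition clamp_real :: "real \<Rightarrow> real \<Rightarrow> real" where "clamp_real M t = max (- M) (min M t)"

lemma clamp_real_measurable [measurable]: "clamp_real M \<in> borel_measurable borel"
  unfolding clamp_real_def[abs_def] by measurable

lemma continuous_clamp_real: "continuous_on UNIV (clamp_real M)"
  unfolding clamp_real_def[abs_def] by (intro continuous_intros)

lemma clamp_real_bounds:
  assumes "0 \<le> M"
  shows "\<bar>clamp_real M t\<bar> \<le> M" "\<bar>t - clamp_real M t\<bar> \<le> \<bar>t\<bar>" "\<bar>t\<bar> \<le> M \<Longrightarrow> clamp_real M t = t" "clamp_real M 0 = 0"
  using assms by (auto simp: clamp_real_def)

lemma continuous_cutoff:
  fixes x0 :: "'a::euclidean_space"
  assumes d: "0 < d"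
  obtains \<xi> :: "'a \<Rightarrow> real" where "continuous_on UNIV \<xi>" "\<And>x. 0 \<le> \<xi> x" "\<And>x. \<xi> x \<le> 1" "\<And>x. x \<in> cball x0 R \<Longrightarrow> \<xi> x = 1"
    "\<And>x. x \<notin> cball x0 (R + d) \<Longrightarrow> \<xi> x = 0"
proof (rule that[of "\<lambda>x. max 0 (min 1 ((R + d - dist x0 x) / d))"])
  show "continuous_on UNIV (\<lambda>x. max 0 (min 1 ((R + d - dist x0 x) / d)))"
    using d by (intro continuous_intros) auto
qed (use d in \<open>auto simp: max_def min_def field_simps\<close>)

text \<open>Clamping \<open>F\<close> at a height \<open>N\<close> costs less than
  \<open>e / 4\<close>. Continuous functions converging to \<open>F\<close> almost everywhere are
  clamped at the same height and cut off; they are then bounded on a fixed ball, and dominated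
  convergence costs another \<open>e / 4\<close>. The inequality
  \<open>(p + q)^2 \<le> 2 p^2 + 2 q^2\<close> adds this up to \<open>e\<close>.\<close>

lemma L2_approximation:
  fixes F :: "'a::euclidean_space \<Rightarrow> real"
  assumes F[measurable]: "F \<in> borel_measurable borel" and F2: "integrable lborel (\<lambda>x. (F x)\<^sup>2)"
    and supp: "\<And>x. x \<notin> cball x0 R \<Longrightarrow> F x = 0" and e: "0 < e"
  obtains \<phi> where "continuous_on UNIV \<phi>" "\<And>x. x \<notin> cball x0 (R + 1) \<Longrightarrow> \<phi> x = 0"
    "(\<integral>\<^sup>+x. ennreal ((F x - \<phi> x)\<^sup>2) \<partial>lborel) \<le> ennreal e"
proof -
  have "(\<lambda>n. \<integral>x. (F x - clamp_real (real n) (F x))\<^sup>2 \<partial>lborel) \<longlonglongrightarrow> (\<integral>x. 0 \<partial>(lborel :: 'a measure))"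
  proof (rule integral_dominated_convergence[OF _ _ F2])
    show "AE x in lborel. (\<lambda>n. (F x - clamp_real (real n) (F x))\<^sup>2) \<longlonglongrightarrow> 0"
    proof (rule AE_I2)
      fix x
      obtain N :: nat where N: "\<bar>F x\<bar> \<le> real N" using real_arch_simple by blast
      have "\<forall>\<^sub>F n in sequentially. (F x - clamp_real (real n) (F x))\<^sup>2 = 0"
        using eventually_ge_at_top[of N]
      proof eventually_elim
        case (elim n)
        then have "\<bar>F x\<bar> \<le> real n" using N by linarith
        then show ?case using clamp_real_bounds(3)[of "real n" "F x"] by simp
      qed
      then show "(\<lambda>n. (F x - clamp_real (real n) (F x))\<^sup>2) \<longlonglongrightarrow> 0" by (rule tendsto_eventually)
    qed
    show "AE x in lborel. norm ((F x - clamp_real (real n) (F x))\<^sup>2) \<le> (F x)\<^sup>2" for n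
    proof (rule AE_I2)
      fix x
      have "\<bar>F x - clamp_real (real n) (F x)\<bar>\<^sup>2 \<le> \<bar>F x\<bar>\<^sup>2"
        using clamp_real_bounds(2)[of "real n" "F x"] by (intro power_mono) auto
      then show "norm ((F x - clamp_real (real n) (F x))\<^sup>2) \<le> (F x)\<^sup>2" by simp
    qed
  qed measurable
  then have "\<forall>\<^sub>F n in sequentially. (\<integral>x. (F x - clamp_real (real n) (F x))\<^sup>2 \<partial>lborel) < e / 4"
    using e by (intro order_tendstoD(2)) auto
  then obtain N :: nat where N: "(\<integral>x. (F x - clamp_real (real N) (F x))\<^sup>2 \<partial>lborel) < e / 4"
    by (meson eventually_sequentially order_refl)
  define H where "H x = clamp_real (real N) (F x)" for x
  have [measurable]: "H \<in> borel_measurable borel" unfolding H_def[abs_def] by measurable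
  have FH: "integrable lborel (\<lambda>x. (F x - H x)\<^sup>2)"
  proof (rule Bochner_Integration.integrable_bound[OF F2])
    show "AE x in lborel. norm ((F x - H x)\<^sup>2) \<le> norm ((F x)\<^sup>2)"
    proof (rule AE_I2)
      fix x
      have "\<bar>F x - H x\<bar>\<^sup>2 \<le> \<bar>F x\<bar>\<^sup>2"
        unfolding H_def using clamp_real_bounds(2)[of "real N" "F x"] by (intro power_mono) auto
      then show "norm ((F x - H x)\<^sup>2) \<le> norm ((F x)\<^sup>2)" by simp
    qed
  qed measurable
  obtain G where G: "\<And>n::nat. continuous_on UNIV (G n)" "AE x in lborel. (\<lambda>n. G n x) \<longlonglongrightarrow> F x"
    using continuous_approximation_AE[OF F] by blast
  have [measurable]: "G n \<in> borel_measurable borel" for n using G(1) by (rule borel_measurable_continuous_onI)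
  obtain \<xi> :: "'a \<Rightarrow> real" where \<xi>: "continuous_on UNIV \<xi>" "\<And>x. 0 \<le> \<xi> x" "\<And>x. \<xi> x \<le> 1" "\<And>x. x \<in> cball x0 R \<Longrightarrow> \<xi> x = 1"
    "\<And>x. x \<notin> cball x0 (R + 1) \<Longrightarrow> \<xi> x = 0"
    using continuous_cutoff[of 1 x0 R] by auto
  have [measurable]: "\<xi> \<in> borel_measurable borel" using \<xi>(1) by (rule borel_measurable_continuous_onI)
  define \<phi> where "\<phi> n x = \<xi> x * clamp_real (real N) (G n x)" for n x
  have \<phi>c: "continuous_on UNIV (\<phi> n)" for n
    unfolding \<phi>_def[abs_def] using continuous_on_compose2[OF continuous_clamp_real G(1)] by (intro continuous_intros \<xi>(1)) auto
  have [measurable]: "\<phi> n \<in> borel_measurable borel" for n using \<phi>c by (rule borel_measurable_continuous_onI)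
  have \<phi>0: "\<phi> n x = 0" if "x \<notin> cball x0 (R + 1)" for n x using \<xi>(5)[OF that] by (simp add: \<phi>_def)
  \<comment> \<open>The support of \<open>F\<close> lies where the cutoff is 1, so cutting off does
    not change the limit.\<close>
  have \<xi>H: "\<xi> x * H x = H x" for x
    using \<xi>(4)[of x] supp[of x] clamp_real_bounds(4)[of "real N"] by (cases "x \<in> cball x0 R") (auto simp: H_def)
  have dom: "integrable lborel (\<lambda>x::'a. (2 * real N)\<^sup>2 * indicator (cball x0 (R + 1)) x)"
    by (intro integrable_mult_right integrable_real_indicator emeasure_bounded_finite bounded_cball) simp
  have lim: "AE x in lborel. (\<lambda>n. (H x - \<phi> n x)\<^sup>2) \<longlonglongrightarrow> 0"
    using G(2)
  proof eventually_elim
    case (elim x)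
    have "isCont (clamp_real (real N)) (F x)"
      using continuous_clamp_real[of "real N"] by (simp add: continuous_on_eq_continuous_at)
    then have "(\<lambda>n. clamp_real (real N) (G n x)) \<longlonglongrightarrow> H x"
      unfolding H_def using elim by (rule isCont_tendsto_compose)
    then have "(\<lambda>n. (H x - \<phi> n x)\<^sup>2) \<longlonglongrightarrow> (H x - \<xi> x * H x)\<^sup>2"
      unfolding \<phi>_def by (intro tendsto_intros)
    then show ?case by (simp add: \<xi>H)
  qed
  have bd: "AE x in lborel. norm ((H x - \<phi> n x)\<^sup>2) \<le> (2 * real N)\<^sup>2 * indicator (cball x0 (R + 1)) x" for n
  proof (rule AE_I2)
    fix x
    show "norm ((H x - \<phi> n x)\<^sup>2) \<le> (2 * real N)\<^sup>2 * indicator (cball x0 (R + 1)) x"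
    proof (cases "x \<in> cball x0 (R + 1)")
      case True
      have "\<bar>H x\<bar> \<le> real N" unfolding H_def by (rule clamp_real_bounds) simp
      moreover have "\<bar>\<phi> n x\<bar> \<le> 1 * real N"
        unfolding \<phi>_def abs_mult using \<xi>(2,3)[of x] clamp_real_bounds(1)[of "real N"] by (intro mult_mono) auto
      ultimately have "\<bar>H x - \<phi> n x\<bar> \<le> 2 * real N" by linarith
      then have "\<bar>H x - \<phi> n x\<bar>\<^sup>2 \<le> (2 * real N)\<^sup>2" by (intro power_mono) auto
      then show ?thesis using True by simp
    next
      case False
      moreover have "H x = 0" using \<xi>H[of x] \<xi>(5)[OF False] by simp
      ultimately show ?thesis using \<phi>0[OF False] by simp
    qed
  qed
  have "(\<lambda>n. \<integral>x. (H x - \<phi> n x)\<^sup>2 \<partial>lborel) \<longlonglongrightarrow> (\<integral>x. 0 \<partial>(lborel :: 'a measure))"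
    by (rule integral_dominated_convergence[OF _ _ dom lim bd]) measurable
  then have "\<forall>\<^sub>F n in sequentially. (\<integral>x. (H x - \<phi> n x)\<^sup>2 \<partial>lborel) < e / 4"
    using e by (intro order_tendstoD(2)) auto
  then obtain n where n: "(\<integral>x. (H x - \<phi> n x)\<^sup>2 \<partial>lborel) < e / 4"
    by (meson eventually_sequentially order_refl)
  have H\<phi>: "integrable lborel (\<lambda>x. (H x - \<phi> n x)\<^sup>2)"
  proof (rule Bochner_Integration.integrable_bound[OF dom])
    show "AE x in lborel. norm ((H x - \<phi> n x)\<^sup>2) \<le> norm ((2 * real N)\<^sup>2 * indicator (cball x0 (R + 1)) x :: real)"
      using bd[of n] by eventually_elim auto
  qed measurable
  have "(\<integral>\<^sup>+x. ennreal ((F x - \<phi> n x)\<^sup>2) \<partial>lborel) \<le> (\<integral>\<^sup>+x. ennreal (2 * (F x - H x)\<^sup>2 + 2 * (H x - \<phi> n x)\<^sup>2) \<partial>lborel)"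
  proof (intro nn_integral_mono ennreal_leI)
    fix x
    have "(F x - \<phi> n x)\<^sup>2 = ((F x - H x) + (H x - \<phi> n x))\<^sup>2" by simp
    also have "\<dots> \<le> 2 * (F x - H x)\<^sup>2 + 2 * (H x - \<phi> n x)\<^sup>2"
      using sum_squares_bound[of "F x - H x" "H x - \<phi> n x"] unfolding power2_sum by linarith
    finally show "(F x - \<phi> n x)\<^sup>2 \<le> 2 * (F x - H x)\<^sup>2 + 2 * (H x - \<phi> n x)\<^sup>2" .
  qed
  also have "\<dots> = ennreal (\<integral>x. 2 * (F x - H x)\<^sup>2 + 2 * (H x - \<phi> n x)\<^sup>2 \<partial>lborel)"
    using FH H\<phi> by (intro nn_integral_eq_integral) auto
  also have "\<dots> \<le> ennreal e"
    using N n FH H\<phi> e by (intro ennreal_leI) (simp add: H_def[symmetric])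
  finally show ?thesis using that[OF \<phi>c \<phi>0] by blast
qed

text \<open>Comparison through a continuous \<open>\<phi>\<close> of compact support, for which
  translation is uniformly continuous; the two errors \<open>F - \<phi>\<close>, shifted and not,
  have the same norm.\<close>

lemma L2_translation_continuous:
  fixes F :: "'a::euclidean_space \<Rightarrow> real"
  assumes F[measurable]: "F \<in> borel_measurable borel" and F2: "integrable lborel (\<lambda>x. (F x)\<^sup>2)"
    and supp: "\<And>x. x \<notin> cball x0 R \<Longrightarrow> F x = 0" and e: "0 < e"
  obtains d where "0 < d" "\<And>z. norm z < d \<Longrightarrow> (\<integral>\<^sup>+x. ennreal ((F (x - z) - F x)\<^sup>2) \<partial>lborel) \<le> ennreal e"
proof -
  obtain \<phi> where \<phi>: "continuous_on UNIV \<phi>" "\<And>x. x \<notin> cball x0 (R + 1) \<Longrightarrow> \<phi> x = 0"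
    and close: "(\<integral>\<^sup>+x. ennreal ((F x - \<phi> x)\<^sup>2) \<partial>lborel) \<le> ennreal (e / 12)"
    using L2_approximation[OF F F2 supp, where e="e / 12"] e by auto
  have [measurable]: "\<phi> \<in> borel_measurable borel" using \<phi>(1) by (rule borel_measurable_continuous_onI)
  define S where "S = cball x0 (R + 2)"
  define V where "V = measure lborel S + 1"
  have V: "0 < V" unfolding V_def by (simp add: add_nonneg_pos)
  have eS: "emeasure lborel S = ennreal (measure lborel S)"
    unfolding S_def using emeasure_bounded_finite[OF bounded_cball, of x0 "R + 2"]
    by (intro emeasure_eq_ennreal_measure) (auto simp: less_top)
  have Sm[measurable]: "S \<in> sets borel" unfolding S_def by simp
  \<comment> \<open>The budget: \<open>3 * e / 12\<close> twice for the approximation errors and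
    \<open>3 a^2 V = e / 2\<close> for the modulus of continuity of \<open>\<phi>\<close>,
    integrated over a ball that contains the support of \<open>\<phi>\<close> and of its shifts by
    less than 1.\<close>
  define a where "a = sqrt (e / (6 * V))"
  have a: "0 < a" "a\<^sup>2 = e / (6 * V)" using e V by (auto simp: a_def)
  obtain d where d: "0 < d" "\<And>x y. dist x y < d \<Longrightarrow> norm (\<phi> x - \<phi> y) \<le> a"
    using convolution_uniformly_close[OF \<phi>(1) compact_cball \<phi>(2) a(1)] by blast
  show ?thesis
  proof (rule that[of "min d 1"])
    fix z :: 'a assume z: "norm z < min d 1"
    have pw: "ennreal ((F (x - z) - F x)\<^sup>2) \<le> 3 * ennreal ((F (x + - z) - \<phi> (x + - z))\<^sup>2) + 3 * ennreal ((F x - \<phi> x)\<^sup>2) + ennreal (3 * a\<^sup>2) * indicator S x" for x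
    proof -
      have \<phi>z: "(\<phi> (x - z) - \<phi> x)\<^sup>2 \<le> a\<^sup>2 * indicator S x"
      proof (cases "x \<in> S")
        case True
        have "\<bar>\<phi> (x - z) - \<phi> x\<bar> \<le> a" using d(2)[of "x - z" x] z by (simp add: dist_norm)
        then have "\<bar>\<phi> (x - z) - \<phi> x\<bar>\<^sup>2 \<le> a\<^sup>2" by (intro power_mono) auto
        then show ?thesis using True by simp
      next
        case False
        then have "R + 2 < dist x0 x" by (simp add: S_def)
        moreover have "dist x0 x \<le> dist x0 (x - z) + norm z"
          by (metis add.commute diff_add_cancel dist_norm dist_triangle norm_minus_commute add_diff_cancel_left')
        ultimately have "R + 1 < dist x0 (x - z)" "R + 1 < dist x0 x" using z by auto
        then show ?thesis using \<phi>(2)[of x] \<phi>(2)[of "x - z"] False by simp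
      qed
      have "(F (x - z) - F x)\<^sup>2 = ((F (x - z) - \<phi> (x - z)) + (\<phi> (x - z) - \<phi> x) + (\<phi> x - F x))\<^sup>2" by simp
      also have "\<dots> \<le> 3 * (F (x - z) - \<phi> (x - z))\<^sup>2 + 3 * (\<phi> (x - z) - \<phi> x)\<^sup>2 + 3 * (\<phi> x - F x)\<^sup>2"
      proof -
        have "(p + q + s)\<^sup>2 \<le> 3 * p\<^sup>2 + 3 * q\<^sup>2 + 3 * s\<^sup>2" for p q s :: real
          using zero_le_power2[of "p - q"] zero_le_power2[of "q - s"] zero_le_power2[of "p - s"]
          by (simp add: power2_eq_square algebra_simps)
        then show ?thesis .
      qed
      also have "\<dots> \<le> 3 * (F (x + - z) - \<phi> (x + - z))\<^sup>2 + 3 * (F x - \<phi> x)\<^sup>2 + 3 * a\<^sup>2 * indicator S x"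
        using \<phi>z by (simp add: power2_commute[of "\<phi> x"])
      finally have "ennreal ((F (x - z) - F x)\<^sup>2) \<le> ennreal (3 * (F (x + - z) - \<phi> (x + - z))\<^sup>2 + 3 * (F x - \<phi> x)\<^sup>2 + 3 * a\<^sup>2 * indicator S x)"
        by (rule ennreal_leI)
      also have "\<dots> = 3 * ennreal ((F (x + - z) - \<phi> (x + - z))\<^sup>2) + 3 * ennreal ((F x - \<phi> x)\<^sup>2) + ennreal (3 * a\<^sup>2) * indicator S x"
        by (simp add: ennreal_mult' split: split_indicator)
      finally show ?thesis .
    qed
    have "(\<integral>\<^sup>+x. ennreal ((F (x - z) - F x)\<^sup>2) \<partial>lborel)
      \<le> (\<integral>\<^sup>+x. 3 * ennreal ((F (x + - z) - \<phi> (x + - z))\<^sup>2) + 3 * ennreal ((F x - \<phi> x)\<^sup>2) + ennreal (3 * a\<^sup>2) * indicator S x \<partial>lborel)"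
      by (rule nn_integral_mono) (rule pw)
    also have "\<dots> = 3 * (\<integral>\<^sup>+x. ennreal ((F (x + - z) - \<phi> (x + - z))\<^sup>2) \<partial>lborel) + 3 * (\<integral>\<^sup>+x. ennreal ((F x - \<phi> x)\<^sup>2) \<partial>lborel) + ennreal (3 * a\<^sup>2) * emeasure lborel S"
      by (simp add: nn_integral_add nn_integral_cmult)
    also have "(\<integral>\<^sup>+x. ennreal ((F (x + - z) - \<phi> (x + - z))\<^sup>2) \<partial>lborel) = (\<integral>\<^sup>+x. ennreal ((F x - \<phi> x)\<^sup>2) \<partial>lborel)"
      by (rule nn_integral_lborel_translate[where f="\<lambda>x. ennreal ((F x - \<phi> x)\<^sup>2)"]) measurable
    also have "3 * (\<integral>\<^sup>+x. ennreal ((F x - \<phi> x)\<^sup>2) \<partial>lborel) + 3 * (\<integral>\<^sup>+x. ennreal ((F x - \<phi> x)\<^sup>2) \<partial>lborel) + ennreal (3 * a\<^sup>2) * emeasure lborel S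
      \<le> 3 * ennreal (e / 12) + 3 * ennreal (e / 12) + ennreal (3 * a\<^sup>2) * ennreal (measure lborel S)"
      unfolding eS using close by (intro add_mono mult_left_mono) auto
    also have "\<dots> = ennreal (3 * (e / 12) + 3 * (e / 12) + 3 * a\<^sup>2 * measure lborel S)"
      using e by (simp add: ennreal_mult'[symmetric] ennreal_plus[symmetric] flip: ennreal_numeral del: ennreal_plus)
    also have "\<dots> \<le> ennreal e"
    proof (rule ennreal_leI)
      have "3 * a\<^sup>2 * measure lborel S \<le> 3 * a\<^sup>2 * V" by (intro mult_left_mono) (auto simp: V_def)
      also have "\<dots> = e / 2" using a(2) V by simp
      finally show "3 * (e / 12) + 3 * (e / 12) + 3 * a\<^sup>2 * measure lborel S \<le> e" by simp
    qed
    finally show "(\<integral>\<^sup>+x. ennreal ((F (x - z) - F x)\<^sup>2) \<partial>lborel) \<le> ennreal e" .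
  qed (use d in auto)
qed

section \<open>Mollifiers and approximation in the strong sense\<close>

lemma diff_mem_ball_0:
  fixes x y :: "'a::real_normed_vector"
  shows "x - y \<in> ball 0 r \<longleftrightarrow> y \<in> ball x r" "x - y \<in> cball 0 r \<longleftrightarrow> y \<in> cball x r"
  by (simp_all only: mem_ball mem_cball dist_0_norm) (simp_all add: dist_norm)

text \<open>Strict positivity on the ball is part of the definition because it keeps averages inside
  an interval that need not be closed.\<close>

definition mollifier :: "real \<Rightarrow> (real^'n \<Rightarrow> real) \<Rightarrow> bool" where
  "mollifier r \<eta> \<longleftrightarrow> (\<forall>k. C_k k \<eta>) \<and> (\<forall>x. 0 \<le> \<eta> x) \<and> (\<forall>x\<in>ball 0 r. 0 < \<eta> x) \<and>
    (\<forall>x. x \<notin> ball 0 r \<longrightarrow> \<eta> x = 0) \<and> integrable lborel \<eta> \<and> (\<integral>x. \<eta> x \<partial>lborel) = 1"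

lemma mollifier_ex: "0 < r \<Longrightarrow> \<exists>\<eta> :: real^'n \<Rightarrow> real. mollifier r \<eta>"
  using mollifier_exists[of r] unfolding mollifier_def by metis

lemma mollifierD:
  fixes \<eta> :: "real^'n \<Rightarrow> real"
  assumes "mollifier r \<eta>"
  shows "C_k k \<eta>" "0 \<le> \<eta> x" "x \<in> ball 0 r \<Longrightarrow> 0 < \<eta> x" "x \<notin> ball 0 r \<Longrightarrow> \<eta> x = 0" "x \<notin> cball 0 r \<Longrightarrow> \<eta> x = 0"
    "integrable lborel \<eta>" "(\<integral>x. \<eta> x \<partial>lborel) = 1" "continuous_on UNIV \<eta>" "\<eta> \<in> borel_measurable borel"
proof -
  show "C_k k \<eta>" "0 \<le> \<eta> x" "x \<in> ball 0 r \<Longrightarrow> 0 < \<eta> x" "x \<notin> ball 0 r \<Longrightarrow> \<eta> x = 0" "x \<notin> cball 0 r \<Longrightarrow> \<eta> x = 0"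
    "integrable lborel \<eta>" "(\<integral>x. \<eta> x \<partial>lborel) = 1"
    using assms unfolding mollifier_def by auto
  have "C_k 0 \<eta>" using assms unfolding mollifier_def by blast
  then show "continuous_on UNIV \<eta>" by simp
  then show "\<eta> \<in> borel_measurable borel" by (rule borel_measurable_continuous_onI)
qed

lemma convolution_reflect:
  fixes F K :: "'a::euclidean_space \<Rightarrow> real"
  assumes [measurable]: "F \<in> borel_measurable borel" "K \<in> borel_measurable borel"
  shows "convolution F K x = (\<integral>z. K z * F (x - z) \<partial>lborel)"
  using integral_lborel_reflect[of "\<lambda>z. K z * F (x - z)" x] by (simp add: convolution_def mult.commute)

lemma integrable_reflect:
  fixes f :: "'a::euclidean_space \<Rightarrow> real"
  assumes [measurable]: "f \<in> borel_measurable borel" and "integrable lborel (\<lambda>y. f (x - y))"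
  shows "integrable lborel f"
proof -
  have "integrable (distr lborel borel (\<lambda>y. x - y)) f"
    using assms by (subst integrable_distr_eq) auto
  then show ?thesis by (simp only: lborel_distr_reflect)
qed

text \<open>Jensen's inequality for the probability density \<open>\<eta>\<close>, followed by an
  exchange of integrals: the error is an average of translation errors over shifts shorter than
  \<open>r\<close>.\<close>

lemma mollification_L2_bound:
  fixes F :: "real^'n \<Rightarrow> real"
  assumes F: "integrable lborel F" and \<eta>: "mollifier r \<eta>"
    and T: "\<And>z. norm z < r \<Longrightarrow> (\<integral>\<^sup>+x. ennreal ((F (x - z) - F x)\<^sup>2) \<partial>lborel) \<le> ennreal e"
  shows "(\<integral>\<^sup>+x. ennreal ((convolution F \<eta> x - F x)\<^sup>2) \<partial>lborel) \<le> ennreal e"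
proof -
  note m = mollifierD[OF \<eta>]
  have Fm[measurable]: "F \<in> borel_measurable borel" using F by auto
  note [measurable] = m(9)
  have pw: "ennreal ((convolution F \<eta> x - F x)\<^sup>2) \<le> (\<integral>\<^sup>+z. ennreal (\<eta> z * (F (x - z) - F x)\<^sup>2) \<partial>lborel)" for x
  proof (cases "(\<integral>\<^sup>+z. ennreal (\<eta> z * (F (x - z) - F x)\<^sup>2) \<partial>lborel) = \<infinity>")
    case False
    have i2: "integrable lborel (\<lambda>z. \<eta> z * (F (x - z) - F x)\<^sup>2)"
      using False m(2) by (intro integrableI_nonneg) (auto simp: less_top)
    have "integrable lborel (\<lambda>y. F y *\<^sub>R \<eta> (x - y))"
      by (rule convolution_integrable[OF F m(8) compact_cball m(5)])
    then have "integrable lborel (\<lambda>y. \<eta> (x - y) * F (x - (x - y)))" by (simp add: mult.commute)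
    then have i0: "integrable lborel (\<lambda>z. \<eta> z * F (x - z))"
      using integrable_reflect[of "\<lambda>z. \<eta> z * F (x - z)" x] by simp
    have i1: "integrable lborel (\<lambda>z. \<eta> z * (F (x - z) - F x))"
      using Bochner_Integration.integrable_diff[OF i0 integrable_mult_left[OF m(6), of "F x"]]
      by (simp add: right_diff_distrib)
    define a where "a = convolution F \<eta> x - F x"
    have a: "(\<integral>z. \<eta> z * (F (x - z) - F x) \<partial>lborel) = a"
    proof -
      have "(\<integral>z. \<eta> z * (F (x - z) - F x) \<partial>lborel) = (\<integral>z. \<eta> z * F (x - z) - \<eta> z * F x \<partial>lborel)"
        by (simp add: right_diff_distrib)
      also have "\<dots> = (\<integral>z. \<eta> z * F (x - z) \<partial>lborel) - (\<integral>z. \<eta> z * F x \<partial>lborel)"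
        by (rule Bochner_Integration.integral_diff[OF i0 integrable_mult_left[OF m(6)]])
      also have "\<dots> = a" by (simp add: a_def convolution_reflect[OF Fm m(9)] m(7))
      finally show ?thesis .
    qed
    \<comment> \<open>Jensen in linear form: \<open>2 a y - a^2 \<le> y^2\<close> is integrated
      against \<open>\<eta>\<close>, where \<open>a\<close> is the mean of
      \<open>y = F (x - z) - F x\<close>.\<close>
    have "2 * a * a - a\<^sup>2 = (\<integral>z. 2 * a * (\<eta> z * (F (x - z) - F x)) - a\<^sup>2 * \<eta> z \<partial>lborel)"
      by (simp only: Bochner_Integration.integral_diff[OF integrable_mult_right[OF i1] integrable_mult_right[OF m(6)]]
          integral_mult_right_zero a m(7) mult_1_right)
    also have "\<dots> \<le> (\<integral>z. \<eta> z * (F (x - z) - F x)\<^sup>2 \<partial>lborel)"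
    proof (rule integral_mono[OF Bochner_Integration.integrable_diff[OF integrable_mult_right[OF i1] integrable_mult_right[OF m(6)]] i2])
      fix z
      have "2 * a * (F (x - z) - F x) - a\<^sup>2 \<le> (F (x - z) - F x)\<^sup>2"
        using sum_squares_bound[of a "F (x - z) - F x"] by linarith
      then have "\<eta> z * (2 * a * (F (x - z) - F x) - a\<^sup>2) \<le> \<eta> z * (F (x - z) - F x)\<^sup>2"
        using m(2) by (intro mult_left_mono) auto
      then show "2 * a * (\<eta> z * (F (x - z) - F x)) - a\<^sup>2 * \<eta> z \<le> \<eta> z * (F (x - z) - F x)\<^sup>2"
        by (simp add: algebra_simps)
    qed
    finally have "a\<^sup>2 \<le> (\<integral>z. \<eta> z * (F (x - z) - F x)\<^sup>2 \<partial>lborel)" by (simp add: power2_eq_square)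
    then show ?thesis
      unfolding a_def[symmetric] using m(2) by (subst nn_integral_eq_integral[OF i2]) (auto intro: ennreal_leI)
  qed simp
  have "(\<integral>\<^sup>+x. ennreal ((convolution F \<eta> x - F x)\<^sup>2) \<partial>lborel) \<le> (\<integral>\<^sup>+x. (\<integral>\<^sup>+z. ennreal (\<eta> z * (F (x - z) - F x)\<^sup>2) \<partial>lborel) \<partial>lborel)"
    by (rule nn_integral_mono) (rule pw)
  also have "\<dots> = (\<integral>\<^sup>+z. (\<integral>\<^sup>+x. ennreal (\<eta> z * (F (x - z) - F x)\<^sup>2) \<partial>lborel) \<partial>lborel)"
    by (rule lborel_pair.Fubini') measurable
  also have "\<dots> \<le> (\<integral>\<^sup>+z. ennreal (\<eta> z) * ennreal e \<partial>lborel)"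
  proof (rule nn_integral_mono)
    fix z
    have "(\<integral>\<^sup>+x. ennreal (\<eta> z * (F (x - z) - F x)\<^sup>2) \<partial>lborel) = ennreal (\<eta> z) * (\<integral>\<^sup>+x. ennreal ((F (x - z) - F x)\<^sup>2) \<partial>lborel)"
      using m(2)[of z] by (subst nn_integral_cmult[symmetric]) (auto simp: ennreal_mult)
    also have "\<dots> \<le> ennreal (\<eta> z) * ennreal e"
      using T[of z] m(4)[of z] by (cases "norm z < r") (auto intro: mult_left_mono)
    finally show "(\<integral>\<^sup>+x. ennreal (\<eta> z * (F (x - z) - F x)\<^sup>2) \<partial>lborel) \<le> ennreal (\<eta> z) * ennreal e" .
  qed
  also have "\<dots> = (\<integral>\<^sup>+z. ennreal (\<eta> z) \<partial>lborel) * ennreal e" by (rule nn_integral_multc) measurable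
  also have "(\<integral>\<^sup>+z. ennreal (\<eta> z) \<partial>lborel) = 1" using nn_integral_eq_integral[OF m(6)] m(2,7) by simp
  finally show ?thesis by simp
qed

lemma integrable_of_square:
  fixes F :: "'a::euclidean_space \<Rightarrow> 'b::euclidean_space"
  assumes [measurable]: "F \<in> borel_measurable borel" and F2: "integrable lborel (\<lambda>x. (norm (F x))\<^sup>2)"
    and supp: "\<And>x. x \<notin> S \<Longrightarrow> F x = 0" and S: "S \<in> sets borel" "bounded S"
  shows "integrable lborel F"
proof (rule Bochner_Integration.integrable_bound)
  show "integrable lborel (\<lambda>x. indicator S x + (norm (F x))\<^sup>2)"
    using S emeasure_bounded_finite[of S] by (intro Bochner_Integration.integrable_add F2 integrable_real_indicator) auto
  show "AE x in lborel. norm (F x) \<le> norm (indicator S x + (norm (F x))\<^sup>2)"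
  proof (rule AE_I2)
    fix x
    show "norm (F x) \<le> norm (indicator S x + (norm (F x))\<^sup>2)"
    proof (cases "x \<in> S")
      case True
      have "2 * norm (F x) \<le> 1 + (norm (F x))\<^sup>2" using sum_squares_bound[of 1 "norm (F x)"] by simp
      then have "norm (F x) \<le> 1 + (norm (F x))\<^sup>2" using norm_ge_zero[of "F x"] by linarith
      then show ?thesis using True by simp
    qed (simp add: supp)
  qed
qed measurable

lemma mollification_converges:
  fixes F :: "real^'n \<Rightarrow> real"
  assumes Fm: "F \<in> borel_measurable borel" and F2: "integrable lborel (\<lambda>x. (F x)\<^sup>2)"
    and supp: "\<And>x. x \<notin> cball x0 R \<Longrightarrow> F x = 0" and e: "0 < e"
  shows "\<forall>\<^sub>F r in at_right 0. \<forall>\<eta>. mollifier r \<eta> \<longrightarrow>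
    (\<integral>\<^sup>+x. ennreal ((convolution F \<eta> x - F x)\<^sup>2) \<partial>lborel) \<le> ennreal e"
proof -
  obtain d where d: "0 < d" "\<And>z. norm z < d \<Longrightarrow> (\<integral>\<^sup>+x. ennreal ((F (x - z) - F x)\<^sup>2) \<partial>lborel) \<le> ennreal e"
    using L2_translation_continuous[OF Fm F2 supp e] by blast
  have F: "integrable lborel F"
    by (rule integrable_of_square[where S="cball x0 R"]) (use Fm F2 supp in auto)
  show ?thesis
    unfolding eventually_at_right_field
  proof (intro exI[of _ d] conjI allI impI d(1))
    fix r \<eta> assume r: "0 < r" "r < d" and "mollifier r (\<eta> :: real^'n \<Rightarrow> real)"
    then show "(\<integral>\<^sup>+x. ennreal ((convolution F \<eta> x - F x)\<^sup>2) \<partial>lborel) \<le> ennreal e"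
      by (intro mollification_L2_bound[OF F]) (use d(2) in auto)
  qed
qed

text \<open>If the average \<open>c\<close> were outside \<open>I\<close>, the whole of
  \<open>I\<close> would lie on one side of it. Then \<open>F - c\<close>, up to the sign
  \<open>t\<close>, would be positive almost everywhere on the ball, while its mean against the
  positive weight vanishes. This is what keeps the smooth approximants in \<open>I\<close>.\<close>

lemma mollification_in_interval:
  fixes F :: "real^'n \<Rightarrow> real"
  assumes F: "integrable lborel F" and \<eta>: "mollifier r \<eta>" and r: "0 < r" and I: "is_interval I"
    and ae: "AE y in lborel. y \<in> ball x r \<longrightarrow> F y \<in> I"
  shows "convolution F \<eta> x \<in> I"
proof (rule ccontr)
  note m = mollifierD[OF \<eta>]
  have Fm[measurable]: "F \<in> borel_measurable borel" using F by auto
  note [measurable] = m(9)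
  define c where "c = convolution F \<eta> x"
  assume "convolution F \<eta> x \<notin> I"
  then have c: "c \<notin> I" by (simp add: c_def)
  have "(\<forall>s\<in>I. c < s) \<or> (\<forall>s\<in>I. s < c)"
    using I c unfolding is_interval_1 by (meson linorder_le_less_linear)
  then obtain t :: real where t: "\<And>s. s \<in> I \<Longrightarrow> 0 < t * (s - c)"
  proof
    assume "\<forall>s\<in>I. c < s" then show ?thesis by (intro that[of 1]) auto
  next
    assume "\<forall>s\<in>I. s < c" then show ?thesis by (intro that[of "-1"]) auto
  qed
  have i0: "integrable lborel (\<lambda>y. F y * \<eta> (x - y))"
  proof -
    have "integrable lborel (\<lambda>y. F y *\<^sub>R \<eta> (x - y))"
      by (rule convolution_integrable[OF F m(8) compact_cball m(5)])
    then show ?thesis by simp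
  qed
  have ir: "integrable lborel (\<lambda>y. \<eta> (x - y))"
    by (rule integrable_reflect[of _ x]) (use m(6) in auto)
  have one: "(\<integral>y. \<eta> (x - y) \<partial>lborel) = 1"
    using integral_lborel_reflect[of \<eta> x] m(7,9) by simp
  have i1: "integrable lborel (\<lambda>y. t * (F y * \<eta> (x - y) - c * \<eta> (x - y)))"
    by (intro integrable_mult_right Bochner_Integration.integrable_diff i0 ir)
  have zero: "(\<integral>y. t * (F y * \<eta> (x - y) - c * \<eta> (x - y)) \<partial>lborel) = 0"
    by (simp only: integral_mult_right_zero Bochner_Integration.integral_diff[OF i0 integrable_mult_right[OF ir]] one)
       (simp add: c_def convolution_def)
  have nn: "AE y in lborel. 0 \<le> t * (F y * \<eta> (x - y) - c * \<eta> (x - y))"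
    and pos: "AE y in lborel. y \<in> ball x r \<longrightarrow> 0 < t * (F y * \<eta> (x - y) - c * \<eta> (x - y))"
  proof -
    have eq: "t * (F y * \<eta> (x - y) - c * \<eta> (x - y)) = (t * (F y - c)) * \<eta> (x - y)" for y
      by (simp add: algebra_simps)
    have ball: "y \<in> ball x r \<longleftrightarrow> x - y \<in> ball 0 r" for y by (simp only: diff_mem_ball_0)
    show "AE y in lborel. y \<in> ball x r \<longrightarrow> 0 < t * (F y * \<eta> (x - y) - c * \<eta> (x - y))"
      unfolding eq using ae by eventually_elim (use t m(3) ball in \<open>auto intro!: mult_pos_pos\<close>)
    then show "AE y in lborel. 0 \<le> t * (F y * \<eta> (x - y) - c * \<eta> (x - y))"
    proof eventually_elim
      case (elim y)
      then show ?case using m(4)[of "x - y"] ball[of y] by (cases "y \<in> ball x r") auto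
    qed
  qed
  have "AE y in lborel. t * (F y * \<eta> (x - y) - c * \<eta> (x - y)) = 0"
    using integral_nonneg_eq_0_iff_AE[OF i1 nn] zero by simp
  with pos have "AE y in lborel. y \<in> ball x r \<longrightarrow> False"
    by eventually_elim auto
  then show False using AE_ball_witness[of x r "\<lambda>_. False"] r by auto
qed

lemma reflected_mollifier_test_function:
  fixes \<eta> :: "real^'n \<Rightarrow> real"
  assumes \<eta>: "mollifier r \<eta>" and "cball x r \<subseteq> U"
  shows "(\<lambda>y. \<eta> (x - y)) \<in> test_functions U"
proof -
  note m = mollifierD[OF \<eta>]
  have "{y. \<eta> (x - y) \<noteq> 0} \<subseteq> cball x r"
  proof
    fix y assume "y \<in> {y. \<eta> (x - y) \<noteq> 0}"
    then have "x - y \<in> cball 0 r" using m(5)[of "x - y"] by auto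
    then show "y \<in> cball x r" by (simp only: diff_mem_ball_0)
  qed
  then have "closure {y. \<eta> (x - y) \<noteq> 0} \<subseteq> cball x r" by (rule closure_minimal) simp
  moreover have "compact (closure {y. \<eta> (x - y) \<noteq> 0})"
    using calculation bounded_subset[OF bounded_cball] by (auto simp: compact_eq_bounded_closed)
  moreover have "C_k k (\<lambda>y. \<eta> (x - y))" for k
    using C_k_reflect(1)[OF m(1), of k 1] by simp
  ultimately show ?thesis using assms(2) unfolding test_functions_def by auto
qed

text \<open>Both \<open>f\<close> and \<open>g\<close> are cut off to the larger ball and mollified.
  At points of the smaller ball a radius below \<open>R - \<rho>\<close> does not reach the cutoff,
  so the weak gradient identity, tested with the reflected mollifier, says that the gradient of the
  mollified function is the mollified weak gradient.\<close>

lemma H1_approx_exists: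
  fixes f :: "real^'n \<Rightarrow> real"
  assumes fm[measurable]: "f \<in> borel_measurable borel" and gm[measurable]: "g \<in> borel_measurable borel"
    and f2: "integrable lborel (\<lambda>x. (f x)\<^sup>2)" and g2: "integrable lborel (\<lambda>x. (norm (g x))\<^sup>2)"
    and weak: "\<And>\<phi> i. \<phi> \<in> test_functions U \<Longrightarrow> (\<integral>x. f x * partial_deriv i \<phi> x \<partial>lborel) = - (\<integral>x. g x $ i * \<phi> x \<partial>lborel)"
    and R: "ball x0 R \<subseteq> U" "0 < \<rho>" "\<rho> < R" and I: "is_interval I"
    and ae: "AE x in lborel. x \<in> ball x0 R \<longrightarrow> f x \<in> I"
  shows "H1_approx (ball x0 \<rho>) I f g"
proof -
  define f1 where "f1 x = indicator (ball x0 R) x * f x" for x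
  define g1 where "g1 i x = indicator (ball x0 R) x * g x $ i" for i x
  have [measurable]: "(\<lambda>x. g x $ i) \<in> borel_measurable borel" for i
    using borel_measurable_inner[OF gm borel_measurable_const[of "axis i 1"]] by (simp add: inner_axis)
  have f1m[measurable]: "f1 \<in> borel_measurable borel" unfolding f1_def[abs_def] by measurable
  have g1m[measurable]: "g1 i \<in> borel_measurable borel" for i unfolding g1_def[abs_def] by measurable
  have f12: "integrable lborel (\<lambda>x. (f1 x)\<^sup>2)"
    by (rule Bochner_Integration.integrable_bound[OF f2]) (auto simp: f1_def split: split_indicator)
  have g12: "integrable lborel (\<lambda>x. (g1 i x)\<^sup>2)" for i
  proof (rule Bochner_Integration.integrable_bound[OF g2])
    show "AE x in lborel. norm ((g1 i x)\<^sup>2) \<le> norm ((norm (g x))\<^sup>2)"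
    proof (rule AE_I2)
      fix x
      have "\<bar>g x $ i\<bar>\<^sup>2 \<le> (norm (g x))\<^sup>2" using component_le_norm_cart by (intro power_mono) auto
      then show "norm ((g1 i x)\<^sup>2) \<le> norm ((norm (g x))\<^sup>2)" by (auto simp: g1_def split: split_indicator)
    qed
  qed measurable
  have s1: "f1 x = 0" "g1 i x = 0" if "x \<notin> cball x0 R" for x i using that by (auto simp: f1_def g1_def)
  have f1i: "integrable lborel f1"
    by (rule integrable_of_square[where S="cball x0 R"]) (use f12 s1 in auto)
  have g1i: "integrable lborel (g1 i)" for i
    by (rule integrable_of_square[where S="cball x0 R"]) (use g12 s1 in auto)
  \<comment> \<open>The error is shared out equally among the function and the components of its
    gradient.\<close>
  define n1 where "n1 = real (CARD('n)) + 1"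
  have n1: "0 < n1" unfolding n1_def by simp
  define P where "P k r \<eta> \<longleftrightarrow> 0 < r \<and> r < R - \<rho> \<and> mollifier r (\<eta> :: real^'n \<Rightarrow> real) \<and>
    (\<integral>\<^sup>+x. ennreal ((convolution f1 \<eta> x - f1 x)\<^sup>2) \<partial>lborel) \<le> ennreal ((1/2)^k / n1) \<and>
    (\<forall>i. (\<integral>\<^sup>+x. ennreal ((convolution (g1 i) \<eta> x - g1 i x)\<^sup>2) \<partial>lborel) \<le> ennreal ((1/2)^k / n1))" for k :: nat and r \<eta>
  have "\<exists>r \<eta>. P k r \<eta>" for k
  proof -
    have ek: "0 < (1/2::real) ^ k / n1" using n1 by simp
    have "\<forall>\<^sub>F r in at_right (0::real). 0 < r \<and> r < R - \<rho> \<and>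
      (\<forall>\<eta>. mollifier r (\<eta> :: real^'n \<Rightarrow> real) \<longrightarrow> (\<integral>\<^sup>+x. ennreal ((convolution f1 \<eta> x - f1 x)\<^sup>2) \<partial>lborel) \<le> ennreal ((1/2)^k / n1)) \<and>
      (\<forall>i. \<forall>\<eta>. mollifier r \<eta> \<longrightarrow> (\<integral>\<^sup>+x. ennreal ((convolution (g1 i) \<eta> x - g1 i x)\<^sup>2) \<partial>lborel) \<le> ennreal ((1/2)^k / n1))"
    proof (intro eventually_conj eventually_all_finite)
      show "\<forall>\<^sub>F r in at_right (0::real). 0 < r" by (simp add: eventually_at_filter)
      show "\<forall>\<^sub>F r in at_right (0::real). r < R - \<rho>"
        unfolding eventually_at_right_field using R by (intro exI[of _ "R - \<rho>"]) auto
      show "\<forall>\<^sub>F r in at_right (0::real). \<forall>\<eta>. mollifier r (\<eta> :: real^'n \<Rightarrow> real) \<longrightarrow>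
          (\<integral>\<^sup>+x. ennreal ((convolution f1 \<eta> x - f1 x)\<^sup>2) \<partial>lborel) \<le> ennreal ((1/2)^k / n1)"
        by (rule mollification_converges[OF f1m f12 _ ek]) (rule s1(1))
      show "\<forall>\<^sub>F r in at_right (0::real). \<forall>\<eta>. mollifier r \<eta> \<longrightarrow>
          (\<integral>\<^sup>+x. ennreal ((convolution (g1 i) \<eta> x - g1 i x)\<^sup>2) \<partial>lborel) \<le> ennreal ((1/2)^k / n1)" for i
        by (rule mollification_converges[OF g1m g12 _ ek]) (rule s1(2))
    qed
    from eventually_happens'[OF _ this] obtain r where r: "0 < r" "r < R - \<rho>"
      "\<And>\<eta> :: real^'n \<Rightarrow> real. mollifier r \<eta> \<Longrightarrow> (\<integral>\<^sup>+x. ennreal ((convolution f1 \<eta> x - f1 x)\<^sup>2) \<partial>lborel) \<le> ennreal ((1/2)^k / n1)"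
      "\<And>i \<eta>. mollifier r \<eta> \<Longrightarrow> (\<integral>\<^sup>+x. ennreal ((convolution (g1 i) \<eta> x - g1 i x)\<^sup>2) \<partial>lborel) \<le> ennreal ((1/2)^k / n1)"
      by auto
    obtain \<eta> :: "real^'n \<Rightarrow> real" where "mollifier r \<eta>" using mollifier_ex[OF r(1), where ?'n='n] by blast
    then have "P k r \<eta>" unfolding P_def using r by blast
    then show ?thesis by blast
  qed
  then obtain r \<eta> where P: "\<And>k. P k (r k) (\<eta> k)" by metis
  then have r: "\<And>k. 0 < r k" "\<And>k. r k < R - \<rho>" and \<eta>: "\<And>k. mollifier (r k) (\<eta> k :: real^'n \<Rightarrow> real)"
    and ef: "\<And>k::nat. (\<integral>\<^sup>+x. ennreal ((convolution f1 (\<eta> k) x - f1 x)\<^sup>2) \<partial>lborel) \<le> ennreal ((1/2)^k / n1)"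
    and eg: "\<And>k i. (\<integral>\<^sup>+x. ennreal ((convolution (g1 i) (\<eta> k) x - g1 i x)\<^sup>2) \<partial>lborel) \<le> ennreal ((1/2)^k / n1)"
    unfolding P_def by blast+
  note m = mollifierD[OF \<eta>]
  define F where "F k = convolution f1 (\<eta> k)" for k
  define D where "D k x = (\<chi> i. convolution (g1 i) (\<eta> k) x)" for k x
  have Fc: "continuous_on UNIV (F k)" for k
    unfolding F_def using convolution_continuous[OF f1i m(8) compact_cball m(5)] by blast
  have gc: "continuous_on UNIV (convolution (g1 i) (\<eta> k))" for i k
    using convolution_continuous[OF g1i m(8) compact_cball m(5)] by blast
  have Dc: "continuous_on UNIV (D k)" for k
    unfolding D_def[abs_def] by (intro continuous_on_vec_lambda gc)
  have [measurable]: "F k \<in> borel_measurable borel" "convolution (g1 i) (\<eta> k) \<in> borel_measurable borel" for i k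
    using Fc gc by (auto intro: borel_measurable_continuous_onI)
  have in_ball: "cball x (r k) \<subseteq> ball x0 R" if "x \<in> ball x0 \<rho>" for x k
  proof
    fix y assume "y \<in> cball x (r k)"
    then show "y \<in> ball x0 R" using that r(2)[of k] dist_triangle[of x0 y x] by auto
  qed
  have grad: "GDERIV (F k) x :> D k x" if x: "x \<in> ball x0 \<rho>" for k x
  proof -
    have G: "\<And>x. GDERIV (\<eta> k) x :> grad (\<eta> k) x" "continuous_on UNIV (grad (\<eta> k))"
      using continuous_on_grad[of "\<eta> k"] m(1) by blast+
    have g0: "grad (\<eta> k) y = 0" if "y \<notin> cball 0 (r k)" for y
      using GDERIV_zero_outside[of "cball 0 (r k)" "\<eta> k" y "grad (\<eta> k) y"] G(1) m(5)[of _ k] that by auto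
    have d: "GDERIV (F k) x :> convolution f1 (grad (\<eta> k)) x"
      unfolding F_def using convolution_GDERIV[OF f1i G(1,2) compact_cball m(5)] by blast
    have "convolution f1 (grad (\<eta> k)) x $ i = D k x $ i" for i
    proof -
      have int: "integrable lborel (\<lambda>y. f1 y *\<^sub>R grad (\<eta> k) (x - y))"
        by (rule convolution_integrable[OF f1i G(2) compact_cball g0])
      have "convolution f1 (grad (\<eta> k)) x $ i = (\<integral>y. (f1 y *\<^sub>R grad (\<eta> k) (x - y)) \<bullet> axis i 1 \<partial>lborel)"
        unfolding convolution_def using int by (subst integral_inner_left) (auto simp: inner_axis)
      also have "\<dots> = (\<integral>y. - (f y * partial_deriv i (\<lambda>y. \<eta> k (x - y)) y) \<partial>lborel)"
      proof (rule Bochner_Integration.integral_cong[OF refl])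
        fix y
        have p: "partial_deriv i (\<lambda>y. \<eta> k (x - y)) y = - partial_deriv i (\<eta> k) (x - y)"
          by (rule C_k_reflect(2)) (rule m(1))
        show "(f1 y *\<^sub>R grad (\<eta> k) (x - y)) \<bullet> axis i 1 = - (f y * partial_deriv i (\<lambda>y. \<eta> k (x - y)) y)"
        proof (cases "y \<in> ball x0 R")
          case True
          then show ?thesis by (simp add: p f1_def inner_axis grad_def)
        next
          case False
          then have "x - y \<notin> cball 0 (r k)" using in_ball[OF x, of k] unfolding diff_mem_ball_0 by blast
          then have "grad (\<eta> k) (x - y) = 0" by (rule g0)
          moreover from this have "partial_deriv i (\<eta> k) (x - y) = 0"
            by (metis grad_def vec_lambda_beta zero_index)
          ultimately show ?thesis by (simp add: p)
        qed
      qed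
      also have "\<dots> = (\<integral>y. g y $ i * \<eta> k (x - y) \<partial>lborel)"
        using weak[OF reflected_mollifier_test_function[OF \<eta>], of x k i] in_ball[OF x, of k] R(1) by auto
      also have "\<dots> = D k x $ i"
        unfolding D_def convolution_def
      proof (simp, rule Bochner_Integration.integral_cong[OF refl])
        fix y
        show "g y $ i * \<eta> k (x - y) = g1 i y * \<eta> k (x - y)"
        proof (cases "y \<in> ball x0 R")
          case False
          then have "x - y \<notin> cball 0 (r k)" using in_ball[OF x, of k] unfolding diff_mem_ball_0 by blast
          then show ?thesis using m(5) by simp
        qed (simp add: g1_def)
      qed
      finally show ?thesis .
    qed
    then have "convolution f1 (grad (\<eta> k)) x = D k x" by (simp add: vec_eq_iff)
    with d show ?thesis by simp
  qed
  have FI: "F k x \<in> I" if "x \<in> ball x0 \<rho>" for k x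
    unfolding F_def
  proof (rule mollification_in_interval[OF f1i \<eta> r(1) I])
    have sub: "ball x (r k) \<subseteq> ball x0 R" using in_ball[OF that, of k] ball_subset_cball by blast
    show "AE y in lborel. y \<in> ball x (r k) \<longrightarrow> f1 y \<in> I"
      using ae by eventually_elim (use sub in \<open>auto simp: f1_def\<close>)
  qed
  define s where "s k x = (F k x - f1 x)\<^sup>2 + (\<Sum>i\<in>UNIV. (convolution (g1 i) (\<eta> k) x - g1 i x)\<^sup>2)" for k x
  have sm[measurable]: "s k \<in> borel_measurable borel" for k unfolding s_def[abs_def] by measurable
  have s0: "0 \<le> s k x" for k x unfolding s_def by (intro add_nonneg_nonneg sum_nonneg) auto
  have s_int: "(\<integral>\<^sup>+x. ennreal (s k x) \<partial>lborel) \<le> ennreal ((1/2) ^ k)" for k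
  proof -
    have "(\<integral>\<^sup>+x. ennreal (s k x) \<partial>lborel) = (\<integral>\<^sup>+x. ennreal ((F k x - f1 x)\<^sup>2) + (\<Sum>i\<in>UNIV. ennreal ((convolution (g1 i) (\<eta> k) x - g1 i x)\<^sup>2)) \<partial>lborel)"
      unfolding s_def by (intro nn_integral_cong) (simp add: sum_nonneg)
    also have "\<dots> = (\<integral>\<^sup>+x. ennreal ((F k x - f1 x)\<^sup>2) \<partial>lborel) + (\<Sum>i\<in>UNIV. \<integral>\<^sup>+x. ennreal ((convolution (g1 i) (\<eta> k) x - g1 i x)\<^sup>2) \<partial>lborel)"
      by (subst nn_integral_add, measurable, subst nn_integral_sum, measurable)
    also have "\<dots> \<le> ennreal ((1/2)^k / n1) + (\<Sum>i\<in>(UNIV::'n set). ennreal ((1/2)^k / n1))"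
      using ef[of k] eg[of _ k] unfolding F_def by (intro add_mono sum_mono) auto
    also have "\<dots> = ennreal ((1/2)^k / n1 + (\<Sum>i\<in>(UNIV::'n set). (1/2)^k / n1))"
      using n1 by (subst sum_ennreal) (auto simp: ennreal_plus[symmetric] sum_nonneg simp del: ennreal_plus)
    also have "(1/2)^k / n1 + (\<Sum>i\<in>(UNIV::'n set). (1/2)^k / n1) = n1 * ((1/2)^k / n1)"
    proof -
      have "t + (\<Sum>i\<in>(UNIV::'n set). t) = n1 * t" for t by (simp add: n1_def distrib_right)
      then show ?thesis by blast
    qed
    also have "\<dots> = (1/2)^k" using n1 by simp
    finally show ?thesis .
  qed
  \<comment> \<open>The squared errors have summable integrals, so their sum is finite almost
    everywhere. Its terms then tend to 0, which gives pointwise convergence, and the sum itself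
    enters the dominating function \<open>W\<close>.\<close>
  define T where "T x = (\<Sum>k. ennreal (s k x))" for x
  have Tm[measurable]: "T \<in> borel_measurable borel" unfolding T_def[abs_def] by measurable
  have T_int: "(\<integral>\<^sup>+x. T x \<partial>lborel) < \<infinity>"
  proof -
    have "(\<integral>\<^sup>+x. T x \<partial>lborel) = (\<Sum>k. \<integral>\<^sup>+x. ennreal (s k x) \<partial>lborel)"
      unfolding T_def by (rule nn_integral_suminf) measurable
    also have "\<dots> \<le> (\<Sum>k. ennreal ((1/2) ^ k))" by (intro suminf_le s_int) auto
    also have "\<dots> = ennreal (\<Sum>k. (1/2) ^ k)" by (intro suminf_ennreal2) (auto simp: summable_geometric)
    also have "\<dots> < \<infinity>" by simp
    finally show ?thesis .
  qed
  then have T_fin: "AE x in lborel. T x \<noteq> \<infinity>" by (intro nn_integral_PInf_AE) auto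
  have T_real: "integrable lborel (\<lambda>x. enn2real (T x))"
  proof (rule integrableI_bounded)
    have "(\<integral>\<^sup>+x. ennreal (norm (enn2real (T x))) \<partial>lborel) \<le> (\<integral>\<^sup>+x. T x \<partial>lborel)"
      by (intro nn_integral_mono) (simp add: ennreal_enn2real_if)
    then show "(\<integral>\<^sup>+x. ennreal (norm (enn2real (T x))) \<partial>lborel) < \<infinity>" using T_int by simp
  qed measurable
  define W where "W x = 2 * (f x)\<^sup>2 + 2 * (norm (g x))\<^sup>2 + 2 * enn2real (T x)" for x
  have W: "set_integrable lborel (ball x0 \<rho>) W"
    unfolding set_integrable_def
    by (rule integrable_mult_indicator) (auto simp: W_def intro!: Bochner_Integration.integrable_add f2 g2 T_real)
  have "AE x in lborel. x \<in> ball x0 \<rho> \<longrightarrow> (\<lambda>k. F k x) \<longlonglongrightarrow> f x \<and> (\<lambda>k. D k x) \<longlonglongrightarrow> g x \<and>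
        (\<forall>k. (F k x)\<^sup>2 \<le> W x \<and> (norm (D k x))\<^sup>2 \<le> W x)"
    using T_fin
  proof eventually_elim
    case (elim x)
    show ?case
    proof
      assume x: "x \<in> ball x0 \<rho>"
      then have "x \<in> ball x0 R" using R by auto
      then have fx: "f1 x = f x" "\<And>i. g1 i x = g x $ i" by (auto simp: f1_def g1_def)
      have summ: "summable (\<lambda>k. s k x)"
        using elim s0 unfolding T_def by (intro summable_suminf_not_top) auto
      have sl: "(\<lambda>k. s k x) \<longlonglongrightarrow> 0" by (rule summable_LIMSEQ_zero[OF summ])
      have sT: "s k x \<le> enn2real (T x)" for k
      proof -
        have "T x = ennreal (\<Sum>k. s k x)" unfolding T_def by (rule suminf_ennreal2[OF s0 summ])
        then have "enn2real (T x) = (\<Sum>k. s k x)" using suminf_nonneg[OF summ s0] by simp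
        moreover have "s k x \<le> (\<Sum>k. s k x)"
          using sum_le_suminf[OF summ, of "{k}"] s0 by simp
        ultimately show ?thesis by simp
      qed
      have c1: "(F k x - f x)\<^sup>2 \<le> s k x" for k
        unfolding s_def fx by (simp add: sum_nonneg)
      have normD: "(norm (D k x - g x))\<^sup>2 = (\<Sum>i\<in>UNIV. (convolution (g1 i) (\<eta> k) x - g1 i x)\<^sup>2)" for k
        unfolding power2_norm_eq_inner inner_vec_def by (simp add: D_def fx power2_eq_square)
      have c2: "(norm (D k x - g x))\<^sup>2 \<le> s k x" for k
        unfolding normD s_def by simp
      have l1: "(\<lambda>k. F k x) \<longlonglongrightarrow> f x"
      proof -
        have "(\<lambda>k. (F k x - f x)\<^sup>2) \<longlonglongrightarrow> 0"
          by (rule tendsto_sandwich[OF _ _ tendsto_const sl]) (auto simp: c1)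
        then have "(\<lambda>k. sqrt ((F k x - f x)\<^sup>2)) \<longlonglongrightarrow> sqrt 0" by (rule tendsto_real_sqrt)
        then have "(\<lambda>k. F k x - f x) \<longlonglongrightarrow> 0" by (simp add: tendsto_rabs_zero_iff)
        then show ?thesis by (simp add: LIM_zero_iff)
      qed
      have l2: "(\<lambda>k. D k x) \<longlonglongrightarrow> g x"
      proof -
        have "(\<lambda>k. (norm (D k x - g x))\<^sup>2) \<longlonglongrightarrow> 0"
          by (rule tendsto_sandwich[OF _ _ tendsto_const sl]) (auto simp: c2)
        then have "(\<lambda>k. sqrt ((norm (D k x - g x))\<^sup>2)) \<longlonglongrightarrow> sqrt 0" by (rule tendsto_real_sqrt)
        then have "(\<lambda>k. norm (D k x - g x)) \<longlonglongrightarrow> 0" by simp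
        then have "(\<lambda>k. D k x - g x) \<longlonglongrightarrow> 0" by (rule tendsto_norm_zero_cancel)
        then show ?thesis by (simp add: LIM_zero_iff)
      qed
      have b1: "(F k x)\<^sup>2 \<le> W x" for k
      proof -
        have "(F k x)\<^sup>2 \<le> 2 * (F k x - f x)\<^sup>2 + 2 * (f x)\<^sup>2"
          using sq_le_double[of "F k x" "f x"] by (simp add: power2_commute)
        then show ?thesis using c1[of k] sT[of k] unfolding W_def by (smt (verit) zero_le_power2)
      qed
      have b2: "(norm (D k x))\<^sup>2 \<le> W x" for k
      proof -
        have "norm (D k x) \<le> norm (D k x - g x) + norm (g x)" using norm_triangle_ineq[of "D k x - g x" "g x"] by simp
        then have "(norm (D k x))\<^sup>2 \<le> (norm (D k x - g x) + norm (g x))\<^sup>2" by (intro power_mono) auto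
        also have "\<dots> \<le> 2 * (norm (D k x - g x))\<^sup>2 + 2 * (norm (g x))\<^sup>2"
          using sum_squares_bound[of "norm (D k x - g x)" "norm (g x)"] unfolding power2_sum by linarith
        finally show ?thesis using c2[of k] sT[of k] unfolding W_def by (smt (verit) zero_le_power2)
      qed
      show "(\<lambda>k. F k x) \<longlonglongrightarrow> f x \<and> (\<lambda>k. D k x) \<longlonglongrightarrow> g x \<and> (\<forall>k. (F k x)\<^sup>2 \<le> W x \<and> (norm (D k x))\<^sup>2 \<le> W x)"
        using l1 l2 b1 b2 by blast
    qed
  qed
  moreover have "\<forall>k. \<forall>x\<in>ball x0 \<rho>. GDERIV (F k) x :> D k x \<and> F k x \<in> I" using grad FI by blast
  moreover have "\<forall>k. continuous_on (ball x0 \<rho>) (D k)" using Dc continuous_on_subset by blast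
  ultimately show ?thesis unfolding H1_approx_def
    by (intro conjI fm gm exI[of _ F] exI[of _ D] exI[of _ W] W)
qed

subsection \<open>Reduction of weak solutions\<close>

text \<open>Fubini's theorem and translations are applied to Borel functions on the whole space, so
  Lebesgue measurable data on \<open>U\<close> are first replaced by Borel versions that vanish
  outside \<open>U\<close>.\<close>

lemma lebesgue_on_borel_version:
  fixes h :: "real^'n \<Rightarrow> real"
  assumes h: "h \<in> borel_measurable (lebesgue_on U)" and U: "open U"
  obtains H where "H \<in> borel_measurable borel" "AE x in lborel. x \<in> U \<longrightarrow> H x = h x" "\<And>x. x \<notin> U \<Longrightarrow> H x = 0"
proof -
  have [measurable]: "U \<in> sets borel" using U by simp
  have "(\<lambda>x. indicator U x *\<^sub>R h x) \<in> borel_measurable lebesgue"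
    using h by (subst (asm) borel_measurable_restrict_space_iff) auto
  then obtain H where [measurable]: "H \<in> borel_measurable lborel" and H: "AE x in lborel. indicator U x *\<^sub>R h x = H x"
    using completion_ex_borel_measurable_real by blast
  show ?thesis
  proof (rule that[of "\<lambda>x. indicator U x * H x"])
    show "AE x in lborel. x \<in> U \<longrightarrow> indicator U x * H x = h x"
      using H by eventually_elim auto
  qed auto
qed

lemma lebesgue_on_integral_eq:
  fixes h :: "real^'n \<Rightarrow> real"
  assumes h: "h \<in> borel_measurable (lebesgue_on U)" and U: "open U"
    and H: "H \<in> borel_measurable borel" "AE x in lborel. x \<in> U \<longrightarrow> H x = h x" "\<And>x. x \<notin> U \<Longrightarrow> H x = 0"
  shows "integral\<^sup>L (lebesgue_on U) h = (\<integral>x. H x \<partial>lborel)"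
    and "integrable (lebesgue_on U) h \<longleftrightarrow> integrable lborel H"
proof -
  have US: "U \<inter> space lebesgue \<in> sets lebesgue" using U by simp
  have m1: "(\<lambda>x. indicator U x *\<^sub>R h x) \<in> borel_measurable lebesgue"
    using h by (subst (asm) borel_measurable_restrict_space_iff[OF US])
  have m2: "H \<in> borel_measurable lebesgue" using H(1) by (simp add: measurable_completion)
  have ae: "AE x in lebesgue. indicator U x *\<^sub>R h x = H x"
    unfolding AE_completion_iff using H(2)
  proof eventually_elim
    case (elim x)
    then show ?case using H(3)[of x] by (cases "x \<in> U") auto
  qed
  show "integral\<^sup>L (lebesgue_on U) h = (\<integral>x. H x \<partial>lborel)"
    unfolding integral_restrict_space[OF US] integral_cong_AE[OF m1 m2 ae]
    using H(1) by (simp add: integral_completion)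
  show "integrable (lebesgue_on U) h \<longleftrightarrow> integrable lborel H"
    unfolding integrable_restrict_space[OF US] integrable_cong_AE[OF m1 m2 ae]
    using H(1) by (simp add: integrable_completion)
qed

lemma borel_measurable_lebesgue_on:
  assumes "f \<in> borel_measurable borel"
  shows "f \<in> borel_measurable (lebesgue_on U)"
  using assms by (intro measurable_restrict_space1) (simp add: measurable_completion)

text \<open>Local integrability speaks of each compact set separately; an exhaustion of
  \<open>U\<close> makes \<open>g\<close> a pointwise limit of measurable functions. It is applied
  to the gradient in the equation, of which only local integrability is known.\<close>

lemma L1_loc_measurable:
  fixes g :: "real^'n \<Rightarrow> 'b::euclidean_space"
  assumes g: "g \<in> L1_loc U" and U: "open U"
  shows "g \<in> borel_measurable (lebesgue_on U)"
proof -
  obtain C where C: "\<And>n::nat. compact (C n)" "\<And>n. C n \<subseteq> U" "\<And>n. C n \<subseteq> interior (C (Suc n))" "\<Union>(range C) = U"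
    by (rule open_Union_compact_subsets[OF U]) blast
  have "C n \<subseteq> C (Suc n)" for n using C(3)[of n] interior_subset[of "C (Suc n)"] by (rule order_trans)
  then have mono: "C m \<subseteq> C n" if "m \<le> n" for m n
    using that by (rule lift_Suc_mono_le)
  have "(\<lambda>x. indicator (C n) x *\<^sub>R g x) \<in> borel_measurable lebesgue" for n
  proof -
    have "integrable (lebesgue_on (C n)) g" using g C(1,2) unfolding L1_loc_def by blast
    then have "g \<in> borel_measurable (lebesgue_on (C n))" by simp
    moreover have "C n \<inter> space lebesgue \<in> sets lebesgue" using C(1) by (simp add: compact_imp_closed)
    ultimately show ?thesis by (simp only: borel_measurable_restrict_space_iff)
  qed
  moreover have "(\<lambda>n. indicator (C n) x *\<^sub>R g x) \<longlonglongrightarrow> indicator U x *\<^sub>R g x" for x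
  proof (rule tendsto_eventually, cases "x \<in> U")
    case True
    then obtain N where "x \<in> C N" using C(4) by auto
    then have "x \<in> C n" if "N \<le> n" for n using mono[OF that] by blast
    then show "\<forall>\<^sub>F n in sequentially. indicator (C n) x *\<^sub>R g x = indicator U x *\<^sub>R g x"
      using True by (auto simp: eventually_sequentially intro!: exI[of _ N])
  next
    case False
    then have "x \<notin> C n" for n using C(2) by blast
    then show "\<forall>\<^sub>F n in sequentially. indicator (C n) x *\<^sub>R g x = indicator U x *\<^sub>R g x"
      using False by simp
  qed
  ultimately have "(\<lambda>x. indicator U x *\<^sub>R g x) \<in> borel_measurable lebesgue"
    by (rule borel_measurable_LIMSEQ_metric)
  moreover have "U \<inter> space lebesgue \<in> sets lebesgue" using U by simp
  ultimately show ?thesis by (simp only: borel_measurable_restrict_space_iff)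
qed

lemma mollify_uniform:
  fixes K :: "real^'n \<Rightarrow> 'b::euclidean_space"
  assumes K: "continuous_on UNIV K" "compact S" "\<And>x. x \<notin> S \<Longrightarrow> K x = 0" and e: "0 < e"
  obtains d where "0 < d" "\<And>r \<eta> x. r \<le> d \<Longrightarrow> mollifier r \<eta> \<Longrightarrow> norm (convolution \<eta> K x - K x) \<le> e"
proof -
  obtain d where d: "0 < d" "\<And>x y. dist x y < d \<Longrightarrow> norm (K x - K y) \<le> e"
    using convolution_uniformly_close[OF K e] by blast
  show ?thesis
  proof (rule that[OF d(1)])
    fix r and \<eta> :: "real^'n \<Rightarrow> real" and x assume r: "r \<le> d" and \<eta>: "mollifier r \<eta>"
    note m = mollifierD[OF \<eta>]
    have i: "integrable lborel (\<lambda>y. \<eta> y *\<^sub>R K (x - y))" by (rule convolution_integrable[OF m(6) K])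
    have i2: "integrable lborel (\<lambda>y. \<eta> y *\<^sub>R K x)" using m(6) by simp
    have "(\<integral>y. \<eta> y *\<^sub>R K x \<partial>lborel) = K x" using m(6,7) by simp
    then have "convolution \<eta> K x - K x = (\<integral>y. \<eta> y *\<^sub>R K (x - y) - \<eta> y *\<^sub>R K x \<partial>lborel)"
      unfolding Bochner_Integration.integral_diff[OF i i2] convolution_def by simp
    also have "norm \<dots> \<le> (\<integral>y. \<eta> y * e \<partial>lborel)"
    proof (rule Bochner_Integration.integral_norm_bound_integral)
      show "norm (\<eta> y *\<^sub>R K (x - y) - \<eta> y *\<^sub>R K x) \<le> \<eta> y * e" for y
      proof (cases "y \<in> ball 0 r")
        case True
        then have "norm (K (x - y) - K x) \<le> e" using r by (intro d(2)) (simp add: dist_norm)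
        then have "\<eta> y * norm (K (x - y) - K x) \<le> \<eta> y * e" using m(2) by (intro mult_left_mono) auto
        then show ?thesis using m(2)[of y] by (simp flip: scaleR_diff_right)
      qed (simp add: m(4))
    qed (use i i2 m(6) in auto)
    also have "\<dots> = e" using m(7) by simp
    finally show "norm (convolution \<eta> K x - K x) \<le> e" .
  qed
qed

text \<open>One compact neighbourhood \<open>K'\<close> of the support serves all small radii, so
  integrability of the other factor on \<open>K'\<close> controls all mollifications at
  once.\<close>

lemma mollified_test_function:
  fixes \<phi> :: "real^'n \<Rightarrow> real"
  assumes \<phi>: "continuous_on UNIV \<phi>" "compact K" "\<And>x. x \<notin> K \<Longrightarrow> \<phi> x = 0" and U: "K \<subseteq> U" "open U"
  obtains \<delta> K' where "0 < \<delta>" "compact K'" "K \<subseteq> K'" "K' \<subseteq> U"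
    "\<And>r \<eta>. r \<le> \<delta> \<Longrightarrow> mollifier r \<eta> \<Longrightarrow> convolution \<phi> \<eta> \<in> test_functions U"
    "\<And>r \<eta> x. r \<le> \<delta> \<Longrightarrow> mollifier r \<eta> \<Longrightarrow> x \<notin> K' \<Longrightarrow> convolution \<phi> \<eta> x = 0"
proof -
  obtain \<delta> where \<delta>: "0 < \<delta>" "(\<Union>x\<in>K. cball x \<delta>) \<subseteq> U"
    using compact_subset_open_imp_cball_epsilon_subset[OF \<phi>(2) U(2,1)] by blast
  define K' where "K' = (\<Union>x\<in>K. \<Union>y\<in>cball 0 \<delta>. {x + y})"
  have K': "compact K'" unfolding K'_def using compact_sums'[OF \<phi>(2) compact_cball] by simp
  have sub: "K' \<subseteq> U"
  proof
    fix z assume "z \<in> K'"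
    then obtain x y where "x \<in> K" "y \<in> cball 0 \<delta>" "z = x + y" unfolding K'_def by auto
    then have "z \<in> cball x \<delta>" by (simp add: dist_norm)
    then show "z \<in> U" using \<delta>(2) \<open>x \<in> K\<close> by blast
  qed
  have KK: "K \<subseteq> K'"
  proof
    fix x assume "x \<in> K"
    moreover have "x = x + 0" "(0 :: real^'n) \<in> cball 0 \<delta>" using \<delta> by auto
    ultimately show "x \<in> K'" unfolding K'_def by blast
  qed
  have \<phi>i: "integrable lborel \<phi>"
  proof -
    have "integrable lborel (\<lambda>x. indicator K x *\<^sub>R \<phi> x)"
      by (rule borel_integrable_compact[OF \<phi>(2)]) (rule continuous_on_subset[OF \<phi>(1)], simp)
    moreover have "(\<lambda>x. indicator K x *\<^sub>R \<phi> x) = \<phi>" using \<phi>(3) by (auto split: split_indicator)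
    ultimately show ?thesis by simp
  qed
  have zero: "convolution \<phi> \<eta> x = 0" if r: "r \<le> \<delta>" and \<eta>: "mollifier r \<eta>" and x: "x \<notin> K'" for r \<eta> x
  proof -
    have zz: "\<phi> y *\<^sub>R \<eta> (x - y) = 0" for y
    proof (cases "y \<in> K")
      case True
      have "x - y \<notin> cball 0 \<delta>"
      proof
        assume "x - y \<in> cball 0 \<delta>"
        moreover have "x = y + (x - y)" by simp
        ultimately show False using x True unfolding K'_def by blast
      qed
      then have "x - y \<notin> ball 0 r" using r by auto
      then show ?thesis using mollifierD(4)[OF \<eta>] by simp
    qed (simp add: \<phi>(3))
    show ?thesis unfolding convolution_def zz by simp
  qed
  show ?thesis
  proof (rule that[OF \<delta>(1) K' KK sub])
    fix r and \<eta> :: "real^'n \<Rightarrow> real" assume r: "r \<le> \<delta>" and \<eta>: "mollifier r \<eta>"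
    have "C_k k (convolution \<phi> \<eta>)" for k
      by (rule convolution_C_k[OF \<phi>i compact_cball[of 0 r]]) (use mollifierD(1,5)[OF \<eta>] in auto)
    moreover have "{x. convolution \<phi> \<eta> x \<noteq> 0} \<subseteq> K'" using zero[OF r \<eta>] by blast
    then have cl: "closure {x. convolution \<phi> \<eta> x \<noteq> 0} \<subseteq> K'"
      by (intro closure_minimal) (use K' in \<open>auto simp: compact_imp_closed\<close>)
    moreover have "compact (closure {x. convolution \<phi> \<eta> x \<noteq> 0})"
      using cl K' by (meson bounded_subset closed_closure compact_eq_bounded_closed)
    ultimately show "convolution \<phi> \<eta> \<in> test_functions U"
      using sub unfolding test_functions_def by blast
  qed (rule zero)
qed

section \<open>From smooth test functions to C1 and continuous ones\<close>

lemma integrable_inner_compact_support: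
  fixes q X :: "'a::euclidean_space \<Rightarrow> 'b::euclidean_space"
  assumes q: "q \<in> borel_measurable borel" "set_integrable lborel K q"
    and X: "continuous_on UNIV X" "compact K" "\<And>x. x \<notin> K \<Longrightarrow> X x = 0"
  shows "integrable lborel (\<lambda>x. q x \<bullet> X x)"
proof -
  obtain c where c: "0 < c" "\<And>x. norm (X x) \<le> c"
    using continuous_compact_support_bounded[OF X(2,3,1)] by blast
  have [measurable]: "X \<in> borel_measurable borel" using X(1) by (rule borel_measurable_continuous_onI)
  note [measurable] = q(1)
  show ?thesis
  proof (rule Bochner_Integration.integrable_bound)
    show "integrable lborel (\<lambda>x. c * norm (indicator K x *\<^sub>R q x))"
      using q(2) unfolding set_integrable_def by (intro integrable_mult_right integrable_norm)
    show "AE x in lborel. norm (q x \<bullet> X x) \<le> norm (c * norm (indicator K x *\<^sub>R q x))"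
    proof (rule AE_I2)
      fix x
      have "\<bar>q x \<bullet> X x\<bar> \<le> norm (q x) * norm (X x)" by (rule Cauchy_Schwarz_ineq2)
      also have "\<dots> \<le> norm (q x) * c" using c by (intro mult_left_mono) auto
      finally show "norm (q x \<bullet> X x) \<le> norm (c * norm (indicator K x *\<^sub>R q x))"
        using X(3)[of x] c by (cases "x \<in> K") (auto simp: mult.commute)
    qed
  qed measurable
qed

text \<open>Since \<open>q\<close> is merely integrable on \<open>K\<close>, the approximation has
  to be uniform, with all supports in \<open>K\<close>.\<close>

lemma integral_inner_zero_by_approximation:
  fixes q X :: "'a::euclidean_space \<Rightarrow> 'b::euclidean_space"
  assumes q: "q \<in> borel_measurable borel" "set_integrable lborel K q" and K: "compact K"
    and X: "continuous_on UNIV X" "\<And>x. x \<notin> K \<Longrightarrow> X x = 0"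
    and appr: "\<And>e. 0 < e \<Longrightarrow> \<exists>Y. continuous_on UNIV Y \<and> (\<forall>x. x \<notin> K \<longrightarrow> Y x = 0) \<and> (\<forall>x. norm (Y x - X x) \<le> e) \<and>
      (\<integral>x. q x \<bullet> Y x \<partial>lborel) = 0"
  shows "(\<integral>x. q x \<bullet> X x \<partial>lborel) = 0"
proof (rule ccontr)
  define N where "N = (\<integral>x. norm (indicator K x *\<^sub>R q x) \<partial>lborel) + 1"
  have N: "0 < N" unfolding N_def by (intro add_nonneg_pos Bochner_Integration.integral_nonneg) auto
  define J where "J = (\<integral>x. q x \<bullet> X x \<partial>lborel)"
  assume "(\<integral>x. q x \<bullet> X x \<partial>lborel) \<noteq> 0"
  then have J: "0 < \<bar>J\<bar>" by (simp add: J_def)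
  \<comment> \<open>With this tolerance the two integrals differ by at most
    \<open>e (N - 1)\<close>, which is less than \<open>e N = |J|\<close>.\<close>
  define e where "e = \<bar>J\<bar> / N"
  have e: "0 < e" using J N by (simp add: e_def)
  obtain Y where Y: "continuous_on UNIV Y" "\<And>x. x \<notin> K \<Longrightarrow> Y x = 0" "\<And>x. norm (Y x - X x) \<le> e"
    "(\<integral>x. q x \<bullet> Y x \<partial>lborel) = 0"
    using appr[OF e] by blast
  have iX: "integrable lborel (\<lambda>x. q x \<bullet> X x)"
    by (rule integrable_inner_compact_support[OF q X(1) K X(2)])
  have iY: "integrable lborel (\<lambda>x. q x \<bullet> Y x)"
    by (rule integrable_inner_compact_support[OF q Y(1) K Y(2)])
  have "- J = (\<integral>x. q x \<bullet> Y x - q x \<bullet> X x \<partial>lborel)"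
    unfolding Bochner_Integration.integral_diff[OF iY iX] Y(4) J_def by simp
  also have "\<bar>\<dots>\<bar> \<le> (\<integral>x. e * norm (indicator K x *\<^sub>R q x) \<partial>lborel)"
    unfolding real_norm_def[symmetric]
  proof (rule Bochner_Integration.integral_norm_bound_integral)
    show "integrable lborel (\<lambda>x. q x \<bullet> Y x - q x \<bullet> X x)" by (rule Bochner_Integration.integrable_diff[OF iY iX])
    show "integrable lborel (\<lambda>x. e * norm (indicator K x *\<^sub>R q x))"
      using q(2) unfolding set_integrable_def by (intro integrable_mult_right integrable_norm)
    fix x
    have "norm (q x \<bullet> Y x - q x \<bullet> X x) = \<bar>q x \<bullet> (Y x - X x)\<bar>" by (simp add: inner_diff_right)
    also have "\<dots> \<le> norm (q x) * norm (Y x - X x)" by (rule Cauchy_Schwarz_ineq2)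
    also have "\<dots> \<le> e * norm (indicator K x *\<^sub>R q x)"
    proof (cases "x \<in> K")
      case True
      then show ?thesis using mult_left_mono[OF Y(3)[of x] norm_ge_zero[of "q x"]] by (simp add: mult.commute)
    qed (simp add: X Y)
    finally show "norm (q x \<bullet> Y x - q x \<bullet> X x) \<le> e * norm (indicator K x *\<^sub>R q x)" .
  qed
  also have "\<dots> = e * (N - 1)" by (simp add: N_def)
  also have "\<dots> < e * N" using e by simp
  also have "\<dots> = \<bar>J\<bar>" using N by (simp add: e_def)
  finally show False by simp
qed

text \<open>The gradient of the mollified \<open>\<phi>\<close> is the mollified \<open>D\<close>,
  which converges uniformly to \<open>D\<close> with supports in a fixed compact set.\<close>

lemma div_free_C1:
  fixes q :: "real^'n \<Rightarrow> real^'n"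
  assumes q: "q \<in> borel_measurable borel" "\<And>K. compact K \<Longrightarrow> K \<subseteq> U \<Longrightarrow> set_integrable lborel K q"
    and eq: "\<And>\<phi>. \<phi> \<in> test_functions U \<Longrightarrow> (\<integral>x. q x \<bullet> grad \<phi> x \<partial>lborel) = 0" and U: "open U"
    and \<phi>: "\<And>x. GDERIV \<phi> x :> D x" "continuous_on UNIV D" "compact K" "K \<subseteq> U" "\<And>x. x \<notin> K \<Longrightarrow> \<phi> x = 0"
  shows "(\<integral>x. q x \<bullet> D x \<partial>lborel) = 0"
proof -
  have \<phi>c: "continuous_on UNIV \<phi>" using borel_measurable_GDERIV_on(2)[of UNIV \<phi> D] \<phi>(1) by auto
  have \<phi>m: "\<phi> \<in> borel_measurable borel" using \<phi>c by (rule borel_measurable_continuous_onI)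
  have D0: "D x = 0" if "x \<notin> K" for x
    using GDERIV_zero_outside[OF compact_imp_closed[OF \<phi>(3)], of \<phi> x "D x"] \<phi>(1,5) that by blast
  obtain \<delta> K' where \<delta>: "0 < \<delta>" and K': "compact K'" "K \<subseteq> K'" "K' \<subseteq> U"
    and test: "\<And>r \<eta>. r \<le> \<delta> \<Longrightarrow> mollifier r \<eta> \<Longrightarrow> convolution \<phi> \<eta> \<in> test_functions U"
    and zero: "\<And>r \<eta> x. r \<le> \<delta> \<Longrightarrow> mollifier r \<eta> \<Longrightarrow> x \<notin> K' \<Longrightarrow> convolution \<phi> \<eta> x = 0"
    using mollified_test_function[OF \<phi>c \<phi>(3,5,4) U] by blast
  show ?thesis
  proof (rule integral_inner_zero_by_approximation[OF q(1) q(2)[OF K'(1,3)] K'(1) \<phi>(2)])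
    show "D x = 0" if "x \<notin> K'" for x using D0 K'(2) that by blast
    fix e :: real assume e: "0 < e"
    obtain d where d: "0 < d" "\<And>r \<eta> x. r \<le> d \<Longrightarrow> mollifier r \<eta> \<Longrightarrow> norm (convolution \<eta> D x - D x) \<le> e"
      using mollify_uniform[OF \<phi>(2,3) D0 e] by blast
    define r where "r = min \<delta> d"
    have r: "0 < r" "r \<le> \<delta>" "r \<le> d" using \<delta> d by (auto simp: r_def)
    obtain \<eta> :: "real^'n \<Rightarrow> real" where \<eta>: "mollifier r \<eta>" using mollifier_ex[OF r(1)] by blast
    note m = mollifierD[OF \<eta>]
    \<comment> \<open>With the roles exchanged, differentiation falls on \<open>\<phi>\<close>
      instead of the mollifier.\<close>
    have sym: "convolution \<phi> \<eta> = convolution \<eta> \<phi>"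
      using convolution_reflect[OF \<phi>m m(9)] by (auto simp: convolution_def)
    have gd: "GDERIV (convolution \<phi> \<eta>) x :> convolution \<eta> D x" for x
      unfolding sym by (rule convolution_GDERIV[OF m(6) \<phi>(1,2,3,5)])
    have gr: "grad (convolution \<phi> \<eta>) x = convolution \<eta> D x" for x
      using partial_deriv_GDERIV[OF gd] by (simp add: grad_def vec_eq_iff)
    show "\<exists>Y. continuous_on UNIV Y \<and> (\<forall>x. x \<notin> K' \<longrightarrow> Y x = 0) \<and> (\<forall>x. norm (Y x - D x) \<le> e) \<and>
      (\<integral>x. q x \<bullet> Y x \<partial>lborel) = 0"
    proof (intro exI[of _ "convolution \<eta> D"] conjI allI impI)
      show "continuous_on UNIV (convolution \<eta> D)" by (rule convolution_continuous[OF m(6) \<phi>(2,3) D0])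
      show "convolution \<eta> D x = 0" if "x \<notin> K'" for x
        using GDERIV_zero_outside[OF compact_imp_closed[OF K'(1)], of "convolution \<phi> \<eta>" x "convolution \<eta> D x"]
          zero[OF r(2) \<eta>] gd that by blast
      show "norm (convolution \<eta> D x - D x) \<le> e" for x by (rule d(2)[OF r(3) \<eta>])
      show "(\<integral>x. q x \<bullet> convolution \<eta> D x \<partial>lborel) = 0"
        using eq[OF test[OF r(2) \<eta>]] by (simp add: gr)
    qed
  qed
qed

text \<open>The fundamental lemma of the calculus of variations. Mollification extends the identity
  to continuous test functions. Bounded ones converging almost everywhere to a cutoff times
  \<open>sgn d\<close> show that \<open>|d|\<close> has integral zero near each point, and countably
  many balls cover \<open>U\<close>.\<close>

lemma test_functions_separate:
  fixes d :: "real^'n \<Rightarrow> real"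
  assumes d: "d \<in> borel_measurable borel" "\<And>K. compact K \<Longrightarrow> K \<subseteq> U \<Longrightarrow> set_integrable lborel K d"
    and eq: "\<And>\<phi>. \<phi> \<in> test_functions U \<Longrightarrow> (\<integral>x. d x * \<phi> x \<partial>lborel) = 0" and U: "open U"
  shows "AE x in lborel. x \<in> U \<longrightarrow> d x = 0"
proof -
  note [measurable] = d(1)
  have cont: "(\<integral>x. d x * \<phi> x \<partial>lborel) = 0"
    if \<phi>: "continuous_on UNIV \<phi>" "compact K" "K \<subseteq> U" "\<And>x. x \<notin> K \<Longrightarrow> \<phi> x = 0" for \<phi> K
  proof -
    have \<phi>m: "\<phi> \<in> borel_measurable borel" using \<phi>(1) by (rule borel_measurable_continuous_onI)
    obtain \<delta> K' where \<delta>: "0 < \<delta>" and K': "compact K'" "K \<subseteq> K'" "K' \<subseteq> U"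
      and test: "\<And>r \<eta>. r \<le> \<delta> \<Longrightarrow> mollifier r \<eta> \<Longrightarrow> convolution \<phi> \<eta> \<in> test_functions U"
      and zero: "\<And>r \<eta> x. r \<le> \<delta> \<Longrightarrow> mollifier r \<eta> \<Longrightarrow> x \<notin> K' \<Longrightarrow> convolution \<phi> \<eta> x = 0"
      using mollified_test_function[OF \<phi>(1,2,4,3) U] by blast
    have "(\<integral>x. d x \<bullet> \<phi> x \<partial>lborel) = 0"
    proof (rule integral_inner_zero_by_approximation[OF d(1) d(2)[OF K'(1,3)] K'(1) \<phi>(1)])
      show "\<phi> x = 0" if "x \<notin> K'" for x using \<phi>(4) K'(2) that by blast
      fix e :: real assume e: "0 < e"
      obtain d' where d': "0 < d'" "\<And>r \<eta> x. r \<le> d' \<Longrightarrow> mollifier r \<eta> \<Longrightarrow> norm (convolution \<eta> \<phi> x - \<phi> x) \<le> e"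
        using mollify_uniform[OF \<phi>(1,2,4) e] by blast
      define r where "r = min \<delta> d'"
      have r: "0 < r" "r \<le> \<delta>" "r \<le> d'" using \<delta> d' by (auto simp: r_def)
      obtain \<eta> :: "real^'n \<Rightarrow> real" where \<eta>: "mollifier r \<eta>" using mollifier_ex[OF r(1)] by blast
      note m = mollifierD[OF \<eta>]
      have sym: "convolution \<phi> \<eta> = convolution \<eta> \<phi>"
        using convolution_reflect[OF \<phi>m m(9)] by (auto simp: convolution_def)
      show "\<exists>Y. continuous_on UNIV Y \<and> (\<forall>x. x \<notin> K' \<longrightarrow> Y x = 0) \<and> (\<forall>x. norm (Y x - \<phi> x) \<le> e) \<and>
        (\<integral>x. d x \<bullet> Y x \<partial>lborel) = 0"
      proof (intro exI[of _ "convolution \<eta> \<phi>"] conjI allI impI)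
        show "continuous_on UNIV (convolution \<eta> \<phi>)" by (rule convolution_continuous[OF m(6) \<phi>(1,2,4)])
        show "convolution \<eta> \<phi> x = 0" if "x \<notin> K'" for x using zero[OF r(2) \<eta> that] sym by simp
        show "norm (convolution \<eta> \<phi> x - \<phi> x) \<le> e" for x by (rule d'(2)[OF r(3) \<eta>])
        show "(\<integral>x. d x \<bullet> convolution \<eta> \<phi> x \<partial>lborel) = 0"
          using eq[OF test[OF r(2) \<eta>]] sym by simp
      qed
    qed
    then show ?thesis by simp
  qed
  define \<B> where "\<B> = {b. \<exists>x r. 0 < r \<and> b = ball x r \<and> b \<subseteq> U \<and> (AE y in lborel. y \<in> b \<longrightarrow> d y = 0)}"
  have "U \<subseteq> \<Union>\<B>"
  proof
    fix x assume "x \<in> U"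
    then obtain \<delta> where \<delta>: "0 < \<delta>" "cball x \<delta> \<subseteq> U" using U open_contains_cball by blast
    obtain G where G: "\<And>n::nat. continuous_on UNIV (G n)" "AE y in lborel. (\<lambda>n. G n y) \<longlonglongrightarrow> sgn (d y)"
      using continuous_approximation_AE[of "\<lambda>y. sgn (d y)"] by auto
    have [measurable]: "G n \<in> borel_measurable borel" for n using G(1) by (rule borel_measurable_continuous_onI)
    obtain \<xi> :: "real^'n \<Rightarrow> real" where \<xi>: "continuous_on UNIV \<xi>" "\<And>y. 0 \<le> \<xi> y" "\<And>y. \<xi> y \<le> 1" "\<And>y. y \<in> cball x (\<delta> / 2) \<Longrightarrow> \<xi> y = 1"
      "\<And>y. y \<notin> cball x (\<delta> / 2 + \<delta> / 2) \<Longrightarrow> \<xi> y = 0"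
      using continuous_cutoff[of "\<delta> / 2" x "\<delta> / 2"] \<delta> by auto
    have [measurable]: "\<xi> \<in> borel_measurable borel" using \<xi>(1) by (rule borel_measurable_continuous_onI)
    define \<phi> where "\<phi> n y = \<xi> y * clamp_real 1 (G n y)" for n y
    have \<phi>c: "continuous_on UNIV (\<phi> n)" for n
      unfolding \<phi>_def[abs_def] using continuous_on_compose2[OF continuous_clamp_real G(1)] by (intro continuous_intros \<xi>(1)) auto
    have [measurable]: "\<phi> n \<in> borel_measurable borel" for n using \<phi>c by (rule borel_measurable_continuous_onI)
    have \<phi>0: "\<phi> n y = 0" if "y \<notin> cball x \<delta>" for n y using \<xi>(5)[of y] that by (simp add: \<phi>_def)
    have zero: "(\<integral>y. d y * \<phi> n y \<partial>lborel) = 0" for n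
      by (rule cont[OF \<phi>c compact_cball \<delta>(2) \<phi>0])
    have dom: "integrable lborel (\<lambda>y. norm (indicator (cball x \<delta>) y *\<^sub>R d y))"
      using d(2)[OF compact_cball \<delta>(2)] unfolding set_integrable_def by (rule integrable_norm)
    have lim: "AE y in lborel. (\<lambda>n. d y * \<phi> n y) \<longlonglongrightarrow> \<xi> y * \<bar>d y\<bar>"
      using G(2)
    proof eventually_elim
      case (elim y)
      have "isCont (clamp_real 1) (sgn (d y))"
        using continuous_clamp_real[of 1] by (simp add: continuous_on_eq_continuous_at)
      then have "(\<lambda>n. clamp_real 1 (G n y)) \<longlonglongrightarrow> clamp_real 1 (sgn (d y))"
        using elim by (rule isCont_tendsto_compose)
      then have "(\<lambda>n. d y * \<phi> n y) \<longlonglongrightarrow> d y * (\<xi> y * clamp_real 1 (sgn (d y)))"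
        unfolding \<phi>_def by (intro tendsto_intros)
      moreover have "clamp_real 1 (sgn (d y)) = sgn (d y)"
        by (rule clamp_real_bounds(3)) (auto simp: sgn_if)
      ultimately show ?case by (simp add: abs_sgn mult_ac)
    qed
    have bd: "AE y in lborel. norm (d y * \<phi> n y) \<le> norm (indicator (cball x \<delta>) y *\<^sub>R d y)" for n
    proof (rule AE_I2)
      fix y
      have "\<bar>\<phi> n y\<bar> \<le> 1 * 1"
        unfolding \<phi>_def abs_mult using \<xi>(2,3)[of y] clamp_real_bounds(1)[of 1] by (intro mult_mono) auto
      then have "\<bar>d y\<bar> * \<bar>\<phi> n y\<bar> \<le> \<bar>d y\<bar> * 1" by (intro mult_left_mono) auto
      then show "norm (d y * \<phi> n y) \<le> norm (indicator (cball x \<delta>) y *\<^sub>R d y)"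
        using \<phi>0[of y n] by (cases "y \<in> cball x \<delta>") (auto simp: abs_mult)
    qed
    have m1: "(\<lambda>y. \<xi> y * \<bar>d y\<bar>) \<in> borel_measurable lborel" by measurable
    have m2: "(\<lambda>y. d y * \<phi> n y) \<in> borel_measurable lborel" for n by measurable
    have int: "integrable lborel (\<lambda>y. \<xi> y * \<bar>d y\<bar>)"
      by (rule integrable_dominated_convergence[OF m1 m2 dom lim bd])
    have "(\<lambda>n. \<integral>y. d y * \<phi> n y \<partial>lborel) \<longlonglongrightarrow> (\<integral>y. \<xi> y * \<bar>d y\<bar> \<partial>lborel)"
      by (rule integral_dominated_convergence[OF m1 m2 dom lim bd])
    then have "(\<integral>y. \<xi> y * \<bar>d y\<bar> \<partial>lborel) = 0" unfolding zero by (simp add: LIMSEQ_const_iff)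
    then have "AE y in lborel. \<xi> y * \<bar>d y\<bar> = 0"
      using integral_nonneg_eq_0_iff_AE[OF int] \<xi>(2) by auto
    then have "AE y in lborel. y \<in> ball x (\<delta> / 2) \<longrightarrow> d y = 0"
    proof eventually_elim
      case (elim y)
      then show ?case using \<xi>(4)[of y] by auto
    qed
    moreover have "ball x (\<delta> / 2) \<subseteq> U" using \<delta> subset_ball[of "\<delta> / 2" \<delta> x] ball_subset_cball by force
    ultimately have "ball x (\<delta> / 2) \<in> \<B>" unfolding \<B>_def using \<delta>(1) half_gt_zero by blast
    then show "x \<in> \<Union>\<B>" using \<delta>(1) by (meson UnionI centre_in_ball half_gt_zero)
  qed
  obtain \<C> where \<C>: "\<C> \<subseteq> \<B>" "countable \<C>" "\<Union>\<C> = \<Union>\<B>"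
    using Lindelof[of \<B>] unfolding \<B>_def by blast
  have "AE x in lborel. \<forall>b\<in>\<C>. x \<in> b \<longrightarrow> d x = 0"
    unfolding AE_ball_countable[OF \<C>(2)] using \<C>(1) unfolding \<B>_def by blast
  then show ?thesis
    by eventually_elim (use \<open>U \<subseteq> \<Union>\<B>\<close> \<C>(3) in blast)
qed

text \<open>Polarisation in place of eigenvalues: let \<open>y\<close> point in the direction of
  \<open>A \<xi>\<close> with the length of \<open>\<xi>\<close>. By symmetry
  \<open>4 (A \<xi> \<bullet> y)\<close> is the difference of the quadratic form at
  \<open>\<xi> + y\<close> and at \<open>\<xi> - y\<close>, hence at most
  \<open>\<Lambda> |\<xi> + y|^2 \<le> 4 \<Lambda> |\<xi>|^2\<close>.\<close>

lemma symmetric_matrix_norm_bound: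
  fixes A :: "real^'n^'n"
  assumes sym: "transpose A = A" and A: "\<And>\<xi>. 0 \<le> (A *v \<xi>) \<bullet> \<xi>" "\<And>\<xi>. (A *v \<xi>) \<bullet> \<xi> \<le> \<Lambda> * (norm \<xi>)\<^sup>2"
  shows "norm (A *v \<xi>) \<le> \<Lambda> * norm \<xi>"
proof (cases "A *v \<xi> = 0 \<or> \<xi> = 0")
  case True
  have "0 \<le> \<Lambda> * (norm \<xi>)\<^sup>2" using A order_trans by blast
  then have "0 \<le> \<Lambda> * norm \<xi>" by (cases "\<xi> = 0") (auto simp: zero_le_mult_iff)
  then show ?thesis using True by auto
next
  case False
  have b_sym: "(A *v x) \<bullet> y = (A *v y) \<bullet> x" for x y
    by (metis dot_lmul_matrix inner_commute sym transpose_matrix_vector)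
  define s where "s = norm \<xi> / norm (A *v \<xi>)"
  define y where "y = s *\<^sub>R (A *v \<xi>)"
  have ny: "norm y = norm \<xi>" using False by (simp add: y_def s_def)
  have "4 * ((A *v \<xi>) \<bullet> y) = (A *v (\<xi> + y)) \<bullet> (\<xi> + y) - (A *v (\<xi> - y)) \<bullet> (\<xi> - y)"
    using b_sym[of \<xi> y] by (simp add: matrix_vector_right_distrib matrix_vector_mult_diff_distrib inner_simps)
  also have "\<dots> \<le> \<Lambda> * (norm (\<xi> + y))\<^sup>2" using A(1)[of "\<xi> - y"] A(2)[of "\<xi> + y"] by linarith
  also have "\<dots> \<le> \<Lambda> * (2 * norm \<xi>)\<^sup>2"
  proof -
    have "0 \<le> \<Lambda> * (norm \<xi>)\<^sup>2" using A order_trans by blast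
    then have "0 \<le> \<Lambda>" using False by (simp add: zero_le_mult_iff)
    moreover have "norm (\<xi> + y) \<le> 2 * norm \<xi>" using norm_triangle_ineq[of \<xi> y] ny by simp
    ultimately show ?thesis by (intro mult_left_mono power_mono) auto
  qed
  finally have "(A *v \<xi>) \<bullet> y \<le> \<Lambda> * (norm \<xi>)\<^sup>2" by (simp add: power_mult_distrib)
  moreover have "(A *v \<xi>) \<bullet> y = norm \<xi> * norm (A *v \<xi>)"
    using False by (simp add: y_def s_def power2_norm_eq_inner[symmetric] power2_eq_square)
  ultimately have "norm \<xi> * norm (A *v \<xi>) \<le> norm \<xi> * (\<Lambda> * norm \<xi>)"
    by (simp add: power2_eq_square mult_ac)
  then show ?thesis using False by simp
qed

section \<open>The weak equation in Borel form\<close>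

lemma vec_component_measurable:
  assumes "g \<in> borel_measurable M"
  shows "(\<lambda>x. g x $ i :: real) \<in> borel_measurable M"
  using borel_measurable_inner[OF assms borel_measurable_const[of "axis i 1"]] by (simp add: inner_axis)

lemma borel_measurable_vec_lambda:
  fixes g :: "'n::finite \<Rightarrow> 'a \<Rightarrow> real"
  assumes "\<And>i. g i \<in> borel_measurable M"
  shows "(\<lambda>x. \<chi> i. g i x) \<in> borel_measurable M"
proof -
  have "(\<lambda>x. \<chi> i. g i x) = (\<lambda>x. \<Sum>i\<in>UNIV. g i x *\<^sub>R axis i 1)"
  proof
    fix x show "(\<chi> i. g i x) = (\<Sum>i\<in>UNIV. g i x *\<^sub>R axis i 1)"
      using basis_expansion[of "\<chi> i. g i x"] by (simp add: scalar_mult_eq_scaleR)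
  qed
  moreover have "(\<lambda>x. \<Sum>i\<in>UNIV. g i x *\<^sub>R (axis i 1 :: real^'n)) \<in> borel_measurable M"
    using assms by measurable
  ultimately show ?thesis by simp
qed

lemma lebesgue_on_borel_version_vec:
  fixes g :: "real^'n \<Rightarrow> real^'m"
  assumes g: "g \<in> borel_measurable (lebesgue_on U)" and U: "open U"
  obtains G where "G \<in> borel_measurable borel" "AE x in lborel. x \<in> U \<longrightarrow> G x = g x" "\<And>x. x \<notin> U \<Longrightarrow> G x = 0"
proof -
  have "\<exists>H. H \<in> borel_measurable borel \<and> (AE x in lborel. x \<in> U \<longrightarrow> H x = g x $ i) \<and> (\<forall>x. x \<notin> U \<longrightarrow> H x = 0)" for i
    by (rule lebesgue_on_borel_version[OF vec_component_measurable[OF g] U, of i]) blast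
  then have "\<forall>i. \<exists>H. H \<in> borel_measurable borel \<and> (AE x in lborel. x \<in> U \<longrightarrow> H x = g x $ i) \<and> (\<forall>x. x \<notin> U \<longrightarrow> H x = 0)"
    by blast
  from choice[OF this] obtain H where H: "\<And>i. H i \<in> borel_measurable borel" "\<And>i. AE x in lborel. x \<in> U \<longrightarrow> H i x = g x $ i"
    "\<And>i x. x \<notin> U \<Longrightarrow> H i x = 0" by blast
  show ?thesis
  proof (rule that[of "\<lambda>x. \<chi> i. H i x"])
    show "(\<lambda>x. \<chi> i. H i x) \<in> borel_measurable borel" by (rule borel_measurable_vec_lambda[OF H(1)])
    have "AE x in lborel. \<forall>i\<in>UNIV. x \<in> U \<longrightarrow> H i x = g x $ i"
      by (intro AE_finite_allI H(2)) simp
    then show "AE x in lborel. x \<in> U \<longrightarrow> (\<chi> i. H i x) = g x"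
      by eventually_elim (simp add: vec_eq_iff)
  qed (simp add: H(3) vec_eq_iff)
qed

lemma test_function_measurable:
  assumes "\<phi> \<in> test_functions U"
  shows "\<phi> \<in> borel_measurable borel" "partial_deriv i \<phi> \<in> borel_measurable borel" "grad \<phi> \<in> borel_measurable borel"
proof -
  have C: "\<And>k. C_k k \<phi>" using assms by (simp add: test_functions_def)
  note g = continuous_on_grad[OF C]
  show "\<phi> \<in> borel_measurable borel" using C[of 0] by (simp add: borel_measurable_continuous_onI)
  show "grad \<phi> \<in> borel_measurable borel" using g(2) by (rule borel_measurable_continuous_onI)
  show "partial_deriv i \<phi> \<in> borel_measurable borel" using g(3)[of 0 i] by (simp add: borel_measurable_continuous_onI)
qed

lemma weak_gradient_borel:
  fixes f :: "real^'n \<Rightarrow> real"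
  assumes wg: "has_weak_gradient U f g" and U: "open U" and \<phi>: "\<phi> \<in> test_functions U"
    and F: "F \<in> borel_measurable borel" "AE x in lborel. x \<in> U \<longrightarrow> F x = f x" "\<And>x. x \<notin> U \<Longrightarrow> F x = 0"
    and G: "G \<in> borel_measurable borel" "AE x in lborel. x \<in> U \<longrightarrow> G x = g x" "\<And>x. x \<notin> U \<Longrightarrow> G x = 0"
  shows "(\<integral>x. F x * partial_deriv i \<phi> x \<partial>lborel) = - (\<integral>x. G x $ i * \<phi> x \<partial>lborel)"
proof -
  note t = test_function_measurable[OF \<phi>]
  note [measurable] = t F(1) vec_component_measurable[OF G(1)]
  have fm: "f \<in> borel_measurable (lebesgue_on U)" and gm: "g \<in> borel_measurable (lebesgue_on U)"
    using wg L1_loc_measurable[OF _ U] unfolding has_weak_gradient_def by blast+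
  have "integral\<^sup>L (lebesgue_on U) (\<lambda>x. f x * partial_deriv i \<phi> x) = (\<integral>x. F x * partial_deriv i \<phi> x \<partial>lborel)"
  proof (rule lebesgue_on_integral_eq(1)[OF _ U])
    show "(\<lambda>x. f x * partial_deriv i \<phi> x) \<in> borel_measurable (lebesgue_on U)"
      by (intro borel_measurable_times fm borel_measurable_lebesgue_on t)
    show "AE x in lborel. x \<in> U \<longrightarrow> F x * partial_deriv i \<phi> x = f x * partial_deriv i \<phi> x"
      using F(2) by eventually_elim auto
  qed (use F(3) in auto)
  moreover have "integral\<^sup>L (lebesgue_on U) (\<lambda>x. g x $ i * \<phi> x) = (\<integral>x. G x $ i * \<phi> x \<partial>lborel)"
  proof (rule lebesgue_on_integral_eq(1)[OF _ U])
    show "(\<lambda>x. g x $ i * \<phi> x) \<in> borel_measurable (lebesgue_on U)"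
      by (intro borel_measurable_times vec_component_measurable[OF gm] borel_measurable_lebesgue_on t)
    show "AE x in lborel. x \<in> U \<longrightarrow> G x $ i * \<phi> x = g x $ i * \<phi> x"
      using G(2) by eventually_elim auto
  qed (use G(3) in auto)
  ultimately show ?thesis using wg \<phi> unfolding has_weak_gradient_def by auto
qed

lemma L1_loc_borel:
  fixes g :: "real^'n \<Rightarrow> real^'n"
  assumes g: "g \<in> L1_loc U" and U: "open U" and K: "compact K" "K \<subseteq> U"
    and G: "G \<in> borel_measurable borel" "AE x in lborel. x \<in> U \<longrightarrow> G x = g x"
  shows "set_integrable lborel K G"
proof -
  have [measurable]: "K \<in> sets borel" using K(1) by (simp add: compact_imp_closed)
  note [measurable] = G(1)
  have KS: "K \<inter> space lebesgue \<in> sets lebesgue" using K(1) by (simp add: compact_imp_closed)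
  have "integrable (lebesgue_on K) g" using g K unfolding L1_loc_def by blast
  then have i: "integrable lebesgue (\<lambda>x. indicator K x *\<^sub>R g x)" by (simp only: integrable_restrict_space[OF KS])
  have m: "(\<lambda>x. indicator K x *\<^sub>R G x) \<in> borel_measurable lborel" by measurable
  have ae: "AE x in lebesgue. indicator K x *\<^sub>R g x = indicator K x *\<^sub>R G x"
    unfolding AE_completion_iff using G(2)
  proof eventually_elim
    case (elim x)
    then show ?case using K(2) by (cases "x \<in> K") auto
  qed
  have "integrable lebesgue (\<lambda>x. indicator K x *\<^sub>R G x)"
    by (rule integrable_cong_AE[OF borel_measurable_integrable[OF i] measurable_completion[OF m] ae, THEN iffD1, OF i])
  then show ?thesis unfolding set_integrable_def using integrable_completion[OF m] by simp
qed

lemma AE_lebesgue_on_open: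
  fixes U :: "'a::euclidean_space set"
  assumes "open U"
  shows "(AE x in lebesgue_on U. P x) \<longleftrightarrow> (AE x in lborel. x \<in> U \<longrightarrow> P x)"
proof -
  have "U \<inter> space lebesgue \<in> sets lebesgue" using assms by simp
  then show ?thesis by (simp only: AE_restrict_space_iff AE_completion_iff)
qed

text \<open>A weak solution comes with two weak gradients: a square integrable one from membership
  in H1, and a locally integrable one in the equation. Once they are known to agree almost
  everywhere, the flux is formed with the former.\<close>

lemma weak_solution_flux:
  fixes f :: "real^'n \<Rightarrow> real"
  assumes Lam: "0 < \<Lambda>" and U: "open U" and A: "elliptic_coefficients \<Lambda> U A" and ws: "weak_solution U A f"
  obtains F G Q where "flux_solution \<Lambda> U F G Q" "AE x in lborel. x \<in> U \<longrightarrow> F x = f x"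
    "sqrt (\<integral>x. indicator U x * (F x)\<^sup>2 \<partial>lborel) = L2_norm U f"
proof -
  have [measurable]: "U \<in> sets borel" using U by simp
  from ws obtain g0 g where f2: "f \<in> L2_space U" and w0: "has_weak_gradient U f g0" and g02: "g0 \<in> L2_space U"
    and w: "has_weak_gradient U f g"
    and eq: "\<And>\<phi>. \<phi> \<in> test_functions U \<Longrightarrow> integral\<^sup>L (lebesgue_on U) (\<lambda>x. (A x *v g x) \<bullet> grad \<phi> x) = 0"
    unfolding weak_solution_def H1_space_def by blast
  have fm: "f \<in> borel_measurable (lebesgue_on U)" and g0m: "g0 \<in> borel_measurable (lebesgue_on U)"
    using f2 g02 by (auto simp: L2_space_def)
  have gL: "g \<in> L1_loc U" and g0L: "g0 \<in> L1_loc U" using w w0 by (auto simp: has_weak_gradient_def)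
  have gm: "g \<in> borel_measurable (lebesgue_on U)" by (rule L1_loc_measurable[OF gL U])
  obtain F where F: "F \<in> borel_measurable borel" "AE x in lborel. x \<in> U \<longrightarrow> F x = f x" "\<And>x. x \<notin> U \<Longrightarrow> F x = 0"
    using lebesgue_on_borel_version[OF fm U] by blast
  obtain G where G: "G \<in> borel_measurable borel" "AE x in lborel. x \<in> U \<longrightarrow> G x = g0 x" "\<And>x. x \<notin> U \<Longrightarrow> G x = 0"
    using lebesgue_on_borel_version_vec[OF g0m U] by blast
  obtain G1 where G1: "G1 \<in> borel_measurable borel" "AE x in lborel. x \<in> U \<longrightarrow> G1 x = g x" "\<And>x. x \<notin> U \<Longrightarrow> G1 x = 0"
    using lebesgue_on_borel_version_vec[OF gm U] by blast
  note [measurable] = F(1) G(1) vec_component_measurable[OF G(1)] vec_component_measurable[OF G1(1)]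
  have sq: "integral\<^sup>L (lebesgue_on U) (\<lambda>x. (norm (f x))\<^sup>2) = (\<integral>x. (F x)\<^sup>2 \<partial>lborel)"
    and sqi: "integrable lborel (\<lambda>x. (F x)\<^sup>2)"
  proof -
    have h: "(\<lambda>x. (norm (f x))\<^sup>2) \<in> borel_measurable (lebesgue_on U)" using fm by measurable
    have Fm: "(\<lambda>x. (F x)\<^sup>2) \<in> borel_measurable borel" by measurable
    have ae: "AE x in lborel. x \<in> U \<longrightarrow> (F x)\<^sup>2 = (norm (f x))\<^sup>2" using F(2) by eventually_elim auto
    have z: "(F x)\<^sup>2 = 0" if "x \<notin> U" for x using F(3)[OF that] by simp
    show "integral\<^sup>L (lebesgue_on U) (\<lambda>x. (norm (f x))\<^sup>2) = (\<integral>x. (F x)\<^sup>2 \<partial>lborel)"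
      by (rule lebesgue_on_integral_eq(1)[OF h U Fm ae z])
    have "integrable (lebesgue_on U) (\<lambda>x. (norm (f x))\<^sup>2) \<longleftrightarrow> integrable lborel (\<lambda>x. (F x)\<^sup>2)"
      by (rule lebesgue_on_integral_eq(2)[OF h U Fm ae z])
    then show "integrable lborel (\<lambda>x. (F x)\<^sup>2)" using f2 by (auto simp: L2_space_def)
  qed
  have gsq: "integrable lborel (\<lambda>x. (norm (G x))\<^sup>2)"
  proof -
    have h: "(\<lambda>x. (norm (g0 x))\<^sup>2) \<in> borel_measurable (lebesgue_on U)" using g0m by measurable
    have Gm: "(\<lambda>x. (norm (G x))\<^sup>2) \<in> borel_measurable borel" by measurable
    have ae: "AE x in lborel. x \<in> U \<longrightarrow> (norm (G x))\<^sup>2 = (norm (g0 x))\<^sup>2" using G(2) by eventually_elim auto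
    have z: "(norm (G x))\<^sup>2 = 0" if "x \<notin> U" for x using G(3)[OF that] by simp
    have "integrable (lebesgue_on U) (\<lambda>x. (norm (g0 x))\<^sup>2) \<longleftrightarrow> integrable lborel (\<lambda>x. (norm (G x))\<^sup>2)"
      by (rule lebesgue_on_integral_eq(2)[OF h U Gm ae z])
    then show ?thesis using g02 by (auto simp: L2_space_def)
  qed
  \<comment> \<open>Both gradients satisfy the same integration by parts against \<open>F\<close>,
    so each component of their difference is orthogonal to all test functions.\<close>
  have GG1: "AE x in lborel. x \<in> U \<longrightarrow> G1 x = G x"
  proof -
    have "AE x in lborel. x \<in> U \<longrightarrow> G1 x $ i - G x $ i = 0" for i
    proof (rule test_functions_separate[where d="\<lambda>x. G1 x $ i - G x $ i", OF _ _ _ U])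
      show "(\<lambda>x. G1 x $ i - G x $ i) \<in> borel_measurable borel"
        by (intro borel_measurable_diff vec_component_measurable G1(1) G(1))
      show "set_integrable lborel K (\<lambda>x. G1 x $ i - G x $ i)" if K: "compact K" "K \<subseteq> U" for K
      proof -
        have "integrable lborel (\<lambda>x. indicator K x *\<^sub>R G1 x)" "integrable lborel (\<lambda>x. indicator K x *\<^sub>R G x)"
          using L1_loc_borel[OF gL U K G1(1,2)] L1_loc_borel[OF g0L U K G(1,2)] by (auto simp: set_integrable_def)
        then have "integrable lborel (\<lambda>x. indicator K x *\<^sub>R G1 x - indicator K x *\<^sub>R G x)"
          by (rule Bochner_Integration.integrable_diff)
        then have "integrable lborel (\<lambda>x. (indicator K x *\<^sub>R G1 x - indicator K x *\<^sub>R G x) \<bullet> axis i 1)"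
          by (rule integrable_inner_left)
        moreover have "(indicator K x *\<^sub>R G1 x - indicator K x *\<^sub>R G x) \<bullet> axis i 1 = indicator K x *\<^sub>R (G1 x $ i - G x $ i)" for x
          by (simp add: inner_axis right_diff_distrib)
        ultimately show ?thesis unfolding set_integrable_def by (simp only:)
      qed
      fix \<phi> assume \<phi>: "\<phi> \<in> test_functions U"
      have C: "\<And>k. C_k k \<phi>" and S: "compact (closure {x. \<phi> x \<noteq> 0})" "closure {x. \<phi> x \<noteq> 0} \<subseteq> U"
        using \<phi> unfolding test_functions_def by blast+
      let ?S = "closure {x. \<phi> x \<noteq> 0}"
      have \<phi>c: "continuous_on UNIV \<phi>" using C[of 0] by simp
      have \<phi>0: "\<phi> x = 0" if "x \<notin> ?S" for x
      proof (rule ccontr)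
        assume "\<phi> x \<noteq> 0"
        then have "x \<in> {x. \<phi> x \<noteq> 0}" by simp
        then have "x \<in> ?S" by (rule subsetD[OF closure_subset])
        with that show False by simp
      qed
      have ax1: "continuous_on UNIV (\<lambda>x. \<phi> x *\<^sub>R (axis i 1 :: real^'n))"
        by (intro continuous_on_scaleR \<phi>c continuous_on_const)
      have ax2: "\<phi> x *\<^sub>R axis i 1 = (0 :: real^'n)" if "x \<notin> ?S" for x
        using \<phi>0[OF that] by simp
      have ip: "integrable lborel (\<lambda>x. H x $ i * \<phi> x)"
        if H: "H \<in> borel_measurable borel" "set_integrable lborel ?S H" for H :: "real^'n \<Rightarrow> real^'n"
      proof -
        have "integrable lborel (\<lambda>x. H x \<bullet> (\<phi> x *\<^sub>R axis i 1))"
          by (rule integrable_inner_compact_support[OF H ax1 S(1) ax2])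
        moreover have "H x \<bullet> (\<phi> x *\<^sub>R axis i 1) = H x $ i * \<phi> x" for x
          by (simp add: inner_axis)
        ultimately show ?thesis by (simp only:)
      qed
      have i1: "integrable lborel (\<lambda>x. G1 x $ i * \<phi> x)"
        by (rule ip[OF G1(1) L1_loc_borel[OF gL U S G1(1,2)]])
      have i2: "integrable lborel (\<lambda>x. G x $ i * \<phi> x)"
        by (rule ip[OF G(1) L1_loc_borel[OF g0L U S G(1,2)]])
      have e1: "(\<integral>x. F x * partial_deriv i \<phi> x \<partial>lborel) = - (\<integral>x. G1 x $ i * \<phi> x \<partial>lborel)"
        by (rule weak_gradient_borel[OF w U \<phi>]) fact+
      have e2: "(\<integral>x. F x * partial_deriv i \<phi> x \<partial>lborel) = - (\<integral>x. G x $ i * \<phi> x \<partial>lborel)"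
        by (rule weak_gradient_borel[OF w0 U \<phi>]) fact+
      have "(\<integral>x. (G1 x $ i - G x $ i) * \<phi> x \<partial>lborel) = (\<integral>x. G1 x $ i * \<phi> x - G x $ i * \<phi> x \<partial>lborel)"
        by (simp only: left_diff_distrib)
      also have "\<dots> = 0" unfolding Bochner_Integration.integral_diff[OF i1 i2] using e1 e2 by linarith
      finally show "(\<integral>x. (G1 x $ i - G x $ i) * \<phi> x \<partial>lborel) = 0" .
    qed
    then have "AE x in lborel. \<forall>i\<in>UNIV. x \<in> U \<longrightarrow> G1 x $ i - G x $ i = 0"
      by (intro AE_finite_allI) simp
    then show ?thesis by eventually_elim (simp add: vec_eq_iff)
  qed
  have Aij: "(\<lambda>x. A x $ i $ j) \<in> borel_measurable (lebesgue_on U)" for i j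
    using A by (simp add: elliptic_coefficients_def)
  have "\<exists>H. H \<in> borel_measurable borel \<and> (AE x in lborel. x \<in> U \<longrightarrow> H x = A x $ fst p $ snd p)" for p
    by (rule lebesgue_on_borel_version[OF Aij U, of "fst p" "snd p"]) blast
  then have "\<forall>p. \<exists>H. H \<in> borel_measurable borel \<and> (AE x in lborel. x \<in> U \<longrightarrow> H x = A x $ fst p $ snd p)"
    by blast
  from choice[OF this] obtain a' where a': "\<And>p. a' p \<in> borel_measurable borel"
    "\<And>p. AE x in lborel. x \<in> U \<longrightarrow> a' p x = A x $ fst p $ snd p"
    by blast
  define a where "a i j = a' (i, j)" for i j
  have a: "\<And>i j. a i j \<in> borel_measurable borel" "\<And>i j. AE x in lborel. x \<in> U \<longrightarrow> a i j x = A x $ i $ j"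
  proof -
    fix i j
    show "a i j \<in> borel_measurable borel" unfolding a_def by (rule a'(1))
    show "AE x in lborel. x \<in> U \<longrightarrow> a i j x = A x $ i $ j" using a'(2)[of "(i, j)"] by (simp add: a_def)
  qed
  \<comment> \<open>Borel versions of the matrix entries make \<open>Q\<close> Borel; it agrees with
    \<open>A x *v G x\<close> almost everywhere on \<open>U\<close> and vanishes outside.\<close>
  define Q where "Q x = (\<chi> i. \<Sum>j\<in>UNIV. a i j x * G x $ j)" for x
  have Qm: "Q \<in> borel_measurable borel"
    unfolding Q_def[abs_def] by (rule borel_measurable_vec_lambda) (use a(1) in measurable)
  have Q0: "Q x = 0" if "x \<notin> U" for x using G(3)[OF that] by (simp add: Q_def vec_eq_iff)
  have aA: "AE x in lborel. \<forall>i\<in>UNIV. \<forall>j\<in>UNIV. x \<in> U \<longrightarrow> a i j x = A x $ i $ j"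
    by (intro AE_finite_allI a(2)) auto
  have QA: "AE x in lborel. x \<in> U \<longrightarrow> Q x = A x *v G x"
    using aA by eventually_elim (simp add: Q_def matrix_vector_mult_def)
  have ell: "AE x in lborel. x \<in> U \<longrightarrow> (\<forall>\<xi>. inverse \<Lambda> * (norm \<xi>)\<^sup>2 \<le> (A x *v \<xi>) \<bullet> \<xi> \<and> (A x *v \<xi>) \<bullet> \<xi> \<le> \<Lambda> * (norm \<xi>)\<^sup>2)"
    by (rule AE_lebesgue_on_open[OF U, THEN iffD1]) (use A[unfolded elliptic_coefficients_def] in blast)
  have flux: "AE x in lborel. x \<in> U \<longrightarrow> norm (Q x) \<le> \<Lambda> * norm (G x) \<and> (norm (G x))\<^sup>2 \<le> \<Lambda> * (Q x \<bullet> G x)"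
    using QA ell
  proof eventually_elim
    case (elim x)
    show ?case
    proof
      assume x: "x \<in> U"
      then have Q: "Q x = A x *v G x" and e: "\<And>\<xi>. inverse \<Lambda> * (norm \<xi>)\<^sup>2 \<le> (A x *v \<xi>) \<bullet> \<xi>" "\<And>\<xi>. (A x *v \<xi>) \<bullet> \<xi> \<le> \<Lambda> * (norm \<xi>)\<^sup>2"
        using elim by auto
      have "0 \<le> (A x *v \<xi>) \<bullet> \<xi>" for \<xi>
      proof -
        have "0 \<le> inverse \<Lambda> * (norm \<xi>)\<^sup>2" using Lam by simp
        then show ?thesis using e(1)[of \<xi>] by linarith
      qed
      moreover have "transpose (A x) = A x" using A x by (simp add: elliptic_coefficients_def)
      ultimately have "norm (A x *v G x) \<le> \<Lambda> * norm (G x)" using e(2) by (intro symmetric_matrix_norm_bound) auto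
      moreover have "(norm (G x))\<^sup>2 \<le> \<Lambda> * ((A x *v G x) \<bullet> G x)"
        using mult_left_mono[OF e(1)[of "G x"], of \<Lambda>] Lam by (simp add: mult.assoc[symmetric])
      ultimately show "norm (Q x) \<le> \<Lambda> * norm (G x) \<and> (norm (G x))\<^sup>2 \<le> \<Lambda> * (Q x \<bullet> G x)" by (simp add: Q)
    qed
  qed
  have Q2: "integrable lborel (\<lambda>x. (norm (Q x))\<^sup>2)"
  proof (rule Bochner_Integration.integrable_bound[OF integrable_mult_right[OF gsq, of "\<Lambda>\<^sup>2"]])
    show "(\<lambda>x. (norm (Q x))\<^sup>2) \<in> borel_measurable lborel" using Qm by measurable
    show "AE x in lborel. norm ((norm (Q x))\<^sup>2) \<le> norm (\<Lambda>\<^sup>2 * (norm (G x))\<^sup>2)"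
      using flux
    proof eventually_elim
      case (elim x)
      show ?case
      proof (cases "x \<in> U")
        case True
        then have "(norm (Q x))\<^sup>2 \<le> (\<Lambda> * norm (G x))\<^sup>2" using elim by (intro power_mono) auto
        then show ?thesis by (simp add: power_mult_distrib)
      qed (simp add: Q0)
    qed
  qed
  have Qi: "set_integrable lborel K Q" if K: "compact K" "K \<subseteq> U" for K
    unfolding set_integrable_def
  proof (rule integrable_of_square[where S=K])
    have [measurable]: "K \<in> sets borel" using K(1) by (simp add: compact_imp_closed)
    note [measurable] = Qm
    show "(\<lambda>x. indicator K x *\<^sub>R Q x) \<in> borel_measurable borel" by measurable
    show "integrable lborel (\<lambda>x. (norm (indicator K x *\<^sub>R Q x))\<^sup>2)"
      by (rule Bochner_Integration.integrable_bound[OF Q2]) (auto split: split_indicator)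
  qed (use K in \<open>auto simp: compact_imp_closed compact_imp_bounded\<close>)
  have Qeq: "(\<integral>x. Q x \<bullet> grad \<phi> x \<partial>lborel) = 0" if \<phi>: "\<phi> \<in> test_functions U" for \<phi>
  proof -
    note t = test_function_measurable[OF \<phi>]
    have "integral\<^sup>L (lebesgue_on U) (\<lambda>x. (A x *v g x) \<bullet> grad \<phi> x) = (\<integral>x. Q x \<bullet> grad \<phi> x \<partial>lborel)"
    proof (rule lebesgue_on_integral_eq(1)[OF _ U])
      have "(\<lambda>x. A x *v g x) \<in> borel_measurable (lebesgue_on U)"
        unfolding matrix_vector_mult_def
        by (intro borel_measurable_vec_lambda borel_measurable_sum borel_measurable_times Aij vec_component_measurable gm)
      then show "(\<lambda>x. (A x *v g x) \<bullet> grad \<phi> x) \<in> borel_measurable (lebesgue_on U)"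
        by (rule borel_measurable_inner[OF _ borel_measurable_lebesgue_on[OF t(3)]])
      show "(\<lambda>x. Q x \<bullet> grad \<phi> x) \<in> borel_measurable borel" by (intro borel_measurable_inner Qm t)
      show "AE x in lborel. x \<in> U \<longrightarrow> Q x \<bullet> grad \<phi> x = (A x *v g x) \<bullet> grad \<phi> x"
        using QA GG1 G1(2) by eventually_elim auto
    qed (simp add: Q0)
    then show ?thesis using eq[OF \<phi>] by simp
  qed
  show ?thesis
  proof (rule that[of F G Q])
    show "flux_solution \<Lambda> U F G Q"
      unfolding flux_solution_def
    proof (intro conjI allI impI F(1))
      show "set_integrable lborel U (\<lambda>x. (F x)\<^sup>2)"
        unfolding set_integrable_def by (rule integrable_mult_indicator[OF _ sqi]) simp
      fix x r R I
      assume h: "ball x R \<subseteq> U \<and> 0 < r \<and> r < R \<and> is_interval I \<and> I \<noteq> {} \<and> closed I \<and> (AE y in lborel. y \<in> ball x R \<longrightarrow> F y \<in> I)"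
      have rU: "ball x r \<subseteq> U" using h subset_ball[of r R x] by auto
      show "elliptic_flux \<Lambda> (ball x r) I F G Q"
      proof
        show "H1_approx (ball x r) I F G"
          by (rule H1_approx_exists[OF F(1) G(1) sqi gsq, where U=U and R=R])
             (use h weak_gradient_borel[OF w0 U _ F G] in auto)
        show "AE y in lborel. y \<in> ball x r \<longrightarrow> norm (Q y) \<le> \<Lambda> * norm (G y) \<and> (norm (G y))\<^sup>2 \<le> \<Lambda> * (Q y \<bullet> G y)"
          using flux by eventually_elim (use rU in auto)
        show "(\<integral>x. Q x \<bullet> D x \<partial>lborel) = 0"
          if "\<And>x. GDERIV \<phi> x :> D x" "continuous_on UNIV D" "compact K" "K \<subseteq> ball x r" "\<And>x. x \<notin> K \<Longrightarrow> \<phi> x = 0" for \<phi> D K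
          by (rule div_free_C1[OF Qm Qi Qeq U that(1-3) _ that(5)]) (use that(4) rU in auto)
      qed (use h Lam Qm in auto)
    qed
    show "sqrt (\<integral>x. indicator U x * (F x)\<^sup>2 \<partial>lborel) = L2_norm U f"
    proof -
      have "(\<lambda>x. indicator U x * (F x)\<^sup>2) = (\<lambda>x. (F x)\<^sup>2)" using F(3) by (auto split: split_indicator)
      then show ?thesis unfolding L2_norm_def sq by (simp only:)
    qed
  qed (rule F(2))
qed

section \<open>Hoelder norms, distance to the boundary and conclusion\<close>

lemma powr_norm_tendsto_0:
  fixes x :: "'a::real_normed_vector"
  assumes "0 < \<alpha>"
  shows "((\<lambda>y. a * norm (y - x) powr \<alpha>) \<longlongrightarrow> 0) (at x within V)"
proof -
  have "((\<lambda>y. norm (y - x)) \<longlongrightarrow> norm (x - x)) (at x within V)" by (intro tendsto_intros)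
  then have "((\<lambda>y. norm (y - x) powr \<alpha>) \<longlongrightarrow> norm (x - x) powr \<alpha>) (at x within V)"
    using assms by (intro tendsto_powr' tendsto_const) auto
  then have "((\<lambda>y. a * norm (y - x) powr \<alpha>) \<longlongrightarrow> a * norm (x - x) powr \<alpha>) (at x within V)"
    by (rule tendsto_mult_left)
  then show ?thesis using assms by simp
qed

lemma holder_norm_le:
  fixes h :: "real^'n \<Rightarrow> real"
  assumes V: "open V" and \<alpha>: "0 < \<alpha>" and a: "0 \<le> a" and bd: "\<And>x. x \<in> V \<Longrightarrow> \<bar>h x\<bar> \<le> a"
    and hol: "\<And>x y. x \<in> V \<Longrightarrow> y \<in> V \<Longrightarrow> \<bar>h x - h y\<bar> \<le> a * norm (x - y) powr \<alpha>"
  shows "holder_norm \<alpha> V h \<le> ennreal (2 * a)"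
proof -
  \<comment> \<open>Continuity supplies the measurability required for the essential
    supremum.\<close>
  have cont: "continuous_on V h"
    unfolding continuous_on
  proof
    fix x assume x: "x \<in> V"
    have "((\<lambda>y. h y - h x) \<longlongrightarrow> 0) (at x within V)"
    proof (rule Lim_null_comparison[OF _ powr_norm_tendsto_0[OF \<alpha>]])
      show "\<forall>\<^sub>F y in at x within V. norm (h y - h x) \<le> a * norm (y - x) powr \<alpha>"
        unfolding eventually_at_filter by (rule always_eventually) (use hol x in auto)
    qed
    then show "(h \<longlongrightarrow> h x) (at x within V)" by (simp add: LIM_zero_iff)
  qed
  have "esssup (lebesgue_on V) (\<lambda>x. ennreal \<bar>h x\<bar>) \<le> ennreal a"
  proof (rule esssup_I)
    have "h \<in> borel_measurable (lebesgue_on V)"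
      using cont V by (intro continuous_imp_measurable_on_sets_lebesgue) auto
    then show "(\<lambda>x. ennreal \<bar>h x\<bar>) \<in> borel_measurable (lebesgue_on V)" by measurable
    show "AE x in lebesgue_on V. ennreal \<bar>h x\<bar> \<le> ennreal a"
      by (rule AE_I2) (use bd in \<open>auto intro: ennreal_leI\<close>)
  qed
  moreover have "(SUP (x, y)\<in>{(x, y). x \<in> V \<and> y \<in> V \<and> x \<noteq> y}. ennreal (\<bar>h x - h y\<bar> / (norm (x - y)) powr \<alpha>)) \<le> ennreal a"
  proof (rule SUP_least, clarify)
    fix x y assume xy: "x \<in> V" "y \<in> V" "x \<noteq> y"
    then show "ennreal (\<bar>h x - h y\<bar> / (norm (x - y)) powr \<alpha>) \<le> ennreal a"
      using hol[of x y] by (intro ennreal_leI) (simp add: divide_le_eq)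
  qed
  ultimately have "holder_norm \<alpha> V h \<le> ennreal a + ennreal a" unfolding holder_norm_def by (rule add_mono)
  also have "\<dots> = ennreal (2 * a)" using a by (simp add: ennreal_plus[symmetric] del: ennreal_plus)
  finally show ?thesis .
qed

text \<open>A finite seminorm on one small ball around each point suffices. With
  \<open>precise_version_continuous\<close> it makes the final estimate hold for every Hoelder
  version rather than for one constructed version.\<close>

lemma holder_version_continuous:
  fixes h :: "real^'n \<Rightarrow> real"
  assumes hv: "holder_version \<alpha> U f h" and U: "open U" and \<alpha>: "0 < \<alpha>"
  shows "continuous_on U h"
  unfolding continuous_on_eq_continuous_at[OF U]
proof
  fix x assume "x \<in> U"
  then obtain r where r: "0 < r" "cball x r \<subseteq> U" using U open_contains_cball by blast
  have "compactly_inside (ball x r) U" using r by (simp add: compactly_inside_def)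
  then have "holder_norm \<alpha> (ball x r) h < \<infinity>" using hv by (simp add: holder_version_def)
  then have fin: "(SUP (x, y)\<in>{(y, z). y \<in> ball x r \<and> z \<in> ball x r \<and> y \<noteq> z}. ennreal (\<bar>h x - h y\<bar> / (norm (x - y)) powr \<alpha>)) < \<infinity>" (is "?S < _")
    unfolding holder_norm_def by (simp add: less_top[symmetric])
  define S where "S = enn2real ?S"
  have S: "?S = ennreal S" using fin by (simp add: S_def less_top)
  have S0: "0 \<le> S" by (simp add: S_def)
  have hol: "\<bar>h y - h x\<bar> \<le> S * norm (y - x) powr \<alpha>" if y: "y \<in> ball x r" for y
  proof (cases "y = x")
    case False
    have "ennreal (\<bar>h y - h x\<bar> / (norm (y - x)) powr \<alpha>) \<le> ?S"
      by (rule SUP_upper2[of "(y, x)"]) (use y r False in auto)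
    then have "\<bar>h y - h x\<bar> / (norm (y - x)) powr \<alpha> \<le> S" unfolding S using S0 by simp
    then show ?thesis using False by (simp add: divide_le_eq)
  qed simp
  have "((\<lambda>y. h y - h x) \<longlongrightarrow> 0) (at x)"
  proof (rule Lim_null_comparison[OF _ powr_norm_tendsto_0[OF \<alpha>]])
    show "\<forall>\<^sub>F y in at x. norm (h y - h x) \<le> S * norm (y - x) powr \<alpha>"
      unfolding eventually_at using r hol by (intro exI[of _ r]) (auto simp: dist_commute)
  qed
  then show "isCont h x" unfolding isCont_def by (simp add: LIM_zero_iff)
qed

text \<open>A ball is connected, so if it met both \<open>U\<close> and the complement of
  \<open>U\<close>, it would meet the frontier at distance less than \<open>\<delta>\<close> from
  its centre. This also covers an empty frontier.\<close>

lemma ball_subset_of_set_edist: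
  fixes V U :: "(real^'n) set"
  assumes x: "x \<in> V" and V: "V \<subseteq> U" and d: "ennreal \<delta> \<le> set_edist V (frontier U)"
  shows "ball x \<delta> \<subseteq> U"
proof (rule ccontr)
  assume no: "\<not> ball x \<delta> \<subseteq> U"
  then obtain y where y: "y \<in> ball x \<delta>" "y \<notin> U" by blast
  then have \<delta>: "0 < \<delta>" by (metis dist_not_less_zero less_le_trans mem_ball not_le)
  have "ball x \<delta> \<inter> frontier U \<noteq> {}"
  proof (rule connected_Int_frontier)
    have "x \<in> ball x \<delta> \<inter> U" using x V \<delta> by auto
    then show "ball x \<delta> \<inter> U \<noteq> {}" by blast
    show "ball x \<delta> - U \<noteq> {}" using y by auto
  qed (rule connected_ball)
  then obtain z where z: "z \<in> ball x \<delta>" "z \<in> frontier U" by blast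
  have "set_edist V (frontier U) \<le> ennreal (dist x z)"
    unfolding set_edist_def by (rule INF_lower2[OF x]) (rule INF_lower[OF z(2)])
  with d have "ennreal \<delta> \<le> ennreal (dist x z)" by (rule order_trans)
  then have "\<delta> \<le> dist x z" by simp
  then show False using z(1) by simp
qed

theorem theorem4:
  fixes \<Lambda> :: real
  assumes "\<Lambda> > 0"
  shows "\<exists>\<alpha>::real. 0 < \<alpha> \<and> \<alpha> < 1 \<and>
    (\<forall>(U :: (real^'n) set) A f.
      open U \<and> elliptic_coefficients \<Lambda> U A \<and> weak_solution U A f \<longrightarrow> f \<in> C_holder_loc \<alpha> U) \<and>
    (\<forall>\<delta>::real. \<delta> > 0 \<longrightarrow> (\<exists>C::real. C > 0 \<and>
      (\<forall>(U :: (real^'n) set) A f h V.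
        open U \<and> elliptic_coefficients \<Lambda> U A \<and> weak_solution U A f \<and> holder_version \<alpha> U f h \<and>
        compactly_inside V U \<and> set_edist V (frontier U) \<ge> ennreal \<delta> \<longrightarrow>
        holder_norm \<alpha> V h \<le> ennreal (C * L2_norm U f))))"
proof -
  obtain \<alpha> where \<alpha>: "0 < \<alpha>" "\<alpha> < 1"
    and est: "\<And>\<delta>. 0 < \<delta> \<Longrightarrow> \<exists>C>0. \<forall>(U::(real^'n) set) f g q h. flux_solution \<Lambda> U f g q \<and> open U \<and> precise_version U f h \<longrightarrow>
      (\<forall>x y. ball x \<delta> \<subseteq> U \<and> ball y \<delta> \<subseteq> U \<longrightarrow>
        \<bar>h x\<bar> \<le> C * sqrt (\<integral>z. indicator U z * (f z)\<^sup>2 \<partial>lborel) \<and>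
        \<bar>h x - h y\<bar> \<le> C * sqrt (\<integral>z. indicator U z * (f z)\<^sup>2 \<partial>lborel) * norm (x - y) powr \<alpha>)"
    and version: "\<And>U f g q h. flux_solution \<Lambda> U f g q \<Longrightarrow> open U \<Longrightarrow> precise_version (U::(real^'n) set) f h \<Longrightarrow>
      (AE x in lborel. x \<in> U \<longrightarrow> h x = f x)"
    using holder_estimate[OF assms, where ?'a="real^'n"] by blast
  \<comment> \<open>The set \<open>V\<close> enters only through \<open>\<delta>\<close>, so this
    serves both the local and the quantitative claim; the constant doubles because the norm is a
    supremum plus a seminorm.\<close>
  have main: "\<exists>C>0. \<forall>(U :: (real^'n) set) F G Q h V.
      flux_solution \<Lambda> U F G Q \<and> open U \<and> precise_version U F h \<and> open V \<and> (\<forall>x\<in>V. ball x \<delta> \<subseteq> U) \<longrightarrow>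
      holder_norm \<alpha> V h \<le> ennreal (C * sqrt (\<integral>z. indicator U z * (F z)\<^sup>2 \<partial>lborel))" if \<delta>: "0 < \<delta>" for \<delta> :: real
  proof -
    obtain C where C: "0 < C" and e: "\<forall>(U::(real^'n) set) f g q h. flux_solution \<Lambda> U f g q \<and> open U \<and> precise_version U f h \<longrightarrow>
      (\<forall>x y. ball x \<delta> \<subseteq> U \<and> ball y \<delta> \<subseteq> U \<longrightarrow>
        \<bar>h x\<bar> \<le> C * sqrt (\<integral>z. indicator U z * (f z)\<^sup>2 \<partial>lborel) \<and>
        \<bar>h x - h y\<bar> \<le> C * sqrt (\<integral>z. indicator U z * (f z)\<^sup>2 \<partial>lborel) * norm (x - y) powr \<alpha>)"
      using est[OF \<delta>] by blast
    show ?thesis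
    proof (intro exI[of _ "2 * C"] conjI allI impI)
      show "0 < 2 * C" using C by simp
      fix U :: "(real^'n) set" and F G Q h V
      assume h: "flux_solution \<Lambda> U F G Q \<and> open U \<and> precise_version U F h \<and> open V \<and> (\<forall>x\<in>V. ball x \<delta> \<subseteq> U)"
      have N: "0 \<le> sqrt (\<integral>z. indicator U z * (F z)\<^sup>2 \<partial>lborel)"
        by (auto intro!: Bochner_Integration.integral_nonneg)
      have "holder_norm \<alpha> V h \<le> ennreal (2 * (C * sqrt (\<integral>z. indicator U z * (F z)\<^sup>2 \<partial>lborel)))"
      proof (rule holder_norm_le[OF _ \<alpha>(1)])
        show "0 \<le> C * sqrt (\<integral>z. indicator U z * (F z)\<^sup>2 \<partial>lborel)" using C N by (intro mult_nonneg_nonneg) auto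
      qed (use h e in blast)+
      then show "holder_norm \<alpha> V h \<le> ennreal (2 * C * sqrt (\<integral>z. indicator U z * (F z)\<^sup>2 \<partial>lborel))"
        by (simp only: mult.assoc)
    qed
  qed
  show ?thesis
  proof (rule exI[of _ \<alpha>], intro conjI allI impI \<alpha>)
    fix U :: "(real^'n) set" and A f
    assume h: "open U \<and> elliptic_coefficients \<Lambda> U A \<and> weak_solution U A f"
    then obtain F G Q where fl: "flux_solution \<Lambda> U F G Q" and Ff: "AE x in lborel. x \<in> U \<longrightarrow> F x = f x"
      using weak_solution_flux[OF assms] by blast
    obtain w where w: "precise_version U F w" using precise_version_exists by blast
    have "AE x in lborel. x \<in> U \<longrightarrow> w x = F x" using version[OF fl _ w] h by blast
    with Ff have "AE x in lborel. x \<in> U \<longrightarrow> w x = f x" by eventually_elim auto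
    then have ae: "AE x in lebesgue_on U. w x = f x"
      using h AE_lebesgue_on_open[of U] by blast
    have "holder_norm \<alpha> V w < \<infinity>" if V: "compactly_inside V U" for V
    proof -
      \<comment> \<open>For the local claim no distance is prescribed; compactness of the closure of
        \<open>V\<close> provides one.\<close>
      obtain \<delta> where \<delta>: "0 < \<delta>" "(\<Union>x\<in>closure V. ball x \<delta>) \<subseteq> U"
        using compact_subset_open_imp_ball_epsilon_subset[of "closure V" U] V h by (auto simp: compactly_inside_def)
      have sub: "\<forall>x\<in>V. ball x \<delta> \<subseteq> U" using \<delta>(2) closure_subset by blast
      obtain C where "\<forall>(U :: (real^'n) set) F G Q h V.
          flux_solution \<Lambda> U F G Q \<and> open U \<and> precise_version U F h \<and> open V \<and> (\<forall>x\<in>V. ball x \<delta> \<subseteq> U) \<longrightarrow>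
          holder_norm \<alpha> V h \<le> ennreal (C * sqrt (\<integral>z. indicator U z * (F z)\<^sup>2 \<partial>lborel))"
        using main[OF \<delta>(1)] by blast
      then have "holder_norm \<alpha> V w \<le> ennreal (C * sqrt (\<integral>z. indicator U z * (F z)\<^sup>2 \<partial>lborel))"
        using fl h w V sub unfolding compactly_inside_def by blast
      also have "\<dots> < \<infinity>" by simp
      finally show ?thesis .
    qed
    with ae show "f \<in> C_holder_loc \<alpha> U" unfolding C_holder_loc_def holder_version_def by blast
  next
    fix \<delta> :: real assume \<delta>: "0 < \<delta>"
    obtain C where C: "0 < C" and e: "\<forall>(U :: (real^'n) set) F G Q h V.
      flux_solution \<Lambda> U F G Q \<and> open U \<and> precise_version U F h \<and> open V \<and> (\<forall>x\<in>V. ball x \<delta> \<subseteq> U) \<longrightarrow>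
      holder_norm \<alpha> V h \<le> ennreal (C * sqrt (\<integral>z. indicator U z * (F z)\<^sup>2 \<partial>lborel))"
      using main[OF \<delta>] by blast
    show "\<exists>C::real. C > 0 \<and>
      (\<forall>(U :: (real^'n) set) A f h V.
        open U \<and> elliptic_coefficients \<Lambda> U A \<and> weak_solution U A f \<and> holder_version \<alpha> U f h \<and>
        compactly_inside V U \<and> set_edist V (frontier U) \<ge> ennreal \<delta> \<longrightarrow>
        holder_norm \<alpha> V h \<le> ennreal (C * L2_norm U f))"
    proof (intro exI[of _ C] conjI allI impI C)
      fix U :: "(real^'n) set" and A f h V
      assume a: "open U \<and> elliptic_coefficients \<Lambda> U A \<and> weak_solution U A f \<and> holder_version \<alpha> U f h \<and>
        compactly_inside V U \<and> set_edist V (frontier U) \<ge> ennreal \<delta>"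
      then obtain F G Q where fl: "flux_solution \<Lambda> U F G Q" and Ff: "AE x in lborel. x \<in> U \<longrightarrow> F x = f x"
        and N: "sqrt (\<integral>x. indicator U x * (F x)\<^sup>2 \<partial>lborel) = L2_norm U f"
        using weak_solution_flux[OF assms] by blast
      have "open U" "AE x in lebesgue_on U. h x = f x" using a unfolding holder_version_def by blast+
      then have "AE x in lborel. x \<in> U \<longrightarrow> h x = f x" by (simp only: AE_lebesgue_on_open)
      with Ff have hF: "AE x in lborel. x \<in> U \<longrightarrow> h x = F x" by eventually_elim auto
      \<comment> \<open>The version \<open>h\<close> is arbitrary here; its continuity makes it a
        precise version of \<open>F\<close>, to which \<open>main\<close> applies directly.\<close>
      have hc: "continuous_on U h" using holder_version_continuous[OF _ _ \<alpha>(1)] a by blast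
      have pv: "precise_version U F h" using precise_version_continuous[OF hF hc] a by blast
      have V: "open V" "V \<subseteq> U" using a closure_subset by (auto simp: compactly_inside_def)
      have "\<forall>x\<in>V. ball x \<delta> \<subseteq> U" using ball_subset_of_set_edist[OF _ V(2)] a by blast
      then show "holder_norm \<alpha> V h \<le> ennreal (C * L2_norm U f)"
        using e fl a pv V(1) unfolding N[symmetric] by blast
    qed
  qed
qed

end
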